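(* Fix $\Delta<\infty$ and $\mathfrak{i}^\star>0$. If $\mathcal{L}$ is a unimodular network concentrated on trees with degrees in $\{2,\ldots,\Delta\}$ and anchored isoperimetric constant at least $\mathfrak{i}^\star$, then $$\Sigma_{p.p.}(\mathcal{L})\;\subseteq\;\left\{\lambda\in\mathbb{A}\colon\tau(\lambda)<\frac{3\Delta^2}{\mathfrak{i}^\star}\right\}.$$
   Context: Unimodular networks. Let $\mathcal{G}_\star$ be the set of isomorphism classes of connected, locally finite, countable rooted graphs $(G,o)$ (isomorphisms preserve the root). It is a Polish space under the distance $1/(1+R)$, where $R$ is the supremum of the $r\ge 0$ such that the balls of radius $r$ around the two roots are isomorphic as rooted graphs. Let $\mathcal{G}_{\star\star}$ be the analogous space of doubly rooted graphs $(G,x,y)$. A probability measure $\mathcal{L}$ on $\mathcal{G}_\star$ (or a random rooted graph $(G,o)\sim\mathcal{L}$) is called unimodular, or a unimodular network, if for every Borel $f\colon\mathcal{G}_{\star\star}\to[0,\infty]$, $\mathbb{E}[\sum_{x\in V(G)}f(G,o,x)]=\mathbb{E}[\sum_{x\in V(G)}f(G,x,o)]$. It is concentrated on trees with given properties if almost surely $G$ is a tree with those properties. Spectral measures. For a countable locally finite graph $G=(V,E)$, the adjacency operator $A$ acts on finitely supported functions in $\ell^2_{\mathbb{C}}(V)$, with $\langle \mathfrak{e}_x|A\mathfrak{e}_y\rangle=1$ if $\{x,y\}\in E$ and $0$ otherwise, where $(\mathfrak{e}_x)_{x\in V}$ is the canonical basis. $G$ is called self-adjoint if $A$ is essentially self-adjoint.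 In that case, for $o\in V$, $\mu_{(G,o)}$ is the unique Borel probability measure on $\mathbb{R}$ such that $\langle \mathfrak{e}_o|(A-z)^{-1}\mathfrak{e}_o\rangle=\int_{\mathbb{R}}\frac{1}{\xi-z}\,\mu_{(G,o)}(d\xi)$ for all $z\in\mathbb{C}\setminus\mathbb{R}$. It is known that under any unimodular network, $G$ is almost surely self-adjoint; one sets $\mu_{\mathcal{L}}(\cdot):=\mathbb{E}[\mu_{(G,o)}(\cdot)]$ with $(G,o)\sim\mathcal{L}$. The pure-point support is $\Sigma_{p.p.}(\mathcal{L}):=\{\lambda\in\mathbb{R}\colon\mu_{\mathcal{L}}(\{\lambda\})>0\}$. The anchored isoperimetric constant of an infinite rooted graph $(G,o)\in\mathcal{G}_\star$ is $$\mathfrak{i}^\star(G,o):=\lim_{n\to\infty}\inf\left\{\frac{|\partial S|}{|S|}\colon o\in S\subseteq V(G),\ \text{the subgraph of } G \text{ induced by } S \text{ is connected},\ n\le|S|<\infty\right\},$$ where $\partial S$ is the set of vertices outside $S$ having at least one neighbor in $S$; the value does not depend on the choice of the root $o$. $\mathbb{A}$ is the set of totally real algebraic integers, i.e. roots of monic polynomials with integer coefficients all of whose complex roots are real. For $\lambda\in\mathbb{A}$, the tree-complexity $\tau(\lambda)$ is the minimum possible number of vertices of a finite tree whose adjacency matrix has $\lambda$ as an eigenvalue (it is known that such a tree exists for every $\lambda\in\mathbb{A}$). *)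

theory Defs
  imports
    "HOL-Probability.Probability"
    "HOL-Library.Diagonal_Subsequence"
    "Jordan_Normal_Form.Char_Poly"
begin

subsection \<open>Graphs\<close>

datatype 'a graph = Graph (verts: "'a set") (edges: "'a set set")

definition is_graph :: "'a graph \<Rightarrow> bool" where
  "is_graph G \<longleftrightarrow> (\<forall>e\<in>edges G. \<exists>x\<in>verts G. \<exists>y\<in>verts G. x \<noteq> y \<and> e = {x, y})"

definition adjacent :: "'a graph \<Rightarrow> 'a \<Rightarrow> 'a \<Rightarrow> bool" where
  "adjacent G x y \<longleftrightarrow> {x, y} \<in> edges G"

definition neighbours :: "'a graph \<Rightarrow> 'a \<Rightarrow> 'a set" where
  "neighbours G x = {y. adjacent G x y}"

definition degree_in :: "'a graph \<Rightarrow> 'a \<Rightarrow> nat" where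
  "degree_in G x = card (neighbours G x)"

definition locally_finite :: "'a graph \<Rightarrow> bool" where
  "locally_finite G \<longleftrightarrow> (\<forall>x\<in>verts G. finite (neighbours G x))"

definition graph_connected :: "'a graph \<Rightarrow> bool" where
  "graph_connected G \<longleftrightarrow>
     verts G \<noteq> {} \<and> (\<forall>x\<in>verts G. \<forall>y\<in>verts G. (adjacent G)\<^sup>*\<^sup>* x y)"

definition is_cycle :: "'a graph \<Rightarrow> 'a list \<Rightarrow> bool" where
  "is_cycle G xs \<longleftrightarrow> length xs \<ge> 3 \<and> distinct xs \<and>
     successively (adjacent G) xs \<and> adjacent G (last xs) (hd xs)"

definition is_tree :: "'a graph \<Rightarrow> bool" where
  "is_tree G \<longleftrightarrow> is_graph G \<and> graph_connected G \<and> (\<nexists>xs. is_cycle G xs)"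

definition induced :: "'a graph \<Rightarrow> 'a set \<Rightarrow> 'a graph" where
  "induced G S = Graph (verts G \<inter> S) {e \<in> edges G. e \<subseteq> S}"

definition graph_ball :: "'a graph \<Rightarrow> nat \<Rightarrow> 'a \<Rightarrow> 'a set" where
  "graph_ball G r x = {y. \<exists>n\<le>r. ((adjacent G) ^^ n) x y}"

definition graph_iso :: "('a \<Rightarrow> 'b) \<Rightarrow> 'a graph \<Rightarrow> 'b graph \<Rightarrow> bool" where
  "graph_iso f G H \<longleftrightarrow> bij_betw f (verts G) (verts H) \<and>
     (\<forall>x\<in>verts G. \<forall>y\<in>verts G. adjacent G x y \<longleftrightarrow> adjacent H (f x) (f y))"

subsection \<open>Isomorphism classes of graphs with one or two roots\<close>

text \<open>
  Graphs with one root and with two roots are treated uniformly by passing the roots as a list.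
  A ball around a list of roots is the subgraph induced by the union of the balls around each
  root. Graph distances being integers, radii range over the natural numbers.
\<close>

definition rooted_iso :: "'a graph \<Rightarrow> 'a list \<Rightarrow> 'b graph \<Rightarrow> 'b list \<Rightarrow> bool" where
  "rooted_iso G xs H ys \<longleftrightarrow> (\<exists>f. graph_iso f G H \<and> map f xs = ys)"

definition rooted_ball :: "'a graph \<Rightarrow> 'a list \<Rightarrow> nat \<Rightarrow> 'a graph" where
  "rooted_ball G xs r = induced G (\<Union>x\<in>set xs. graph_ball G r x)"

definition agree_upto :: "nat \<Rightarrow> 'a graph \<Rightarrow> 'a list \<Rightarrow> 'b graph \<Rightarrow> 'b list \<Rightarrow> bool" where
  "agree_upto r G xs H ys \<longleftrightarrow> rooted_iso (rooted_ball G xs r) xs (rooted_ball H ys r) ys"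

text \<open>
  In \<^typ>\<open>ennreal\<close> the supremum of the empty set is 0 and 1 / top = 0, so isomorphic rooted
  graphs are at distance 0.
\<close>

definition local_dist :: "'a graph \<Rightarrow> 'a list \<Rightarrow> 'b graph \<Rightarrow> 'b list \<Rightarrow> real" where
  "local_dist G xs H ys =
     enn2real (1 / (1 + (SUP r\<in>{r. agree_upto r G xs H ys}. of_nat r)))"

text \<open>
  Every countable graph is isomorphic to one whose vertices are natural numbers, so isomorphism
  classes of countable graphs are taken over those.
\<close>

definition is_network :: "nat graph \<Rightarrow> nat list \<Rightarrow> bool" where
  "is_network G xs \<longleftrightarrow> is_graph G \<and> graph_connected G \<and> locally_finite G \<and> set xs \<subseteq> verts G"

definition network_iso :: "nat graph \<Rightarrow> nat list \<Rightarrow> nat graph \<Rightarrow> nat list \<Rightarrow> bool" where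
  "network_iso G xs H ys \<longleftrightarrow> is_network G xs \<and> is_network H ys \<and> rooted_iso G xs H ys"

lemma adjacent_commute: "adjacent G x y \<longleftrightarrow> adjacent G y x"
  by (simp add: adjacent_def insert_commute)

lemma adjacent_verts:
  assumes "is_graph G" "adjacent G x y"
  shows "x \<in> verts G" "y \<in> verts G"
  using assms unfolding is_graph_def adjacent_def
  by (metis doubleton_eq_iff)+

lemma graph_iso_id: "graph_iso id G G"
  by (simp add: graph_iso_def)

lemma graph_iso_comp:
  assumes "graph_iso f G H" "graph_iso g H K"
  shows "graph_iso (g \<circ> f) G K"
proof -
  have "\<And>x. x \<in> verts G \<Longrightarrow> f x \<in> verts H"
    using assms(1) by (auto simp: graph_iso_def bij_betw_def)
  then show ?thesis
    using assms by (auto simp: graph_iso_def intro: bij_betw_trans)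
qed

lemma graph_iso_inv:
  assumes "graph_iso f G H"
  shows "graph_iso (inv_into (verts G) f) H G"
proof -
  have b: "bij_betw f (verts G) (verts H)" using assms by (simp add: graph_iso_def)
  have b': "bij_betw (inv_into (verts G) f) (verts H) (verts G)"
    by (rule bij_betw_inv_into[OF b])
  have "\<And>x. x \<in> verts H \<Longrightarrow> f (inv_into (verts G) f x) = x \<and> inv_into (verts G) f x \<in> verts G"
    using b b' by (metis bij_betw_apply bij_betw_inv_into_right)
  then show ?thesis
    using assms b' unfolding graph_iso_def by metis
qed

lemma rooted_iso_refl: "rooted_iso G xs G xs"
  unfolding rooted_iso_def using graph_iso_id by (metis list.map_id)

lemma rooted_iso_trans:
  "rooted_iso G xs H ys \<Longrightarrow> rooted_iso H ys K zs \<Longrightarrow> rooted_iso G xs K zs"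
  unfolding rooted_iso_def using graph_iso_comp by (metis list.map_comp)

lemma rooted_iso_sym:
  assumes "rooted_iso G xs H ys" "set xs \<subseteq> verts G"
  shows "rooted_iso H ys G xs"
proof -
  obtain f where f: "graph_iso f G H" "map f xs = ys"
    using assms(1) by (auto simp: rooted_iso_def)
  have "map (inv_into (verts G) f) ys = xs"
    using f assms(2) unfolding graph_iso_def
    by (auto simp: bij_betw_def subset_iff intro!: map_idI)
  with graph_iso_inv[OF f(1)] show ?thesis by (auto simp: rooted_iso_def)
qed

lemma network_iso_refl: "is_network G xs \<Longrightarrow> network_iso G xs G xs"
  by (simp add: network_iso_def rooted_iso_refl)

lemma network_iso_sym: "network_iso G xs H ys \<Longrightarrow> network_iso H ys G xs"
  by (auto simp: network_iso_def is_network_def intro: rooted_iso_sym)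

lemma network_iso_trans:
  "network_iso G xs H ys \<Longrightarrow> network_iso H ys K zs \<Longrightarrow> network_iso G xs K zs"
  by (auto simp: network_iso_def intro: rooted_iso_trans)

lemma is_network_single:
  "is_network (Graph {0} {}) [0]" "is_network (Graph {0} {}) [0, 0]"
  by (auto simp: is_network_def is_graph_def graph_connected_def locally_finite_def
      neighbours_def adjacent_def)

quotient_type gstar = "nat graph \<times> nat" /
  partial: "\<lambda>(G, x) (H, y). network_iso G [x] H [y]"
proof (rule part_equivpI)
  show "\<exists>a. (case a of (G, x) \<Rightarrow> \<lambda>(H, y). network_iso G [x] H [y]) a"
    using network_iso_refl[OF is_network_single(1)] by (intro exI[of _ "(Graph {0} {}, 0)"]) simp
qed (auto simp: symp_def transp_def intro: network_iso_sym network_iso_trans)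

quotient_type gstar2 = "nat graph \<times> nat \<times> nat" /
  partial: "\<lambda>(G, x, x') (H, y, y'). network_iso G [x, x'] H [y, y']"
proof (rule part_equivpI)
  show "\<exists>a. (case a of (G, x, x') \<Rightarrow> \<lambda>(H, y, y'). network_iso G [x, x'] H [y, y']) a"
    using network_iso_refl[OF is_network_single(2)]
    by (intro exI[of _ "(Graph {0} {}, 0, 0)"]) simp
qed (auto simp: symp_def transp_def intro: network_iso_sym network_iso_trans)

subsection \<open>The local metric\<close>

lemma graph_ball_self: "x \<in> graph_ball G r x"
  unfolding graph_ball_def by (auto intro!: exI[of _ 0])

lemma graph_ball_mono: "r \<le> s \<Longrightarrow> graph_ball G r x \<subseteq> graph_ball G s x"
  unfolding graph_ball_def by (auto intro: order_trans)

lemma graph_ball_subset: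
  assumes "is_graph G" "x \<in> verts G"
  shows "graph_ball G r x \<subseteq> verts G"
proof
  fix y assume "y \<in> graph_ball G r x"
  then obtain n where n: "((adjacent G) ^^ n) x y" by (auto simp: graph_ball_def)
  show "y \<in> verts G"
    using n assms adjacent_verts(2)[OF assms(1)] by (cases n) auto
qed

lemma graph_ball_finite:
  assumes "is_graph G" "locally_finite G" "x \<in> verts G"
  shows "finite (graph_ball G r x)"
proof (induction r)
  case 0
  then show ?case by (simp add: graph_ball_def)
next
  case (Suc r)
  have "graph_ball G (Suc r) x \<subseteq> graph_ball G r x \<union> (\<Union>y\<in>graph_ball G r x. neighbours G y)"
  proof
    fix z assume "z \<in> graph_ball G (Suc r) x"
    then obtain n where n: "n \<le> Suc r" "((adjacent G) ^^ n) x z" by (auto simp: graph_ball_def)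
    show "z \<in> graph_ball G r x \<union> (\<Union>y\<in>graph_ball G r x. neighbours G y)"
    proof (cases "n \<le> r")
      case True
      then show ?thesis using n by (auto simp: graph_ball_def)
    next
      case False
      then have "n = Suc r" using n by simp
      then obtain y where "((adjacent G) ^^ r) x y" "adjacent G y z" using n by auto
      then show ?thesis by (auto simp: graph_ball_def neighbours_def)
    qed
  qed
  moreover have "finite (\<Union>y\<in>graph_ball G r x. neighbours G y)"
    using Suc graph_ball_subset[OF assms(1,3)] assms(2) by (auto simp: locally_finite_def)
  ultimately show ?case using Suc finite_subset by blast
qed

lemma verts_rooted_ball:
  "verts (rooted_ball G xs r) = verts G \<inter> (\<Union>x\<in>set xs. graph_ball G r x)"
  by (simp add: rooted_ball_def induced_def)

lemma adjacent_rooted_ball: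
  assumes "x \<in> verts (rooted_ball G xs r)" "y \<in> verts (rooted_ball G xs r)"
  shows "adjacent (rooted_ball G xs r) x y \<longleftrightarrow> adjacent G x y"
  using assms by (auto simp: rooted_ball_def induced_def adjacent_def)

lemma iso_ball_into:
  assumes G: "is_graph G" "set xs \<subseteq> verts G"
    and f: "graph_iso f (rooted_ball G xs r) (rooted_ball H (map f xs) r)"
    and "s \<le> r"
  shows "f ` verts (rooted_ball G xs s) \<subseteq> verts (rooted_ball H (map f xs) s)"
proof -
  let ?B = "verts (rooted_ball G xs r)"
  let ?C = "verts (rooted_ball H (map f xs) r)"
  have fB: "f v \<in> ?C" if "v \<in> ?B" for v
    using f that by (auto simp: graph_iso_def bij_betw_def)
  have adj: "adjacent H (f u) (f v)" if "u \<in> ?B" "v \<in> ?B" "adjacent G u v" for u v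
    using f that fB by (auto simp: graph_iso_def adjacent_rooted_ball)
  have walk: "((adjacent G) ^^ n) x y \<Longrightarrow> n \<le> r \<Longrightarrow> ((adjacent H) ^^ n) (f x) (f y)"
    if "x \<in> set xs" for x y n
  proof (induction n arbitrary: y)
    case 0
    then show ?case by simp
  next
    case (Suc n)
    then obtain w where w: "((adjacent G) ^^ n) x w" "adjacent G w y" by auto
    have "n \<le> r" using Suc.prems by simp
    then have "w \<in> graph_ball G r x" "y \<in> graph_ball G r x"
      using w(1) Suc.prems unfolding graph_ball_def by blast+
    then have "w \<in> ?B" "y \<in> ?B"
      using that G graph_ball_subset[OF G(1), of x r] by (auto simp: verts_rooted_ball)
    with Suc w adj show ?case by auto
  qed
  show ?thesis
  proof
    fix z assume "z \<in> f ` verts (rooted_ball G xs s)"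
    then obtain x y n where z: "z = f y" "y \<in> verts G" "x \<in> set xs" "n \<le> s"
      "((adjacent G) ^^ n) x y"
      by (auto simp: verts_rooted_ball graph_ball_def)
    have "n \<le> r" using z \<open>s \<le> r\<close> by simp
    then have "y \<in> ?B" using z unfolding verts_rooted_ball graph_ball_def by blast
    then have "z \<in> verts H" using fB z by (auto simp: verts_rooted_ball)
    moreover have "((adjacent H) ^^ n) (f x) z" using walk z \<open>s \<le> r\<close> by simp
    ultimately show "z \<in> verts (rooted_ball H (map f xs) s)"
      using z by (auto simp: verts_rooted_ball graph_ball_def)
  qed
qed

lemma roots_in_ball: "set xs \<subseteq> verts G \<Longrightarrow> set xs \<subseteq> verts (rooted_ball G xs r)"
  using graph_ball_self by (fastforce simp: verts_rooted_ball)

lemma verts_rooted_ball_mono: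
  "r \<le> s \<Longrightarrow> verts (rooted_ball G xs r) \<subseteq> verts (rooted_ball G xs s)"
  using graph_ball_mono[of r s G] by (fastforce simp: verts_rooted_ball)

lemma iso_ball_image:
  assumes G: "is_graph G" "set xs \<subseteq> verts G" and H: "is_graph H" "set ys \<subseteq> verts H"
    and f: "graph_iso f (rooted_ball G xs r) (rooted_ball H ys r)" "map f xs = ys"
    and "s \<le> r"
  shows "f ` verts (rooted_ball G xs s) = verts (rooted_ball H ys s)"
proof
  show "f ` verts (rooted_ball G xs s) \<subseteq> verts (rooted_ball H ys s)"
    using iso_ball_into[OF G _ \<open>s \<le> r\<close>, of f H] f by simp
  let ?B = "verts (rooted_ball G xs r)"
  define g where "g = inv_into ?B f"
  have b: "bij_betw f ?B (verts (rooted_ball H ys r))"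
    using f(1) by (simp add: graph_iso_def)
  have gi: "graph_iso g (rooted_ball H ys r) (rooted_ball G xs r)"
    unfolding g_def by (rule graph_iso_inv[OF f(1)])
  have gy: "map g ys = xs"
    using roots_in_ball[OF G(2), of r] b unfolding g_def f(2)[symmetric]
    by (auto simp: bij_betw_def subset_iff intro!: map_idI)
  have into: "g ` verts (rooted_ball H ys s) \<subseteq> verts (rooted_ball G xs s)"
    using iso_ball_into[OF H _ \<open>s \<le> r\<close>, of g G] gi gy by simp
  show "verts (rooted_ball H ys s) \<subseteq> f ` verts (rooted_ball G xs s)"
  proof
    fix w assume w: "w \<in> verts (rooted_ball H ys s)"
    then have "w \<in> verts (rooted_ball H ys r)"
      using verts_rooted_ball_mono[OF \<open>s \<le> r\<close>, of H ys] by blast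
    then have "f (g w) = w" using b unfolding g_def by (metis bij_betw_inv_into_right)
    then show "w \<in> f ` verts (rooted_ball G xs s)" using into w by (metis image_subset_iff imageI)
  qed
qed

lemma graph_iso_restrict:
  assumes f: "graph_iso f (rooted_ball G xs r) (rooted_ball H ys r)" and "s \<le> r"
    and im: "f ` verts (rooted_ball G xs s) = verts (rooted_ball H ys s)"
  shows "graph_iso f (rooted_ball G xs s) (rooted_ball H ys s)"
proof -
  have sub: "verts (rooted_ball G xs s) \<subseteq> verts (rooted_ball G xs r)"
    "verts (rooted_ball H ys s) \<subseteq> verts (rooted_ball H ys r)"
    by (rule verts_rooted_ball_mono[OF \<open>s \<le> r\<close>])+
  have "bij_betw f (verts (rooted_ball G xs s)) (verts (rooted_ball H ys s))"
    using f im sub by (auto simp: graph_iso_def bij_betw_def intro: inj_on_subset)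
  moreover have "adjacent (rooted_ball G xs s) u v \<longleftrightarrow> adjacent (rooted_ball H ys s) (f u) (f v)"
    if "u \<in> verts (rooted_ball G xs s)" "v \<in> verts (rooted_ball G xs s)" for u v
  proof -
    have "f u \<in> verts (rooted_ball H ys s)" "f v \<in> verts (rooted_ball H ys s)"
      using im that by auto
    then show ?thesis
      using f that sub unfolding graph_iso_def by (metis adjacent_rooted_ball subsetD)
  qed
  ultimately show ?thesis by (simp add: graph_iso_def)
qed

lemma finite_rooted_ball:
  assumes "is_network G xs"
  shows "finite (verts (rooted_ball G xs r))"
proof -
  have "finite (graph_ball G r x)" if "x \<in> set xs" for x
    using assms that by (intro graph_ball_finite) (auto simp: is_network_def)
  then have "finite (\<Union>x\<in>set xs. graph_ball G r x)" by blast
  then show ?thesis unfolding verts_rooted_ball by blast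
qed

lemma agree_upto_mono:
  assumes "is_network G xs" "is_network H ys" "agree_upto r G xs H ys" "s \<le> r"
  shows "agree_upto s G xs H ys"
proof -
  obtain f where f: "graph_iso f (rooted_ball G xs r) (rooted_ball H ys r)" "map f xs = ys"
    using assms(3) by (auto simp: agree_upto_def rooted_iso_def)
  have "f ` verts (rooted_ball G xs s) = verts (rooted_ball H ys s)"
    using assms f by (intro iso_ball_image[of G xs H ys f r s]) (auto simp: is_network_def)
  from graph_iso_restrict[OF f(1) assms(4) this] f(2) show ?thesis
    by (auto simp: agree_upto_def rooted_iso_def)
qed

lemma agree_upto_refl: "agree_upto r G xs G xs"
  by (simp add: agree_upto_def rooted_iso_refl)

lemma agree_upto_sym:
  "is_network G xs \<Longrightarrow> agree_upto r G xs H ys \<Longrightarrow> agree_upto r H ys G xs"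
  unfolding agree_upto_def by (rule rooted_iso_sym) (auto simp: is_network_def intro: subsetD[OF roots_in_ball])

lemma agree_upto_trans:
  "agree_upto r G xs H ys \<Longrightarrow> agree_upto r H ys K zs \<Longrightarrow> agree_upto r G xs K zs"
  unfolding agree_upto_def by (rule rooted_iso_trans)

lemma verts_eq_UN_balls:
  assumes "is_network G xs" "xs \<noteq> []" "v \<in> verts G"
  shows "\<exists>r. v \<in> verts (rooted_ball G xs r)"
proof -
  have x: "hd xs \<in> set xs" "hd xs \<in> verts G" using assms by (auto simp: is_network_def)
  then have "(adjacent G)\<^sup>*\<^sup>* (hd xs) v"
    using assms by (auto simp: is_network_def graph_connected_def)
  then obtain n where "((adjacent G) ^^ n) (hd xs) v" by (auto dest: rtranclp_imp_relpowp)
  with x assms(3) show ?thesis by (auto simp: verts_rooted_ball graph_ball_def)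
qed

lemma rooted_iso_imp_agree_upto:
  assumes G: "is_network G xs" and H: "is_network H ys" and iso: "rooted_iso G xs H ys"
  shows "agree_upto r G xs H ys"
proof -
  obtain f where f: "graph_iso f G H" "map f xs = ys" using iso by (auto simp: rooted_iso_def)
  have b: "bij_betw f (verts G) (verts H)" using f by (simp add: graph_iso_def)
  have walk: "((adjacent K) ^^ n) x y \<Longrightarrow> ((adjacent K') ^^ n) (g x) (g y)"
    if "is_graph K" "graph_iso g K K'" for K K' :: "nat graph" and g n x y
  proof (induction n arbitrary: y)
    case (Suc n)
    then obtain w where w: "((adjacent K) ^^ n) x w" "adjacent K w y" by auto
    with that Suc show ?case
      by (auto simp: graph_iso_def dest: adjacent_verts intro!: relcomppI[of _ _ "g w"])
  qed simp
  define g where "g = inv_into (verts G) f"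
  have gi: "graph_iso g H G" unfolding g_def by (rule graph_iso_inv[OF f(1)])
  have gf: "g (f u) = u" if "u \<in> verts G" for u
    using b that by (simp add: g_def bij_betw_def)
  have gr: "is_graph G" "is_graph H" "set xs \<subseteq> verts G" using G H by (auto simp: is_network_def)
  have ball: "f v \<in> verts (rooted_ball H ys r) \<longleftrightarrow> v \<in> verts (rooted_ball G xs r)"
    if "v \<in> verts G" for v
  proof -
    have "((adjacent G) ^^ n) x v \<longleftrightarrow> ((adjacent H) ^^ n) (f x) (f v)" if "x \<in> set xs" for x n
      using walk[OF gr(1) f(1), of n x v] walk[OF gr(2) gi, of n "f x" "f v"] gf that
        \<open>v \<in> verts G\<close> gr(3) by auto
    moreover have "f v \<in> verts H" using b that by (auto simp: bij_betw_def)
    ultimately show ?thesis using that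
      by (auto simp: verts_rooted_ball graph_ball_def f(2)[symmetric])
  qed
  have im: "f ` verts (rooted_ball G xs r) = verts (rooted_ball H ys r)"
  proof
    show "f ` verts (rooted_ball G xs r) \<subseteq> verts (rooted_ball H ys r)"
      using ball by (auto simp: verts_rooted_ball)
    show "verts (rooted_ball H ys r) \<subseteq> f ` verts (rooted_ball G xs r)"
    proof
      fix w assume w: "w \<in> verts (rooted_ball H ys r)"
      then have "w \<in> verts H" by (simp add: verts_rooted_ball)
      then obtain v where "v \<in> verts G" "w = f v" using b by (auto simp: bij_betw_def)
      then show "w \<in> f ` verts (rooted_ball G xs r)" using ball w by auto
    qed
  qed
  have sub: "verts (rooted_ball G xs r) \<subseteq> verts G" by (auto simp: verts_rooted_ball)
  have "graph_iso f (rooted_ball G xs r) (rooted_ball H ys r)"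
    unfolding graph_iso_def
  proof (intro conjI ballI)
    show "bij_betw f (verts (rooted_ball G xs r)) (verts (rooted_ball H ys r))"
      using im b sub by (auto simp: bij_betw_def intro: inj_on_subset)
    fix u v assume uv: "u \<in> verts (rooted_ball G xs r)" "v \<in> verts (rooted_ball G xs r)"
    then have "f u \<in> verts (rooted_ball H ys r)" "f v \<in> verts (rooted_ball H ys r)"
      using im by auto
    then show "adjacent (rooted_ball G xs r) u v \<longleftrightarrow> adjacent (rooted_ball H ys r) (f u) (f v)"
      using uv f(1) sub by (auto simp: adjacent_rooted_ball graph_iso_def)
  qed
  with f(2) show ?thesis by (auto simp: agree_upto_def rooted_iso_def)
qed

text \<open>Local finiteness enters here: isomorphisms of all balls have a limit along a subsequence.\<close>

lemma agree_upto_all_imp_rooted_iso: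
  assumes G: "is_network G xs" and H: "is_network H ys" and ne: "xs \<noteq> []"
    and agr: "\<And>r. agree_upto r G xs H ys"
  shows "rooted_iso G xs H ys"
proof -
  let ?B = "\<lambda>r. verts (rooted_ball G xs r)" and ?C = "\<lambda>r. verts (rooted_ball H ys r)"
  have "\<forall>r. \<exists>f. graph_iso f (rooted_ball G xs r) (rooted_ball H ys r) \<and> map f xs = ys"
    using agr by (auto simp: agree_upto_def rooted_iso_def)
  from choice[OF this] obtain F where F: "\<And>r. graph_iso (F r) (rooted_ball G xs r) (rooted_ball H ys r)"
    "\<And>r. map (F r) xs = ys" by blast
  have im: "F r ` ?B s = ?C s" if "s \<le> r" for r s
    using G H F that by (intro iso_ball_image[of G xs H ys "F r" r s]) (auto simp: is_network_def)
  have finB: "finite (?B r)" for r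
    by (rule finite_rooted_ball[OF G])
  have finC: "finite (?C r)" for r
    by (rule finite_rooted_ball[OF H])
  have ne': "ys \<noteq> []" using F(2)[of 0] ne by auto
  define h where "h n v = (if v \<in> ?B n then F n v else 0)" for n v
  have finh: "finite (range (\<lambda>n. h n v))" for v
  proof (cases "\<exists>s. v \<in> ?B s")
    case True
    then obtain s where s: "v \<in> ?B s" by blast
    have "range (\<lambda>n. h n v) \<subseteq> (\<lambda>n. h n v) ` {..<s} \<union> ?C s"
    proof
      fix w assume "w \<in> range (\<lambda>n. h n v)"
      then obtain n where n: "w = h n v" by blast
      show "w \<in> (\<lambda>n. h n v) ` {..<s} \<union> ?C s"
      proof (cases "n < s")
        case False
        then have "s \<le> n" by simp
        have "v \<in> ?B n" using s verts_rooted_ball_mono[OF \<open>s \<le> n\<close>, of G xs] by blast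
        then have "w = F n v" using n by (simp add: h_def)
        then have "w \<in> F n ` ?B s" using s by blast
        then show ?thesis using im[OF \<open>s \<le> n\<close>] by blast
      qed (use n in auto)
    qed
    then show ?thesis using finC finite_subset by (metis finite_UnI finite_imageI finite_lessThan)
  next
    case False
    then have "range (\<lambda>n. h n v) \<subseteq> {0}" by (auto simp: h_def)
    then show ?thesis using finite_subset by blast
  qed
  define P where "P v s \<longleftrightarrow> (\<exists>w. \<forall>k. h (s k) v = w)" for v and s :: "nat \<Rightarrow> nat"
  interpret subseqs P
  proof
    fix v and s :: "nat \<Rightarrow> nat" assume "strict_mono s"
    have "finite (range (\<lambda>k. h (s k) v))"
      using finh[of v] by (rule rev_finite_subset) auto
    then obtain k0 where "infinite {k \<in> UNIV. h (s k) v = h (s k0) v}"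
      using pigeonhole_infinite[of UNIV "\<lambda>k. h (s k) v"] by blast
    from infinite_enumerate[OF this] obtain r :: "nat \<Rightarrow> nat" where
      r: "strict_mono r \<and> (\<forall>k. r k \<in> {k \<in> UNIV. h (s k) v = h (s k0) v})" ..
    have "\<forall>k. h ((s \<circ> r) k) v = h (s k0) v" using r by simp
    then have "P v (s \<circ> r)" unfolding P_def by (rule exI)
    with r show "\<exists>r'. strict_mono r' \<and> P v (s \<circ> r')" by (intro exI[of _ r] conjI) auto
  qed
  have diag: "P v (diagseq \<circ> (+) (Suc v))" for v
  proof (rule diagseq_holds)
    fix r s :: "nat \<Rightarrow> nat" and n assume "P n s"
    then obtain w where "\<forall>k. h (s k) n = w" unfolding P_def by (elim exE)
    then have "\<forall>k. h ((s \<circ> r) k) n = w" by simp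
    then show "P n (s \<circ> r)" unfolding P_def by (rule exI)
  qed
  have "\<forall>v. \<exists>w. \<forall>k. h (diagseq (Suc v + k)) v = w"
  proof
    fix v show "\<exists>w. \<forall>k. h (diagseq (Suc v + k)) v = w"
      using diag[of v] unfolding P_def o_def .
  qed
  from choice[OF this] obtain f where f0: "\<And>v k. h (diagseq (Suc v + k)) v = f v"
    by blast
  have f: "h (diagseq k) v = f v" if "v < k" for v k
    using f0[of v "k - Suc v"] that by simp
  have key: "\<exists>k\<ge>s. \<forall>v\<in>?B s. F k v = f v" for s
  proof -
    obtain m where m: "\<forall>v\<in>?B s. v < m" using finB finite_nat_set_iff_bounded by blast
    let ?k = "diagseq (max m s)"
    have k: "s \<le> ?k" using seq_suble[OF subseq_diagseq, of "max m s"] by simp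
    have "F ?k v = f v" if "v \<in> ?B s" for v
    proof -
      have "v \<in> ?B ?k" using that verts_rooted_ball_mono[OF k, of G xs] by blast
      then show ?thesis using f[of v "max m s"] m that by (auto simp: h_def)
    qed
    with k show ?thesis by blast
  qed
  have bigB: "\<exists>s. u \<in> ?B s \<and> v \<in> ?B s" if uv: "u \<in> verts G" "v \<in> verts G" for u v
  proof -
    obtain a b where "u \<in> ?B a" "v \<in> ?B b" using verts_eq_UN_balls[OF G ne] uv by metis
    then have "u \<in> ?B (max a b)" "v \<in> ?B (max a b)"
      using verts_rooted_ball_mono[of a "max a b" G xs] verts_rooted_ball_mono[of b "max a b" G xs]
      by auto
    then show ?thesis by blast
  qed
  have loc: "graph_iso f (rooted_ball G xs s) (rooted_ball H ys s)" for s
  proof -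
    obtain k where k: "k \<ge> s" "\<forall>v\<in>?B s. F k v = f v" using key by blast
    have "graph_iso (F k) (rooted_ball G xs s) (rooted_ball H ys s)"
      by (rule graph_iso_restrict[OF F(1) k(1) im[OF k(1)]])
    moreover have "bij_betw f (?B s) (?C s) \<longleftrightarrow> bij_betw (F k) (?B s) (?C s)"
      using k(2) by (intro bij_betw_cong) auto
    ultimately show ?thesis using k(2) unfolding graph_iso_def by metis
  qed
  have roots: "map f xs = ys"
  proof -
    obtain k where "\<forall>v\<in>?B 0. F k v = f v" using key by blast
    moreover have "set xs \<subseteq> ?B 0" using G by (intro roots_in_ball) (auto simp: is_network_def)
    ultimately have "map f xs = map (F k) xs" by auto
    then show ?thesis using F(2) by simp
  qed
  have "inj_on f (verts G)"
  proof (rule inj_onI)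
    fix u v assume uv: "u \<in> verts G" "v \<in> verts G" "f u = f v"
    then obtain s where "u \<in> ?B s" "v \<in> ?B s" using bigB by blast
    then show "u = v" using loc[of s] uv by (auto simp: graph_iso_def bij_betw_def inj_on_def)
  qed
  moreover have "f ` verts G = verts H"
  proof (intro equalityI subsetI)
    fix w assume "w \<in> f ` verts G"
    then obtain v where v: "v \<in> verts G" "w = f v" by blast
    then obtain s where "v \<in> ?B s" using bigB by blast
    then have "w \<in> ?C s" using loc[of s] v by (auto simp: graph_iso_def bij_betw_def)
    then show "w \<in> verts H" by (simp add: verts_rooted_ball)
  next
    fix w assume "w \<in> verts H"
    then obtain s where "w \<in> ?C s" using verts_eq_UN_balls[OF H ne'] by blast
    then have "w \<in> f ` ?B s" using loc[of s] by (auto simp: graph_iso_def bij_betw_def)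
    then show "w \<in> f ` verts G" by (auto simp: verts_rooted_ball)
  qed
  moreover have "adjacent G u v \<longleftrightarrow> adjacent H (f u) (f v)" if uv: "u \<in> verts G" "v \<in> verts G" for u v
  proof -
    obtain s where s: "u \<in> ?B s" "v \<in> ?B s" using bigB[OF uv] by blast
    then have "f u \<in> ?C s" "f v \<in> ?C s" using loc[of s] by (auto simp: graph_iso_def bij_betw_def)
    then show ?thesis using loc[of s] s by (auto simp: graph_iso_def adjacent_rooted_ball)
  qed
  ultimately have "graph_iso f G H" by (auto simp: graph_iso_def bij_betw_def)
  with roots show ?thesis by (auto simp: rooted_iso_def)
qed

lemma local_dist_eq:
  assumes "is_network G xs" "is_network H ys"
  shows "local_dist G xs H ys =
    (if \<forall>r. agree_upto r G xs H ys then 0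
     else 1 / (1 + real ((LEAST r. \<not> agree_upto r G xs H ys) - 1)))"
proof (cases "\<forall>r. agree_upto r G xs H ys")
  case True
  then have "{r. agree_upto r G xs H ys} = UNIV" by simp
  then have "local_dist G xs H ys = enn2real (1 / (1 + \<infinity>))"
    unfolding local_dist_def by (simp only: ennreal_SUP_of_nat_eq_top infinity_ennreal_def)
  also have "\<dots> = 0" by simp
  finally show ?thesis using True by simp
next
  case False
  define k where "k = (LEAST r. \<not> agree_upto r G xs H ys)"
  have k: "\<not> agree_upto k G xs H ys" 
    unfolding k_def by (rule LeastI_ex) (use False in simp)
  have less: "agree_upto r G xs H ys \<longleftrightarrow> r < k" for r
  proof
    assume "agree_upto r G xs H ys"
    then show "r < k" using k agree_upto_mono[OF assms, of r k] by (cases "r < k") simp_all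
  next
    assume "r < k"
    then show "agree_upto r G xs H ys" unfolding k_def using not_less_Least by blast
  qed
  have "(SUP r\<in>{r. agree_upto r G xs H ys}. of_nat r) = (of_nat (k - 1) :: ennreal)"
  proof (cases "k = 0")
    case True
    then show ?thesis by (simp add: less bot_ennreal)
  next
    case False
    show ?thesis
    proof (rule antisym)
      show "(SUP r\<in>{r. agree_upto r G xs H ys}. of_nat r) \<le> (of_nat (k - 1) :: ennreal)"
        by (rule SUP_least) (auto simp: less)
      show "(of_nat (k - 1) :: ennreal) \<le> (SUP r\<in>{r. agree_upto r G xs H ys}. of_nat r)"
        using False by (intro SUP_upper) (auto simp: less)
    qed
  qed
  then have "local_dist G xs H ys = enn2real (1 / (1 + of_nat (k - 1)))"
    by (simp add: local_dist_def)
  also have "1 + of_nat (k - 1) = ennreal (1 + real (k - 1))"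
    by (simp only: ennreal_plus[OF zero_le_one of_nat_0_le_iff] ennreal_1 ennreal_of_nat_eq_real_of_nat)
  also have "1 / ennreal (1 + real (k - 1)) = ennreal (1 / (1 + real (k - 1)))"
    using divide_ennreal[of 1 "1 + real (k - 1)"] by (simp only: ennreal_1) 
  also have "enn2real \<dots> = 1 / (1 + real (k - 1))"
    by (rule enn2real_ennreal) simp
  finally show ?thesis using False unfolding k_def by (simp only: if_False)
qed

lemma local_dist_eq_0_iff:
  assumes "is_network G xs" "is_network H ys" "xs \<noteq> []"
  shows "local_dist G xs H ys = 0 \<longleftrightarrow> network_iso G xs H ys"
proof -
  have "local_dist G xs H ys = 0 \<longleftrightarrow> (\<forall>r. agree_upto r G xs H ys)"
    using local_dist_eq[OF assms(1,2)] by (simp add: add_nonneg_eq_0_iff)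
  then show ?thesis
    using assms agree_upto_all_imp_rooted_iso rooted_iso_imp_agree_upto
    by (metis network_iso_def)
qed

lemma local_dist_triangle:
  assumes G: "is_network G xs" and H: "is_network H ys" and K: "is_network K zs"
  shows "local_dist G xs H ys \<le> local_dist G xs K zs + local_dist H ys K zs"
proof -
  have nn: "0 \<le> local_dist G xs K zs" "0 \<le> local_dist H ys K zs"
    by (auto simp: local_dist_def)
  have tr: "agree_upto r G xs K zs \<Longrightarrow> agree_upto r H ys K zs \<Longrightarrow> agree_upto r G xs H ys" for r
    using agree_upto_sym[OF H] agree_upto_trans by blast
  show ?thesis
  proof (cases "\<forall>r. agree_upto r G xs H ys")
    case True
    then have "local_dist G xs H ys = 0" using local_dist_eq[OF G H] by simp
    then show ?thesis using nn by simp
  next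
    case False
    define k where "k = (LEAST r. \<not> agree_upto r G xs H ys)"
    have "\<not> agree_upto k G xs H ys" 
      unfolding k_def by (rule LeastI_ex) (use False in simp)
    then consider "\<not> agree_upto k G xs K zs" | "\<not> agree_upto k H ys K zs" using tr by blast
    moreover have d: "local_dist G xs H ys = 1 / (1 + real (k - 1))"
      using local_dist_eq[OF G H] False by (simp add: k_def del: of_nat_diff)
    moreover have *: "1 / (1 + real (k - 1)) \<le> local_dist G' xs' K zs"
      if nw: "is_network G' xs'" and n: "\<not> agree_upto k G' xs' K zs" for G' xs'
    proof -
      have "(LEAST r. \<not> agree_upto r G' xs' K zs) \<le> k" using n by (rule Least_le)
      then have "1 / (1 + real (k - 1)) \<le> 1 / (1 + real ((LEAST r. \<not> agree_upto r G' xs' K zs) - 1))"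
        by (intro divide_left_mono add_left_mono mult_pos_pos) (auto simp del: of_nat_diff)
      then show ?thesis using local_dist_eq[OF nw K] n by (auto simp del: of_nat_diff)
    qed
    ultimately show ?thesis using nn *[OF G] *[OF H] by cases linarith+
  qed
qed

lemma is_network_rep_gstar: "rep_gstar g = (G, x) \<Longrightarrow> is_network G [x]"
  using Quotient3_rep_reflp[OF Quotient3_gstar, of g] by (simp add: network_iso_def)

lemma is_network_rep_gstar2: "rep_gstar2 g = (G, x, y) \<Longrightarrow> is_network G [x, y]"
  using Quotient3_rep_reflp[OF Quotient3_gstar2, of g] by (simp add: network_iso_def)

instantiation gstar :: metric_space
begin

definition dist_gstar :: "gstar \<Rightarrow> gstar \<Rightarrow> real" where
  "dist_gstar g h =
     (case rep_gstar g of (G, x) \<Rightarrow> case rep_gstar h of (H, y) \<Rightarrow> local_dist G [x] H [y])"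

definition uniformity_gstar :: "(gstar \<times> gstar) filter" where
  "uniformity_gstar = (INF e\<in>{0<..}. principal {(g, h). dist g h < e})"

definition open_gstar :: "gstar set \<Rightarrow> bool" where
  "open_gstar U \<longleftrightarrow> (\<forall>g\<in>U. eventually (\<lambda>(g', h). g' = g \<longrightarrow> h \<in> U) uniformity)"

instance
proof
  fix g h k :: gstar
  obtain G x H y K z where r: "rep_gstar g = (G, x)" "rep_gstar h = (H, y)" "rep_gstar k = (K, z)"
    by (metis surj_pair)
  note n = r[THEN is_network_rep_gstar]
  show "dist g h = 0 \<longleftrightarrow> g = h"
    using local_dist_eq_0_iff[OF n(1,2)] Quotient3_rel_rep[OF Quotient3_gstar, of g h] r
    by (simp add: dist_gstar_def)
  show "dist g h \<le> dist g k + dist h k"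
    using local_dist_triangle[OF n] r by (simp add: dist_gstar_def)
qed (rule uniformity_gstar_def open_gstar_def)+

end

instantiation gstar2 :: metric_space
begin

definition dist_gstar2 :: "gstar2 \<Rightarrow> gstar2 \<Rightarrow> real" where
  "dist_gstar2 g h =
     (case rep_gstar2 g of (G, x, x') \<Rightarrow> case rep_gstar2 h of (H, y, y') \<Rightarrow>
        local_dist G [x, x'] H [y, y'])"

definition uniformity_gstar2 :: "(gstar2 \<times> gstar2) filter" where
  "uniformity_gstar2 = (INF e\<in>{0<..}. principal {(g, h). dist g h < e})"

definition open_gstar2 :: "gstar2 set \<Rightarrow> bool" where
  "open_gstar2 U \<longleftrightarrow> (\<forall>g\<in>U. eventually (\<lambda>(g', h). g' = g \<longrightarrow> h \<in> U) uniformity)"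

instance
proof
  fix g h k :: gstar2
  obtain G x x' H y y' K z z' where r: "rep_gstar2 g = (G, x, x')" "rep_gstar2 h = (H, y, y')"
    "rep_gstar2 k = (K, z, z')"
    by (metis surj_pair)
  note n = r[THEN is_network_rep_gstar2]
  show "dist g h = 0 \<longleftrightarrow> g = h"
    using local_dist_eq_0_iff[OF n(1,2)] Quotient3_rel_rep[OF Quotient3_gstar2, of g h] r
    by (simp add: dist_gstar2_def)
  show "dist g h \<le> dist g k + dist h k"
    using local_dist_triangle[OF n] r by (simp add: dist_gstar2_def)
qed (rule uniformity_gstar2_def open_gstar2_def)+

end

subsection \<open>Unimodular networks\<close>

text \<open>
  Functionals of an isomorphism class are evaluated on a representative \<^term>\<open>rep_gstar g\<close>; all of
  those below are invariant under rooted isomorphism.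
\<close>

definition unimodular :: "gstar measure \<Rightarrow> bool" where
  "unimodular L \<longleftrightarrow> prob_space L \<and> sets L = sets borel \<and>
     (\<forall>f \<in> borel_measurable (borel :: gstar2 measure).
        (\<integral>\<^sup>+ g. (case rep_gstar g of (G, v) \<Rightarrow> \<Sum>\<^sub>\<infinity>x\<in>verts G. f (abs_gstar2 (G, v, x))) \<partial>L) =
        (\<integral>\<^sup>+ g. (case rep_gstar g of (G, v) \<Rightarrow> \<Sum>\<^sub>\<infinity>x\<in>verts G. f (abs_gstar2 (G, x, v))) \<partial>L
           :: ennreal))"

definition concentrated_on :: "gstar measure \<Rightarrow> (nat graph \<Rightarrow> nat \<Rightarrow> bool) \<Rightarrow> bool" where
  "concentrated_on L P \<longleftrightarrow> (AE g in L. case rep_gstar g of (G, v) \<Rightarrow> P G v)"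

subsection \<open>The adjacency operator and its spectral measures\<close>

text \<open>
  Vectors of the Hilbert space of square-summable functions on a set \<open>V\<close> are functions that vanish
  outside \<open>V\<close>; unbounded operators are represented by their graphs.
\<close>

definition ell2 :: "'a set \<Rightarrow> ('a \<Rightarrow> complex) set" where
  "ell2 V = {f. (\<forall>x. x \<notin> V \<longrightarrow> f x = 0) \<and> (\<lambda>x. (cmod (f x))\<^sup>2) summable_on V}"

definition ell2_inner :: "'a set \<Rightarrow> ('a \<Rightarrow> complex) \<Rightarrow> ('a \<Rightarrow> complex) \<Rightarrow> complex" where
  "ell2_inner V f g = (\<Sum>\<^sub>\<infinity>x\<in>V. cnj (f x) * g x)"

definition ell2_norm :: "'a set \<Rightarrow> ('a \<Rightarrow> complex) \<Rightarrow> real" where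
  "ell2_norm V f = sqrt (\<Sum>\<^sub>\<infinity>x\<in>V. (cmod (f x))\<^sup>2)"

definition basis_vec :: "'a \<Rightarrow> 'a \<Rightarrow> complex" where
  "basis_vec x = (\<lambda>y. if y = x then 1 else 0)"

type_synonym 'a operator = "(('a \<Rightarrow> complex) \<times> ('a \<Rightarrow> complex)) set"

definition adjoint_op :: "'a set \<Rightarrow> 'a operator \<Rightarrow> 'a operator" where
  "adjoint_op V T = {(g, h). g \<in> ell2 V \<and> h \<in> ell2 V \<and>
     (\<forall>(f, f') \<in> T. ell2_inner V g f' = ell2_inner V h f)}"

definition closure_op :: "'a set \<Rightarrow> 'a operator \<Rightarrow> 'a operator" where
  "closure_op V T = {(g, h). g \<in> ell2 V \<and> h \<in> ell2 V \<and>
     (\<forall>e>0. \<exists>(f, f') \<in> T. ell2_norm V (\<lambda>x. f x - g x) < e \<and> ell2_norm V (\<lambda>x. f' x - h x) < e)}"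

definition essentially_self_adjoint :: "'a set \<Rightarrow> 'a operator \<Rightarrow> bool" where
  "essentially_self_adjoint V T \<longleftrightarrow> adjoint_op V (closure_op V T) = closure_op V T"

definition adjacency_op :: "'a graph \<Rightarrow> 'a operator" where
  "adjacency_op G = {(f, \<lambda>x. \<Sum>y\<in>neighbours G x. f y) | f.
     finite {x. f x \<noteq> 0} \<and> {x. f x \<noteq> 0} \<subseteq> verts G}"

definition self_adjoint_graph :: "'a graph \<Rightarrow> bool" where
  "self_adjoint_graph G \<longleftrightarrow> essentially_self_adjoint (verts G) (adjacency_op G)"

text \<open>The vector \<open>(T - z)\<^sup>-\<^sup>1 g\<close>.\<close>

definition resolvent_op :: "'a operator \<Rightarrow> complex \<Rightarrow> ('a \<Rightarrow> complex) \<Rightarrow> 'a \<Rightarrow> complex" where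
  "resolvent_op T z g = (THE f. \<exists>h. (f, h) \<in> T \<and> (\<lambda>x. h x - z * f x) = g)"

text \<open>
  On graphs that are not self-adjoint the spectral measure is not defined; the null measure is
  a dummy value there.
\<close>

definition spectral_measure :: "'a graph \<Rightarrow> 'a \<Rightarrow> real measure" where
  "spectral_measure G v =
     (if self_adjoint_graph G
      then THE \<mu>. prob_space \<mu> \<and> sets \<mu> = sets borel \<and>
        (\<forall>z. z \<notin> \<real> \<longrightarrow>
          ell2_inner (verts G) (basis_vec v)
            (resolvent_op (closure_op (verts G) (adjacency_op G)) z (basis_vec v)) =
          (\<integral>\<xi>. 1 / (complex_of_real \<xi> - z) \<partial>\<mu>))
      else null_measure borel)"

definition mean_spectral :: "gstar measure \<Rightarrow> real set \<Rightarrow> ennreal" where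
  "mean_spectral L B = (\<integral>\<^sup>+ g. (case rep_gstar g of (G, v) \<Rightarrow> emeasure (spectral_measure G v) B) \<partial>L)"

definition pure_point_support :: "gstar measure \<Rightarrow> real set" where
  "pure_point_support L = {\<theta>. mean_spectral L {\<theta>} > 0}"

subsection \<open>Anchored isoperimetry\<close>

definition vertex_boundary :: "'a graph \<Rightarrow> 'a set \<Rightarrow> 'a set" where
  "vertex_boundary G S = {y \<in> verts G - S. \<exists>x\<in>S. adjacent G x y}"

definition anchored_isoperimetric :: "'a graph \<Rightarrow> 'a \<Rightarrow> ereal" where
  "anchored_isoperimetric G v = lim (\<lambda>n.
     INF S \<in> {S. v \<in> S \<and> S \<subseteq> verts G \<and> graph_connected (induced G S) \<and> finite S \<and> n \<le> card S}.
       ereal (real (card (vertex_boundary G S)) / real (card S)))"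

subsection \<open>Totally real algebraic integers and tree-complexity\<close>

definition totally_real_algebraic_ints :: "real set" where
  "totally_real_algebraic_ints = {\<theta>. \<exists>p :: int poly. lead_coeff p = 1 \<and>
     poly (map_poly of_int p) \<theta> = 0 \<and>
     (\<forall>z :: complex. poly (map_poly of_int p) z = 0 \<longrightarrow> z \<in> \<real>)}"

text \<open>The adjacency matrix of a graph with vertex set \<open>{..<n}\<close>.\<close>

definition adjacency_matrix :: "nat \<Rightarrow> nat graph \<Rightarrow> real mat" where
  "adjacency_matrix n T = Matrix.mat n n (\<lambda>(i, j). if adjacent T i j then 1 else 0)"

definition tree_complexity :: "real \<Rightarrow> nat" where
  "tree_complexity \<theta> = (LEAST n. \<exists>T. is_tree T \<and> verts T = {..<n} \<and>
     eigenvalue (adjacency_matrix n T) \<theta>)"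

end

theory Submission
  imports Defs
begin

text \<open>
  Let \<open>P\<close> be the orthogonal projection of \<open>\<ell>\<^sup>2(V)\<close> onto the \<open>\<theta>\<close>-eigenspace of the adjacency
  operator, \<open>S\<close> the set of vertices \<open>x\<close> with \<open>\<langle>e\<^sub>x, P e\<^sub>x\<rangle> > 0\<close>, and \<open>\<partial>S\<close> its outer vertex boundary. On a
  tree, cutting an edge shows that \<open>P e\<^sub>x\<close> and \<open>P e\<^sub>y\<close> are proportional whenever \<open>x, y \<in> S\<close> are adjacent.
  Hence every component of \<open>S\<close> carries a single eigenvector up to scaling, whose restriction to a finite component
  is an eigenvector of a finite tree, so finite components have at least \<open>\<tau>(\<theta>)\<close> vertices.

  Let each \<open>x \<in> S\<close> send to a neighbour \<open>y\<close> the fraction of the mass of \<open>(P e\<^sub>x)\<^sup>2\<close> lying behind \<open>y\<close>. The two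
  flows along an edge inside \<open>S\<close> add up to 1, every \<open>y \<in> \<partial>S\<close> receives at least 1 in total, and the mass which a
  component keeps or sends to \<open>\<partial>S\<close> is at most 1. With \<open>s\<close>, \<open>b\<close>, \<open>m\<close> the expectations of \<open>1\<^sub>S\<close>,
  \<open>1\<^bsub>\<partial>S\<^esub>\<close> and \<open>\<langle>e\<^sub>o, P e\<^sub>o\<rangle>\<close> at the root, mass transport yields \<open>\<tau>(\<theta>) (b + m) \<le> s\<close>, and
  bounds the total degree on \<open>S \<union> \<partial>S\<close> by \<open>2 s + 2 \<Delta> b\<close>. Anchored expansion bounds it below by
  \<open>(c + 2) (s + b)\<close> for each \<open>c\<close> below the isoperimetric constant. Together, \<open>c \<tau>(\<theta>) (b + m) \<le> 2 \<Delta> b\<close>.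
\<close>

subsection \<open>The real Hilbert space of square-summable sequences\<close>

text \<open>The hard step is the lower degree bound. Anchored expansion controls only large finite
  connected sets through a given vertex, with a threshold depending on that vertex, while
  \<open>S\<close> and its boundary may have infinite components. So each vertex gets the weight c +
  2 - degree, and l(x, y) is the largest weight of a finite connected subset of \<open>S\<close> and
  its boundary that starts at x and avoids the neighbour y. As a connected W spans at least |W| - 1
  edges, anchored expansion keeps l finite. If t(x) is the largest weight through x, then l(x, y) =
  max 0 (t(x) - l(y, x)). Since every vertex concerned has two neighbours in \<open>S\<close> or its
  boundary, its weight is at most half the net outflow of l, so mass transport makes the mean weight
  nonpositive. A boundary vertex receives at least 1 by Cauchy-Schwarz, applied to the eigenvalue
  equation there. In the last inequality m > 0 lets b + m cancel; c = 2 i / 3 then gives 3 \<Delta>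
  / i, and \<Delta> \<ge> 2 makes this smaller than 3 \<Delta>^2 / i. The adjacency matrix is real,
  so real sequences suffice: a complex resolvent vector is a pair of them.\<close>

typedef hilb = "{f :: nat \<Rightarrow> real. summable (\<lambda>n. (f n)\<^sup>2)}"
  by (rule exI[of _ "\<lambda>_. 0"]) simp

setup_lifting type_definition_hilb

lemma summable_sq_mult:
  fixes f g :: "nat \<Rightarrow> real"
  assumes "summable (\<lambda>n. (f n)\<^sup>2)" "summable (\<lambda>n. (g n)\<^sup>2)"
  shows "summable (\<lambda>n. f n * g n)"
proof (rule summable_comparison_test')
  show "summable (\<lambda>n. (f n)\<^sup>2 + (g n)\<^sup>2)" using assms by (rule summable_add)
  fix n
  have "2 * (\<bar>f n\<bar> * \<bar>g n\<bar>) \<le> (f n)\<^sup>2 + (g n)\<^sup>2"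
    using sum_squares_bound[of "\<bar>f n\<bar>" "\<bar>g n\<bar>"] by simp
  moreover have "0 \<le> \<bar>f n\<bar> * \<bar>g n\<bar>" by simp
  ultimately have "\<bar>f n\<bar> * \<bar>g n\<bar> \<le> (f n)\<^sup>2 + (g n)\<^sup>2" by linarith
  then show "norm (f n * g n) \<le> (f n)\<^sup>2 + (g n)\<^sup>2" by (simp add: abs_mult)
qed

lemma summable_sq_add:
  fixes f g :: "nat \<Rightarrow> real"
  assumes "summable (\<lambda>n. (f n)\<^sup>2)" "summable (\<lambda>n. (g n)\<^sup>2)"
  shows "summable (\<lambda>n. (f n + g n)\<^sup>2)"
proof -
  have "summable (\<lambda>n. (f n)\<^sup>2 + 2 * (f n * g n) + (g n)\<^sup>2)"
    using assms summable_sq_mult[OF assms] by (intro summable_add summable_mult)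
  moreover have "(\<lambda>n. (f n + g n)\<^sup>2) = (\<lambda>n. (f n)\<^sup>2 + 2 * (f n * g n) + (g n)\<^sup>2)"
    by (simp add: fun_eq_iff power2_eq_square algebra_simps)
  ultimately show ?thesis by simp
qed

instantiation hilb :: real_inner
begin

lift_definition zero_hilb :: hilb is "\<lambda>_. 0" by simp
lift_definition plus_hilb :: "hilb \<Rightarrow> hilb \<Rightarrow> hilb" is "\<lambda>f g n. f n + g n"
  by (rule summable_sq_add)
lift_definition uminus_hilb :: "hilb \<Rightarrow> hilb" is "\<lambda>f n. - f n" by simp
lift_definition minus_hilb :: "hilb \<Rightarrow> hilb \<Rightarrow> hilb" is "\<lambda>f g n. f n - g n"
proof -
  fix f g :: "nat \<Rightarrow> real"
  assume "summable (\<lambda>n. (f n)\<^sup>2)" "summable (\<lambda>n. (g n)\<^sup>2)"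
  then show "summable (\<lambda>n. (f n - g n)\<^sup>2)"
    using summable_sq_add[of f "\<lambda>n. - g n"] by simp
qed
lift_definition scaleR_hilb :: "real \<Rightarrow> hilb \<Rightarrow> hilb" is "\<lambda>c f n. c * f n"
  by (simp add: power_mult_distrib summable_mult)
lift_definition inner_hilb :: "hilb \<Rightarrow> hilb \<Rightarrow> real" is "\<lambda>f g. \<Sum>n. f n * g n" .

definition norm_hilb :: "hilb \<Rightarrow> real" where "norm_hilb f = sqrt (inner f f)"
definition dist_hilb :: "hilb \<Rightarrow> hilb \<Rightarrow> real" where "dist_hilb f g = norm (f - g)"
definition sgn_hilb :: "hilb \<Rightarrow> hilb" where "sgn_hilb f = inverse (norm f) *\<^sub>R f"
definition uniformity_hilb :: "(hilb \<times> hilb) filter" where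
  "uniformity_hilb = (INF e\<in>{0<..}. principal {(x, y). dist x y < e})"
definition open_hilb :: "hilb set \<Rightarrow> bool" where
  "open_hilb U \<longleftrightarrow> (\<forall>x\<in>U. eventually (\<lambda>(x', y). x' = x \<longrightarrow> y \<in> U) uniformity)"

instance
proof
  fix x y z :: hilb and r s :: real
  show "x + y + z = x + (y + z)" "x + y = y + x" "0 + x = x" "- x + x = 0" "x - y = x + - y"
    "r *\<^sub>R (x + y) = r *\<^sub>R x + r *\<^sub>R y" "(r + s) *\<^sub>R x = r *\<^sub>R x + s *\<^sub>R x"
    "r *\<^sub>R s *\<^sub>R x = (r * s) *\<^sub>R x" "1 *\<^sub>R x = x"
    by (transfer, simp add: algebra_simps)+
  show "inner x y = inner y x" by transfer (simp add: mult.commute)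
  show "inner (x + y) z = inner x z + inner y z"
    by transfer (simp add: algebra_simps suminf_add summable_sq_mult)
  show "inner (r *\<^sub>R x) y = r * inner x y"
    by transfer (simp add: mult.assoc suminf_mult summable_sq_mult)
  show "0 \<le> inner x x"
    by transfer (auto intro!: suminf_nonneg simp: power2_eq_square)
  show "inner x x = 0 \<longleftrightarrow> x = 0"
    by transfer (auto simp: power2_eq_square suminf_eq_zero_iff)
qed (rule norm_hilb_def dist_hilb_def sgn_hilb_def uniformity_hilb_def open_hilb_def)+

end

abbreviation crd :: "hilb \<Rightarrow> nat \<Rightarrow> real" where "crd \<equiv> Rep_hilb"

lemma crd_simps [simp]:
  "crd 0 n = 0" "crd (f + g) n = crd f n + crd g n" "crd (f - g) n = crd f n - crd g n"
  "crd (- f) n = - crd f n" "crd (c *\<^sub>R f) n = c * crd f n"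
  by (transfer, simp)+

lemma hilb_eqI: "(\<And>n. crd f n = crd g n) \<Longrightarrow> f = g"
  by (metis Rep_hilb_inject ext)

lemma summable_crd: "summable (\<lambda>n. (crd f n)\<^sup>2)"
  using Rep_hilb by simp

lemma norm_hilb_sq: "(norm (f :: hilb))\<^sup>2 = (\<Sum>n. (crd f n)\<^sup>2)"
  unfolding power2_norm_eq_inner inner_hilb.rep_eq by (simp add: power2_eq_square)

lemma sum_crd_sq_le: "finite K \<Longrightarrow> (\<Sum>n\<in>K. (crd f n)\<^sup>2) \<le> (norm f)\<^sup>2"
  unfolding norm_hilb_sq by (intro sum_le_suminf summable_crd) auto

lemma abs_crd_le_norm: "\<bar>crd f n\<bar> \<le> norm f"
  using sum_crd_sq_le[of "{n}" f] abs_le_square_iff[of "crd f n" "norm f"] by simp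

lemma bounded_linear_crd: "bounded_linear (\<lambda>f. crd f n)"
  by (rule bounded_linear_intro[where K=1]) (auto simp: abs_crd_le_norm)

instance hilb :: banach
proof
  fix X :: "nat \<Rightarrow> hilb" assume "Cauchy X"
  then have C: "\<And>e. e > 0 \<Longrightarrow> \<exists>N. \<forall>m\<ge>N. \<forall>k\<ge>N. norm (X m - X k) < e"
    by (simp add: Cauchy_iff)
  have "Cauchy (\<lambda>k. crd (X k) n)" for n
    by (rule bounded_linear.Cauchy[OF bounded_linear_crd \<open>Cauchy X\<close>])
  then have "\<exists>l. (\<lambda>k. crd (X k) n) \<longlonglongrightarrow> l" for n
    by (simp add: Cauchy_convergent_iff convergent_def)
  then obtain l where l: "\<And>n. (\<lambda>k. crd (X k) n) \<longlonglongrightarrow> l n" by metis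
  \<comment> \<open>A finite partial sum involves finitely many coordinates, so the bound for
    \<open>X m - X k\<close> survives the coordinatewise limit in \<open>k\<close>; letting
    \<open>K\<close> grow afterwards bounds the whole series.\<close>
  have fin: "(\<Sum>n<K. (crd (X m) n - l n)\<^sup>2) \<le> e\<^sup>2"
    if "\<forall>m\<ge>N. \<forall>k\<ge>N. norm (X m - X k) < e" "m \<ge> N" for K m N e
  proof (rule LIMSEQ_le_const2)
    show "(\<lambda>k. \<Sum>n<K. (crd (X m) n - crd (X k) n)\<^sup>2) \<longlonglongrightarrow> (\<Sum>n<K. (crd (X m) n - l n)\<^sup>2)"
      by (intro tendsto_intros l)
    have "(\<Sum>n<K. (crd (X m) n - crd (X k) n)\<^sup>2) \<le> e\<^sup>2" if "k \<ge> N" for k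
    proof -
      have "(\<Sum>n<K. (crd (X m) n - crd (X k) n)\<^sup>2) \<le> (norm (X m - X k))\<^sup>2"
        using sum_crd_sq_le[of "{..<K}" "X m - X k"] by simp
      also have "\<dots> \<le> e\<^sup>2"
        using that \<open>m \<ge> N\<close> \<open>\<forall>m\<ge>N. \<forall>k\<ge>N. norm (X m - X k) < e\<close>
        by (intro power_mono) (auto intro: less_imp_le)
      finally show ?thesis .
    qed
    then show "\<exists>N. \<forall>k\<ge>N. (\<Sum>n<K. (crd (X m) n - crd (X k) n)\<^sup>2) \<le> e\<^sup>2" by blast
  qed
  have sm: "summable (\<lambda>n. (crd (X m) n - l n)\<^sup>2)" and bd: "(\<Sum>n. (crd (X m) n - l n)\<^sup>2) \<le> e\<^sup>2"
    if "\<forall>m\<ge>N. \<forall>k\<ge>N. norm (X m - X k) < e" "m \<ge> N" for m N e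
  proof -
    show s: "summable (\<lambda>n. (crd (X m) n - l n)\<^sup>2)"
      by (rule summableI_nonneg_bounded[where x="e\<^sup>2"]) (use fin[OF that] in auto)
    show "(\<Sum>n. (crd (X m) n - l n)\<^sup>2) \<le> e\<^sup>2"
      by (rule suminf_le_const[OF s]) (use fin[OF that] in auto)
  qed
  obtain N1 where N1: "\<forall>m\<ge>N1. \<forall>k\<ge>N1. norm (X m - X k) < 1" using C[of 1] by auto
  have "summable (\<lambda>n. (l n - crd (X N1) n)\<^sup>2)"
    using sm[OF N1 order_refl] by (subst power2_commute)
  then have "summable (\<lambda>n. (crd (X N1) n + (l n - crd (X N1) n))\<^sup>2)"
    by (intro summable_sq_add summable_crd)
  then have "summable (\<lambda>n. (l n)\<^sup>2)" by simp
  then have L: "crd (Abs_hilb l) = l" by (simp add: Abs_hilb_inverse)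
  have "X \<longlonglongrightarrow> Abs_hilb l"
  proof (rule LIMSEQ_I)
    fix e :: real assume "e > 0"
    then obtain N where N: "\<forall>m\<ge>N. \<forall>k\<ge>N. norm (X m - X k) < e/2" using C[of "e/2"] by auto
    have "norm (X m - Abs_hilb l) < e" if "m \<ge> N" for m
    proof -
      have "(norm (X m - Abs_hilb l))\<^sup>2 \<le> (e/2)\<^sup>2"
        using bd[OF N that] by (simp add: norm_hilb_sq L)
      then have "norm (X m - Abs_hilb l) \<le> e/2"
        using \<open>e > 0\<close> by (simp add: abs_le_square_iff[symmetric])
      then show ?thesis using \<open>e > 0\<close> by simp
    qed
    then show "\<exists>N. \<forall>m\<ge>N. norm (X m - Abs_hilb l) < e" by blast
  qed
  then show "convergent X" by (rule convergentI)
qed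

subsection \<open>Polynomials in a bounded self-adjoint operator\<close>

text \<open>Horner evaluation of the polynomial at the operator. It stands in for a functional
  calculus: resolvent vectors and eigenprojections are obtained below as limits of such
  polynomials.\<close>

definition polyop :: "('a::real_vector \<Rightarrow> 'a) \<Rightarrow> real poly \<Rightarrow> 'a \<Rightarrow> 'a" where
  "polyop A p = fold_coeffs (\<lambda>a f u. a *\<^sub>R u + A (f u)) p (\<lambda>u. 0)"

locale self_adjoint_op =
  fixes A :: "'a::{real_inner,banach} \<Rightarrow> 'a" and M :: real
  assumes lin: "linear A" and sym: "inner (A u) v = inner u (A v)"
    and bound: "norm (A u) \<le> M * norm u" and M_pos: "M > 0"
begin

lemma bl: "bounded_linear A"
  using lin bound by (intro bounded_linear_intro[where K=M]) (auto simp: linear_add linear_scale mult.commute)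

lemma polyop_0 [simp]: "polyop A 0 u = 0"
  by (simp add: polyop_def)

lemma polyop_pCons [simp]: "polyop A (pCons a p) u = a *\<^sub>R u + A (polyop A p u)"
  by (cases "p = 0 \<and> a = 0") (auto simp: polyop_def linear_0[OF lin])

lemma polyop_1 [simp]: "polyop A 1 u = u"
  by (simp add: one_pCons linear_0[OF lin])

lemma polyop_add: "polyop A (p + q) u = polyop A p u + polyop A q u"
  by (induction p q rule: poly_induct2) (simp_all add: linear_add[OF lin] algebra_simps)

lemma polyop_smult: "polyop A (Polynomial.smult c p) u = c *\<^sub>R polyop A p u"
  by (induction p) (simp_all add: linear_scale[OF lin] algebra_simps)

lemma polyop_diff: "polyop A (p - q) u = polyop A p u - polyop A q u"
  using polyop_add[of p "Polynomial.smult (-1) q" u] polyop_smult[of "-1" q u] by simp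

lemma polyop_mult: "polyop A (p * q) u = polyop A p (polyop A q u)"
  by (induction p) (simp_all add: polyop_add polyop_smult)

lemma polyop_sum: "polyop A (\<Sum>i\<in>I. p i) u = (\<Sum>i\<in>I. polyop A (p i) u)"
  by (induction I rule: infinite_finite_induct) (simp_all add: polyop_add)

lemma polyop_bl: "bounded_linear (polyop A p)"
proof (induction p)
  case 0
  have "polyop A 0 = (\<lambda>u. 0)" by (rule ext) simp
  then show ?case by (simp only:) (rule bounded_linear_zero)
next
  case (pCons a p)
  have "polyop A (pCons a p) = (\<lambda>u. a *\<^sub>R u + A (polyop A p u))" by (rule ext) simp
  then show ?case
    by (simp only:) (intro bounded_linear_add bounded_linear_scaleR_right
        bounded_linear_compose[OF bl] pCons)
qed

lemma polyop_lin: "linear (polyop A p)"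
  by (rule bounded_linear.linear[OF polyop_bl])

lemma polyop_commute: "A (polyop A p u) = polyop A p (A u)"
  by (induction p) (simp_all add: linear_add[OF lin] linear_scale[OF lin] linear_0[OF lin])

lemma polyop_sym: "inner (polyop A p u) v = inner u (polyop A p v)"
  by (induction p arbitrary: u v)
    (simp_all add: inner_add_left inner_add_right sym polyop_commute)

lemma polyop_eigen:
  assumes "A v = \<theta> *\<^sub>R v"
  shows "polyop A p v = poly p \<theta> *\<^sub>R v"
  by (induction p) (simp_all add: linear_scale[OF lin] assms algebra_simps)

definition pos :: "real poly \<Rightarrow> bool" where
  "pos p \<longleftrightarrow> (\<forall>u. 0 \<le> inner (polyop A p u) u)"

lemma pos_sq_mult: "pos p \<Longrightarrow> pos (q\<^sup>2 * p)"
proof -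
  assume p: "pos p"
  have "inner (polyop A (q\<^sup>2 * p) u) u = inner (polyop A p (polyop A q u)) (polyop A q u)" for u
  proof -
    have "q\<^sup>2 * p = q * (p * q)" by (simp add: power2_eq_square)
    then have "polyop A (q\<^sup>2 * p) u = polyop A q (polyop A p (polyop A q u))"
      by (simp only: polyop_mult)
    then show ?thesis by (simp add: polyop_sym)
  qed
  then show ?thesis using p by (simp add: pos_def)
qed

lemma pos_add: "pos p \<Longrightarrow> pos q \<Longrightarrow> pos (p + q)"
  by (simp add: pos_def polyop_add inner_add_left)

lemma pos_1: "pos 1"
  by (simp add: pos_def)

text \<open>The barycentric coordinates of the interval [-M, M]: \<open>tp\<close> runs from 0 to 1
  on it and \<open>sp\<close> is the complement.\<close>

definition tp :: "real poly" where "tp = [:1/2, 1/(2*M):]"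
definition sp :: "real poly" where "sp = [:1/2, -1/(2*M):]"

lemma tp_sp: "tp + sp = 1"
  by (simp add: tp_def sp_def one_pCons)

lemma inner_A_bound: "\<bar>inner (A u) u\<bar> \<le> M * inner u u"
proof -
  have "\<bar>inner (A u) u\<bar> \<le> norm (A u) * norm u" by (rule Cauchy_Schwarz_ineq2)
  also have "\<dots> \<le> (M * norm u) * norm u" by (intro mult_right_mono bound) simp
  also have "\<dots> = M * inner u u" by (simp add: dot_square_norm power2_eq_square)
  finally show ?thesis .
qed

lemma pos_tp: "pos tp" and pos_sp: "pos sp"
proof -
  have "0 \<le> inner (polyop A tp u) u \<and> 0 \<le> inner (polyop A sp u) u" for u
  proof -
    have "inner (polyop A tp u) u = (M * inner u u + inner (A u) u) / (2*M)"
      "inner (polyop A sp u) u = (M * inner u u - inner (A u) u) / (2*M)"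
      using M_pos by (simp_all add: tp_def sp_def inner_add_left inner_diff_left linear_scale[OF lin] linear_add[OF lin] linear_0[OF lin] linear_neg[OF lin] field_simps)
    then show ?thesis using inner_A_bound[of u] M_pos by simp
  qed
  then show "pos tp" "pos sp" by (auto simp: pos_def)
qed

text \<open>Multiplying by \<open>tp + sp = 1\<close> turns the product into a square times
  \<open>sp\<close> plus a square times \<open>tp\<close>. This gives positivity of a product of
  commuting positive operators without operator square roots.\<close>

lemma pos_tp_sp: "pos (tp * sp)"
proof -
  have "tp * sp = tp * sp * (tp + sp)" by (simp add: tp_sp)
  also have "\<dots> = tp\<^sup>2 * sp + sp\<^sup>2 * tp" by (simp add: power2_eq_square algebra_simps)
  finally show ?thesis using pos_add pos_sq_mult pos_tp pos_sp by metis
qed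

text \<open>Even powers form a square, which \<open>pos_sq_mult\<close> absorbs; the remaining
  exponents are 0 or 1.\<close>

lemma pos_power_mult:
  assumes p: "pos p" and q: "pos q" and pq: "pos (p * q)"
  shows "pos (p ^ k * q ^ j)"
proof -
  have *: "pos (p ^ a * q ^ b)" if "a < 2" "b < 2" for a b :: nat
  proof -
    have "a = 0 \<or> a = 1" "b = 0 \<or> b = 1" using that by auto
    then show ?thesis using p q pq pos_1 by auto
  qed
  have "p ^ k * q ^ j = (p ^ (k div 2) * q ^ (j div 2))\<^sup>2 * (p ^ (k mod 2) * q ^ (j mod 2))"
  proof -
    have "p ^ k = (p ^ (k div 2))\<^sup>2 * p ^ (k mod 2)" "q ^ j = (q ^ (j div 2))\<^sup>2 * q ^ (j mod 2)"
      by (simp_all only: power_mult[symmetric] power_add[symmetric] mult.commute[of _ 2] mult_div_mod_eq)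
    then show ?thesis by (simp add: power_mult_distrib mult_ac)
  qed
  then show ?thesis using pos_sq_mult[OF *, of "k mod 2" "j mod 2"] by simp
qed

section \<open>The moment functional of a vector and its Bernstein approximation\<close>

definition Lam :: "'a \<Rightarrow> real poly \<Rightarrow> real" where
  "Lam e p = inner (polyop A p e) e"

lemma Lam_add: "Lam e (p + q) = Lam e p + Lam e q"
  by (simp add: Lam_def polyop_add inner_add_left)

lemma Lam_smult: "Lam e (Polynomial.smult c p) = c * Lam e p"
  by (simp add: Lam_def polyop_smult)

lemma Lam_of_nat_mult: "Lam e (of_nat c * p) = real c * Lam e p"
  by (simp add: of_nat_poly Lam_smult)

lemma Lam_sum: "Lam e (\<Sum>i\<in>I. p i) = (\<Sum>i\<in>I. Lam e (p i))"
  by (simp add: Lam_def polyop_sum inner_sum_left)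

lemma Lam_mult: "Lam e (p * q) = inner (polyop A p e) (polyop A q e)"
  by (simp only: Lam_def mult.commute[of p q] polyop_mult polyop_sym)

text \<open>The weights of the Bernstein approximation of the moment functional \<open>Lam e\<close> on \<open>[-M, M]\<close>; they are
  nonnegative since \<open>M + A\<close> and \<open>M - A\<close> are positive and commute, and their weak limit is the spectral measure.\<close>

definition bern :: "'a \<Rightarrow> nat \<Rightarrow> nat \<Rightarrow> real" where
  "bern e n k = real (n choose k) * Lam e (tp ^ k * sp ^ (n - k))"

lemma bern_nonneg: "0 \<le> bern e n k"
  using pos_power_mult[OF pos_tp pos_sp pos_tp_sp] by (simp add: bern_def Lam_def pos_def)

lemma sum_bern:
  "(\<Sum>k\<le>n. real (n choose k) * Lam e (p * (tp ^ k * sp ^ (n - k)))) = Lam e p"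
proof -
  have "Lam e p = Lam e (p * (tp + sp) ^ n)" by (simp add: tp_sp)
  also have "\<dots> = Lam e (\<Sum>k\<le>n. of_nat (n choose k) * (p * (tp ^ k * sp ^ (n - k))))"
    by (simp only: binomial_ring sum_distrib_left mult_ac)
  also have "\<dots> = (\<Sum>k\<le>n. real (n choose k) * Lam e (p * (tp ^ k * sp ^ (n - k))))"
    by (simp only: Lam_sum Lam_of_nat_mult)
  finally show ?thesis by simp
qed

lemma bern_sum_1: "norm e = 1 \<Longrightarrow> (\<Sum>k\<le>n. bern e n k) = 1"
  using sum_bern[of n e 1] by (simp add: bern_def) (simp add: Lam_def dot_square_norm)

text \<open>Binomial test functions are reproduced exactly: \<open>(n choose k) * (k choose j) = (n
  choose j) * ((n - j) choose (k - j))\<close> turns the sum into the expansion of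
  \<open>(tp + sp) ^ (n - j)\<close>. Ordinary powers are reproduced only in the limit.\<close>

lemma bern_factorial_moment:
  assumes "j \<le> n"
  shows "(\<Sum>k\<le>n. bern e n k * (real (k choose j) / real (n choose j))) = Lam e (tp ^ j)"
proof -
  have nz: "real (n choose j) \<noteq> 0" using assms by simp
  have "(\<Sum>k\<le>n. bern e n k * real (k choose j)) = (\<Sum>k\<in>{j..n}. bern e n k * real (k choose j))"
    by (rule sum.mono_neutral_right) auto
  also have "\<dots> = (\<Sum>i\<le>n - j. real (n choose j) *
      (real ((n - j) choose i) * Lam e (tp ^ j * (tp ^ i * sp ^ (n - j - i)))))"
  proof (rule sum.reindex_bij_witness[of _ "\<lambda>i. i + j" "\<lambda>k. k - j"])
    fix k assume k: "k \<in> {j..n}"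
    then have c: "(n choose k) * (k choose j) = (n choose j) * ((n - j) choose (k - j))"
      by (intro choose_mult) auto
    have t: "tp ^ k = tp ^ j * tp ^ (k - j)" using k by (simp add: power_add[symmetric])
    have "real (n choose k) * real (k choose j) = real (n choose j) * real ((n - j) choose (k - j))"
      by (simp only: of_nat_mult[symmetric] c)
    then have "bern e n k * real (k choose j) = real (n choose j) * real ((n - j) choose (k - j)) *
        Lam e (tp ^ k * sp ^ (n - k))"
      unfolding bern_def by (metis mult.assoc mult.commute)
    moreover have "tp ^ k * sp ^ (n - k) = tp ^ j * (tp ^ (k - j) * sp ^ (n - j - (k - j)))"
      using k by (simp add: t mult.assoc)
    ultimately show "real (n choose j) * (real ((n - j) choose (k - j)) *
        Lam e (tp ^ j * (tp ^ (k - j) * sp ^ (n - j - (k - j))))) = bern e n k * real (k choose j)"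
      by (simp add: mult.assoc)
  qed (use assms in auto)
  also have "\<dots> = real (n choose j) * Lam e (tp ^ j)"
    by (simp only: sum_distrib_left[symmetric] sum_bern)
  finally show ?thesis using nz by (simp add: sum_divide_distrib[symmetric] divide_eq_eq mult.commute)
qed

text \<open>The ratio is a product of \<open>j\<close> factors (k - i) / (n - i), each close to k /
  n, and products of numbers of modulus at most 1 differ by at most the sum of the differences of
  their factors. The assumption \<open>2 * j < n\<close> keeps the modulus at most 1 even where
  \<open>k < i\<close> makes a factor negative.\<close>

lemma choose_ratio_diff:
  assumes "2 * j < n" "k \<le> n"
  shows "\<bar>real (k choose j) / real (n choose j) - (real k / real n) ^ j\<bar> \<le> real j * (real j / (real n - real j))"
proof -
  have r: "real (k choose j) / real (n choose j) = (\<Prod>i<j. (real k - real i) / (real n - real i))"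
    by (simp add: binomial_gbinomial gbinomial_prod_rev prod_dividef lessThan_atLeast0)
  have p: "(real k / real n) ^ j = (\<Prod>i<j. real k / real n)" by simp
  have a: "\<bar>(real k - real i) / (real n - real i)\<bar> \<le> 1" if "i < j" for i
    using that assms by (simp add: abs_le_iff field_simps)
  have d: "\<bar>(real k - real i) / (real n - real i) - real k / real n\<bar> \<le> real j / (real n - real j)"
    if "i < j" for i
  proof -
    have pos: "real n - real i > 0" "real n > 0" "real n - real j > 0" using that assms by auto
    define X where "X = (real n - real k) / real n"
    have eq: "(real k - real i) / (real n - real i) - real k / real n = - (real i * X / (real n - real i))"
      using pos by (simp add: X_def field_simps)
    have "0 \<le> X" "X \<le> 1" using assms by (auto simp: X_def field_simps)
    then have "0 \<le> real i * X / (real n - real i)"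
       "real i * X / (real n - real i) \<le> real j * 1 / (real n - real j)"
      using pos that by (intro divide_nonneg_pos mult_nonneg_nonneg frac_le mult_mono; simp)+
    then show ?thesis unfolding eq abs_minus_cancel by (simp only: abs_of_nonneg mult_1_right)
  qed
  have "norm ((\<Prod>i<j. (real k - real i) / (real n - real i)) - (\<Prod>i<j. real k / real n))
      \<le> (\<Sum>i<j. norm ((real k - real i) / (real n - real i) - real k / real n))"
    by (rule norm_prod_diff) (use a assms in auto)
  also have "\<dots> \<le> (\<Sum>i<j. real j / (real n - real j))"
    by (rule sum_mono) (use d in auto)
  finally show ?thesis unfolding r p by simp
qed

lemma bern_moment:
  assumes "norm e = 1"
  shows "(\<lambda>n. \<Sum>k\<le>n. bern e n k * (real k / real n) ^ j) \<longlonglongrightarrow> Lam e (tp ^ j)"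
proof -
  have "(\<lambda>n. (\<Sum>k\<le>n. bern e n k * (real k / real n) ^ j) - Lam e (tp ^ j)) \<longlonglongrightarrow> 0"
  proof (rule Lim_null_comparison)
    show "(\<lambda>n. real j * (real j / (real n - real j))) \<longlonglongrightarrow> 0"
      by real_asymp
    show "\<forall>\<^sub>F n in sequentially. norm ((\<Sum>k\<le>n. bern e n k * (real k / real n) ^ j) - Lam e (tp ^ j))
        \<le> real j * (real j / (real n - real j))"
      unfolding eventually_sequentially
    proof (intro exI[of _ "Suc (2 * j)"] allI impI)
      fix n assume "Suc (2 * j) \<le> n"
      then have n: "2 * j < n" "j \<le> n" by auto
      have "(\<Sum>k\<le>n. bern e n k * (real k / real n) ^ j) - Lam e (tp ^ j) =
        (\<Sum>k\<le>n. bern e n k * ((real k / real n) ^ j - real (k choose j) / real (n choose j)))"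
        by (simp add: bern_factorial_moment[OF n(2), symmetric] right_diff_distrib sum_subtractf)
      also have "norm \<dots> \<le> (\<Sum>k\<le>n. bern e n k * (real j * (real j / (real n - real j))))"
      proof (rule sum_norm_le)
        fix k assume "k \<in> {..n}"
        then have "\<bar>(real k / real n) ^ j - real (k choose j) / real (n choose j)\<bar> \<le> real j * (real j / (real n - real j))"
          using choose_ratio_diff[OF n(1), of k] by (simp add: abs_minus_commute)
        then show "norm (bern e n k * ((real k / real n) ^ j - real (k choose j) / real (n choose j)))
            \<le> bern e n k * (real j * (real j / (real n - real j)))"
          unfolding real_norm_def abs_mult abs_of_nonneg[OF bern_nonneg]
          by (rule mult_left_mono[OF _ bern_nonneg])
      qed
      also have "\<dots> = real j * (real j / (real n - real j))"
        by (simp only: sum_distrib_right[symmetric] bern_sum_1[OF assms] mult_1)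
      finally show "norm ((\<Sum>k\<le>n. bern e n k * (real k / real n) ^ j) - Lam e (tp ^ j))
        \<le> real j * (real j / (real n - real j))" .
    qed
  qed
  then show ?thesis by (rule LIM_zero_cancel)
qed

text \<open>The weight with index \<open>k\<close> sits at the point where \<open>tp\<close> takes
  the value k / n.\<close>

definition bernm :: "'a \<Rightarrow> nat \<Rightarrow> real measure" where
  "bernm e n = distr (point_measure {..n} (\<lambda>k. ennreal (bern e n k))) borel
     (\<lambda>k. 2 * M * (real k / real n) - M)"

lemma bernm_dist:
  assumes "norm e = 1"
  shows "real_distribution (bernm e n)"
proof -
  have "prob_space (point_measure {..n} (\<lambda>k. ennreal (bern e n k)))"
    using bern_nonneg bern_sum_1[OF assms, of n]
    by (intro prob_space_point_measure) (auto simp: sum_ennreal)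
  then show ?thesis unfolding bernm_def
    by (intro prob_space.real_distribution_distr) (auto simp: measurable_point_measure_eq1)
qed

lemma integral_bernm:
  fixes f :: "real \<Rightarrow> real"
  assumes [measurable]: "f \<in> borel_measurable borel"
  shows "integral\<^sup>L (bernm e n) f = (\<Sum>k\<le>n. bern e n k * f (2 * M * (real k / real n) - M))"
  unfolding bernm_def
  by (subst integral_distr)
    (auto simp: measurable_point_measure_eq1 lebesgue_integral_point_measure_finite bern_nonneg)

lemma bern_point_range:
  assumes "k \<le> n"
  shows "- M \<le> 2 * M * (real k / real n) - M" "2 * M * (real k / real n) - M \<le> M"
proof -
  have "0 \<le> real k / real n" "real k / real n \<le> 1" using assms by (auto simp: divide_le_eq)
  then have "0 \<le> M * (real k / real n)" "M * (real k / real n) \<le> M * 1"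
    using M_pos by (intro mult_nonneg_nonneg mult_left_mono; simp)+
  then show "- M \<le> 2 * M * (real k / real n) - M" "2 * M * (real k / real n) - M \<le> M" by auto
qed

lemma bernm_poly:
  assumes "norm e = 1"
  shows "(\<lambda>n. integral\<^sup>L (bernm e n) (poly p)) \<longlonglongrightarrow> Lam e p"
proof -
  let ?C = "\<lambda>p. (\<lambda>n. integral\<^sup>L (bernm e n) (poly p)) \<longlonglongrightarrow> Lam e p"
  have I: "integral\<^sup>L (bernm e n) (poly p) = (\<Sum>k\<le>n. bern e n k * poly p (2 * M * (real k / real n) - M))" for p n
    by (rule integral_bernm) (intro borel_measurable_continuous_onI continuous_intros)
  have add: "?C (p + q)" if "?C p" "?C q" for p q
    using tendsto_add[OF that] by (simp add: I Lam_add distrib_left sum.distrib)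
  have smult: "?C (Polynomial.smult c p)" if "?C p" for p c
    using tendsto_mult_left[OF that, of c] by (simp add: I Lam_smult sum_distrib_left mult_ac)
  have tpj: "?C (tp ^ j)" for j
  proof -
    have "poly tp (2 * M * (real k / real n) - M) = real k / real n" for k n
      using M_pos by (simp add: tp_def field_simps)
    then show ?thesis using bern_moment[OF assms, of j] by (simp add: I poly_power)
  qed
  have zero: "?C 0" by (simp add: I Lam_def)
  \<comment> \<open>Every polynomial is a polynomial in \<open>tp\<close>. The extra power
    \<open>tp ^ j\<close> lets the induction on \<open>q\<close> absorb the factor \<open>tp\<close>
    that each Horner step produces.\<close>
  have "\<forall>j. ?C (tp ^ j * pcompose q tp)" for q
  proof (induction q)
    case 0
    have "tp ^ j * pcompose 0 tp = 0" for j by simp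
    then show ?case using zero by (auto simp only:)
  next
    case (pCons a q)
    have "tp ^ j * pcompose (pCons a q) tp = Polynomial.smult a (tp ^ j) + tp ^ Suc j * pcompose q tp" for j
      by (simp add: pcompose_pCons algebra_simps)
    then show ?case using pCons.IH add smult tpj by metis
  qed
  from this[of "pcompose p [:-M, 2*M:]"] have "?C (tp ^ 0 * pcompose (pcompose p [:-M, 2*M:]) tp)" by blast
  moreover have "pcompose (pcompose p [:-M, 2*M:]) tp = pcompose p (pcompose [:-M, 2*M:] tp)"
    by (simp only: pcompose_assoc)
  moreover have "pcompose [:-M, 2*M:] tp = [:0, 1:]"
    using M_pos by (simp add: tp_def pcompose_pCons)
  ultimately show ?thesis by simp
qed

text \<open>The approximating measures all live on [-M, M], so a subsequence converges weakly. Weak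
  convergence tests bounded continuous functions only; polynomials become bounded by composition
  with the retraction \<open>c\<close> onto [-M, M].\<close>

lemma spectral_measure_exists:
  assumes e: "norm e = 1"
  obtains \<mu> where "real_distribution \<mu>" "AE \<xi> in \<mu>. \<bar>\<xi>\<bar> \<le> M"
    "\<And>p. (\<integral>\<xi>. poly p \<xi> \<partial>\<mu>) = Lam e p"
proof -
  have rd: "real_distribution (bernm e n)" for n by (rule bernm_dist[OF e])
  have tight: "tight (bernm e)"
    unfolding tight_def
  proof (intro conjI allI impI rd)
    fix \<epsilon> :: real assume "0 < \<epsilon>"
    have "measure (bernm e n) {-M-1<..M} > 1 - \<epsilon>" for n
    proof -
      interpret real_distribution "bernm e n" by (rule rd)
      have "measure (bernm e n) {-M-1<..M} = (\<integral>x. indicator {-M-1<..M} x \<partial>bernm e n)"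
        by simp
      also have "\<dots> = (\<Sum>k\<le>n. bern e n k * indicator {-M-1<..M} (2 * M * (real k / real n) - M))"
        by (rule integral_bernm) simp
      also have "\<dots> = (\<Sum>k\<le>n. bern e n k * 1)"
        using bern_point_range by (intro sum.cong) (auto simp: indicator_def, smt (verit))
      finally show ?thesis using bern_sum_1[OF e] \<open>0 < \<epsilon>\<close> by simp
    qed
    then show "\<exists>a b. a < b \<and> (\<forall>n. 1 - \<epsilon> < measure (bernm e n) {a<..b})"
      using M_pos by (intro exI[of _ "-M-1"] exI[of _ M]) auto
  qed
  obtain r \<mu> where r: "strict_mono r" and \<mu>: "real_distribution \<mu>"
    and w: "weak_conv_m (bernm e \<circ> id \<circ> r) \<mu>"
    using tight_imp_convergent_subsubsequence[OF tight strict_mono_id] by blast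
  interpret \<mu>: real_distribution \<mu> by (rule \<mu>)
  define c where "c \<xi> = max (-M) (min M \<xi>)" for \<xi>
  have c_cont: "isCont c \<xi>" for \<xi> unfolding c_def by (intro continuous_intros)
  have cM: "\<bar>c \<xi>\<bar> \<le> M" for \<xi> using M_pos by (auto simp: c_def)
  have cid: "c \<xi> = \<xi>" if "- M \<le> \<xi>" "\<xi> \<le> M" for \<xi> using that by (auto simp: c_def)
  have conv: "(\<lambda>n. integral\<^sup>L (bernm e (r n)) f) \<longlonglongrightarrow> integral\<^sup>L \<mu> f"
    if "\<And>x. isCont f x" "\<And>x. norm (f x) \<le> B" for f :: "real \<Rightarrow> real" and B
    using weak_conv_imp_integral_bdd_continuous_conv[of "bernm e \<circ> id \<circ> r" \<mu> f B] rd \<mu> w that by auto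
  have meas: "f \<in> borel_measurable borel" if "\<And>x. isCont f x" for f :: "real \<Rightarrow> real"
    using that by (intro borel_measurable_continuous_onI) (simp add: continuous_at_imp_continuous_on)
  \<comment> \<open>A bounded continuous function that vanishes exactly on [-M, M]. Its integral is
    0 along the sequence, hence in the limit, which confines the limit measure to this
    interval.\<close>
  define d where "d \<xi> = min 1 \<bar>\<xi> - c \<xi>\<bar>" for \<xi>
  have d_cont: "isCont d \<xi>" for \<xi> unfolding d_def by (intro continuous_intros c_cont)
  have d0: "integral\<^sup>L (bernm e n) d = 0" for n
    unfolding integral_bernm[OF meas[OF d_cont]]
    using cid bern_point_range by (intro sum.neutral) (auto simp: d_def)
  have "integral\<^sup>L \<mu> d = 0"
    using LIMSEQ_unique[OF conv[OF d_cont, of 1] , unfolded d0, OF _ tendsto_const] by (auto simp: d_def)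
  moreover have "integrable \<mu> d"
    by (rule \<mu>.integrable_const_bound[where B=1]) (use meas[OF d_cont] in \<open>auto simp: d_def\<close>)
  ultimately have "AE \<xi> in \<mu>. d \<xi> = 0"
    using integral_nonneg_eq_0_iff_AE[of \<mu> d] by (auto simp: d_def)
  then have ae: "AE \<xi> in \<mu>. c \<xi> = \<xi>"
    by eventually_elim (auto simp: d_def min_def split: if_splits)
  then have "AE \<xi> in \<mu>. \<bar>\<xi>\<bar> \<le> M"
    by eventually_elim (metis cM)
  moreover have "(\<integral>\<xi>. poly p \<xi> \<partial>\<mu>) = Lam e p" for p
  proof -
    have pc: "isCont (\<lambda>\<xi>. poly p (c \<xi>)) \<xi>" for \<xi> by (intro continuous_intros c_cont)
    have "compact ((poly p) ` {-M..M})"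
      by (intro compact_continuous_image continuous_intros) auto
    then obtain B where "\<forall>x\<in>poly p ` {-M..M}. norm x \<le> B"
      by (blast dest: compact_imp_bounded bounded_iff[THEN iffD1])
    then have B: "norm (poly p \<xi>) \<le> B" if "\<xi> \<in> {-M..M}" for \<xi> using that by blast
    have cI: "c \<xi> \<in> {-M..M}" for \<xi> using cM[of \<xi>] by (auto simp: abs_le_iff)
    have "(\<lambda>n. integral\<^sup>L (bernm e (r n)) (\<lambda>\<xi>. poly p (c \<xi>))) \<longlonglongrightarrow> integral\<^sup>L \<mu> (\<lambda>\<xi>. poly p (c \<xi>))"
      by (rule conv[OF pc B[OF cI]])
    moreover have "integral\<^sup>L (bernm e n) (\<lambda>\<xi>. poly p (c \<xi>)) = integral\<^sup>L (bernm e n) (poly p)" for n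
      unfolding integral_bernm[OF meas[OF pc]] integral_bernm[OF meas[OF poly_isCont]]
      using cid bern_point_range by (intro sum.cong) auto
    ultimately have "(\<lambda>n. integral\<^sup>L (bernm e (r n)) (poly p)) \<longlonglongrightarrow> integral\<^sup>L \<mu> (\<lambda>\<xi>. poly p (c \<xi>))" by simp
    moreover have "(\<lambda>n. integral\<^sup>L (bernm e (r n)) (poly p)) \<longlonglongrightarrow> Lam e p"
      using LIMSEQ_subseq_LIMSEQ[OF bernm_poly[OF e] r] by (simp add: o_def)
    ultimately have "Lam e p = integral\<^sup>L \<mu> (\<lambda>\<xi>. poly p (c \<xi>))" by (rule LIMSEQ_unique[rotated])
    also have "\<dots> = integral\<^sup>L \<mu> (poly p)"
      by (intro integral_cong_AE) (use ae meas[OF pc] meas[OF poly_isCont] in auto)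
    finally show ?thesis by simp
  qed
  ultimately show ?thesis using that \<mu> by blast
qed

section \<open>Resolvents and eigenprojections read off from the spectral measure\<close>

definition spec :: "'a \<Rightarrow> real measure \<Rightarrow> bool" where
  "spec e \<mu> \<longleftrightarrow> real_distribution \<mu> \<and> (AE \<xi> in \<mu>. \<bar>\<xi>\<bar> \<le> M) \<and> (\<forall>p. (\<integral>\<xi>. poly p \<xi> \<partial>\<mu>) = Lam e p)"

lemma poly_bounded: obtains B where "\<And>\<xi>. \<bar>\<xi>\<bar> \<le> M \<Longrightarrow> \<bar>poly p \<xi>\<bar> \<le> B" "B \<ge> 0"
proof -
  have "compact ((poly p) ` {-M..M})"
    by (intro compact_continuous_image continuous_intros) auto
  then obtain B where B: "\<forall>x\<in>poly p ` {-M..M}. norm x \<le> B"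
    by (blast dest: compact_imp_bounded bounded_iff[THEN iffD1])
  have "\<bar>poly p \<xi>\<bar> \<le> max B 0" if "\<bar>\<xi>\<bar> \<le> M" for \<xi>
  proof -
    have "\<xi> \<in> {-M..M}" using that by auto
    then have "norm (poly p \<xi>) \<le> B" using B by blast
    then show ?thesis by simp
  qed
  then show ?thesis using that[of "max B 0"] by simp
qed

lemma borel_measurable_poly [measurable]: "poly p \<in> borel_measurable (borel :: real measure)"
  by (intro borel_measurable_continuous_onI continuous_intros)

lemma spec_integrable:
  assumes "spec e \<mu>"
  shows "integrable \<mu> (poly p)"
proof -
  interpret real_distribution \<mu> using assms by (simp add: spec_def)
  obtain B where B: "\<And>\<xi>. \<bar>\<xi>\<bar> \<le> M \<Longrightarrow> \<bar>poly p \<xi>\<bar> \<le> B" "B \<ge> 0" by (rule poly_bounded[of p]) blast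
  have "AE \<xi> in \<mu>. \<bar>\<xi>\<bar> \<le> M" using assms by (simp add: spec_def)
  then have "AE \<xi> in \<mu>. norm (poly p \<xi>) \<le> B" by eventually_elim (use B in auto)
  then show ?thesis by (intro integrable_const_bound[where B=B]) auto
qed

text \<open>The equation ((A - a)^2 + b^2) u = e is the real form of the resolvent equation at a + b
  i. A Neumann series solves it; its convergence is seen through the spectral measure, since the
  squared norm of \<open>polyop A (r ^ n) e\<close> is the integral of the 2n-th power of
  \<open>r\<close>.\<close>

lemma resolvent_exists:
  assumes \<mu>: "spec e \<mu>" and "b \<noteq> 0"
  obtains u where "polyop A [:a\<^sup>2 + b\<^sup>2, -2*a, 1:] u = e"
    "\<And>h. inner (polyop A h u) e = (\<integral>\<xi>. poly h \<xi> / ((\<xi> - a)\<^sup>2 + b\<^sup>2) \<partial>\<mu>)"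
proof -
  interpret \<mu>: real_distribution \<mu> using \<mu> by (simp add: spec_def)
  have ae: "AE \<xi> in \<mu>. \<bar>\<xi>\<bar> \<le> M" and mom: "\<And>p. (\<integral>\<xi>. poly p \<xi> \<partial>\<mu>) = Lam e p"
    using \<mu> by (auto simp: spec_def)
  define q where "q = [:a\<^sup>2 + b\<^sup>2, -2*a, 1:]"
  \<comment> \<open>\<open>N\<close> bounds \<open>q\<close> from above on [-M, M], so that
    \<open>r\<close> is nonnegative there, and the lower bound b^2 for \<open>q\<close> keeps
    \<open>r\<close> below \<open>\<rho> < 1\<close>.\<close>
  define N where "N = (M + \<bar>a\<bar>)\<^sup>2 + b\<^sup>2"
  define r where "r = 1 - Polynomial.smult (1/N) q"
  define \<rho> where "\<rho> = 1 - b\<^sup>2 / N"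
  have pq: "poly q \<xi> = (\<xi> - a)\<^sup>2 + b\<^sup>2" for \<xi>
    by (simp add: q_def power2_eq_square algebra_simps)
  have b2: "b\<^sup>2 > 0" using \<open>b \<noteq> 0\<close> by simp
  have N: "N > 0" unfolding N_def using b2 by (intro add_nonneg_pos) auto
  have q0: "poly q \<xi> \<ge> b\<^sup>2" for \<xi> by (simp add: pq)
  have qN: "poly q \<xi> \<le> N" if "\<bar>\<xi>\<bar> \<le> M" for \<xi>
  proof -
    have "\<bar>\<xi> - a\<bar> \<le> M + \<bar>a\<bar>" using that by linarith
    then have "\<bar>\<xi> - a\<bar>\<^sup>2 \<le> (M + \<bar>a\<bar>)\<^sup>2" by (intro power_mono) auto
    then show ?thesis by (simp add: pq N_def)
  qed
  have rr: "0 \<le> poly r \<xi>" "poly r \<xi> \<le> \<rho>" if "\<bar>\<xi>\<bar> \<le> M" for \<xi>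
    using qN[OF that] q0[of \<xi>] N by (simp_all add: r_def \<rho>_def divide_right_mono)
  have bN: "b\<^sup>2 \<le> N" unfolding N_def by simp
  have \<rho>: "0 \<le> \<rho>" "\<rho> < 1" using bN b2 N by (auto simp: \<rho>_def)
  have nrm: "norm (polyop A (r ^ n) e) \<le> \<rho> ^ n" for n
  proof -
    have "AE \<xi> in \<mu>. poly (r ^ n * r ^ n) \<xi> \<le> (\<rho> ^ n)\<^sup>2"
      using ae
    proof eventually_elim
      fix \<xi> assume "\<bar>\<xi>\<bar> \<le> M"
      then have "poly r \<xi> ^ n \<le> \<rho> ^ n" "0 \<le> poly r \<xi> ^ n" using rr by (auto intro: power_mono)
      then show "poly (r ^ n * r ^ n) \<xi> \<le> (\<rho> ^ n)\<^sup>2"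
        by (simp add: poly_power power2_eq_square mult_mono)
    qed
    then have "(\<integral>\<xi>. poly (r ^ n * r ^ n) \<xi> \<partial>\<mu>) \<le> (\<rho> ^ n)\<^sup>2"
      by (intro \<mu>.integral_le_const spec_integrable[OF \<mu>])
    then have "(norm (polyop A (r ^ n) e))\<^sup>2 \<le> (\<rho> ^ n)\<^sup>2"
      unfolding mom Lam_mult power2_norm_eq_inner .
    then show ?thesis by (rule power2_le_imp_le) (use \<rho> in simp)
  qed
  define T where "T n = (1/N) *\<^sub>R polyop A (r ^ n) e" for n
  have "summable T"
  proof (rule summable_norm_cancel, rule summable_comparison_test')
    show "summable (\<lambda>n. (1/N) * \<rho> ^ n)" using \<rho> by (intro summable_mult summable_geometric) auto
    show "norm (norm (T n)) \<le> (1/N) * \<rho> ^ n" for n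
      using nrm[of n] N by (simp add: T_def divide_right_mono)
  qed
  define u where "u = suminf T"
  have Tu: "T sums u" using \<open>summable T\<close> by (simp add: u_def summable_sums)
  have hT: "polyop A h (T n) = polyop A (Polynomial.smult (1/N) (h * r ^ n)) e" for h n
    by (simp add: T_def polyop_smult polyop_mult linear_scale[OF polyop_lin])
  have hu: "(\<lambda>n. polyop A (Polynomial.smult (1/N) (h * r ^ n)) e) sums polyop A h u" for h
    using bounded_linear.sums[OF polyop_bl Tu, of h] by (simp only: hT)
  have "polyop A q u = e"
  proof -
    have "Polynomial.smult (1/N) (q * r ^ n) = r ^ n - r ^ Suc n" for n
    proof -
      have "Polynomial.smult (1/N) q = 1 - r" by (simp add: r_def)
      then have "Polynomial.smult (1/N) (q * r ^ n) = (1 - r) * r ^ n" by (metis mult_smult_left)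
      then show ?thesis by (simp add: algebra_simps)
    qed
    then have "(\<lambda>n. polyop A (r ^ n) e - polyop A (r ^ Suc n) e) sums polyop A q u"
      using hu[of q] by (simp only: polyop_diff)
    moreover have "(\<lambda>n. polyop A (r ^ n) e) \<longlonglongrightarrow> 0"
    proof (rule Lim_null_comparison)
      show "(\<lambda>n. \<rho> ^ n) \<longlonglongrightarrow> 0" using \<rho> by (intro LIMSEQ_realpow_zero) auto
    qed (simp add: nrm)
    then have "(\<lambda>n. polyop A (r ^ n) e - polyop A (r ^ Suc n) e) sums (polyop A (r ^ 0) e - 0)"
      by (rule telescope_sums')
    ultimately have "polyop A q u = polyop A (r ^ 0) e - 0" by (rule sums_unique2)
    then show ?thesis by simp
  qed
  moreover have "inner (polyop A h u) e = (\<integral>\<xi>. poly h \<xi> / ((\<xi> - a)\<^sup>2 + b\<^sup>2) \<partial>\<mu>)" for h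
  proof -
    obtain B where B: "\<And>\<xi>. \<bar>\<xi>\<bar> \<le> M \<Longrightarrow> \<bar>poly h \<xi>\<bar> \<le> B" "B \<ge> 0" by (rule poly_bounded[of h]) blast
    have "(\<lambda>n. \<Sum>i<n. Lam e (Polynomial.smult (1/N) (h * r ^ i))) \<longlonglongrightarrow> inner (polyop A h u) e"
      using bounded_linear.sums[OF bounded_linear_inner_left[of e] hu[of h]] by (simp add: Lam_def sums_def)
    moreover have "(\<lambda>n. \<Sum>i<n. Lam e (Polynomial.smult (1/N) (h * r ^ i))) \<longlonglongrightarrow>
        (\<integral>\<xi>. poly h \<xi> / poly q \<xi> \<partial>\<mu>)"
    proof -
      have "(\<Sum>i<n. Lam e (Polynomial.smult (1/N) (h * r ^ i))) =
          (\<integral>\<xi>. poly h \<xi> * (1 - poly r \<xi> ^ n) / poly q \<xi> \<partial>\<mu>)" for n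
      proof -
        have pt: "poly (\<Sum>i<n. Polynomial.smult (1/N) (h * r ^ i)) \<xi> =
            poly h \<xi> * (1 - poly r \<xi> ^ n) / poly q \<xi>" for \<xi>
        proof -
          have "1 - poly r \<xi> = poly q \<xi> / N" by (simp add: r_def)
          then have "1 - poly r \<xi> ^ n = poly q \<xi> / N * (\<Sum>i<n. poly r \<xi> ^ i)"
            using one_diff_power_eq[of "poly r \<xi>" n] by simp
          moreover have "poly q \<xi> \<noteq> 0" using q0[of \<xi>] b2 by auto
          moreover have "poly (\<Sum>i<n. Polynomial.smult (1/N) (h * r ^ i)) \<xi> =
              poly h \<xi> / N * (\<Sum>i<n. poly r \<xi> ^ i)"
            by (simp add: poly_sum poly_power sum_distrib_left mult_ac)
          ultimately show ?thesis by simp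
        qed
        have "(\<Sum>i<n. Lam e (Polynomial.smult (1/N) (h * r ^ i))) =
            (\<integral>\<xi>. poly (\<Sum>i<n. Polynomial.smult (1/N) (h * r ^ i)) \<xi> \<partial>\<mu>)"
          by (simp only: mom Lam_sum)
        also have "\<dots> = (\<integral>\<xi>. poly h \<xi> * (1 - poly r \<xi> ^ n) / poly q \<xi> \<partial>\<mu>)"
          by (simp only: pt)
        finally show ?thesis .
      qed
      moreover have "(\<lambda>n. (\<integral>\<xi>. poly h \<xi> * (1 - poly r \<xi> ^ n) / poly q \<xi> \<partial>\<mu>)) \<longlonglongrightarrow>
        (\<integral>\<xi>. poly h \<xi> / poly q \<xi> \<partial>\<mu>)"
      proof (rule integral_dominated_convergence[where w="\<lambda>_. B / b\<^sup>2"])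
        show "AE \<xi> in \<mu>. (\<lambda>n. poly h \<xi> * (1 - poly r \<xi> ^ n) / poly q \<xi>) \<longlonglongrightarrow> poly h \<xi> / poly q \<xi>"
          using ae
        proof eventually_elim
          fix \<xi> assume "\<bar>\<xi>\<bar> \<le> M"
          then have "(\<lambda>n. poly r \<xi> ^ n) \<longlonglongrightarrow> 0" using rr[OF \<open>\<bar>\<xi>\<bar> \<le> M\<close>] \<rho> by (intro LIMSEQ_realpow_zero) auto
          then have "(\<lambda>n. poly h \<xi> * (1 - poly r \<xi> ^ n) / poly q \<xi>) \<longlonglongrightarrow> poly h \<xi> * (1 - 0) / poly q \<xi>"
            using q0[of \<xi>] b2 by (intro tendsto_divide tendsto_mult tendsto_diff tendsto_const) auto
          then show "(\<lambda>n. poly h \<xi> * (1 - poly r \<xi> ^ n) / poly q \<xi>) \<longlonglongrightarrow> poly h \<xi> / poly q \<xi>" by simp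
        qed
        show "AE \<xi> in \<mu>. norm (poly h \<xi> * (1 - poly r \<xi> ^ n) / poly q \<xi>) \<le> B / b\<^sup>2" for n
          using ae
        proof eventually_elim
          fix \<xi> assume M: "\<bar>\<xi>\<bar> \<le> M"
          have "0 \<le> poly r \<xi> ^ n" "poly r \<xi> ^ n \<le> 1" using rr[OF M] \<rho> by (auto intro!: power_le_one)
          then have "\<bar>poly h \<xi> * (1 - poly r \<xi> ^ n)\<bar> \<le> B * 1"
            unfolding abs_mult using B M by (intro mult_mono) auto
          then have "\<bar>poly h \<xi> * (1 - poly r \<xi> ^ n)\<bar> / \<bar>poly q \<xi>\<bar> \<le> B / b\<^sup>2"
            using q0[of \<xi>] b2 B(2) by (intro frac_le) auto
          then show "norm (poly h \<xi> * (1 - poly r \<xi> ^ n) / poly q \<xi>) \<le> B / b\<^sup>2" by simp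
        qed
      qed auto
      ultimately show ?thesis by simp
    qed
    ultimately have "inner (polyop A h u) e = (\<integral>\<xi>. poly h \<xi> / poly q \<xi> \<partial>\<mu>)"
      by (rule LIMSEQ_unique)
    then show ?thesis by (simp only: pq)
  qed
  ultimately show ?thesis by (intro that[of u]) (simp_all only: q_def)
qed

text \<open>On \<open>[-M, M]\<close> this polynomial takes values in \<open>[0, 1]\<close> and equals 1 only at \<open>\<theta>\<close>, so its powers
  converge to the indicator of \<open>\<theta>\<close>.\<close>

definition dpoly :: "real \<Rightarrow> real poly" where
  "dpoly \<theta> = 1 - Polynomial.smult (1 / (M + \<bar>\<theta>\<bar>)\<^sup>2) ([:-\<theta>, 1:] * [:-\<theta>, 1:])"

text \<open>Inner products of the vectors \<open>polyop A (dpoly \<theta> ^ n) e\<close> depend only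
  on the sum of the two exponents and converge to the mass of \<theta>, so the vectors form a Cauchy
  sequence. The limit is the orthogonal projection of \<open>e\<close> onto the eigenspace.\<close>

lemma eigenprojection_exists:
  assumes \<mu>: "spec e \<mu>"
  obtains w where "(\<lambda>n. polyop A (dpoly \<theta> ^ n) e) \<longlonglongrightarrow> w" "A w = \<theta> *\<^sub>R w"
    "inner w w = measure \<mu> {\<theta>}" "\<And>v. A v = \<theta> *\<^sub>R v \<Longrightarrow> inner v w = inner v e"
proof -
  interpret \<mu>: real_distribution \<mu> using \<mu> by (simp add: spec_def)
  have ae: "AE \<xi> in \<mu>. \<bar>\<xi>\<bar> \<le> M" and mom: "\<And>p. (\<integral>\<xi>. poly p \<xi> \<partial>\<mu>) = Lam e p"
    using \<mu> by (auto simp: spec_def)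
  define N where "N = (M + \<bar>\<theta>\<bar>)\<^sup>2"
  have N: "N > 0" using M_pos by (simp add: N_def)
  let ?d = "dpoly \<theta>"
  have pd: "poly ?d \<xi> = 1 - (\<xi> - \<theta>)\<^sup>2 / N" for \<xi>
  proof -
    have "poly [:-\<theta>, 1:] \<xi> = \<xi> - \<theta>" by simp
    then show ?thesis
      unfolding dpoly_def N_def poly_diff poly_smult poly_mult poly_1 power2_eq_square
      by (simp only: mult_1_left times_divide_eq_left)
  qed
  have d01: "0 \<le> poly ?d \<xi>" "poly ?d \<xi> \<le> 1" if "\<bar>\<xi>\<bar> \<le> M" for \<xi>
  proof -
    have "\<bar>\<xi> - \<theta>\<bar> \<le> M + \<bar>\<theta>\<bar>" using that by linarith
    then have "\<bar>\<xi> - \<theta>\<bar>\<^sup>2 \<le> (M + \<bar>\<theta>\<bar>)\<^sup>2" by (intro power_mono) auto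
    then have "(\<xi> - \<theta>)\<^sup>2 \<le> N" by (simp add: N_def)
    then show "0 \<le> poly ?d \<xi>" "poly ?d \<xi> \<le> 1" using N by (auto simp: pd)
  qed
  define X where "X n = polyop A (?d ^ n) e" for n
  define l where "l n = Lam e (?d ^ n)" for n
  have inn: "inner (X n) (X m) = l (n + m)" for n m
    by (simp add: X_def l_def power_add Lam_mult)
  have "(\<lambda>n. (\<integral>\<xi>. poly (?d ^ n) \<xi> \<partial>\<mu>)) \<longlonglongrightarrow> (\<integral>\<xi>. indicator {\<theta>} \<xi> \<partial>\<mu>)"
  proof (rule integral_dominated_convergence[where w="\<lambda>_. 1"])
    show "AE \<xi> in \<mu>. (\<lambda>n. poly (?d ^ n) \<xi>) \<longlonglongrightarrow> indicator {\<theta>} \<xi>"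
      using ae
    proof eventually_elim
      fix \<xi> assume "\<bar>\<xi>\<bar> \<le> M"
      show "(\<lambda>n. poly (?d ^ n) \<xi>) \<longlonglongrightarrow> indicator {\<theta>} \<xi>"
      proof (cases "\<xi> = \<theta>")
        case True
        then show ?thesis by (simp add: poly_power pd)
      next
        case False
        then have "poly ?d \<xi> < 1" using N by (simp add: pd)
        then show ?thesis using False d01[OF \<open>\<bar>\<xi>\<bar> \<le> M\<close>]
          by (simp add: poly_power LIMSEQ_realpow_zero)
      qed
    qed
    show "AE \<xi> in \<mu>. norm (poly (?d ^ n) \<xi>) \<le> 1" for n
      using ae by eventually_elim (use d01 in \<open>auto simp: poly_power power_le_one\<close>)
  qed auto
  then have l: "l \<longlonglongrightarrow> measure \<mu> {\<theta>}"
    unfolding mom by (simp add: l_def[abs_def])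
  have "Cauchy X"
    unfolding Cauchy_iff
  proof (intro allI impI)
    fix \<epsilon> :: real assume "\<epsilon> > 0"
    then obtain K where K: "\<And>n. n \<ge> K \<Longrightarrow> \<bar>l n - measure \<mu> {\<theta>}\<bar> < \<epsilon>\<^sup>2 / 4"
      using LIMSEQ_D[OF l, of "\<epsilon>\<^sup>2 / 4"] by auto
    have "norm (X n - X m) < \<epsilon>" if "n \<ge> K" "m \<ge> K" for n m
    proof -
      have "(norm (X n - X m))\<^sup>2 = l (n + n) + l (m + m) - 2 * l (n + m)"
        by (simp add: power2_norm_eq_inner inner_diff_left inner_diff_right inn add.commute)
      also have "\<dots> < \<epsilon>\<^sup>2"
        using K[OF trans_le_add1[OF that(1)], of n] K[OF trans_le_add1[OF that(2)], of m]
          K[OF trans_le_add1[OF that(1)], of m] by linarith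
      finally show ?thesis by (rule power2_less_imp_less) (use \<open>\<epsilon> > 0\<close> in simp)
    qed
    then show "\<exists>K. \<forall>m\<ge>K. \<forall>n\<ge>K. norm (X m - X n) < \<epsilon>" by blast
  qed
  then obtain w where w: "X \<longlonglongrightarrow> w" by (auto simp: Cauchy_convergent_iff convergent_def)
  have "polyop A ?d w = w"
  proof (rule LIMSEQ_unique)
    show "(\<lambda>n. polyop A ?d (X n)) \<longlonglongrightarrow> polyop A ?d w"
      by (rule bounded_linear.tendsto[OF polyop_bl w])
    have "polyop A ?d (X n) = X (Suc n)" for n
      by (simp add: X_def polyop_mult)
    then show "(\<lambda>n. polyop A ?d (X n)) \<longlonglongrightarrow> w" using LIMSEQ_Suc[OF w] by simp
  qed
  \<comment> \<open>As \<open>dpoly \<theta>\<close> fixes \<open>w\<close>, the operator (A -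
    \<theta>)^2 annihilates \<open>w\<close>. By symmetry the squared norm of (A - \<theta>) w is
    then 0 as well.\<close>
  define t where "t = [:-\<theta>, 1:]"
  have "(1/N) *\<^sub>R polyop A (t * t) w = w - polyop A ?d w"
    by (simp only: dpoly_def polyop_diff polyop_smult polyop_1 N_def t_def) simp
  then have "(1/N) *\<^sub>R polyop A (t * t) w = 0" by (simp only: \<open>polyop A ?d w = w\<close> diff_self)
  then have "polyop A t (polyop A t w) = 0"
    using N by (simp add: polyop_mult)
  then have "inner (polyop A t w) (polyop A t w) = 0"
    by (simp add: polyop_sym)
  then have "polyop A t w = 0" by (rule inner_eq_zero_iff[THEN iffD1])
  then have Aw: "A w = \<theta> *\<^sub>R w" by (simp add: t_def linear_0[OF lin])
  have "inner w w = measure \<mu> {\<theta>}"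
  proof (rule LIMSEQ_unique)
    show "(\<lambda>n. inner (X n) (X n)) \<longlonglongrightarrow> inner w w" by (intro tendsto_intros w)
    have "strict_mono (\<lambda>n::nat. n + n)" by (auto simp: strict_mono_def)
    then show "(\<lambda>n. inner (X n) (X n)) \<longlonglongrightarrow> measure \<mu> {\<theta>}"
      unfolding inn using LIMSEQ_subseq_LIMSEQ[OF l] by (auto simp: o_def)
  qed
  moreover have "inner v w = inner v e" if "A v = \<theta> *\<^sub>R v" for v
  proof (rule LIMSEQ_unique)
    show "(\<lambda>n. inner v (X n)) \<longlonglongrightarrow> inner v w" by (intro tendsto_intros w)
    have "inner v (X n) = inner v e" for n
      unfolding X_def polyop_sym[symmetric] polyop_eigen[OF that] by (simp add: poly_power pd)
    then show "(\<lambda>n. inner v (X n)) \<longlonglongrightarrow> inner v e" by simp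
  qed
  ultimately show ?thesis using that w Aw unfolding X_def by blast
qed

end

subsection \<open>Stieltjes inversion\<close>

lemma abs_arctan_diff: "norm (arctan s - arctan t) \<le> pi"
  using arctan_ubound[of s] arctan_lbound[of s] arctan_ubound[of t] arctan_lbound[of t]
  by (simp add: abs_le_iff)

text \<open>Up to the factor pi these are the masses that the Poisson-smoothed measure at scale 1 /
  n^2 gives to [x + 1 / n, n]. The left end approaches \<open>x\<close> much more slowly than the
  scale shrinks, so an atom at \<open>x\<close> is dropped entirely rather than by half, and the
  limit is the open half-line.\<close>

lemma stieltjes_halfline:
  assumes "real_distribution \<mu>"
  shows "(\<lambda>n. \<integral>\<xi>. (arctan ((real n - \<xi>) * (real n)\<^sup>2) - arctan ((x + 1 / real n - \<xi>) * (real n)\<^sup>2)) \<partial>\<mu>)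
    \<longlonglongrightarrow> pi * measure \<mu> {x<..}"
proof -
  interpret real_distribution \<mu> by (rule assms)
  have "(\<lambda>n. \<integral>\<xi>. (arctan ((real n - \<xi>) * (real n)\<^sup>2) - arctan ((x + 1 / real n - \<xi>) * (real n)\<^sup>2)) \<partial>\<mu>)
    \<longlonglongrightarrow> (\<integral>\<xi>. pi * indicator {x<..} \<xi> \<partial>\<mu>)"
  proof (rule integral_dominated_convergence[where w="\<lambda>_. pi"])
    show "AE \<xi> in \<mu>. (\<lambda>n. arctan ((real n - \<xi>) * (real n)\<^sup>2) - arctan ((x + 1 / real n - \<xi>) * (real n)\<^sup>2))
        \<longlonglongrightarrow> pi * indicator {x<..} \<xi>"
    proof (rule AE_I2)
      fix \<xi>
      have 1: "(\<lambda>n. arctan ((real n - \<xi>) * (real n)\<^sup>2)) \<longlonglongrightarrow> pi / 2"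
        by (rule filterlim_compose[OF tendsto_arctan_at_top]) real_asymp
      show "(\<lambda>n. arctan ((real n - \<xi>) * (real n)\<^sup>2) - arctan ((x + 1 / real n - \<xi>) * (real n)\<^sup>2))
        \<longlonglongrightarrow> pi * indicator {x<..} \<xi>"
      proof (cases "\<xi> > x")
        case True
        have "filterlim (\<lambda>n. (x + 1 / real n - \<xi>) * (real n)\<^sup>2) at_bot sequentially"
          using True by real_asymp
        then have "(\<lambda>n. arctan ((x + 1 / real n - \<xi>) * (real n)\<^sup>2)) \<longlonglongrightarrow> - (pi / 2)"
          by (rule filterlim_compose[OF tendsto_arctan_at_bot])
        from tendsto_diff[OF 1 this] True show ?thesis by simp
      next
        case False
        have "filterlim (\<lambda>n. (x + 1 / real n - \<xi>) * (real n)\<^sup>2) at_top sequentially"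
        proof (cases "\<xi> = x")
          case True
          have "filterlim (\<lambda>n. (1 / real n) * (real n)\<^sup>2) at_top sequentially" by real_asymp
          then show ?thesis using True by simp
        next
          case False
          then have "\<xi> < x" using \<open>\<not> \<xi> > x\<close> by simp
          then show ?thesis by real_asymp
        qed
        then have "(\<lambda>n. arctan ((x + 1 / real n - \<xi>) * (real n)\<^sup>2)) \<longlonglongrightarrow> pi / 2"
          by (rule filterlim_compose[OF tendsto_arctan_at_top])
        from tendsto_diff[OF 1 this] False show ?thesis by simp
      qed
    qed
    show "AE \<xi> in \<mu>. norm (arctan ((real n - \<xi>) * (real n)\<^sup>2) - arctan ((x + 1 / real n - \<xi>) * (real n)\<^sup>2)) \<le> pi" for n
    proof (rule AE_I2)
      fix \<xi>
      show "norm (arctan ((real n - \<xi>) * (real n)\<^sup>2) - arctan ((x + 1 / real n - \<xi>) * (real n)\<^sup>2)) \<le> pi"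
        by (rule abs_arctan_diff)
    qed
  qed auto
  then show ?thesis by simp
qed

text \<open>The kernel is the imaginary part of 1 / (\<xi> - (a + i \<epsilon>)), so these
  arctangent averages are determined by the Stieltjes transform. Its antiderivative in
  \<open>a\<close> is an arctangent, and Fubini applies because the kernel is nonnegative.\<close>

lemma integral_poisson_kernel:
  assumes "real_distribution \<mu>" "\<epsilon> > 0" "x \<le> y"
  shows "(\<integral>\<^sup>+a. indicator {x..y} a * ennreal (\<integral>\<xi>. \<epsilon> / ((\<xi> - a)\<^sup>2 + \<epsilon>\<^sup>2) \<partial>\<mu>) \<partial>lborel) =
    ennreal (\<integral>\<xi>. (arctan ((y - \<xi>) / \<epsilon>) - arctan ((x - \<xi>) / \<epsilon>)) \<partial>\<mu>)"
proof -
  interpret real_distribution \<mu> by (rule assms)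
  interpret pair_sigma_finite lborel \<mu> ..
  have pos: "(\<xi> - a)\<^sup>2 + \<epsilon>\<^sup>2 \<ge> \<epsilon>\<^sup>2" "\<epsilon>\<^sup>2 > 0" for \<xi> a :: real using assms by auto
  have pos': "(\<xi> - a)\<^sup>2 + \<epsilon>\<^sup>2 > 0" for \<xi> a :: real using pos(1)[of \<xi> a] pos(2) by linarith
  have I: "ennreal (\<integral>\<xi>. \<epsilon> / ((\<xi> - a)\<^sup>2 + \<epsilon>\<^sup>2) \<partial>\<mu>) = (\<integral>\<^sup>+\<xi>. ennreal (\<epsilon> / ((\<xi> - a)\<^sup>2 + \<epsilon>\<^sup>2)) \<partial>\<mu>)" for a
  proof (rule nn_integral_eq_integral[symmetric])
    show "integrable \<mu> (\<lambda>\<xi>. \<epsilon> / ((\<xi> - a)\<^sup>2 + \<epsilon>\<^sup>2))"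
    proof (rule integrable_const_bound[where B="\<epsilon> / \<epsilon>\<^sup>2"])
      show "AE \<xi> in \<mu>. norm (\<epsilon> / ((\<xi> - a)\<^sup>2 + \<epsilon>\<^sup>2)) \<le> \<epsilon> / \<epsilon>\<^sup>2"
      proof (rule AE_I2)
        fix \<xi>
        have "\<epsilon> / ((\<xi> - a)\<^sup>2 + \<epsilon>\<^sup>2) \<le> \<epsilon> / \<epsilon>\<^sup>2" using pos(1)[of \<xi> a] assms by (intro divide_left_mono mult_pos_pos pos') auto
        then show "norm (\<epsilon> / ((\<xi> - a)\<^sup>2 + \<epsilon>\<^sup>2)) \<le> \<epsilon> / \<epsilon>\<^sup>2" using pos'[of \<xi> a] assms by simp
      qed
    qed simp
  qed (use pos' assms in \<open>auto intro!: divide_nonneg_pos\<close>)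
  have "(\<integral>\<^sup>+a. indicator {x..y} a * ennreal (\<integral>\<xi>. \<epsilon> / ((\<xi> - a)\<^sup>2 + \<epsilon>\<^sup>2) \<partial>\<mu>) \<partial>lborel) =
    (\<integral>\<^sup>+a. (\<integral>\<^sup>+\<xi>. indicator {x..y} a * ennreal (\<epsilon> / ((\<xi> - a)\<^sup>2 + \<epsilon>\<^sup>2)) \<partial>\<mu>) \<partial>lborel)"
    unfolding I by (intro nn_integral_cong nn_integral_cmult[symmetric]) auto
  also have "\<dots> = (\<integral>\<^sup>+\<xi>. (\<integral>\<^sup>+a. indicator {x..y} a * ennreal (\<epsilon> / ((\<xi> - a)\<^sup>2 + \<epsilon>\<^sup>2)) \<partial>lborel) \<partial>\<mu>)"
    by (rule Fubini'[symmetric]) measurable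
  also have "\<dots> = (\<integral>\<^sup>+\<xi>. ennreal (arctan ((y - \<xi>) / \<epsilon>) - arctan ((x - \<xi>) / \<epsilon>)) \<partial>\<mu>)"
  proof (rule nn_integral_cong)
    fix \<xi>
    have "(\<integral>\<^sup>+a. ennreal (\<epsilon> / ((\<xi> - a)\<^sup>2 + \<epsilon>\<^sup>2)) * indicator {x..y} a \<partial>lborel) =
      ennreal (arctan ((y - \<xi>) / \<epsilon>) - arctan ((x - \<xi>) / \<epsilon>))"
    proof (rule nn_integral_FTC_Icc)
      show "((\<lambda>a. arctan ((a - \<xi>) / \<epsilon>)) has_real_derivative \<epsilon> / ((\<xi> - a)\<^sup>2 + \<epsilon>\<^sup>2)) (at a)" for a
      proof -
        have "1 / \<epsilon> * (1 / (1 + ((a - \<xi>) / \<epsilon>)\<^sup>2)) = \<epsilon> / ((\<xi> - a)\<^sup>2 + \<epsilon>\<^sup>2)"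
        proof -
          have "1 + ((a - \<xi>) / \<epsilon>)\<^sup>2 = ((\<xi> - a)\<^sup>2 + \<epsilon>\<^sup>2) / \<epsilon>\<^sup>2"
            using assms by (simp add: power_divide power2_commute add_divide_distrib)
          then show ?thesis using assms by (simp add: power2_eq_square)
        qed
        moreover have "((\<lambda>a. arctan ((a - \<xi>) / \<epsilon>)) has_real_derivative 1 / \<epsilon> * (1 / (1 + ((a - \<xi>) / \<epsilon>)\<^sup>2))) (at a)"
          using assms by (auto intro!: derivative_eq_intros simp: divide_inverse)
        ultimately show ?thesis by simp
      qed
    qed (use assms pos' in \<open>auto intro!: divide_nonneg_pos\<close>)
    then show "(\<integral>\<^sup>+a. indicator {x..y} a * ennreal (\<epsilon> / ((\<xi> - a)\<^sup>2 + \<epsilon>\<^sup>2)) \<partial>lborel) =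
      ennreal (arctan ((y - \<xi>) / \<epsilon>) - arctan ((x - \<xi>) / \<epsilon>))" by (simp add: mult.commute)
  qed
  also have "\<dots> = ennreal (\<integral>\<xi>. (arctan ((y - \<xi>) / \<epsilon>) - arctan ((x - \<xi>) / \<epsilon>)) \<partial>\<mu>)"
  proof (rule nn_integral_eq_integral)
    show "integrable \<mu> (\<lambda>\<xi>. arctan ((y - \<xi>) / \<epsilon>) - arctan ((x - \<xi>) / \<epsilon>))"
    proof (rule integrable_const_bound[where B=pi])
      show "AE \<xi> in \<mu>. norm (arctan ((y - \<xi>) / \<epsilon>) - arctan ((x - \<xi>) / \<epsilon>)) \<le> pi"
      proof (rule AE_I2)
        fix \<xi>
        show "norm (arctan ((y - \<xi>) / \<epsilon>) - arctan ((x - \<xi>) / \<epsilon>)) \<le> pi"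
          by (rule abs_arctan_diff)
      qed
    qed simp
    show "AE \<xi> in \<mu>. 0 \<le> arctan ((y - \<xi>) / \<epsilon>) - arctan ((x - \<xi>) / \<epsilon>)"
      using assms by (intro AE_I2) (auto simp: arctan_le_iff divide_right_mono)
  qed
  finally show ?thesis .
qed

text \<open>This evaluates the definite description in \<open>spectral_measure\<close>. The
  transform determines the Poisson averages, these the masses of open half-lines, and these the
  measure.\<close>

lemma stieltjes_unique:
  assumes \<mu>: "real_distribution \<mu>" and \<nu>: "real_distribution \<nu>"
    and eq: "\<And>z. z \<notin> \<real> \<Longrightarrow> (\<integral>\<xi>. 1 / (complex_of_real \<xi> - z) \<partial>\<mu>) = (\<integral>\<xi>. 1 / (complex_of_real \<xi> - z) \<partial>\<nu>)"
  shows "\<mu> = \<nu>"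
proof -
  have Im: "Im (\<integral>\<xi>. 1 / (complex_of_real \<xi> - Complex a \<epsilon>) \<partial>\<kappa>) = (\<integral>\<xi>. \<epsilon> / ((\<xi> - a)\<^sup>2 + \<epsilon>\<^sup>2) \<partial>\<kappa>)"
    if "real_distribution \<kappa>" "\<epsilon> > 0" for \<kappa> a \<epsilon>
  proof -
    interpret real_distribution \<kappa> by (rule that)
    have "integrable \<kappa> (\<lambda>\<xi>. 1 / (complex_of_real \<xi> - Complex a \<epsilon>))"
    proof (rule integrable_const_bound[where B="1 / \<epsilon>"])
      show "AE \<xi> in \<kappa>. norm (1 / (complex_of_real \<xi> - Complex a \<epsilon>)) \<le> 1 / \<epsilon>"
      proof (rule AE_I2)
        fix \<xi>
        have "\<epsilon> \<le> cmod (complex_of_real \<xi> - Complex a \<epsilon>)"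
          using abs_Im_le_cmod[of "complex_of_real \<xi> - Complex a \<epsilon>"] that by simp
        then have "1 / cmod (complex_of_real \<xi> - Complex a \<epsilon>) \<le> 1 / \<epsilon>" using that by (intro frac_le) auto
        then show "norm (1 / (complex_of_real \<xi> - Complex a \<epsilon>)) \<le> 1 / \<epsilon>" by (simp add: norm_divide)
      qed
    qed simp
    then have *: "Im (\<integral>\<xi>. 1 / (complex_of_real \<xi> - Complex a \<epsilon>) \<partial>\<kappa>) = (\<integral>\<xi>. Im (1 / (complex_of_real \<xi> - Complex a \<epsilon>)) \<partial>\<kappa>)"
      by (rule integral_Im[symmetric])
    moreover have "Im (1 / (complex_of_real \<xi> - Complex a \<epsilon>)) = \<epsilon> / ((\<xi> - a)\<^sup>2 + \<epsilon>\<^sup>2)" for \<xi>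
      by (simp add: Im_divide)
    ultimately show ?thesis by simp
  qed
  have P: "(\<integral>\<xi>. \<epsilon> / ((\<xi> - a)\<^sup>2 + \<epsilon>\<^sup>2) \<partial>\<mu>) = (\<integral>\<xi>. \<epsilon> / ((\<xi> - a)\<^sup>2 + \<epsilon>\<^sup>2) \<partial>\<nu>)" if "\<epsilon> > 0" for a \<epsilon>
  proof -
    have "Complex a \<epsilon> \<notin> \<real>" using that by (simp add: complex_is_Real_iff)
    from eq[OF this] show ?thesis using Im[OF \<mu> that] Im[OF \<nu> that] by metis
  qed
  have H: "(\<integral>\<xi>. (arctan ((y - \<xi>) / \<epsilon>) - arctan ((x - \<xi>) / \<epsilon>)) \<partial>\<mu>) =
      (\<integral>\<xi>. (arctan ((y - \<xi>) / \<epsilon>) - arctan ((x - \<xi>) / \<epsilon>)) \<partial>\<nu>)" if "\<epsilon> > 0" "x \<le> y" for x y \<epsilon>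
  proof -
    have "ennreal (\<integral>\<xi>. (arctan ((y - \<xi>) / \<epsilon>) - arctan ((x - \<xi>) / \<epsilon>)) \<partial>\<mu>) =
      ennreal (\<integral>\<xi>. (arctan ((y - \<xi>) / \<epsilon>) - arctan ((x - \<xi>) / \<epsilon>)) \<partial>\<nu>)"
      using integral_poisson_kernel[OF \<mu> that] integral_poisson_kernel[OF \<nu> that] P[OF that(1)] by simp
    moreover have "0 \<le> (\<integral>\<xi>. (arctan ((y - \<xi>) / \<epsilon>) - arctan ((x - \<xi>) / \<epsilon>)) \<partial>\<kappa>)" for \<kappa>
      using that by (intro integral_nonneg_AE AE_I2) (auto simp: arctan_le_iff divide_right_mono)
    ultimately show ?thesis by simp
  qed
  have half: "measure \<mu> {x<..} = measure \<nu> {x<..}" for x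
  proof -
    let ?F = "\<lambda>\<kappa> n. \<integral>\<xi>. (arctan ((real n - \<xi>) * (real n)\<^sup>2) - arctan ((x + 1 / real n - \<xi>) * (real n)\<^sup>2)) \<partial>\<kappa>"
    have "\<forall>\<^sub>F n in sequentially. x + 1 / real n \<le> real n \<and> real n > 0"
      by (intro eventually_conj; real_asymp)
    then have "\<forall>\<^sub>F n in sequentially. ?F \<mu> n = ?F \<nu> n"
    proof eventually_elim
      case (elim n)
      then show ?case using H[of "1 / (real n)\<^sup>2" "x + 1 / real n" "real n"] by simp
    qed
    then have "?F \<nu> \<longlonglongrightarrow> pi * measure \<mu> {x<..}"
      using stieltjes_halfline[OF \<mu>] by (rule Lim_transform_eventually[rotated])
    then have "pi * measure \<mu> {x<..} = pi * measure \<nu> {x<..}"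
      using stieltjes_halfline[OF \<nu>] LIMSEQ_unique by blast
    then show ?thesis by simp
  qed
  interpret \<mu>: real_distribution \<mu> by (rule \<mu>)
  interpret \<nu>: real_distribution \<nu> by (rule \<nu>)
  show ?thesis
    by (rule measure_eqI_lessThan)
      (auto simp: half \<mu>.emeasure_eq_measure \<nu>.emeasure_eq_measure)
qed

subsection \<open>The adjacency operator of a graph of bounded degree\<close>

lift_definition bas :: "nat \<Rightarrow> hilb" is "\<lambda>x y. if y = x then 1 else 0"
  by (rule summable_finite[of "{_}"]) auto

lemma crd_bas [simp]: "crd (bas x) y = (if y = x then 1 else 0)"
  by transfer simp

lemma inner_bas: "inner (bas x) v = crd v x"
proof -
  have "inner (bas x) v = (\<Sum>n. crd (bas x) n * crd v n)" by (rule inner_hilb.rep_eq)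
  also have "\<dots> = (\<Sum>n\<in>{x}. crd (bas x) n * crd v n)" by (rule suminf_finite) auto
  finally show ?thesis by simp
qed

lemma inner_bas': "inner v (bas x) = crd v x"
  by (simp add: inner_commute[of v] inner_bas)

lemma norm_bas [simp]: "norm (bas x) = 1"
  by (simp add: norm_eq_sqrt_inner inner_bas)

lemma bas_expansion: "(\<lambda>x. crd u x *\<^sub>R bas x) sums u"
proof -
  have c: "crd (\<Sum>x<K. crd u x *\<^sub>R bas x) n = (if n < K then crd u n else 0)" for K n
    by (induction K) (auto simp: less_Suc_eq)
  have "(\<lambda>K. (norm ((\<Sum>x<K. crd u x *\<^sub>R bas x) - u))\<^sup>2) \<longlonglongrightarrow> 0"
  proof -
    have "(norm ((\<Sum>x<K. crd u x *\<^sub>R bas x) - u))\<^sup>2 = (\<Sum>n. (crd u (n + K))\<^sup>2)" for K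
    proof -
      have s: "summable (\<lambda>n. (crd ((\<Sum>x<K. crd u x *\<^sub>R bas x) - u) n)\<^sup>2)" by (rule summable_crd)
      have "(norm ((\<Sum>x<K. crd u x *\<^sub>R bas x) - u))\<^sup>2 =
          (\<Sum>n. (crd ((\<Sum>x<K. crd u x *\<^sub>R bas x) - u) (n + K))\<^sup>2) +
          (\<Sum>n<K. (crd ((\<Sum>x<K. crd u x *\<^sub>R bas x) - u) n)\<^sup>2)"
        unfolding norm_hilb_sq by (rule suminf_split_initial_segment[OF s])
      then show ?thesis by (simp add: c)
    qed
    moreover have "(\<lambda>K. \<Sum>n. (crd u (n + K))\<^sup>2) \<longlonglongrightarrow> 0"
      by (rule suminf_exist_split2[OF summable_crd])
    ultimately show ?thesis by simp
  qed
  then have "(\<lambda>K. sqrt ((norm ((\<Sum>x<K. crd u x *\<^sub>R bas x) - u))\<^sup>2)) \<longlonglongrightarrow> sqrt 0"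
    by (rule tendsto_real_sqrt)
  then have "(\<lambda>K. (\<Sum>x<K. crd u x *\<^sub>R bas x) - u) \<longlonglongrightarrow> 0"
    by (simp add: tendsto_norm_zero_iff)
  then show ?thesis unfolding sums_def by (rule LIM_zero_cancel)
qed

locale bdd_graph =
  fixes G :: "nat graph" and \<Delta> :: nat
  assumes graph: "is_graph G" and fin_nb: "\<And>x. x \<in> verts G \<Longrightarrow> finite (neighbours G x)"
    and card_nb: "\<And>x. x \<in> verts G \<Longrightarrow> card (neighbours G x) \<le> \<Delta>" and \<Delta>_pos: "\<Delta> > 0"
begin

abbreviation "V \<equiv> verts G"
abbreviation "nb \<equiv> neighbours G"

lemma nb_sym: "y \<in> nb x \<longleftrightarrow> x \<in> nb y"
  by (simp add: neighbours_def adjacent_commute)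

lemma nb_verts: "y \<in> nb x \<Longrightarrow> x \<in> V" "y \<in> nb x \<Longrightarrow> y \<in> V"
  using adjacent_verts[OF graph] by (auto simp: neighbours_def)

lemma nb_outside: "x \<notin> V \<Longrightarrow> nb x = {}"
  using nb_verts by blast

lemma nb_irrefl: "x \<notin> nb x"
  using graph by (auto simp: neighbours_def adjacent_def is_graph_def doubleton_eq_iff)

lemma finite_nb [simp]: "finite (nb x)"
  by (cases "x \<in> V") (auto simp: fin_nb nb_outside)

lemma card_nb_le: "card (nb x) \<le> \<Delta>"
  by (cases "x \<in> V") (auto simp: card_nb nb_outside)

text \<open>Schur test: Cauchy-Schwarz in each row costs one factor \<Delta>, and each coordinate
  occurs in at most \<Delta> rows, which costs the other.\<close>

lemma adj_sq_bound:
  assumes "finite K"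
  shows "(\<Sum>x\<in>K. (\<Sum>y\<in>nb x. crd u y)\<^sup>2) \<le> (real \<Delta> * norm u)\<^sup>2"
proof -
  define U where "U = (\<Union>x\<in>K. nb x)"
  have fU: "finite U" using assms by (simp add: U_def)
  have "(\<Sum>x\<in>K. (\<Sum>y\<in>nb x. crd u y)\<^sup>2) \<le> (\<Sum>x\<in>K. real \<Delta> * (\<Sum>y\<in>nb x. (crd u y)\<^sup>2))"
  proof (rule sum_mono)
    fix x
    have "(\<Sum>y\<in>nb x. crd u y)\<^sup>2 \<le> real (card (nb x)) * (\<Sum>y\<in>nb x. (crd u y)\<^sup>2)"
      using Cauchy_Schwarz_ineq_sum[of "\<lambda>_. 1" "\<lambda>y. crd u y" "nb x"] by simp
    also have "\<dots> \<le> real \<Delta> * (\<Sum>y\<in>nb x. (crd u y)\<^sup>2)"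
      using card_nb_le by (intro mult_right_mono sum_nonneg) auto
    finally show "(\<Sum>y\<in>nb x. crd u y)\<^sup>2 \<le> real \<Delta> * (\<Sum>y\<in>nb x. (crd u y)\<^sup>2)" .
  qed
  also have "\<dots> = real \<Delta> * (\<Sum>x\<in>K. \<Sum>y\<in>{y \<in> U. y \<in> nb x}. (crd u y)\<^sup>2)"
  proof -
    have "{y \<in> U. y \<in> nb x} = nb x" if "x \<in> K" for x using that by (auto simp: U_def)
    then show ?thesis by (simp add: sum_distrib_left)
  qed
  also have "(\<Sum>x\<in>K. \<Sum>y\<in>{y \<in> U. y \<in> nb x}. (crd u y)\<^sup>2) = (\<Sum>y\<in>U. \<Sum>x\<in>{x \<in> K. y \<in> nb x}. (crd u y)\<^sup>2)"
    by (rule sum.swap_restrict[OF assms fU])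
  also have "\<dots> \<le> (\<Sum>y\<in>U. real \<Delta> * (crd u y)\<^sup>2)"
  proof (rule sum_mono)
    fix y
    have "card {x \<in> K. y \<in> nb x} \<le> card (nb y)"
      by (rule card_mono) (auto simp: nb_sym)
    then have "real (card {x \<in> K. y \<in> nb x}) \<le> real \<Delta>" using card_nb_le[of y] by linarith
    then show "(\<Sum>x\<in>{x \<in> K. y \<in> nb x}. (crd u y)\<^sup>2) \<le> real \<Delta> * (crd u y)\<^sup>2"
      by (simp add: mult_right_mono)
  qed
  also have "\<dots> \<le> real \<Delta> * (norm u)\<^sup>2"
    unfolding sum_distrib_left[symmetric] by (intro mult_left_mono sum_crd_sq_le[OF fU]) auto
  finally have "(\<Sum>x\<in>K. (\<Sum>y\<in>nb x. crd u y)\<^sup>2) \<le> real \<Delta> * (real \<Delta> * (norm u)\<^sup>2)"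
    by (simp add: mult_left_mono)
  also have "\<dots> = (real \<Delta> * norm u)\<^sup>2" by (simp add: power_mult_distrib power2_eq_square)
  finally show ?thesis .
qed

text \<open>Sequences are indexed by all natural numbers, not only by \<open>V\<close>. An index
  outside \<open>V\<close> has no neighbours, so the operator annihilates its basis vector.\<close>

definition Aop :: "hilb \<Rightarrow> hilb" where
  "Aop u = Abs_hilb (\<lambda>x. \<Sum>y\<in>nb x. crd u y)"

lemma crd_Aop: "crd (Aop u) x = (\<Sum>y\<in>nb x. crd u y)"
proof -
  have "summable (\<lambda>x. (\<Sum>y\<in>nb x. crd u y)\<^sup>2)"
    by (rule summableI_nonneg_bounded[where x="(real \<Delta> * norm u)\<^sup>2"]) (auto intro: adj_sq_bound)
  then show ?thesis by (simp add: Aop_def Abs_hilb_inverse)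
qed

lemma norm_Aop: "norm (Aop u) \<le> real \<Delta> * norm u"
proof (rule power2_le_imp_le)
  show "(norm (Aop u))\<^sup>2 \<le> (real \<Delta> * norm u)\<^sup>2"
    unfolding norm_hilb_sq[of "Aop u"]
    by (rule suminf_le_const[OF summable_crd]) (simp add: crd_Aop adj_sq_bound)
qed simp

lemma linear_Aop: "linear Aop"
  by (rule linearI) (auto intro!: hilb_eqI simp: crd_Aop sum.distrib sum_distrib_left)

lemma Aop_sym: "inner (Aop u) v = inner u (Aop v)"
proof -
  have blA: "bounded_linear Aop"
    using norm_Aop linear_Aop by (intro bounded_linear_intro[where K="real \<Delta>"]) (auto simp: linear_add linear_scale mult.commute)
  \<comment> \<open>On basis vectors this is the symmetry of the edge relation; boundedness extends
    it along the norm-convergent basis expansion.\<close>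
  have b: "inner (Aop (bas x)) v = inner (bas x) (Aop v)" for x
  proof -
    have "Aop (bas x) = (\<Sum>z\<in>nb x. bas z)"
    proof (rule hilb_eqI)
      fix n
      have "crd (\<Sum>z\<in>Z. bas z) n = (if n \<in> Z then 1 else 0)" if "finite Z" for Z
        using that by (induction Z) auto
      moreover have "(\<Sum>y\<in>nb n. crd (bas x) y) = (if x \<in> nb n then 1 else 0)"
        by (simp add: sum.delta')
      ultimately show "crd (Aop (bas x)) n = crd (\<Sum>z\<in>nb x. bas z) n"
        by (simp add: crd_Aop nb_sym[of x n])
    qed
    then show ?thesis by (simp add: inner_sum_left inner_bas crd_Aop)
  qed
  have "(\<lambda>x. inner (Aop (crd u x *\<^sub>R bas x)) v) sums inner (Aop u) v"
    by (rule bounded_linear.sums[OF bounded_linear_inner_left bounded_linear.sums[OF blA bas_expansion]])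
  moreover have "inner (Aop (crd u x *\<^sub>R bas x)) v = inner (crd u x *\<^sub>R bas x) (Aop v)" for x
    by (simp add: linear_scale[OF linear_Aop] b)
  moreover have "(\<lambda>x. inner (crd u x *\<^sub>R bas x) (Aop v)) sums inner u (Aop v)"
    by (rule bounded_linear.sums[OF bounded_linear_inner_left bas_expansion])
  ultimately show ?thesis using sums_unique2 by simp
qed

sublocale A: self_adjoint_op Aop "real \<Delta>"
  by (rule self_adjoint_op.intro) (use linear_Aop Aop_sym norm_Aop \<Delta>_pos in auto)

lemma spec_exists: obtains \<mu> where "A.spec (bas x) \<mu>"
  using A.spectral_measure_exists[OF norm_bas[of x]] unfolding A.spec_def by metis

text \<open>The orthogonal projection of \<open>bas x\<close> onto the \<theta>-eigenspace. Written
  as a limit of polynomials in the adjacency operator, its entries are limits of functionals of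
  finite balls, which makes them measurable later.\<close>

definition proj :: "real \<Rightarrow> nat \<Rightarrow> hilb" where
  "proj \<theta> x = lim (\<lambda>n. polyop Aop (A.dpoly \<theta> ^ n) (bas x))"

lemma proj_props:
  shows proj_lim: "(\<lambda>n. polyop Aop (A.dpoly \<theta> ^ n) (bas x)) \<longlonglongrightarrow> proj \<theta> x"
    and proj_eigen: "Aop (proj \<theta> x) = \<theta> *\<^sub>R proj \<theta> x"
    and proj_inner: "Aop v = \<theta> *\<^sub>R v \<Longrightarrow> inner v (proj \<theta> x) = crd v x"
    and proj_measure: "A.spec (bas x) \<mu> \<Longrightarrow> measure \<mu> {\<theta>} = crd (proj \<theta> x) x"
proof -
  have *: "(\<lambda>n. polyop Aop (A.dpoly \<theta> ^ n) (bas x)) \<longlonglongrightarrow> proj \<theta> x \<and>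
      Aop (proj \<theta> x) = \<theta> *\<^sub>R proj \<theta> x \<and> inner (proj \<theta> x) (proj \<theta> x) = measure \<mu> {\<theta>} \<and>
      (\<forall>v. Aop v = \<theta> *\<^sub>R v \<longrightarrow> inner v (proj \<theta> x) = crd v x)"
    if h: "A.spec (bas x) \<mu>" for \<mu>
  proof -
    obtain w where w: "(\<lambda>n. polyop Aop (A.dpoly \<theta> ^ n) (bas x)) \<longlonglongrightarrow> w" "Aop w = \<theta> *\<^sub>R w"
      "inner w w = measure \<mu> {\<theta>}" "\<And>v. Aop v = \<theta> *\<^sub>R v \<Longrightarrow> inner v w = inner v (bas x)"
      by (rule A.eigenprojection_exists[OF h, of \<theta>]) blast
    have "proj \<theta> x = w" unfolding proj_def by (rule limI[OF w(1)])
    then show ?thesis using w by (simp add: inner_bas')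
  qed
  obtain \<mu>' where "A.spec (bas x) \<mu>'" by (rule spec_exists)
  note ** = *[OF this]
  show "(\<lambda>n. polyop Aop (A.dpoly \<theta> ^ n) (bas x)) \<longlonglongrightarrow> proj \<theta> x"
    "Aop (proj \<theta> x) = \<theta> *\<^sub>R proj \<theta> x" using ** by auto
  show "Aop v = \<theta> *\<^sub>R v \<Longrightarrow> inner v (proj \<theta> x) = crd v x" using ** by blast
  show "A.spec (bas x) \<mu> \<Longrightarrow> measure \<mu> {\<theta>} = crd (proj \<theta> x) x"
    using *[of \<mu>] by metis
qed

subsection \<open>Identification of the spectral measure\<close>

text \<open>Complex vectors are handled as pairs of real ones; this lemma and
  \<open>ell2_obtain\<close> are the two directions of the translation.\<close>

lemma ell2_Complex:
  assumes "\<And>x. x \<notin> V \<Longrightarrow> crd r x = 0 \<and> crd s x = 0"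
  shows "(\<lambda>x. Complex (crd r x) (crd s x)) \<in> ell2 V"
    "ell2_norm V (\<lambda>x. Complex (crd r x) (crd s x)) = sqrt ((norm r)\<^sup>2 + (norm s)\<^sup>2)"
proof -
  have sq: "(cmod (Complex (crd r x) (crd s x)))\<^sup>2 = (crd r x)\<^sup>2 + (crd s x)\<^sup>2" for x
    by (simp add: cmod_power2)
  have hs: "((\<lambda>x. (crd r x)\<^sup>2 + (crd s x)\<^sup>2) has_sum ((norm r)\<^sup>2 + (norm s)\<^sup>2)) UNIV"
  proof (rule norm_summable_imp_has_sum)
    show "summable (\<lambda>x. norm ((crd r x)\<^sup>2 + (crd s x)\<^sup>2))"
      using summable_add[OF summable_crd[of r] summable_crd[of s]] by simp
    show "(\<lambda>x. (crd r x)\<^sup>2 + (crd s x)\<^sup>2) sums ((norm r)\<^sup>2 + (norm s)\<^sup>2)"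
      unfolding norm_hilb_sq by (intro sums_add summable_sums summable_crd)
  qed
  have "((\<lambda>x. (crd r x)\<^sup>2 + (crd s x)\<^sup>2) has_sum ((norm r)\<^sup>2 + (norm s)\<^sup>2)) V"
    using hs by (rule has_sum_cong_neutral[THEN iffD1, rotated -1]) (use assms in auto)
  then have h: "((\<lambda>x. (cmod (Complex (crd r x) (crd s x)))\<^sup>2) has_sum ((norm r)\<^sup>2 + (norm s)\<^sup>2)) V"
    by (simp only: sq)
  then show "(\<lambda>x. Complex (crd r x) (crd s x)) \<in> ell2 V"
    using assms by (auto simp: ell2_def complex_eq_iff summable_on_def)
  show "ell2_norm V (\<lambda>x. Complex (crd r x) (crd s x)) = sqrt ((norm r)\<^sup>2 + (norm s)\<^sup>2)"
    using infsumI[OF h] by (simp add: ell2_norm_def)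
qed

lemma ell2_obtain:
  assumes "f \<in> ell2 V"
  obtains r s where "f = (\<lambda>x. Complex (crd r x) (crd s x))" "\<And>x. x \<notin> V \<Longrightarrow> crd r x = 0 \<and> crd s x = 0"
proof -
  have z: "\<And>x. x \<notin> V \<Longrightarrow> f x = 0" and s: "(\<lambda>x. (cmod (f x))\<^sup>2) summable_on V"
    using assms by (auto simp: ell2_def)
  have "(\<lambda>x. (cmod (f x))\<^sup>2) summable_on UNIV"
    using s by (rule summable_on_cong_neutral[THEN iffD1, rotated -1]) (use z in auto)
  then have sm: "summable (\<lambda>x. (cmod (f x))\<^sup>2)" by (rule summable_on_imp_summable)
  have "summable (\<lambda>x. (Re (f x))\<^sup>2)" "summable (\<lambda>x. (Im (f x))\<^sup>2)"
    by (rule summable_comparison_test'[OF sm]; simp add: cmod_power2)+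
  then have "crd (Abs_hilb (\<lambda>x. Re (f x))) = (\<lambda>x. Re (f x))" "crd (Abs_hilb (\<lambda>x. Im (f x))) = (\<lambda>x. Im (f x))"
    by (auto simp: Abs_hilb_inverse)
  then show ?thesis using that[of "Abs_hilb (\<lambda>x. Re (f x))" "Abs_hilb (\<lambda>x. Im (f x))"] z by simp
qed

lemma cmod_le_ell2_norm:
  assumes "f \<in> ell2 V"
  shows "cmod (f x) \<le> ell2_norm V f"
proof -
  obtain r s where rs: "f = (\<lambda>x. Complex (crd r x) (crd s x))" "\<And>x. x \<notin> V \<Longrightarrow> crd r x = 0 \<and> crd s x = 0"
    by (rule ell2_obtain[OF assms]) blast
  have "(crd r x)\<^sup>2 + (crd s x)\<^sup>2 \<le> (norm r)\<^sup>2 + (norm s)\<^sup>2"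
    using sum_crd_sq_le[of "{x}"] by (intro add_mono) auto
  moreover have "ell2_norm V f = sqrt ((norm r)\<^sup>2 + (norm s)\<^sup>2)"
    unfolding rs(1) by (rule ell2_Complex(2)) (rule rs(2))
  moreover have "cmod (f x) = sqrt ((crd r x)\<^sup>2 + (crd s x)\<^sup>2)" by (simp add: rs(1) cmod_def)
  ultimately show ?thesis by simp
qed

lemma ell2_diff: "f \<in> ell2 V \<Longrightarrow> g \<in> ell2 V \<Longrightarrow> (\<lambda>x. f x - g x) \<in> ell2 V"
proof -
  assume fg: "f \<in> ell2 V" "g \<in> ell2 V"
  obtain r s where r: "f = (\<lambda>x. Complex (crd r x) (crd s x))" "\<And>x. x \<notin> V \<Longrightarrow> crd r x = 0 \<and> crd s x = 0"
    by (rule ell2_obtain[OF fg(1)]) blast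
  obtain r' s' where s: "g = (\<lambda>x. Complex (crd r' x) (crd s' x))" "\<And>x. x \<notin> V \<Longrightarrow> crd r' x = 0 \<and> crd s' x = 0"
    by (rule ell2_obtain[OF fg(2)]) blast
  note rs = r s
  have "(\<lambda>x. Complex (crd (r - r') x) (crd (s - s') x)) \<in> ell2 V"
    by (rule ell2_Complex) (use rs in auto)
  moreover have "(\<lambda>x. f x - g x) = (\<lambda>x. Complex (crd (r - r') x) (crd (s - s') x))"
    by (simp add: rs complex_diff)
  ultimately show ?thesis by simp
qed

lemma sum_Complex: "(\<Sum>y\<in>N. Complex (f y) (g y)) = Complex (\<Sum>y\<in>N. f y) (\<Sum>y\<in>N. g y)"
  by (induction N rule: infinite_finite_induct) (auto simp: complex_eq_iff)

abbreviation "cA \<equiv> closure_op V (adjacency_op G)"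

lemma adjacency_op_ell2:
  assumes "(f, f') \<in> adjacency_op G"
  shows "f \<in> ell2 V" "f' \<in> ell2 V" "f' = (\<lambda>x. \<Sum>y\<in>nb x. f y)"
proof -
  have f: "finite {x. f x \<noteq> 0}" "{x. f x \<noteq> 0} \<subseteq> V" and f': "f' = (\<lambda>x. \<Sum>y\<in>nb x. f y)"
    using assms by (auto simp: adjacency_op_def)
  show "f' = (\<lambda>x. \<Sum>y\<in>nb x. f y)" by (rule f')
  have "(\<lambda>x. (cmod (f x))\<^sup>2) summable_on {x. f x \<noteq> 0}" using f(1) by (rule summable_on_finite)
  then have "(\<lambda>x. (cmod (f x))\<^sup>2) summable_on V"
    by (rule summable_on_cong_neutral[THEN iffD1, rotated -1]) (use f in auto)
  then show f2: "f \<in> ell2 V" using f by (auto simp: ell2_def)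
  obtain r s where rs: "f = (\<lambda>x. Complex (crd r x) (crd s x))" "\<And>x. x \<notin> V \<Longrightarrow> crd r x = 0 \<and> crd s x = 0"
    by (rule ell2_obtain[OF f2]) blast
  have "f' = (\<lambda>x. Complex (crd (Aop r) x) (crd (Aop s) x))"
    by (simp add: f' rs(1) crd_Aop sum_Complex)
  then show "f' \<in> ell2 V" using ell2_Complex(1)[of "Aop r" "Aop s"] by (simp add: crd_Aop nb_outside)
qed

text \<open>Convergence in norm forces convergence of every coordinate, and a row involves at most
  \<Delta> of them, so the neighbour sum passes to the limit.\<close>

lemma closure_adj:
  assumes "(f, h) \<in> cA"
  shows "f \<in> ell2 V" "h = (\<lambda>x. \<Sum>y\<in>nb x. f y)"
proof -
  have fh: "f \<in> ell2 V" "h \<in> ell2 V"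
    and ap: "\<And>e. e > 0 \<Longrightarrow> \<exists>(f', h') \<in> adjacency_op G. ell2_norm V (\<lambda>x. f' x - f x) < e \<and> ell2_norm V (\<lambda>x. h' x - h x) < e"
    using assms by (auto simp: closure_op_def)
  show "f \<in> ell2 V" by (rule fh)
  show "h = (\<lambda>x. \<Sum>y\<in>nb x. f y)"
  proof
    fix x
    have "cmod (h x - (\<Sum>y\<in>nb x. f y)) \<le> 0 + e" if "e > 0" for e
    proof -
      \<comment> \<open>The error budget: one \<open>d\<close> for the coordinate of the image and
        one for each of the at most \<Delta> neighbours.\<close>
      define d where "d = e / (1 + real \<Delta>)"
      have "d > 0" using that by (simp add: d_def add_pos_nonneg)
      then obtain f' h' where a: "(f', h') \<in> adjacency_op G" "ell2_norm V (\<lambda>x. f' x - f x) < d"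
        "ell2_norm V (\<lambda>x. h' x - h x) < d" using ap by blast
      note a' = adjacency_op_ell2[OF a(1)]
      have 1: "cmod (f' y - f y) \<le> d" for y
        using cmod_le_ell2_norm[OF ell2_diff[OF a'(1) fh(1)], of y] a(2) by simp
      have 2: "cmod (h' x - h x) \<le> d"
        using cmod_le_ell2_norm[OF ell2_diff[OF a'(2) fh(2)], of x] a(3) by simp
      have "h x - (\<Sum>y\<in>nb x. f y) = (\<Sum>y\<in>nb x. f' y - f y) - (h' x - h x)"
        by (simp add: a'(3) sum_subtractf)
      then have "cmod (h x - (\<Sum>y\<in>nb x. f y)) \<le> cmod (\<Sum>y\<in>nb x. f' y - f y) + cmod (h' x - h x)"
        using norm_triangle_ineq4 by metis
      also have "cmod (\<Sum>y\<in>nb x. f' y - f y) \<le> (\<Sum>y\<in>nb x. d)"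
        by (rule sum_norm_le) (rule 1)
      also have "\<dots> \<le> real \<Delta> * d" using card_nb_le[of x] \<open>d > 0\<close> by (simp add: mult_right_mono)
      finally have "cmod (h x - (\<Sum>y\<in>nb x. f y)) \<le> (1 + real \<Delta>) * d" using 2 by (simp add: algebra_simps)
      then show ?thesis by (simp add: d_def)
    qed
    then have "cmod (h x - (\<Sum>y\<in>nb x. f y)) \<le> 0" by (rule field_le_epsilon)
    then show "h x = (\<Sum>y\<in>nb x. f y)" by simp
  qed
qed

text \<open>Every square-summable vector on \<open>V\<close> lies in the domain of the closure: its
  truncations have finite support, and boundedness of \<open>Aop\<close> makes their images converge
  too.\<close>

lemma closure_adjI:
  assumes z: "\<And>x. x \<notin> V \<Longrightarrow> crd r x = 0 \<and> crd s x = 0"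
  shows "((\<lambda>x. Complex (crd r x) (crd s x)), (\<lambda>x. Complex (crd (Aop r) x) (crd (Aop s) x))) \<in> cA"
  unfolding closure_op_def
proof (intro CollectI case_prodI conjI allI impI)
  have zA: "\<And>x. x \<notin> V \<Longrightarrow> crd (Aop r) x = 0 \<and> crd (Aop s) x = 0" by (simp add: crd_Aop nb_outside)
  show "(\<lambda>x. Complex (crd r x) (crd s x)) \<in> ell2 V" "(\<lambda>x. Complex (crd (Aop r) x) (crd (Aop s) x)) \<in> ell2 V"
    using ell2_Complex z zA by blast+
  fix e :: real assume "e > 0"
  define t where "t u K = (\<Sum>x<K. crd u x *\<^sub>R bas x)" for u K
  have t: "t u \<longlonglongrightarrow> u" for u using bas_expansion[of u] by (simp add: sums_def t_def[abs_def])
  have At: "(\<lambda>K. Aop (t u K)) \<longlonglongrightarrow> Aop u" for u by (rule bounded_linear.tendsto[OF A.bl t])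
  have c: "crd (t u K) n = (if n < K then crd u n else 0)" for u K n
    unfolding t_def by (induction K) (auto simp: less_Suc_eq)
  have "(\<lambda>K. sqrt ((norm (t r K - r))\<^sup>2 + (norm (t s K - s))\<^sup>2)) \<longlonglongrightarrow> sqrt ((norm (r - r))\<^sup>2 + (norm (s - s))\<^sup>2)"
    by (intro tendsto_intros t)
  moreover have "(\<lambda>K. sqrt ((norm (Aop (t r K) - Aop r))\<^sup>2 + (norm (Aop (t s K) - Aop s))\<^sup>2)) \<longlonglongrightarrow>
      sqrt ((norm (Aop r - Aop r))\<^sup>2 + (norm (Aop s - Aop s))\<^sup>2)"
    by (intro tendsto_intros At)
  ultimately have "\<forall>\<^sub>F K in sequentially. sqrt ((norm (t r K - r))\<^sup>2 + (norm (t s K - s))\<^sup>2) < e \<and>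
      sqrt ((norm (Aop (t r K) - Aop r))\<^sup>2 + (norm (Aop (t s K) - Aop s))\<^sup>2) < e"
    using \<open>e > 0\<close> by (intro eventually_conj) (auto dest!: order_tendstoD(2)[where a=e])
  then obtain K where K: "sqrt ((norm (t r K - r))\<^sup>2 + (norm (t s K - s))\<^sup>2) < e"
      "sqrt ((norm (Aop (t r K) - Aop r))\<^sup>2 + (norm (Aop (t s K) - Aop s))\<^sup>2) < e"
    by (auto simp: eventually_sequentially)
  let ?f = "\<lambda>x. Complex (crd (t r K) x) (crd (t s K) x)"
  let ?h = "\<lambda>x. Complex (crd (Aop (t r K)) x) (crd (Aop (t s K)) x)"
  have "(?f, ?h) \<in> adjacency_op G"
  proof -
    have "?h = (\<lambda>x. \<Sum>y\<in>nb x. ?f y)" by (simp add: crd_Aop sum_Complex)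
    moreover have "{x. ?f x \<noteq> 0} \<subseteq> {..<K} \<inter> V" using z by (auto simp: c complex_eq_iff split: if_splits)
    then have "finite {x. ?f x \<noteq> 0}" "{x. ?f x \<noteq> 0} \<subseteq> V"
      by (auto intro: finite_subset[of _ "{..<K}"])
    ultimately show ?thesis unfolding adjacency_op_def by blast
  qed
  moreover have "ell2_norm V (\<lambda>x. ?f x - Complex (crd r x) (crd s x)) < e"
    using ell2_Complex(2)[of "t r K - r" "t s K - s"] z K(1) by (simp add: c complex_diff)
  moreover have "ell2_norm V (\<lambda>x. ?h x - Complex (crd (Aop r) x) (crd (Aop s) x)) < e"
    using ell2_Complex(2)[of "Aop (t r K) - Aop r" "Aop (t s K) - Aop s"] K(2)
    by (simp add: crd_Aop nb_outside complex_diff)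
  ultimately show "\<exists>(f', h')\<in>adjacency_op G.
      ell2_norm V (\<lambda>x. f' x - Complex (crd r x) (crd s x)) < e \<and>
      ell2_norm V (\<lambda>x. h' x - Complex (crd (Aop r) x) (crd (Aop s) x)) < e"
    by (intro bexI[of _ "(?f, ?h)"] case_prodI conjI)
qed

text \<open>Symmetry of \<open>Aop\<close>, applied to the real part r and the imaginary part s,
  yields Im z (|r|^2 + |s|^2) = 0. This is the uniqueness behind the definite description in
  \<open>resolvent_op\<close>.\<close>

lemma eigen_nonreal:
  assumes g: "g \<in> ell2 V" and eq: "\<And>x. (\<Sum>y\<in>nb x. g y) = z * g x" and "Im z \<noteq> 0"
  shows "g x = 0"
proof -
  obtain r s where rs: "g = (\<lambda>x. Complex (crd r x) (crd s x))" "\<And>x. x \<notin> V \<Longrightarrow> crd r x = 0 \<and> crd s x = 0"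
    by (rule ell2_obtain[OF g]) blast
  have e: "(\<Sum>y\<in>nb x. crd r y) = Re z * crd r x - Im z * crd s x"
    "(\<Sum>y\<in>nb x. crd s y) = Re z * crd s x + Im z * crd r x" for x
    using eq[of x] by (auto simp: rs(1) sum_Complex complex_eq_iff)
  have E: "Aop r = Re z *\<^sub>R r - Im z *\<^sub>R s" "Aop s = Re z *\<^sub>R s + Im z *\<^sub>R r"
    by (auto intro!: hilb_eqI simp: crd_Aop e)
  have "inner (Re z *\<^sub>R r - Im z *\<^sub>R s) s = inner r (Re z *\<^sub>R s + Im z *\<^sub>R r)"
    using Aop_sym[of r s] by (simp only: E)
  then have "Im z * (inner r r + inner s s) = 0"
    by (simp add: inner_add_right inner_diff_left inner_commute[of s r] algebra_simps)
  then have "inner r r + inner s s = 0" using \<open>Im z \<noteq> 0\<close> by simp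
  then have "inner r r = 0" "inner s s = 0" using inner_ge_zero[of r] inner_ge_zero[of s] by linarith+
  then have "r = 0" "s = 0" by auto
  then show ?thesis by (simp add: rs complex_eq_iff)
qed

text \<open>With z = a + b i and \<open>u\<close> solving ((A - a)^2 + b^2) u =
  \<open>bas v\<close>, the resolvent vector is (A - cnj z) u. Its real part is \<open>p\<close>,
  that is (A - a) u, and its imaginary part is b u.\<close>

lemma resolvent_entry:
  assumes v: "v \<in> V" and \<mu>: "A.spec (bas v) \<mu>" and z: "z \<notin> \<real>"
  shows "ell2_inner V (basis_vec v) (resolvent_op cA z (basis_vec v)) = (\<integral>\<xi>. 1 / (complex_of_real \<xi> - z) \<partial>\<mu>)"
proof -
  interpret \<mu>: real_distribution \<mu> using \<mu> by (simp add: A.spec_def)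
  define a b where "a = Re z" and "b = Im z"
  have b: "b \<noteq> 0" using z by (auto simp: b_def complex_is_Real_iff)
  obtain u where u: "polyop Aop [:a\<^sup>2 + b\<^sup>2, -2*a, 1:] u = bas v"
    and I: "\<And>h. inner (polyop Aop h u) (bas v) = (\<integral>\<xi>. poly h \<xi> / ((\<xi> - a)\<^sup>2 + b\<^sup>2) \<partial>\<mu>)"
    using A.resolvent_exists[OF \<mu> b, of a] by blast
  have lin: "Aop 0 = 0" "Aop (x - y) = Aop x - Aop y" "Aop (x + y) = Aop x + Aop y" "Aop (c *\<^sub>R x) = c *\<^sub>R Aop x" for x y c
    using linear_Aop by (auto simp: linear_0 linear_diff linear_scale linear_add)
  define p where "p = Aop u - a *\<^sub>R u"
  have eqn: "(a\<^sup>2 + b\<^sup>2) *\<^sub>R u - (2*a) *\<^sub>R Aop u + Aop (Aop u) = bas v"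
    using u by (simp add: lin algebra_simps)
  have u0: "crd u x = 0" if "x \<notin> V" for x
  proof -
    have "crd (bas v) x = 0" using that v by auto
    then have "(a\<^sup>2 + b\<^sup>2) * crd u x = 0"
      unfolding eqn[symmetric] using that by (simp add: crd_Aop nb_outside)
    then show ?thesis using b by (auto simp: sum_power2_eq_zero_iff)
  qed
  have z0: "crd p x = 0 \<and> crd (b *\<^sub>R u) x = 0" if "x \<notin> V" for x
    using u0 that by (simp add: p_def crd_Aop nb_outside)
  define f where "f = (\<lambda>x. Complex (crd p x) (crd (b *\<^sub>R u) x))"
  define h where "h = (\<lambda>x. Complex (crd (Aop p) x) (crd (Aop (b *\<^sub>R u)) x))"
  have fh: "(f, h) \<in> cA" unfolding f_def h_def by (rule closure_adjI) (rule z0)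
  have sol: "(\<lambda>x. h x - z * f x) = basis_vec v"
  proof
    fix x
    have re: "crd (Aop p) x - (a * crd p x - b * crd (b *\<^sub>R u) x) = crd (bas v) x"
      unfolding eqn[symmetric] by (simp add: p_def lin power2_eq_square algebra_simps)
    have im: "crd (Aop (b *\<^sub>R u)) x - (a * crd (b *\<^sub>R u) x + b * crd p x) = 0"
      by (simp add: p_def lin algebra_simps)
    show "h x - z * f x = basis_vec v x"
      using re im by (simp add: complex_eq_iff f_def h_def basis_vec_def a_def b_def)
  qed
  have "resolvent_op cA z (basis_vec v) = f"
    unfolding resolvent_op_def
  proof (rule the_equality)
    show "\<exists>h. (f, h) \<in> cA \<and> (\<lambda>x. h x - z * f x) = basis_vec v" using fh sol by blast
    fix f' assume "\<exists>h. (f', h) \<in> cA \<and> (\<lambda>x. h x - z * f' x) = basis_vec v"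
    then obtain h' where h': "(f', h') \<in> cA" "(\<lambda>x. h' x - z * f' x) = basis_vec v" by blast
    have "f' x - f x = 0" for x
    proof (rule eigen_nonreal)
      show "(\<lambda>x. f' x - f x) \<in> ell2 V" using ell2_diff closure_adj(1) fh h' by blast
      show "(\<Sum>y\<in>nb x. f' y - f y) = z * (f' x - f x)" for x
      proof -
        have "h' x - z * f' x = h x - z * f x" using h'(2) sol by metis
        then show ?thesis
          unfolding closure_adj(2)[OF fh] closure_adj(2)[OF h'(1)] by (simp add: sum_subtractf algebra_simps)
      qed
      show "Im z \<noteq> 0" using b by (simp add: b_def)
    qed
    then show "f' = f" by auto
  qed
  moreover have "ell2_inner V (basis_vec v) f = f v"
  proof -
    have "ell2_inner V (basis_vec v) f = (\<Sum>\<^sub>\<infinity>x\<in>{v}. cnj (basis_vec v x) * f x)"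
      unfolding ell2_inner_def by (rule infsum_cong_neutral) (use v in \<open>auto simp: basis_vec_def\<close>)
    then show ?thesis by (simp add: basis_vec_def)
  qed
  moreover have "f v = (\<integral>\<xi>. 1 / (complex_of_real \<xi> - z) \<partial>\<mu>)"
  proof -
    have int: "integrable \<mu> (\<lambda>\<xi>. 1 / (complex_of_real \<xi> - z))"
    proof (rule \<mu>.integrable_const_bound[where B="1 / \<bar>b\<bar>"])
      show "AE \<xi> in \<mu>. norm (1 / (complex_of_real \<xi> - z)) \<le> 1 / \<bar>b\<bar>"
      proof (rule AE_I2)
        fix \<xi>
        have "\<bar>b\<bar> \<le> cmod (complex_of_real \<xi> - z)"
          using abs_Im_le_cmod[of "complex_of_real \<xi> - z"] by (simp add: b_def)
        then have "1 / cmod (complex_of_real \<xi> - z) \<le> 1 / \<bar>b\<bar>" using b by (intro frac_le) auto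
        then show "norm (1 / (complex_of_real \<xi> - z)) \<le> 1 / \<bar>b\<bar>" by (simp add: norm_divide)
      qed
    qed simp
    have re: "Re (1 / (complex_of_real \<xi> - z)) = poly [:-a, 1:] \<xi> / ((\<xi> - a)\<^sup>2 + b\<^sup>2)"
      and im: "Im (1 / (complex_of_real \<xi> - z)) = b * (poly 1 \<xi> / ((\<xi> - a)\<^sup>2 + b\<^sup>2))" for \<xi>
      by (simp_all add: Re_divide Im_divide a_def b_def)
    have "polyop Aop [:-a, 1:] u = p" by (simp add: p_def lin)
    then have "crd p v = (\<integral>\<xi>. poly [:-a, 1:] \<xi> / ((\<xi> - a)\<^sup>2 + b\<^sup>2) \<partial>\<mu>)"
      using I[of "[:-a, 1:]"] by (simp only: inner_bas')
    moreover have "crd (b *\<^sub>R u) v = (\<integral>\<xi>. b * (poly 1 \<xi> / ((\<xi> - a)\<^sup>2 + b\<^sup>2)) \<partial>\<mu>)"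
      using I[of 1] by (simp only: A.polyop_1 inner_bas' integral_mult_right_zero crd_simps)
    ultimately show ?thesis
      using integral_Re[OF int] integral_Im[OF int] by (simp only: complex_eq_iff f_def complex.sel re im)
  qed
  ultimately show ?thesis by simp
qed

text \<open>On a self-adjoint graph the two sides agree. On any other graph
  \<open>spectral_measure\<close> is the null measure, which an inequality covers.\<close>

lemma emeasure_spectral_measure_le:
  assumes "v \<in> V"
  shows "emeasure (spectral_measure G v) {\<theta>} \<le> ennreal (crd (proj \<theta> v) v)"
proof (cases "self_adjoint_graph G")
  case True
  obtain \<mu> where \<mu>: "A.spec (bas v) \<mu>" by (rule spec_exists)
  then interpret real_distribution \<mu> by (simp add: A.spec_def)
  have "spectral_measure G v = \<mu>"
    unfolding spectral_measure_def if_P[OF True]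
  proof (rule the_equality)
    show "prob_space \<mu> \<and> sets \<mu> = sets borel \<and> (\<forall>z. z \<notin> \<real> \<longrightarrow>
      ell2_inner V (basis_vec v) (resolvent_op cA z (basis_vec v)) = (\<integral>\<xi>. 1 / (complex_of_real \<xi> - z) \<partial>\<mu>))"
      using resolvent_entry[OF assms \<mu>] prob_space_axioms by simp
    fix \<nu> assume \<nu>: "prob_space \<nu> \<and> sets \<nu> = sets borel \<and> (\<forall>z. z \<notin> \<real> \<longrightarrow>
      ell2_inner V (basis_vec v) (resolvent_op cA z (basis_vec v)) = (\<integral>\<xi>. 1 / (complex_of_real \<xi> - z) \<partial>\<nu>))"
    then have "real_distribution \<nu>"
      by (simp add: real_distribution_def real_distribution_axioms_def)
    then show "\<nu> = \<mu>"
      using real_distribution_axioms \<nu> resolvent_entry[OF assms \<mu>] by (intro stieltjes_unique) auto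
  qed
  then show ?thesis by (simp add: emeasure_eq_measure proj_measure[OF \<mu>])
next
  case False
  then show ?thesis by (simp add: spectral_measure_def)
qed

end

subsection \<open>Branches of a tree\<close>

text \<open>Loop erasure: a path that returns to one of its own vertices is cut off at that
  vertex.\<close>

lemma rtranclp_distinct_path:
  assumes "r\<^sup>*\<^sup>* x y"
  shows "\<exists>xs. xs \<noteq> [] \<and> hd xs = x \<and> last xs = y \<and> successively r xs \<and> distinct xs"
  using assms
proof (induction rule: rtranclp_induct)
  case base
  show ?case by (intro exI[of _ "[x]"]) simp
next
  case (step y z)
  then obtain xs where xs: "xs \<noteq> []" "hd xs = x" "last xs = y" "successively r xs" "distinct xs" by blast
  show ?case
  proof (cases "z \<in> set xs")
    case True
    then obtain ys zs where s: "xs = ys @ z # zs" by (meson split_list)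
    show ?thesis
      by (rule exI[of _ "ys @ [z]"]) (use xs s in \<open>auto simp: successively_append_iff hd_append\<close>)
  next
    case False
    show ?thesis
      by (rule exI[of _ "xs @ [z]"]) (use xs False step(2) in \<open>auto simp: successively_append_iff\<close>)
  qed
qed

text \<open>For \<open>y \<noteq> x\<close> this is the component of \<open>y\<close> after deletion
  of \<open>x\<close>, since no step may land on \<open>x\<close>. For \<open>y = x\<close> it is
  empty, so \<open>x\<close> never belongs to it.\<close>

definition branch :: "'a graph \<Rightarrow> 'a \<Rightarrow> 'a \<Rightarrow> 'a set" where
  "branch G x y = {w. y \<noteq> x \<and> (\<lambda>u w. adjacent G u w \<and> w \<noteq> x)\<^sup>*\<^sup>* y w}"

locale tree_graph = bdd_graph +
  assumes tree: "is_tree G"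
begin

abbreviation "B \<equiv> branch G"

lemma nb_adjacent: "y \<in> nb x \<longleftrightarrow> adjacent G x y"
  by (simp add: neighbours_def)

lemma B_self: "y \<noteq> x \<Longrightarrow> y \<in> B x y"
  by (simp add: branch_def)

lemma B_step: "u \<in> B x y \<Longrightarrow> w \<in> nb u \<Longrightarrow> w \<noteq> x \<Longrightarrow> w \<in> B x y"
  unfolding branch_def nb_adjacent by (auto intro: rtranclp.rtrancl_into_rtrancl)

lemma B_induct [consumes 1, case_names self step]:
  assumes "w \<in> B x y" "P y"
    "\<And>u w. u \<in> B x y \<Longrightarrow> P u \<Longrightarrow> w \<in> nb u \<Longrightarrow> w \<noteq> x \<Longrightarrow> w \<in> B x y \<Longrightarrow> P w"
  shows "P w"
proof -
  have yx: "y \<noteq> x" and "(\<lambda>u w. adjacent G u w \<and> w \<noteq> x)\<^sup>*\<^sup>* y w" using assms(1) by (auto simp: branch_def)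
  from this(2) have "w \<in> B x y \<and> P w"
  proof (induction rule: rtranclp_induct)
    case base
    then show ?case using yx assms(2) by (simp add: B_self)
  next
    case (step u w)
    then have "w \<in> B x y" using B_step[of u x y w] by (simp add: nb_adjacent)
    then show ?case using step assms(3)[of u w] by (simp add: nb_adjacent)
  qed
  then show ?thesis ..
qed

lemma B_not_root: "x \<notin> B x y"
proof
  assume "x \<in> B x y"
  then have "x \<noteq> x" by (rule B_induct) (use \<open>x \<in> B x y\<close> in \<open>auto simp: branch_def\<close>)
  then show False by simp
qed

lemma B_trans: "w \<in> B x y \<Longrightarrow> z \<in> B x w \<Longrightarrow> z \<in> B x y"
  unfolding branch_def by (auto intro: rtranclp_trans)

lemma B_sym:
  assumes "w \<in> B x y"
  shows "y \<in> B x w"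
  using assms
proof (induction rule: B_induct)
  case self
  show ?case using assms by (intro B_self) (simp add: branch_def)
next
  case (step u w)
  have "u \<in> B x w" using step B_self[of w x] B_step[of w x w u] B_not_root[of x y] by (metis nb_sym)
  then show ?case using step B_trans by blast
qed

lemma B_verts: "y \<in> nb x \<Longrightarrow> w \<in> B x y \<Longrightarrow> w \<in> V"
  by (erule B_induct) (use nb_verts in blast)+

text \<open>Acyclicity enters the study of branches here: a path from \<open>p\<close> to
  \<open>q\<close> that avoids \<open>w\<close> would close up through \<open>w\<close> to a
  cycle.\<close>

lemma no_detour:
  assumes "p \<in> nb w" "q \<in> nb w" "p \<noteq> q"
  shows "q \<notin> B w p"
proof
  assume q: "q \<in> B w p"
  then have "(\<lambda>u z. adjacent G u z \<and> z \<noteq> w)\<^sup>*\<^sup>* p q" by (simp add: branch_def)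
  from rtranclp_distinct_path[OF this] obtain xs where
    xs: "xs \<noteq> []" "hd xs = p" "last xs = q" "successively (\<lambda>u z. adjacent G u z \<and> z \<noteq> w) xs" "distinct xs"
    by blast
  have adj: "successively (adjacent G) xs" using xs(4) by (rule successively_mono) auto
  have pw: "p \<noteq> w" using q by (auto simp: branch_def)
  have "w \<notin> set xs"
    using xs(1,2,4) pw
  proof (induction xs arbitrary: p)
    case (Cons a xs)
    then show ?case by (cases xs) auto
  qed simp
  moreover have "length xs \<ge> 2" using xs(1-3) assms(3) by (cases xs; cases "tl xs") auto
  ultimately have "is_cycle G (w # xs)"
    using xs adj assms by (auto simp: is_cycle_def successively_Cons nb_adjacent adjacent_commute)
  then show False using tree by (auto simp: is_tree_def)
qed

lemma B_unique:
  assumes "y \<in> nb x" "y' \<in> nb x" "w \<in> B x y" "w \<in> B x y'"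
  shows "y = y'"
  using no_detour[OF assms(1,2)] B_trans[OF assms(3) B_sym[OF assms(4)]] by blast

lemma connected: "x \<in> V \<Longrightarrow> w \<in> V \<Longrightarrow> (adjacent G)\<^sup>*\<^sup>* x w"
  using tree by (simp add: is_tree_def graph_connected_def)

lemma B_cover:
  assumes "x \<in> V" "w \<in> V" "w \<noteq> x"
  shows "\<exists>y\<in>nb x. w \<in> B x y"
proof -
  have "(adjacent G)\<^sup>*\<^sup>* x w" using assms connected by blast
  then have "w = x \<or> (\<exists>y\<in>nb x. w \<in> B x y)"
  proof (induction rule: rtranclp_induct)
    case (step u w)
    then have uw: "w \<in> nb u" by (simp add: nb_adjacent)
    show ?case
    proof (cases "w = x")
      case False
      show ?thesis
      proof (cases "u = x")
        case True
        then show ?thesis using uw False B_self[of w x] by blast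
      next
        case u: False
        then show ?thesis using step.IH False B_step[OF _ uw] by blast
      qed
    qed simp
  qed simp
  then show ?thesis using assms by blast
qed

lemma B_subset_opposite:
  assumes "y \<in> nb x" "y' \<in> nb x" "y' \<noteq> y"
  shows "B x y' \<subseteq> B y x"
proof
  fix w assume "w \<in> B x y'"
  then show "w \<in> B y x"
  proof (induction rule: B_induct)
    case self
    show ?case by (rule B_step[OF B_self]) (use assms nb_irrefl in auto)
  next
    case (step u w)
    have "w \<noteq> y" using step no_detour[OF assms(2,1,3)] by blast
    then show ?case using step B_step by blast
  qed
qed

lemma B_opposite_cover:
  assumes "y \<in> nb x" "w \<in> V"
  shows "w \<in> B x y \<or> w \<in> B y x"
proof (cases "w = x")
  case True
  then show ?thesis using assms nb_irrefl B_self by metis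
next
  case False
  then obtain y' where "y' \<in> nb x" "w \<in> B x y'" using B_cover assms nb_verts by blast
  then show ?thesis using B_subset_opposite[OF assms(1)] by (cases "y' = y") blast+
qed

lemma B_opposite_disjoint:
  assumes "y \<in> nb x"
  shows "B x y \<inter> B y x = {}"
proof (rule ccontr)
  assume "B x y \<inter> B y x \<noteq> {}"
  then obtain w where w: "w \<in> B x y" "w \<in> B y x" by blast
  from w(2) have "w = x \<or> (\<exists>z\<in>nb x - {y}. w \<in> B x z)"
  proof (induction rule: B_induct)
    case (step u w)
    show ?case
    proof (cases "w = x")
      case False
      then show ?thesis using step B_step[of u x] B_self[of w x] by blast
    qed simp
  qed simp
  then show False using w(1) B_not_root B_unique[OF assms] by blast
qed

text \<open>A vertex of the branch that is adjacent to \<open>x\<close> spans its own branch at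
  \<open>x\<close>, and branches are unique, so it must be \<open>y\<close>. The cut formula
  \<open>Aop_res\<close> rests on this.\<close>

lemma B_exit:
  assumes "y \<in> nb x" "u \<in> B x y" "u' \<in> nb u" "u' \<notin> B x y"
  shows "u' = x \<and> u = y"
proof -
  have "u' = x" using B_step assms by blast
  moreover have "u \<in> nb x" using assms nb_sym calculation by blast
  moreover have "u \<in> B x u" using calculation nb_irrefl B_self by metis
  ultimately show ?thesis using B_unique assms by blast
qed

lemma B_mono:
  assumes "x' \<in> B x y" "z \<in> nb x'" "z \<noteq> x" "x \<notin> B x' z"
  shows "B x' z \<subseteq> B x y"
proof
  fix w assume "w \<in> B x' z"
  then show "w \<in> B x y"
  proof (induction rule: B_induct)
    case self
    then show ?case using assms B_step by blast
  next
    case (step u w)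
    then show ?case using assms B_step by metis
  qed
qed

lemma B_child:
  assumes "y \<in> nb x" "z \<in> nb y" "z \<noteq> x"
  shows "B y z \<subseteq> B x y"
  using assms no_detour[of z y x] by (intro B_mono B_self) (auto simp: nb_sym nb_irrefl)

end

subsection \<open>Restriction of vectors to branches\<close>

definition res :: "nat set \<Rightarrow> hilb \<Rightarrow> hilb" where
  "res S h = Abs_hilb (\<lambda>n. if n \<in> S then crd h n else 0)"

lemma crd_res [simp]: "crd (res S h) n = (if n \<in> S then crd h n else 0)"
proof -
  have "summable (\<lambda>n. (if n \<in> S then crd h n else 0)\<^sup>2)"
    by (rule summable_comparison_test'[OF summable_crd[of h]]) auto
  then show ?thesis by (simp add: res_def Abs_hilb_inverse)
qed

lemma inner_res: "inner (res S h) k = inner (res S h) (res S k)"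
  unfolding inner_hilb.rep_eq by (intro suminf_cong) simp

text \<open>The energy of the vector on \<open>S\<close>: the squared norm of its
  restriction.\<close>

definition en :: "nat set \<Rightarrow> hilb \<Rightarrow> real" where
  "en S h = inner (res S h) h"

lemma en_norm: "en S h = (norm (res S h))\<^sup>2"
  unfolding en_def inner_res[of S h h] by (simp add: power2_norm_eq_inner)

lemma en_nonneg [simp]: "0 \<le> en S h"
  by (simp add: en_norm)

lemma en_scale: "en S (c *\<^sub>R h) = c\<^sup>2 * en S h"
proof -
  have "res S (c *\<^sub>R h) = c *\<^sub>R res S h" by (rule hilb_eqI) simp
  then show ?thesis by (simp add: en_norm power_mult_distrib)
qed

lemma en_suminf: "en S h = (\<Sum>n. if n \<in> S then (crd h n)\<^sup>2 else 0)"
  unfolding en_def inner_hilb.rep_eq by (intro suminf_cong) (simp add: power2_eq_square)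

lemma summable_en: "summable (\<lambda>n. if n \<in> S then (crd h n)\<^sup>2 else 0)"
  by (rule summable_comparison_test'[OF summable_crd[of h]]) auto

lemma en_UN:
  assumes "finite I" "disjoint_family_on D I"
  shows "en (\<Union>i\<in>I. D i) h = (\<Sum>i\<in>I. en (D i) h)"
proof -
  have "(if n \<in> (\<Union>i\<in>I. D i) then (crd h n)\<^sup>2 else 0) = (\<Sum>i\<in>I. if n \<in> D i then (crd h n)\<^sup>2 else 0)" for n
  proof (cases "n \<in> (\<Union>i\<in>I. D i)")
    case True
    then obtain i where i: "i \<in> I" "n \<in> D i" by blast
    then have "n \<in> D j \<longleftrightarrow> j = i" if "j \<in> I" for j
      using assms(2) that by (auto simp: disjoint_family_on_def)
    then have "(\<Sum>i\<in>I. if n \<in> D i then (crd h n)\<^sup>2 else 0) = (\<Sum>j\<in>I. if j = i then (crd h n)\<^sup>2 else 0)"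
      by (intro sum.cong) auto
    then show ?thesis using True i assms(1) by simp
  next
    case False
    then show ?thesis by (auto intro!: sum.neutral)
  qed
  then show ?thesis unfolding en_suminf by (simp add: suminf_sum summable_en)
qed

lemma en_Un: "S \<inter> T = {} \<Longrightarrow> en (S \<union> T) h = en S h + en T h"
  unfolding en_suminf suminf_add[OF summable_en summable_en] by (intro suminf_cong) auto

lemma en_mono: "S \<subseteq> T \<Longrightarrow> en S h \<le> en T h"
  unfolding en_suminf by (intro suminf_le summable_en) auto

lemma en_singleton: "en {x} h = (crd h x)\<^sup>2"
  using en_suminf[of "{x}" h] suminf_finite[of "{x}" "\<lambda>n. if n \<in> {x} then (crd h n)\<^sup>2 else 0"] by simp

lemma en_supp:
  assumes "\<And>n. n \<notin> S \<Longrightarrow> crd h n = 0"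
  shows "en S h = (norm h)\<^sup>2"
proof -
  have "res S h = h" by (rule hilb_eqI) (use assms in simp)
  then show ?thesis by (simp add: en_norm)
qed

lemma en_pos: "x \<in> S \<Longrightarrow> crd h x \<noteq> 0 \<Longrightarrow> 0 < en S h"
  using en_mono[of "{x}" S h] by (simp add: en_singleton) (smt (verit) zero_less_power2)

context tree_graph
begin

lemma en_split_edge:
  assumes "y \<in> nb x" "\<And>n. n \<notin> V \<Longrightarrow> crd h n = 0"
  shows "en (B x y) h + en (B y x) h = (norm h)\<^sup>2"
proof -
  have "B x y \<union> B y x = V"
    using B_opposite_cover[OF assms(1)] B_verts assms(1) nb_sym by blast
  then show ?thesis
    using en_Un[OF B_opposite_disjoint[OF assms(1)], of h] en_supp[of V h] assms by simp
qed

lemma en_split_vertex: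
  assumes "x \<in> V" "\<And>n. n \<notin> V \<Longrightarrow> crd h n = 0"
  shows "(crd h x)\<^sup>2 + (\<Sum>y\<in>nb x. en (B x y) h) = (norm h)\<^sup>2"
proof -
  have V: "V = {x} \<union> (\<Union>y\<in>nb x. B x y)"
    using B_cover assms(1) B_verts by blast
  have "disjoint_family_on (B x) (nb x)"
    using B_unique by (auto simp: disjoint_family_on_def)
  then have "en (\<Union>y\<in>nb x. B x y) h = (\<Sum>y\<in>nb x. en (B x y) h)" by (intro en_UN) auto
  moreover have "{x} \<inter> (\<Union>y\<in>nb x. B x y) = {}" using B_not_root by auto
  ultimately show ?thesis using en_Un[of "{x}" "\<Union>y\<in>nb x. B x y" h] en_supp[of V h] assms(2) V
    by (simp add: en_singleton)
qed

text \<open>Only the edge between \<open>x\<close> and \<open>y\<close> crosses the cut. Hence the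
  eigenvalue equation of the truncated vector fails at these two vertices alone, each time by the
  value at the opposite end.\<close>

lemma Aop_res:
  assumes w: "Aop w = \<theta> *\<^sub>R w" and y: "y \<in> nb x"
  shows "Aop (res (B x y) w) = \<theta> *\<^sub>R res (B x y) w + crd w y *\<^sub>R bas x - crd w x *\<^sub>R bas y"
proof (rule hilb_eqI)
  fix n
  have yx: "y \<noteq> x" using y nb_irrefl by blast
  have yB: "y \<in> B x y" using yx by (rule B_self)
  have Aw: "(\<Sum>m\<in>nb n. crd w m) = \<theta> * crd w n"
    using arg_cong[OF w, of "\<lambda>u. crd u n"] by (simp add: crd_Aop)
  have L: "crd (Aop (res (B x y) w)) n = (\<Sum>m\<in>nb n \<inter> B x y. crd w m)"
    by (simp add: crd_Aop sum.inter_restrict)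
  show "crd (Aop (res (B x y) w)) n = crd (\<theta> *\<^sub>R res (B x y) w + crd w y *\<^sub>R bas x - crd w x *\<^sub>R bas y) n"
  proof (cases "n \<in> B x y")
    case True
    have nx: "n \<noteq> x" using True B_not_root by blast
    show ?thesis
    proof (cases "n = y")
      case True
      have "nb n \<inter> B x y = nb n - {x}"
        using B_exit[OF y yB] B_not_root True by blast
      moreover have "x \<in> nb n" using y True nb_sym by blast
      ultimately have "(\<Sum>m\<in>nb n \<inter> B x y. crd w m) = \<theta> * crd w n - crd w x"
        using Aw by (simp add: sum_diff1)
      then show ?thesis using True L yB yx by simp
    next
      case False
      have "nb n \<inter> B x y = nb n" using B_exit[OF y \<open>n \<in> B x y\<close>] False by blast
      then show ?thesis using L Aw \<open>n \<in> B x y\<close> False nx by simp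
    qed
  next
    case False
    have ny: "n \<noteq> y" using False yB by blast
    show ?thesis
    proof (cases "n = x")
      case True
      have "nb n \<inter> B x y = {y}"
        using y yB True no_detour[OF y] by blast
      then show ?thesis using L True False ny by simp
    next
      case nx: False
      have "nb n \<inter> B x y = {}"
        using B_exit[OF y] False nx nb_sym by blast
      then show ?thesis using L False nx ny by simp
    qed
  qed
qed

end

subsection \<open>Energy of eigenvectors behind an edge\<close>

locale tree_eig = tree_graph +
  fixes \<theta> :: real
begin

abbreviation P :: "nat \<Rightarrow> hilb" where "P \<equiv> proj \<theta>"
abbreviation p :: "nat \<Rightarrow> nat \<Rightarrow> real" where "p x y \<equiv> crd (P x) y"

text \<open>The restriction to \<open>V\<close> matters for \<open>\<theta> = 0\<close>: an index
  outside \<open>V\<close> is isolated, so its basis vector is an eigenvector for 0.\<close>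

definition S :: "nat set" where "S = {x \<in> V. p x x > 0}"
definition dS :: "nat set" where "dS = {y \<in> V - S. nb y \<inter> S \<noteq> {}}"

lemma Aop_lin: "Aop 0 = 0" "Aop (u - v) = Aop u - Aop v" "Aop (u + v) = Aop u + Aop v" "Aop (c *\<^sub>R u) = c *\<^sub>R Aop u"
  using linear_Aop by (auto simp: linear_0 linear_diff linear_scale linear_add)

lemma P_eigen: "Aop (P x) = \<theta> *\<^sub>R P x"
  by (rule proj_eigen)

lemma P_repr: "Aop v = \<theta> *\<^sub>R v \<Longrightarrow> inner v (P x) = crd v x"
  by (rule proj_inner)

lemma norm_P: "(norm (P x))\<^sup>2 = p x x"
  by (simp add: power2_norm_eq_inner P_repr P_eigen)

lemma p_nonneg: "0 \<le> p x x"
  using norm_P[of x] by (metis zero_le_power2)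

lemma p_sym: "p x y = p y x"
  using P_repr[OF P_eigen, of x y] P_repr[OF P_eigen, of y x] by (simp add: inner_commute)

lemma S_verts: "x \<in> S \<Longrightarrow> x \<in> V" and S_pos: "x \<in> S \<Longrightarrow> 0 < p x x"
  by (auto simp: S_def)

lemma outside_S:
  assumes "x \<in> V" "x \<notin> S" "Aop v = \<theta> *\<^sub>R v"
  shows "crd v x = 0"
proof -
  have "p x x = 0" using assms p_nonneg[of x] by (simp add: S_def)
  then have "P x = 0" using norm_P[of x] by simp
  then show ?thesis using P_repr[OF assms(3), of x] by simp
qed

text \<open>Subtracting from \<open>P x\<close> its restriction to \<open>V\<close> leaves an
  eigenvector \<open>r\<close> that vanishes at \<open>x\<close>. By \<open>P_repr\<close> it is
  orthogonal to \<open>P x\<close>, and this inner product is also its squared norm.\<close>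

lemma P_supp:
  assumes "x \<in> V" "n \<notin> V"
  shows "p x n = 0"
proof -
  define r where "r = P x - res V (P x)"
  have "Aop (res V (P x)) = \<theta> *\<^sub>R res V (P x)"
  proof (rule hilb_eqI)
    fix n
    have "crd (Aop (res V (P x))) n = (\<Sum>m\<in>nb n. p x m)"
      unfolding crd_Aop by (intro sum.cong) (auto dest: nb_verts)
    also have "\<dots> = \<theta> * p x n" using arg_cong[OF P_eigen[of x], of "\<lambda>u. crd u n"] by (simp add: crd_Aop)
    finally have "crd (Aop (res V (P x))) n = \<theta> * p x n" .
    moreover have "crd (Aop (res V (P x))) n = 0" if "n \<notin> V" using that by (simp add: crd_Aop nb_outside)
    ultimately show "crd (Aop (res V (P x))) n = crd (\<theta> *\<^sub>R res V (P x)) n" by auto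
  qed
  then have re: "Aop r = \<theta> *\<^sub>R r" by (simp add: r_def Aop_lin P_eigen algebra_simps)
  have "inner r r = inner r (P x)"
    unfolding r_def inner_hilb.rep_eq by (intro suminf_cong) simp
  also have "\<dots> = 0" using P_repr[OF re, of x] assms(1) by (simp add: r_def)
  finally have "r = 0" by simp
  then have "crd r n = 0" by simp
  then show ?thesis using assms by (simp add: r_def)
qed

text \<open>The Wronskian of two eigenvectors across an edge of a tree is 0: take the part of
  \<open>v\<close> beyond the edge, apply \<open>Aop\<close> and pair with \<open>w\<close>, once by
  the cut formula and once by symmetry.\<close>

lemma vanish_neighbour:
  assumes v: "Aop v = \<theta> *\<^sub>R v" and w: "Aop w = \<theta> *\<^sub>R w" and y: "y \<in> nb x"
    and "crd v x = 0" "crd w x \<noteq> 0"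
  shows "crd v y = 0"
proof -
  let ?r = "res (B x y) v"
  have "inner (Aop ?r) w = \<theta> * inner ?r w + crd v y * crd w x"
    using assms by (simp add: Aop_res[OF v y] inner_add_left inner_bas)
  moreover have "inner (Aop ?r) w = \<theta> * inner ?r w" by (simp add: Aop_sym w)
  ultimately show ?thesis using assms by simp
qed

text \<open>The scalar makes \<open>v\<close> vanish at \<open>x\<close>, hence at \<open>y\<close>.
  By \<open>P_repr\<close> it is then orthogonal to both \<open>P x\<close> and \<open>P y\<close>,
  and so to itself.\<close>

lemma P_proportional:
  assumes "x \<in> S" "y \<in> S" "y \<in> nb x"
  shows "P y = (p x y / p x x) *\<^sub>R P x"
proof -
  define v where "v = P y - (p x y / p x x) *\<^sub>R P x"
  have v: "Aop v = \<theta> *\<^sub>R v" by (simp add: v_def Aop_lin P_eigen algebra_simps)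
  have vx: "crd v x = 0" using S_pos[OF assms(1)] p_sym[of x y] by (simp add: v_def)
  then have vy: "crd v y = 0" using vanish_neighbour[OF v P_eigen assms(3)] S_pos[OF assms(1)] by force
  have "inner v v = inner v (P y) - (p x y / p x x) * inner v (P x)"
    by (subst (2) v_def) (simp add: inner_diff_right)
  then have "inner v v = 0" using P_repr[OF v] vx vy by simp
  then show ?thesis by (simp add: v_def)
qed

section \<open>Energy shares as a flow along edges\<close>

definition ee :: "nat \<Rightarrow> nat \<Rightarrow> real" where
  "ee x y = en (B x y) (P x) / p x x"

lemma ee_nonneg: "0 \<le> ee x y"
  by (simp add: ee_def p_nonneg)

lemma sum_ee:
  assumes "x \<in> S"
  shows "(\<Sum>y\<in>nb x. ee x y) = 1 - p x x"
proof -
  have "(p x x)\<^sup>2 + (\<Sum>y\<in>nb x. en (B x y) (P x)) = p x x"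
    using en_split_vertex[of x "P x"] P_supp assms S_verts by (simp add: norm_P)
  then have "(\<Sum>y\<in>nb x. en (B x y) (P x)) = (1 - p x x) * p x x"
    by (simp add: power2_eq_square algebra_simps)
  then show ?thesis using S_pos[OF assms] by (simp add: ee_def sum_divide_distrib[symmetric])
qed

text \<open>Shares of energy ignore scaling, so all vertices of a component may be compared by means
  of a single vector.\<close>

lemma ee_share_scale:
  assumes "P y = c *\<^sub>R P x" "c \<noteq> 0"
  shows "en D (P y) / p y y = en D (P x) / p x x"
proof -
  have "p y y = c\<^sup>2 * p x x"
  proof -
    have "p y y = (norm (c *\<^sub>R P x))\<^sup>2" by (simp only: norm_P[symmetric] assms(1)[symmetric])
    then show ?thesis by (simp add: power_mult_distrib norm_P)
  qed
  then show ?thesis using assms by (simp add: en_scale)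
qed

lemma P_proportional':
  assumes "x \<in> S" "y \<in> S" "y \<in> nb x"
  obtains c where "P y = c *\<^sub>R P x" "c \<noteq> 0"
proof -
  have "p x y / p x x \<noteq> 0"
    using P_proportional[OF assms] S_pos[OF assms(2)] by auto
  then show ?thesis using that P_proportional[OF assms] by blast
qed

text \<open>As \<open>P x\<close> and \<open>P y\<close> are proportional, both shares belong to one
  vector, whose energy the two sides of the edge divide between them.\<close>

lemma ee_opposite:
  assumes "x \<in> S" "y \<in> S" "y \<in> nb x"
  shows "ee x y + ee y x = 1"
proof -
  obtain c where c: "P y = c *\<^sub>R P x" "c \<noteq> 0" by (rule P_proportional'[OF assms])
  have "ee y x = en (B y x) (P x) / p x x"
    unfolding ee_def by (rule ee_share_scale[OF c])
  then have "ee x y + ee y x = (en (B x y) (P x) + en (B y x) (P x)) / p x x"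
    by (simp add: ee_def add_divide_distrib)
  also have "\<dots> = 1"
    using en_split_edge[OF assms(3), of "P x"] P_supp S_verts[OF assms(1)] S_pos[OF assms(1)]
    by (simp add: norm_P)
  finally show ?thesis .
qed

lemma eigen_sum_0:
  assumes "y \<in> V" "y \<notin> S" "Aop v = \<theta> *\<^sub>R v"
  shows "(\<Sum>k\<in>nb y \<inter> S. crd v k) = 0"
proof -
  have "(\<Sum>k\<in>nb y. crd v k) = \<theta> * crd v y"
    using arg_cong[OF assms(3), of "\<lambda>u. crd u y"] by (simp add: crd_Aop)
  also have "\<dots> = 0" using outside_S[OF assms] by simp
  finally have "(\<Sum>k\<in>nb y. crd v k) = 0" .
  moreover have "(\<Sum>k\<in>nb y. crd v k) = (\<Sum>k\<in>nb y \<inter> S. crd v k)"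
    by (rule sum.mono_neutral_right) (auto dest: nb_verts intro: outside_S[OF _ _ assms(3)])
  ultimately show ?thesis by simp
qed

text \<open>Every eigenvector vanishes at a boundary vertex, so its values at the neighbours in
  \<open>S\<close> sum to 0. With a single such neighbour \<open>j\<close>, this would force
  \<open>p j j = 0\<close>.\<close>

lemma dS_two_neighbours:
  assumes "y \<in> dS"
  shows "card (nb y \<inter> S) \<ge> 2"
proof (rule ccontr)
  assume "\<not> card (nb y \<inter> S) \<ge> 2"
  moreover have "card (nb y \<inter> S) \<noteq> 0" using assms by (auto simp: dS_def)
  ultimately have "card (nb y \<inter> S) = 1" by linarith
  then obtain j where j: "nb y \<inter> S = {j}" by (auto simp: card_1_singleton_iff)
  then have "p j j = 0" using eigen_sum_0[of y "P j"] assms P_eigen by (simp add: dS_def)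
  then show False using S_pos[of j] j by auto
qed

text \<open>On the branch of \<open>k\<close> at \<open>y\<close>, the vector \<open>P j\<close> is
  a multiple of \<open>P k\<close>. Indeed \<open>h\<close> vanishes at \<open>k\<close> and
  \<open>y\<close>, so its part \<open>r\<close> on that branch is itself an eigenvector;
  \<open>r\<close> vanishes at \<open>j\<close> and \<open>k\<close>, hence is orthogonal to
  \<open>h\<close>, and this inner product is the energy of \<open>r\<close>.\<close>

lemma branch_transfer:
  assumes y: "y \<in> V" "y \<notin> S" and j: "j \<in> nb y \<inter> S" and k: "k \<in> nb y \<inter> S" and "j \<noteq> k"
  shows "(p k k)\<^sup>2 * en (B y k) (P j) = (p j k)\<^sup>2 * en (B y k) (P k)"
proof -
  define h where "h = p k k *\<^sub>R P j - p j k *\<^sub>R P k"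
  define r where "r = res (B y k) h"
  have h: "Aop h = \<theta> *\<^sub>R h" by (simp add: h_def Aop_lin P_eigen algebra_simps)
  have hk: "crd h k = 0" by (simp add: h_def)
  have hy: "crd h y = 0" by (rule outside_S[OF y h])
  have r: "Aop r = \<theta> *\<^sub>R r" using Aop_res[OF h, of k y] k hk hy by (simp add: r_def)
  have "j \<notin> B y k" using no_detour[of k y j] j k \<open>j \<noteq> k\<close> by blast
  then have rj: "crd r j = 0" by (simp add: r_def)
  have rk: "crd r k = 0" using hk by (simp add: r_def)
  have "en (B y k) h = inner r h" by (simp add: en_def r_def)
  also have "\<dots> = 0" unfolding h_def by (simp add: inner_diff_right P_repr[OF r] rj rk)
  finally have "r = 0" by (simp add: en_norm r_def)
  then have "p k k *\<^sub>R res (B y k) (P j) = p j k *\<^sub>R res (B y k) (P k)"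
  proof -
    have "p k k *\<^sub>R res (B y k) (P j) - p j k *\<^sub>R res (B y k) (P k) = r"
      by (rule hilb_eqI) (simp add: r_def h_def)
    then show ?thesis using \<open>r = 0\<close> by simp
  qed
  then have "(norm (p k k *\<^sub>R res (B y k) (P j)))\<^sup>2 = (norm (p j k *\<^sub>R res (B y k) (P k)))\<^sup>2" by simp
  then show ?thesis by (simp add: en_norm power_mult_distrib)
qed

text \<open>Each neighbour \<open>j\<close> gets a weight \<open>m j\<close> such that
  \<open>ee j y\<close> is at least its fraction \<open>m j / Mt\<close> of the total, and the
  fractions sum to 1. The estimate is Cauchy-Schwarz in the equation saying that the values of
  \<open>P j\<close> at the neighbours of \<open>y\<close> in \<open>S\<close> sum to 0.\<close>

lemma sum_ee_boundary:
  assumes y: "y \<in> dS"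
  shows "1 \<le> (\<Sum>x\<in>nb y \<inter> S. ee x y)"
proof -
  define N where "N = nb y \<inter> S"
  have yV: "y \<in> V" "y \<notin> S" and N0: "N \<noteq> {}" and fN: "finite N"
    using y by (auto simp: dS_def N_def)
  define a where "a k = en (B y k) (P k)" for k
  \<comment> \<open>The inverse of the energy on the branch of \<open>k\<close>, after
    \<open>P k\<close> has been scaled to the value 1 at \<open>k\<close>.\<close>
  define m where "m k = (p k k)\<^sup>2 / a k" for k
  have kpos: "p k k > 0" "a k > 0" "m k > 0" if "k \<in> N" for k
  proof -
    show p: "p k k > 0" using that S_pos by (simp add: N_def)
    have "k \<in> B y k" using that yV by (intro B_self) (auto simp: N_def)
    then show "a k > 0" unfolding a_def using p by (intro en_pos) auto
    then show "m k > 0" using p by (simp add: m_def)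
  qed
  define Mt where "Mt = (\<Sum>k\<in>N. m k)"
  have Mt: "Mt > 0" unfolding Mt_def using fN N0 kpos by (intro sum_pos) auto
  have key: "m j \<le> ee j y * Mt" if j: "j \<in> N" for j
  proof -
    have jy: "y \<in> nb j" using j by (auto simp: N_def nb_sym)
    have supp: "crd (P j) n = 0" if "n \<notin> V" for n using P_supp that j S_verts by (simp add: N_def)
    have eb: "en (B j y) (P j) + a j = p j j"
      using en_split_edge[OF jy supp] by (simp add: a_def norm_P)
    have ej: "en (B j y) (P j) = ee j y * p j j" using kpos[OF j] by (simp add: ee_def)
    have "0 = p j j + (\<Sum>k\<in>N - {j}. p j k)"
      using eigen_sum_0[OF yV P_eigen, of j] sum.remove[OF fN j, of "\<lambda>k. p j k"] by (simp add: N_def)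
    then have "(p j j)\<^sup>2 = (\<Sum>k\<in>N - {j}. p j k)\<^sup>2" by (metis add_eq_0_iff power2_minus)
    \<comment> \<open>The factors are chosen so that the first has as its square the energy of
      \<open>P j\<close> on the branch of \<open>k\<close>, by \<open>branch_transfer\<close>, and
      the second has the square \<open>m k\<close>.\<close>
    also have "\<dots> = (\<Sum>k\<in>N - {j}. (p j k * sqrt (a k) / p k k) * (p k k / sqrt (a k)))\<^sup>2"
      using kpos by (intro arg_cong[where f="\<lambda>t. t\<^sup>2"] sum.cong) (auto simp: less_imp_neq[THEN not_sym])
    also have "\<dots> \<le> (\<Sum>k\<in>N - {j}. (p j k * sqrt (a k) / p k k)\<^sup>2) * (\<Sum>k\<in>N - {j}. (p k k / sqrt (a k))\<^sup>2)"
      by (rule Cauchy_Schwarz_ineq_sum)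
    also have "(\<Sum>k\<in>N - {j}. (p k k / sqrt (a k))\<^sup>2) = Mt - m j"
    proof -
      have "(\<Sum>k\<in>N - {j}. (p k k / sqrt (a k))\<^sup>2) = (\<Sum>k\<in>N - {j}. m k)"
        using kpos by (intro sum.cong) (auto simp: m_def power_divide less_imp_le)
      then show ?thesis using fN j by (simp add: Mt_def sum_diff1)
    qed
    also have "(\<Sum>k\<in>N - {j}. (p j k * sqrt (a k) / p k k)\<^sup>2) = (\<Sum>k\<in>N - {j}. en (B y k) (P j))"
    proof (rule sum.cong)
      fix k assume k: "k \<in> N - {j}"
      have "(p k k)\<^sup>2 * en (B y k) (P j) = (p j k)\<^sup>2 * a k"
        unfolding a_def using branch_transfer[OF yV, of j k] j k by (auto simp: N_def)
      then have "en (B y k) (P j) = (p j k)\<^sup>2 * a k / (p k k)\<^sup>2" using kpos[of k] k by (simp add: field_simps)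
      moreover have "(sqrt (a k))\<^sup>2 = a k" using kpos(2)[of k] k by simp
      ultimately show "(p j k * sqrt (a k) / p k k)\<^sup>2 = en (B y k) (P j)"
        by (simp only: power_divide power_mult_distrib)
    qed simp
    finally have "(p j j)\<^sup>2 \<le> (\<Sum>k\<in>N - {j}. en (B y k) (P j)) * (Mt - m j)" .
    also have "\<dots> \<le> en (B j y) (P j) * (Mt - m j)"
    proof (rule mult_right_mono)
      have "(\<Sum>k\<in>N - {j}. en (B y k) (P j)) = en (\<Union>k\<in>N - {j}. B y k) (P j)"
        using fN B_unique by (intro en_UN[symmetric]) (auto simp: disjoint_family_on_def N_def)
      also have "\<dots> \<le> en (B j y) (P j)"
        using B_subset_opposite[OF jy[THEN nb_sym[THEN iffD1]]] by (intro en_mono) (auto simp: N_def)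
      finally show "(\<Sum>k\<in>N - {j}. en (B y k) (P j)) \<le> en (B j y) (P j)" .
      show "0 \<le> Mt - m j"
        using sum_nonneg[of "N - {j}" m] kpos fN j by (simp add: Mt_def sum_diff1 less_imp_le)
    qed
    finally have "p j j * p j j \<le> p j j * (ee j y * (Mt - m j))"
      using kpos(1)[OF j] by (simp add: ee_def power2_eq_square)
    then have 1: "p j j \<le> ee j y * (Mt - m j)" using kpos(1)[OF j] by simp
    \<comment> \<open>The energy of \<open>P j\<close> on its own side of the edge gives
      \<open>m j * (1 - ee j y) = p j j\<close>. Combined with the upper bound for
      \<open>p j j\<close> just shown, the terms \<open>m j * ee j y\<close> cancel.\<close>
    have "m j * a j = (p j j)\<^sup>2" using kpos[OF j] by (simp add: m_def)
    moreover have "a j = (1 - ee j y) * p j j" using eb unfolding ej by (simp add: left_diff_distrib)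
    ultimately have "p j j * (m j * (1 - ee j y)) = p j j * p j j" by (simp add: power2_eq_square mult_ac)
    then have "m j * (1 - ee j y) = p j j" using kpos(1)[OF j] by simp
    then show ?thesis using 1 by (simp add: algebra_simps)
  qed
  have "Mt \<le> (\<Sum>j\<in>N. ee j y * Mt)" unfolding Mt_def by (rule sum_mono) (use key in \<open>simp add: Mt_def\<close>)
  then have "1 * Mt \<le> (\<Sum>j\<in>N. ee j y) * Mt" by (simp add: sum_distrib_right)
  then show ?thesis using Mt by (simp add: N_def)
qed

section \<open>Components of \<open>S\<close> and the mass that does not stay in transit inside
  them\<close>

definition Cc :: "nat \<Rightarrow> nat set" where
  "Cc x = {w. (\<lambda>u w. w \<in> nb u \<and> w \<in> S)\<^sup>*\<^sup>* x w}"

lemma Cc_self: "x \<in> Cc x"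
  by (simp add: Cc_def)

lemma Cc_step: "u \<in> Cc x \<Longrightarrow> w \<in> nb u \<Longrightarrow> w \<in> S \<Longrightarrow> w \<in> Cc x"
  unfolding Cc_def by (auto intro: rtranclp.rtrancl_into_rtrancl)

lemma Cc_trans: "w \<in> Cc x \<Longrightarrow> z \<in> Cc w \<Longrightarrow> z \<in> Cc x"
  unfolding Cc_def by (auto intro: rtranclp_trans)

lemma Cc_induct [consumes 1, case_names self step]:
  assumes "w \<in> Cc x" "Q x" "\<And>u w. u \<in> Cc x \<Longrightarrow> Q u \<Longrightarrow> w \<in> nb u \<Longrightarrow> w \<in> S \<Longrightarrow> Q w"
  shows "Q w"
proof -
  have "(\<lambda>u w. w \<in> nb u \<and> w \<in> S)\<^sup>*\<^sup>* x w" using assms(1) by (simp add: Cc_def)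
  then have "w \<in> Cc x \<and> Q w"
  proof (induction rule: rtranclp_induct)
    case base
    then show ?case using Cc_self assms(2) by simp
  next
    case (step u w)
    then show ?case using Cc_step assms(3) by blast
  qed
  then show ?thesis ..
qed

lemma Cc_S: "x \<in> S \<Longrightarrow> w \<in> Cc x \<Longrightarrow> w \<in> S"
  by (erule Cc_induct) auto

lemma Cc_sym:
  assumes "x \<in> S" "w \<in> Cc x"
  shows "x \<in> Cc w"
  using assms(2)
proof (induction rule: Cc_induct)
  case self
  show ?case by (rule Cc_self)
next
  case (step u w)
  have "u \<in> Cc w" using step Cc_S[OF assms(1)] Cc_step[OF Cc_self] nb_sym by blast
  then show ?case using step Cc_trans by blast
qed

lemma Cc_proportional:
  assumes "x \<in> S" "z \<in> Cc x"
  obtains c where "P z = c *\<^sub>R P x" "c \<noteq> 0"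
proof -
  have "\<exists>c. P z = c *\<^sub>R P x \<and> c \<noteq> 0"
    using assms(2)
  proof (induction rule: Cc_induct)
    case self
    show ?case by (rule exI[of _ 1]) simp
  next
    case (step u w)
    then obtain c where c: "P u = c *\<^sub>R P x" "c \<noteq> 0" by blast
    have "u \<in> S" using step Cc_S assms by blast
    then obtain d where "P w = d *\<^sub>R P u" "d \<noteq> 0" using P_proportional'[of u w] step by blast
    then show ?case using c by (intro exI[of _ "d * c"]) simp
  qed
  then show ?thesis using that by blast
qed

lemma Cc_branch:
  assumes "w \<in> Cc x" "w \<noteq> x"
  shows "\<exists>y\<in>nb x \<inter> S. w \<in> B x y"
proof -
  have "w = x \<or> (\<exists>y\<in>nb x \<inter> S. w \<in> B x y)"
    using assms(1)
  proof (induction rule: Cc_induct)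
    case (step u w)
    then show ?case using B_step[of u x] B_self[of w x] by blast
  qed simp
  then show ?thesis using assms by blast
qed

text \<open>The share that \<open>x\<close> does not pass on inside \<open>S\<close>; by
  \<open>rho_eq\<close> it is what \<open>x\<close> keeps plus what it sends out of
  \<open>S\<close>.\<close>

definition rho :: "nat \<Rightarrow> real" where
  "rho x = 1 - (\<Sum>y\<in>nb x \<inter> S. ee x y)"

lemma rho_eq:
  assumes "x \<in> S"
  shows "rho x = p x x + (\<Sum>y\<in>nb x - S. ee x y)"
  using sum_ee[OF assms] sum.Int_Diff[of "nb x" "ee x" S] by (simp add: rho_def)

lemma rho_nonneg: "x \<in> S \<Longrightarrow> 0 \<le> rho x"
  by (simp add: rho_eq p_nonneg sum_nonneg ee_nonneg)

text \<open>The region on which \<open>P x\<close> has the energy share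
  \<open>rho x\<close>.\<close>

definition Dx :: "nat \<Rightarrow> nat set" where
  "Dx x = {x} \<union> (\<Union>y\<in>nb x - S. B x y)"

lemma rho_en:
  assumes "x \<in> S"
  shows "rho x = en (Dx x) (P x) / p x x"
proof -
  have "disjoint_family_on (B x) (nb x - S)"
    using B_unique by (auto simp: disjoint_family_on_def)
  then have "en (\<Union>y\<in>nb x - S. B x y) (P x) = (\<Sum>y\<in>nb x - S. en (B x y) (P x))" by (intro en_UN) auto
  moreover have "{x} \<inter> (\<Union>y\<in>nb x - S. B x y) = {}" using B_not_root by auto
  ultimately have "en (Dx x) (P x) = (p x x)\<^sup>2 + (\<Sum>y\<in>nb x - S. en (B x y) (P x))"
    unfolding Dx_def using en_Un[of "{x}" "\<Union>y\<in>nb x - S. B x y" "P x"] by (simp only: en_singleton)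
  then show ?thesis using S_pos[OF assms]
    by (simp add: rho_eq[OF assms] ee_def add_divide_distrib sum_divide_distrib power2_eq_square)
qed

text \<open>All of \<open>Dx x'\<close> lies in the branch at \<open>x\<close> that leads to
  \<open>x'\<close>, and this branch starts in \<open>S\<close>, whereas \<open>Dx x\<close>
  consists of \<open>x\<close> and of branches that start outside \<open>S\<close>.\<close>

lemma Dx_disjoint:
  assumes x: "x \<in> S" and x': "x' \<in> Cc x" "x' \<noteq> x"
  shows "Dx x \<inter> Dx x' = {}"
proof -
  obtain y where y: "y \<in> nb x" "y \<in> S" "x' \<in> B x y" using Cc_branch[OF x'] by blast
  have "x \<in> Cc x'" using Cc_sym x x' by blast
  then obtain y' where y': "y' \<in> nb x'" "y' \<in> S" "x \<in> B x' y'" using Cc_branch x'(2) by blast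
  have "Dx x' \<subseteq> B x y"
  proof
    fix w assume "w \<in> Dx x'"
    then consider "w = x'" | z where "z \<in> nb x'" "z \<notin> S" "w \<in> B x' z" by (auto simp: Dx_def)
    then show "w \<in> B x y"
    proof cases
      case 1
      then show ?thesis using y by simp
    next
      case 2
      have "x \<notin> B x' z" using B_unique[OF y'(1) 2(1) y'(3)] y'(2) 2(2) by blast
      moreover have "z \<noteq> x" using 2 x by blast
      ultimately show ?thesis using B_mono[OF y(3) 2(1)] 2(3) by blast
    qed
  qed
  moreover have "Dx x \<inter> B x y = {}"
    using B_unique[OF _ y(1)] y(2) B_not_root by (auto simp: Dx_def)
  ultimately show ?thesis by blast
qed

text \<open>All vectors \<open>P z\<close> of the component are multiples of \<open>P x\<close>, so
  the numbers \<open>rho z\<close> are shares of the energy of one vector on disjoint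
  regions.\<close>

lemma sum_rho_component:
  assumes x: "x \<in> S" and F: "finite F" "F \<subseteq> Cc x"
  shows "(\<Sum>z\<in>F. rho z) \<le> 1"
proof -
  have "(\<Sum>z\<in>F. rho z) = (\<Sum>z\<in>F. en (Dx z) (P x) / p x x)"
  proof (rule sum.cong)
    fix z assume z: "z \<in> F"
    then have zC: "z \<in> Cc x" using F by blast
    obtain c where c: "P z = c *\<^sub>R P x" "c \<noteq> 0" by (rule Cc_proportional[OF x zC])
    show "rho z = en (Dx z) (P x) / p x x"
      using rho_en[OF Cc_S[OF x zC]] ee_share_scale[OF c] by simp
  qed simp
  also have "\<dots> = en (\<Union>z\<in>F. Dx z) (P x) / p x x"
  proof -
    have "disjoint_family_on Dx F"
      unfolding disjoint_family_on_def
    proof (intro ballI impI)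
      fix z z' assume "z \<in> F" "z' \<in> F" "z \<noteq> z'"
      then have "z \<in> S" "z' \<in> Cc z" using F x Cc_S Cc_sym Cc_trans by blast+
      then show "Dx z \<inter> Dx z' = {}" using Dx_disjoint \<open>z \<noteq> z'\<close> by blast
    qed
    then show ?thesis using F by (simp add: en_UN sum_divide_distrib)
  qed
  also have "\<dots> \<le> 1"
  proof -
    have "en (\<Union>z\<in>F. Dx z) (P x) \<le> en UNIV (P x)" by (rule en_mono) simp
    then show ?thesis using S_pos[OF x] en_supp[of UNIV "P x"] by (simp add: norm_P)
  qed
  finally show ?thesis .
qed

text \<open>A neighbour that does not belong to the component is not in \<open>S\<close>, and
  eigenvectors vanish there.\<close>

lemma component_eigen:
  assumes x: "x \<in> S" and n: "n \<in> Cc x"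
  shows "(\<Sum>m\<in>nb n \<inter> Cc x. p x m) = \<theta> * p x n"
proof -
  have "(\<Sum>m\<in>nb n. p x m) = \<theta> * p x n"
    using arg_cong[OF P_eigen[of x], of "\<lambda>u. crd u n"] by (simp add: crd_Aop)
  moreover have "(\<Sum>m\<in>nb n. p x m) = (\<Sum>m\<in>nb n \<inter> Cc x. p x m)"
  proof (rule sum.mono_neutral_right)
    show "\<forall>i\<in>nb n - nb n \<inter> Cc x. p x i = 0"
      using Cc_step[OF n] outside_S[OF _ _ P_eigen] nb_verts by blast
  qed auto
  ultimately show ?thesis by simp
qed

end

subsection \<open>Eigenvalues of finite trees\<close>

text \<open>Integer entries make the characteristic polynomial monic and integral. Its complex roots
  are real because the Hermitian form \<open>s\<close> of an eigenvector is invariant under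
  conjugation, by symmetry of the matrix.\<close>

lemma adjacency_eigenvalue_totally_real:
  assumes "eigenvalue (adjacency_matrix n T) \<theta>"
  shows "\<theta> \<in> totally_real_algebraic_ints"
proof -
  define M :: "int mat" where "M = Matrix.mat n n (\<lambda>(i, j). if adjacent T i j then 1 else 0)"
  have M: "M \<in> carrier_mat n n" by (simp add: M_def)
  have r: "adjacency_matrix n T = map_mat of_int M"
    by (rule eq_matI) (auto simp: adjacency_matrix_def M_def)
  have "poly (map_poly of_int (char_poly M)) \<theta> = 0"
    using assms eigenvalue_root_char_poly[of "adjacency_matrix n T" n \<theta>] M
    by (simp add: r of_int_hom.char_poly_hom[OF M, symmetric])
  moreover have "lead_coeff (char_poly M) = 1"
    using degree_monic_char_poly[OF M] by simp
  moreover have "z \<in> \<real>" if z: "poly (map_poly of_int (char_poly M)) z = 0" for z :: complex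
  proof -
    define A :: "complex mat" where "A = map_mat of_int M"
    have A: "A \<in> carrier_mat n n" using M by (simp add: A_def)
    have "eigenvalue A z"
      using z eigenvalue_root_char_poly[OF A, of z] by (simp add: A_def of_int_hom.char_poly_hom[OF M])
    then obtain v where v: "v \<in> carrier_vec n" "v \<noteq> 0\<^sub>v n" "A *\<^sub>v v = z \<cdot>\<^sub>v v"
      using A by (auto simp: eigenvalue_def eigenvector_def)
    define a :: "nat \<Rightarrow> nat \<Rightarrow> complex" where "a i j = (if adjacent T i j then 1 else 0)" for i j
    have as: "a i j = a j i" "cnj (a i j) = a i j" for i j
      by (auto simp: a_def adjacent_commute)
    have Av: "(\<Sum>j<n. a i j * v $ j) = z * v $ i" if "i < n" for i
    proof -
      have "(A *\<^sub>v v) $ i = (\<Sum>j<n. a i j * v $ j)"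
        using that v(1) A by (auto simp: scalar_prod_def A_def M_def a_def lessThan_atLeast0 intro!: sum.cong)
      then show ?thesis using v that by simp
    qed
    define s where "s = (\<Sum>i<n. \<Sum>j<n. a i j * (cnj (v $ i) * v $ j))"
    define N where "N = (\<Sum>i<n. (cmod (v $ i))\<^sup>2)"
    have "s = (\<Sum>i<n. cnj (v $ i) * (\<Sum>j<n. a i j * v $ j))"
      by (simp add: s_def sum_distrib_left mult_ac)
    also have "\<dots> = (\<Sum>i<n. cnj (v $ i) * (z * v $ i))" by (intro sum.cong) (auto simp: Av)
    also have "\<dots> = (\<Sum>i<n. z * complex_of_real ((cmod (v $ i))\<^sup>2))"
      by (intro sum.cong) (simp_all only: complex_norm_square mult_ac)
    also have "\<dots> = z * complex_of_real N"
      by (simp only: N_def sum_distrib_left of_real_sum)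
    finally have sz: "s = z * complex_of_real N" .
    have "cnj s = (\<Sum>i<n. \<Sum>j<n. a j i * (cnj (v $ j) * v $ i))"
      by (simp add: s_def as mult_ac)
    also have "\<dots> = s" unfolding s_def by (rule sum.swap)
    finally have "cnj z * complex_of_real N = z * complex_of_real N" using sz by simp
    moreover have "N > 0"
    proof -
      obtain i where "i < n" "v $ i \<noteq> 0" using v(1,2) by (metis carrier_vecD eq_vecI index_zero_vec)
      then show ?thesis unfolding N_def by (intro sum_pos2[of _ i]) auto
    qed
    ultimately have "cnj z = z" by simp
    then show ?thesis using Reals_cnj_iff by blast
  qed
  ultimately show ?thesis unfolding totally_real_algebraic_ints_def by blast
qed

context tree_eig
begin

text \<open>The trees in \<open>tree_complexity\<close> live on initial segments of the naturals, so
  the component is transported along a bijection \<open>g\<close>; the entries of \<open>P x\<close>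
  form the eigenvector.\<close>

lemma component_tree:
  assumes x: "x \<in> S" and fin: "finite (Cc x)"
  shows "\<exists>T. is_tree T \<and> verts T = {..<card (Cc x)} \<and> eigenvalue (adjacency_matrix (card (Cc x)) T) \<theta>"
proof -
  define n where "n = card (Cc x)"
  obtain g where g: "bij_betw g {..<n} (Cc x)"
    using ex_bij_betw_nat_finite[OF fin] by (auto simp: n_def lessThan_atLeast0)
  have gC: "g i \<in> Cc x" if "i < n" for i using g that by (auto simp: bij_betw_def)
  have ginj: "inj_on g {..<n}" using g by (simp add: bij_betw_def)
  define T where "T = Graph {..<n} {{i, j} | i j. i < n \<and> j < n \<and> adjacent G (g i) (g j)}"
  have eT: "edges T = {{i, j} | i j. i < n \<and> j < n \<and> adjacent G (g i) (g j)}" by (simp add: T_def)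
  have adjT: "adjacent T i j \<longleftrightarrow> i < n \<and> j < n \<and> adjacent G (g i) (g j)" for i j
    unfolding adjacent_def[of T] eT by (auto simp: doubleton_eq_iff adjacent_commute)
  have gsurj: "\<exists>i<n. g i = w" if "w \<in> Cc x" for w
    using g that unfolding bij_betw_def by (metis imageE lessThan_iff)
  have irr: "\<not> adjacent G u u" for u using nb_irrefl by (simp add: neighbours_def)
  have vT: "verts T = {..<n}" by (simp add: T_def)
  have "is_graph T"
    unfolding is_graph_def vT eT
  proof (intro ballI)
    fix e assume "e \<in> {{i, j} |i j. i < n \<and> j < n \<and> adjacent G (g i) (g j)}"
    then obtain i j where ij: "e = {i, j}" "i < n" "j < n" "adjacent G (g i) (g j)" by blast
    then have "i \<noteq> j" using irr by metis
    then show "\<exists>x\<in>{..<n}. \<exists>y\<in>{..<n}. x \<noteq> y \<and> e = {x, y}" using ij by blast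
  qed
  moreover have "graph_connected T"
  proof -
    obtain i0 where i0: "i0 < n" "g i0 = x" using gsurj[OF Cc_self] by blast
    have path: "\<exists>i<n. g i = w \<and> (adjacent T)\<^sup>*\<^sup>* i0 i" if "w \<in> Cc x" for w
      using that
    proof (induction rule: Cc_induct)
      case self
      then show ?case using i0 by blast
    next
      case (step u w)
      then obtain i where i: "i < n" "g i = u" "(adjacent T)\<^sup>*\<^sup>* i0 i" by blast
      have "w \<in> Cc x" using step Cc_step by blast
      then obtain j where j: "j < n" "g j = w" using gsurj by blast
      have "adjacent T i j" using i j step by (simp add: adjT neighbours_def)
      from rtranclp.rtrancl_into_rtrancl[OF i(3) this] show ?case using j by blast
    qed
    have reach: "(adjacent T)\<^sup>*\<^sup>* i0 i" if i: "i < n" for i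
    proof -
      obtain j where "j < n" "g j = g i" "(adjacent T)\<^sup>*\<^sup>* i0 j" using path[OF gC[OF i]] by blast
      then show ?thesis using ginj i by (auto simp: inj_on_def)
    qed
    have "symp (adjacent T)" by (auto simp: symp_def adjacent_commute)
    then have "(adjacent T)\<^sup>*\<^sup>* i j" if "i < n" "j < n" for i j
      using reach[OF that(1)] reach[OF that(2)] by (meson rtranclp_trans symp_rtranclp sympD)
    then show ?thesis using i0 by (auto simp: graph_connected_def vT)
  qed
  moreover have "\<nexists>xs. is_cycle T xs"
  proof
    assume "\<exists>xs. is_cycle T xs"
    then obtain xs where xs: "length xs \<ge> 3" "distinct xs" "successively (adjacent T) xs" "adjacent T (last xs) (hd xs)"
      by (auto simp: is_cycle_def)
    have ne: "xs \<noteq> []" using xs(1) by auto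
    have sub: "set xs \<subseteq> {..<n}"
    proof
      fix i assume "i \<in> set xs"
      have "successively (\<lambda>i j. i < n \<and> j < n) xs" using xs(3) by (rule successively_mono) (auto simp: adjT)
      moreover have "last xs < n" "hd xs < n" using xs(4) by (auto simp: adjT)
      ultimately show "i \<in> {..<n}" using \<open>i \<in> set xs\<close>
      proof (induction xs)
        case (Cons a xs)
        then show ?case by (cases xs) (auto split: if_splits)
      qed simp
    qed
    have "is_cycle G (map g xs)"
      unfolding is_cycle_def
    proof (intro conjI)
      show "3 \<le> length (map g xs)" using xs by simp
      show "distinct (map g xs)" using xs(2) sub ginj by (simp add: distinct_map inj_on_subset)
      show "successively (adjacent G) (map g xs)"
        unfolding successively_map using xs(3) by (rule successively_mono) (auto simp: adjT)
      show "adjacent G (last (map g xs)) (hd (map g xs))"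
        using xs(4) ne by (simp add: last_map hd_map adjT)
    qed
    then show False using tree by (auto simp: is_tree_def)
  qed
  ultimately have "is_tree T" by (simp add: is_tree_def)
  moreover have "eigenvalue (adjacency_matrix n T) \<theta>"
  proof -
    define v where "v = Matrix.vec n (\<lambda>i. p x (g i))"
    have A: "adjacency_matrix n T \<in> carrier_mat n n" by (simp add: adjacency_matrix_def)
    obtain i0 where i0: "i0 < n" "g i0 = x" using gsurj[OF Cc_self] by blast
    have "v $ i0 \<noteq> 0" using i0 S_pos[OF x] by (simp add: v_def)
    then have "v \<noteq> 0\<^sub>v n" using i0 by auto
    moreover have "adjacency_matrix n T *\<^sub>v v = \<theta> \<cdot>\<^sub>v v"
    proof (rule eq_vecI)
      fix i assume "i < dim_vec (\<theta> \<cdot>\<^sub>v v)"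
      then have i: "i < n" by (simp add: v_def)
      have "(adjacency_matrix n T *\<^sub>v v) $ i = (\<Sum>j<n. (if adjacent T i j then 1 else 0) * p x (g j))"
        using i by (simp add: adjacency_matrix_def scalar_prod_def v_def lessThan_atLeast0)
      also have "\<dots> = (\<Sum>j<n. if g j \<in> nb (g i) then p x (g j) else 0)"
        using i by (intro sum.cong) (auto simp: adjT neighbours_def)
      also have "\<dots> = (\<Sum>m\<in>Cc x. if m \<in> nb (g i) then p x m else 0)"
        by (rule sum.reindex_bij_betw[OF g])
      also have "\<dots> = (\<Sum>m\<in>nb (g i) \<inter> Cc x. p x m)"
        using fin by (simp add: sum.inter_restrict[symmetric] Int_commute)
      also have "\<dots> = \<theta> * p x (g i)" by (rule component_eigen[OF x gC[OF i]])
      finally show "(adjacency_matrix n T *\<^sub>v v) $ i = (\<theta> \<cdot>\<^sub>v v) $ i" using i by (simp add: v_def)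
    qed (simp add: v_def adjacency_matrix_def)
    ultimately show ?thesis
      unfolding eigenvalue_def eigenvector_def using A by (intro exI[of _ v]) (simp add: v_def)
  qed
  ultimately show ?thesis using vT n_def by blast
qed

lemma component_tree_complexity:
  assumes "x \<in> S" "finite (Cc x)"
  shows "\<theta> \<in> totally_real_algebraic_ints" "tree_complexity \<theta> \<le> card (Cc x)"
proof -
  obtain T where T: "is_tree T \<and> verts T = {..<card (Cc x)} \<and> eigenvalue (adjacency_matrix (card (Cc x)) T) \<theta>"
    using component_tree[OF assms] by blast
  then show "\<theta> \<in> totally_real_algebraic_ints" using adjacency_eigenvalue_totally_real by blast
  show "tree_complexity \<theta> \<le> card (Cc x)"
    unfolding tree_complexity_def by (rule Least_le) (use T in blast)
qed

end

subsection \<open>Measurable functionals of rooted networks\<close>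

text \<open>Measurability is checked on concrete networks with \<open>k\<close> distinguished vertices. A set is local if it
  only depends on the isomorphism class of the union of the balls of some radius around these vertices.\<close>

definition nets :: "nat \<Rightarrow> (nat graph \<times> nat list) set" where
  "nets k = {(G, xs). is_network G xs \<and> length xs = k}"

definition local_set :: "nat \<Rightarrow> (nat graph \<times> nat list) set \<Rightarrow> bool" where
  "local_set k A \<longleftrightarrow> A \<subseteq> nets k \<and> (\<exists>r. \<forall>G xs H ys. (G, xs) \<in> A \<longrightarrow> (H, ys) \<in> nets k \<longrightarrow>
     agree_upto r G xs H ys \<longrightarrow> (H, ys) \<in> A)"

definition NM :: "nat \<Rightarrow> (nat graph \<times> nat list) measure" where
  "NM k = sigma (nets k) {A. local_set k A}"

lemma space_NM: "space (NM k) = nets k"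
  unfolding NM_def by (rule space_measure_of) (auto simp: local_set_def)

lemma sets_NM: "sets (NM k) = sigma_sets (nets k) {A. local_set k A}"
  unfolding NM_def by (rule sets_measure_of) (auto simp: local_set_def)

lemma local_set_in_NM: "local_set k A \<Longrightarrow> A \<in> sets (NM k)"
  by (simp add: sets_NM sigma_sets.Basic)

lemma netsD: "(G, xs) \<in> nets k \<Longrightarrow> is_network G xs \<and> length xs = k"
  by (simp add: nets_def)

lemma Int_stable_local: "Int_stable {A. local_set k A}"
proof (rule Int_stableI)
  fix A B assume "A \<in> {A. local_set k A}" "B \<in> {A. local_set k A}"
  then have sub: "A \<subseteq> nets k" "B \<subseteq> nets k" and "\<exists>r. \<forall>G xs H ys. (G, xs) \<in> A \<longrightarrow> (H, ys) \<in> nets k \<longrightarrow>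
     agree_upto r G xs H ys \<longrightarrow> (H, ys) \<in> A" "\<exists>r. \<forall>G xs H ys. (G, xs) \<in> B \<longrightarrow> (H, ys) \<in> nets k \<longrightarrow>
     agree_upto r G xs H ys \<longrightarrow> (H, ys) \<in> B" by (auto simp: local_set_def)
  then obtain r s where
    r: "\<And>G xs H ys. (G, xs) \<in> A \<Longrightarrow> (H, ys) \<in> nets k \<Longrightarrow> agree_upto r G xs H ys \<Longrightarrow> (H, ys) \<in> A" and
    s: "\<And>G xs H ys. (G, xs) \<in> B \<Longrightarrow> (H, ys) \<in> nets k \<Longrightarrow> agree_upto s G xs H ys \<Longrightarrow> (H, ys) \<in> B" by metis
  have "(H, ys) \<in> A \<inter> B"
    if "(G, xs) \<in> A \<inter> B" "(H, ys) \<in> nets k" "agree_upto (max r s) G xs H ys" for G xs H ys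
  proof -
    have n: "is_network G xs" "is_network H ys" using that sub by (auto dest: netsD)
    have "agree_upto r G xs H ys" "agree_upto s G xs H ys"
      using agree_upto_mono[OF n that(3)] by auto
    then show ?thesis using r s that by blast
  qed
  then show "A \<inter> B \<in> {A. local_set k A}" using sub unfolding local_set_def by blast
qed

lemma NM_iso_invariant:
  assumes "A \<in> sets (NM k)" "(G, xs) \<in> nets k" "(H, ys) \<in> nets k" "rooted_iso G xs H ys"
  shows "(G, xs) \<in> A \<longleftrightarrow> (H, ys) \<in> A"
proof -
  have n: "is_network G xs" "is_network H ys" using assms by (auto dest: netsD)
  have a: "agree_upto r G xs H ys" for r by (rule rooted_iso_imp_agree_upto[OF n assms(4)])
  have b: "agree_upto r H ys G xs" for r by (rule agree_upto_sym[OF n(1) a])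
  have "A \<in> sigma_sets (nets k) {A. local_set k A}" using assms(1) by (simp add: sets_NM)
  then show ?thesis
  proof (induction rule: sigma_sets.induct)
    case (Basic A)
    then show ?case using a b assms(2,3) unfolding local_set_def by blast
  qed (use assms(2,3) in auto)
qed

text \<open>Measurability with respect to \<open>NM k\<close> contains invariance under rooted
  isomorphism, so measurable functionals descend to isomorphism classes.\<close>

lemma NM_fun_invariant:
  fixes F :: "nat graph \<times> nat list \<Rightarrow> ennreal"
  assumes "F \<in> borel_measurable (NM k)" "(G, xs) \<in> nets k" "(H, ys) \<in> nets k" "rooted_iso G xs H ys"
  shows "F (G, xs) = F (H, ys)"
proof -
  have "F -` {F (G, xs)} \<inter> space (NM k) \<in> sets (NM k)"
    by (rule measurable_sets[OF assms(1)]) simp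
  from NM_iso_invariant[OF this assms(2-4)] show ?thesis using assms(2,3) by (auto simp: space_NM)
qed

lemma local_dist_less_imp_agree:
  assumes "is_network G xs" "is_network H ys" "local_dist G xs H ys < 1 / (1 + real r)"
  shows "agree_upto r G xs H ys"
proof (rule ccontr)
  assume n: "\<not> agree_upto r G xs H ys"
  define m where "m = (LEAST r. \<not> agree_upto r G xs H ys)"
  have "m \<le> r" unfolding m_def using n by (rule Least_le)
  then have "1 / (1 + real r) \<le> 1 / (1 + real (m - 1))" by (intro divide_left_mono) auto
  moreover have "local_dist G xs H ys = 1 / (1 + real (m - 1))"
    using local_dist_eq[OF assms(1,2)] n by (auto simp: m_def)
  ultimately show False using assms(3) by linarith
qed

definition rep1 :: "gstar \<Rightarrow> nat graph \<times> nat list" where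
  "rep1 g = (case rep_gstar g of (G, v) \<Rightarrow> (G, [v]))"

definition rep2 :: "gstar2 \<Rightarrow> nat graph \<times> nat list" where
  "rep2 g = (case rep_gstar2 g of (G, v, w) \<Rightarrow> (G, [v, w]))"

text \<open>Representatives are chosen without any regularity. Nevertheless the preimage of a local
  set is open, since classes at distance below 1 / (1 + r) have isomorphic balls of radius
  \<open>r\<close>.\<close>

lemma rep1_measurable: "rep1 \<in> measurable borel (NM 1)"
  unfolding NM_def
proof (rule measurable_measure_of)
  have n: "rep1 g \<in> nets 1" for g
    by (cases "rep_gstar g") (auto simp: rep1_def nets_def is_network_rep_gstar)
  then show "rep1 \<in> space borel \<rightarrow> nets 1" by simp
  fix A assume "A \<in> {A. local_set 1 A}"
  then obtain r where
    r: "\<And>G xs H ys. (G, xs) \<in> A \<Longrightarrow> (H, ys) \<in> nets 1 \<Longrightarrow> agree_upto r G xs H ys \<Longrightarrow> (H, ys) \<in> A"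
    unfolding local_set_def by blast
  have "open (rep1 -` A)"
    unfolding open_dist
  proof (intro ballI exI conjI allI impI)
    fix g h assume g: "g \<in> rep1 -` A" and d: "dist h g < 1 / (1 + real r)"
    obtain G v H w where GH: "rep_gstar g = (G, v)" "rep_gstar h = (H, w)" by (metis surj_pair)
    have "local_dist G [v] H [w] < 1 / (1 + real r)" using d GH unfolding dist_commute[of h] by (simp add: dist_gstar_def)
    then have "agree_upto r G [v] H [w]"
      by (rule local_dist_less_imp_agree[OF is_network_rep_gstar[OF GH(1)] is_network_rep_gstar[OF GH(2)]])
    then show "h \<in> rep1 -` A" using r[of G "[v]" H "[w]"] g n[of h] GH by (simp add: rep1_def)
  qed simp
  then show "rep1 -` A \<inter> space borel \<in> sets borel" by simp
qed (auto simp: local_set_def)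

lemma rep2_measurable: "rep2 \<in> measurable borel (NM 2)"
  unfolding NM_def
proof (rule measurable_measure_of)
  have n: "rep2 g \<in> nets 2" for g
    by (cases "rep_gstar2 g") (auto simp: rep2_def nets_def is_network_rep_gstar2)
  then show "rep2 \<in> space borel \<rightarrow> nets 2" by simp
  fix A assume "A \<in> {A. local_set 2 A}"
  then obtain r where
    r: "\<And>G xs H ys. (G, xs) \<in> A \<Longrightarrow> (H, ys) \<in> nets 2 \<Longrightarrow> agree_upto r G xs H ys \<Longrightarrow> (H, ys) \<in> A"
    unfolding local_set_def by blast
  have "open (rep2 -` A)"
    unfolding open_dist
  proof (intro ballI exI conjI allI impI)
    fix g h assume g: "g \<in> rep2 -` A" and d: "dist h g < 1 / (1 + real r)"
    obtain G v v' H w w' where GH: "rep_gstar2 g = (G, v, v')" "rep_gstar2 h = (H, w, w')" by (metis surj_pair)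
    have "local_dist G [v, v'] H [w, w'] < 1 / (1 + real r)" using d GH unfolding dist_commute[of h] by (simp add: dist_gstar2_def)
    then have "agree_upto r G [v, v'] H [w, w']"
      by (rule local_dist_less_imp_agree[OF is_network_rep_gstar2[OF GH(1)] is_network_rep_gstar2[OF GH(2)]])
    then show "h \<in> rep2 -` A" using r[of G "[v, v']" H "[w, w']"] g n[of h] GH by (simp add: rep2_def)
  qed simp
  then show "rep2 -` A \<inter> space borel \<in> sets borel" by simp
qed (auto simp: local_set_def)

subsection \<open>Adding a root\<close>

lemma graph_ball_trans:
  "y \<in> graph_ball G R x \<Longrightarrow> z \<in> graph_ball G r y \<Longrightarrow> z \<in> graph_ball G (R + r) x"
proof -
  assume "y \<in> graph_ball G R x" "z \<in> graph_ball G r y"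
  then obtain m n where "m \<le> R" "((adjacent G) ^^ m) x y" "n \<le> r" "((adjacent G) ^^ n) y z"
    by (auto simp: graph_ball_def)
  then have "m + n \<le> R + r" "((adjacent G) ^^ (m + n)) x z" by (auto simp: relpowp_add)
  then show ?thesis unfolding graph_ball_def by blast
qed

lemma iso_walk:
  assumes G: "is_graph G" and f: "graph_iso f (rooted_ball G xs s) (rooted_ball H ys s)"
    and u: "graph_ball G r u \<subseteq> verts (rooted_ball G xs s)"
    and y: "y \<in> graph_ball G r u"
  shows "f y \<in> graph_ball H r (f u)"
proof -
  have "((adjacent G) ^^ n) u y \<Longrightarrow> n \<le> r \<Longrightarrow> ((adjacent H) ^^ n) (f u) (f y)" for n y
  proof (induction n arbitrary: y)
    case (Suc n)
    then obtain w where w: "((adjacent G) ^^ n) u w" "adjacent G w y" by auto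
    have "w \<in> graph_ball G r u" "y \<in> graph_ball G r u"
      using w(1) Suc.prems unfolding graph_ball_def by (blast intro: Suc_leD)+
    then have wy: "w \<in> verts (rooted_ball G xs s)" "y \<in> verts (rooted_ball G xs s)" using u by blast+
    then have "f w \<in> verts (rooted_ball H ys s)" "f y \<in> verts (rooted_ball H ys s)"
      using f by (auto simp: graph_iso_def bij_betw_def)
    then have "adjacent H (f w) (f y)"
      using f wy w(2) by (auto simp: graph_iso_def adjacent_rooted_ball)
    then show ?case using Suc w by auto
  qed simp
  then show ?thesis using y by (auto simp: graph_ball_def)
qed

text \<open>The ball of radius R + r around a root contains the ball of radius \<open>r\<close>
  around each \<open>w\<close> within distance \<open>R\<close> of it. So an isomorphism of the
  larger balls remains one of the smaller balls after \<open>w\<close> has become a root.\<close>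

lemma iso_reroot:
  assumes G: "is_network G xs" and H: "is_network H ys"
    and f: "graph_iso f (rooted_ball G xs (R + r)) (rooted_ball H ys (R + r))" "map f xs = ys"
    and x: "x \<in> set xs" and w: "w \<in> graph_ball G R x"
  shows "f w \<in> graph_ball H R (f x)" "agree_upto r G (w # xs) H (f w # ys)"
proof -
  let ?B = "rooted_ball G xs (R + r)" and ?C = "rooted_ball H ys (R + r)"
  have gr: "is_graph G" "is_graph H" and xsG: "set xs \<subseteq> verts G" and ysH: "set ys \<subseteq> verts H"
    using G H by (auto simp: is_network_def)
  have inB: "graph_ball G t u \<subseteq> verts ?B" if "u \<in> set xs" "t \<le> R + r" for t u
    using that graph_ball_mono[of t "R + r" G u] graph_ball_subset[OF gr(1), of u t] xsG by (auto simp: verts_rooted_ball)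
  have inC: "graph_ball H t u \<subseteq> verts ?C" if "u \<in> set ys" "t \<le> R + r" for t u
    using that graph_ball_mono[of t "R + r" H u] graph_ball_subset[OF gr(2), of u t] ysH by (auto simp: verts_rooted_ball)
  have fx: "f u \<in> set ys" if "u \<in> set xs" for u using f(2) that by auto
  show fw: "f w \<in> graph_ball H R (f x)"
    using iso_walk[OF gr(1) f(1) inB[OF x] w] by simp
  have wB: "graph_ball G r w \<subseteq> verts ?B"
    using graph_ball_trans[OF w] inB[OF x, of "R + r"] by auto
  have wC: "graph_ball H r (f w) \<subseteq> verts ?C"
    using graph_ball_trans[OF fw] inC[OF fx[OF x], of "R + r"] by auto
  have wG: "w \<in> verts G" using w graph_ball_subset[OF gr(1)] x xsG by blast
  have wH: "f w \<in> verts H" using fw graph_ball_subset[OF gr(2)] fx[OF x] ysH by blast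
  have rootsB: "graph_ball G r u \<subseteq> verts ?B" if "u \<in> set (w # xs)" for u
    using that wB inB[of u r] by auto
  have rootsC: "graph_ball H r u \<subseteq> verts ?C" if "u \<in> set (f w # ys)" for u
    using that wC inC[of u r] by auto
  have sB: "verts (rooted_ball G (w # xs) r) \<subseteq> verts ?B" using rootsB by (auto simp: verts_rooted_ball[of G "w # xs"])
  have sC: "verts (rooted_ball H (f w # ys) r) \<subseteq> verts ?C" using rootsC by (auto simp: verts_rooted_ball[of H "f w # ys"])
  define g where "g = inv_into (verts ?B) f"
  have gi: "graph_iso g ?C ?B" unfolding g_def by (rule graph_iso_inv[OF f(1)])
  have bf: "bij_betw f (verts ?B) (verts ?C)" using f(1) by (simp add: graph_iso_def)
  have gf: "g (f v) = v" if "v \<in> verts ?B" for v using bf that by (simp add: g_def bij_betw_def)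
  have fg: "f (g v) = v" if "v \<in> verts ?C" for v using bf that unfolding g_def by (metis bij_betw_inv_into_right)
  have im: "f ` verts (rooted_ball G (w # xs) r) = verts (rooted_ball H (f w # ys) r)"
  proof (intro equalityI subsetI)
    fix v assume "v \<in> f ` verts (rooted_ball G (w # xs) r)"
    then obtain y u where y: "v = f y" "u \<in> set (w # xs)" "y \<in> graph_ball G r u" by (auto simp: verts_rooted_ball)
    then have "v \<in> graph_ball H r (f u)" using iso_walk[OF gr(1) f(1) rootsB] by blast
    moreover have "f u \<in> set (f w # ys)" using y fx by auto
    moreover have "v \<in> verts H" using rootsC calculation by (auto simp: verts_rooted_ball)
    ultimately show "v \<in> verts (rooted_ball H (f w # ys) r)" unfolding verts_rooted_ball by blast
  next
    fix v assume "v \<in> verts (rooted_ball H (f w # ys) r)"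
    then obtain u' where u': "u' \<in> set (f w # ys)" "v \<in> graph_ball H r u'" by (auto simp: verts_rooted_ball)
    have "set (f w # ys) = f ` set (w # xs)" using f(2) by auto
    then obtain u where u: "u \<in> set (w # xs)" "u' = f u" using u'(1) by blast
    have uB: "u \<in> verts ?B" using rootsB[OF u(1)] graph_ball_self[of u G r] by (rule subsetD)
    have "g v \<in> graph_ball G r (g u')" by (rule iso_walk[OF gr(2) gi rootsC[OF u'(1)] u'(2)])
    then have gv: "g v \<in> graph_ball G r u" using u gf uB by simp
    then have "g v \<in> verts G" using rootsB[OF u(1)] by (auto simp: verts_rooted_ball)
    then have "g v \<in> verts (rooted_ball G (w # xs) r)" using gv u unfolding verts_rooted_ball by blast
    moreover have "f (g v) = v" using fg rootsC[OF u'(1)] u'(2) by blast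
    ultimately show "v \<in> f ` verts (rooted_ball G (w # xs) r)" by (metis imageI)
  qed
  have "graph_iso f (rooted_ball G (w # xs) r) (rooted_ball H (f w # ys) r)"
    unfolding graph_iso_def
  proof (intro conjI ballI)
    show "bij_betw f (verts (rooted_ball G (w # xs) r)) (verts (rooted_ball H (f w # ys) r))"
      using im bf sB by (auto simp: bij_betw_def intro: inj_on_subset)
    fix u v assume uv: "u \<in> verts (rooted_ball G (w # xs) r)" "v \<in> verts (rooted_ball G (w # xs) r)"
    then have fuv: "f u \<in> verts (rooted_ball H (f w # ys) r)" "f v \<in> verts (rooted_ball H (f w # ys) r)" using im by auto
    have "adjacent G u v \<longleftrightarrow> adjacent H (f u) (f v)"
      using f(1) uv fuv sB sC adjacent_rooted_ball[of u G xs "R + r" v] adjacent_rooted_ball[of "f u" H ys "R + r" "f v"]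
      unfolding graph_iso_def by blast
    then show "adjacent (rooted_ball G (w # xs) r) u v = adjacent (rooted_ball H (f w # ys) r) (f u) (f v)"
      using uv fuv by (simp add: adjacent_rooted_ball)
  qed
  then show "agree_upto r G (w # xs) H (f w # ys)"
    unfolding agree_upto_def rooted_iso_def using f(2) by (intro exI[of _ f]) simp
qed

text \<open>Confining the new root to a ball keeps the count finite, so complements turn into
  subtractions in the measurability proof.\<close>

definition ballcount :: "(nat graph \<times> nat list) set \<Rightarrow> nat \<Rightarrow> nat graph \<times> nat list \<Rightarrow> nat" where
  "ballcount A R \<omega> = card {w \<in> graph_ball (fst \<omega>) R (hd (snd \<omega>)). (fst \<omega>, w # snd \<omega>) \<in> A}"

lemma finite_ball_nets:
  assumes "\<omega> \<in> nets (Suc k)"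
  shows "finite (graph_ball (fst \<omega>) R (hd (snd \<omega>)))" "graph_ball (fst \<omega>) R (hd (snd \<omega>)) \<subseteq> verts (fst \<omega>)"
proof -
  obtain G xs where \<omega>: "\<omega> = (G, xs)" by (cases \<omega>)
  then have n: "is_network G xs" "xs \<noteq> []" using assms by (auto simp: nets_def)
  then have "hd xs \<in> verts G" by (auto simp: is_network_def dest: hd_in_set)
  then show "finite (graph_ball (fst \<omega>) R (hd (snd \<omega>)))" "graph_ball (fst \<omega>) R (hd (snd \<omega>)) \<subseteq> verts (fst \<omega>)"
    using n graph_ball_finite[of G "hd xs" R] graph_ball_subset[of G "hd xs" R]
    by (simp_all add: \<omega> is_network_def)
qed

lemma nets_Cons: "(G, xs) \<in> nets k \<Longrightarrow> w \<in> verts G \<Longrightarrow> (G, w # xs) \<in> nets (Suc k)"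
  by (auto simp: nets_def is_network_def)

lemma ballcount_le_local:
  assumes A: "A \<subseteq> nets (Suc (Suc k))"
    and r: "\<And>G xs H ys. (G, xs) \<in> A \<Longrightarrow> (H, ys) \<in> nets (Suc (Suc k)) \<Longrightarrow> agree_upto r G xs H ys \<Longrightarrow> (H, ys) \<in> A"
    and G: "(G, xs) \<in> nets (Suc k)" and H: "(H, ys) \<in> nets (Suc k)" and ag: "agree_upto (R + r) G xs H ys"
  shows "ballcount A R (G, xs) \<le> ballcount A R (H, ys)"
proof -
  obtain f where f: "graph_iso f (rooted_ball G xs (R + r)) (rooted_ball H ys (R + r))" "map f xs = ys"
    using ag by (auto simp: agree_upto_def rooted_iso_def)
  have n: "is_network G xs" "is_network H ys" and ne: "xs \<noteq> []" using G H by (auto simp: nets_def)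
  have x: "hd xs \<in> set xs" and fhd: "f (hd xs) = hd ys" using ne f(2) hd_map[OF ne, of f] by simp_all
  have xG: "hd xs \<in> verts G" using n x by (auto simp: is_network_def)
  have sub: "graph_ball G R (hd xs) \<subseteq> verts (rooted_ball G xs (R + r))"
    using graph_ball_mono[of R "R + r" G "hd xs"] graph_ball_subset[of G "hd xs" R] n x xG
    by (auto simp: verts_rooted_ball is_network_def)
  have "inj_on f (graph_ball G R (hd xs))"
    using f(1) sub by (auto simp: graph_iso_def bij_betw_def intro: inj_on_subset)
  then have inj: "inj_on f {w \<in> graph_ball G R (hd xs). (G, w # xs) \<in> A}" by (rule inj_on_subset) auto
  have "f ` {w \<in> graph_ball G R (hd xs). (G, w # xs) \<in> A} \<subseteq> {w \<in> graph_ball H R (hd ys). (H, w # ys) \<in> A}"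
  proof
    fix v assume "v \<in> f ` {w \<in> graph_ball G R (hd xs). (G, w # xs) \<in> A}"
    then obtain w where w: "v = f w" "w \<in> graph_ball G R (hd xs)" "(G, w # xs) \<in> A" by blast
    note rr = iso_reroot[OF n f x w(2)]
    have "f w \<in> verts H" using rr(1) finite_ball_nets(2)[OF H, of R] fhd by auto
    then have "(H, f w # ys) \<in> A" using r[OF w(3) nets_Cons[OF H] rr(2)] by blast
    then show "v \<in> {w \<in> graph_ball H R (hd ys). (H, w # ys) \<in> A}" using w rr(1) fhd by simp
  qed
  then show ?thesis unfolding ballcount_def fst_conv snd_conv
    using card_inj_on_le[OF inj] finite_ball_nets(1)[OF H, of R] by auto
qed

lemma ballcount_local_measurable:
  assumes "local_set (Suc (Suc k)) A"
  shows "ballcount A R \<in> measurable (NM (Suc k)) (count_space UNIV)"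
proof (rule measurableI)
  obtain r where A: "A \<subseteq> nets (Suc (Suc k))" and
    r: "\<And>G xs H ys. (G, xs) \<in> A \<Longrightarrow> (H, ys) \<in> nets (Suc (Suc k)) \<Longrightarrow> agree_upto r G xs H ys \<Longrightarrow> (H, ys) \<in> A"
    using assms unfolding local_set_def by blast
  fix N :: "nat set"
  have "(H, ys) \<in> ballcount A R -` N"
    if "(G, xs) \<in> ballcount A R -` N" "(G, xs) \<in> nets (Suc k)" "(H, ys) \<in> nets (Suc k)" "agree_upto (R + r) G xs H ys"
    for G xs H ys
  proof -
    have n: "is_network G xs" using that by (auto simp: nets_def)
    have "ballcount A R (G, xs) \<le> ballcount A R (H, ys)"
      by (rule ballcount_le_local[OF A r that(2,3,4)])
    moreover have "ballcount A R (H, ys) \<le> ballcount A R (G, xs)"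
      by (rule ballcount_le_local[OF A r that(3,2) agree_upto_sym[OF n that(4)]])
    ultimately show ?thesis using that(1) by simp
  qed
  then have "local_set (Suc k) (ballcount A R -` N \<inter> nets (Suc k))"
    unfolding local_set_def by blast
  then show "ballcount A R -` N \<inter> space (NM (Suc k)) \<in> sets (NM (Suc k))"
    by (simp add: space_NM local_set_in_NM)
qed simp

text \<open>Local sets generate the sigma-algebra and are closed under intersection, so only
  complements and disjoint countable unions remain to be treated.\<close>

lemma ballcount_measurable:
  assumes "A \<in> sets (NM (Suc (Suc k)))"
  shows "ballcount A R \<in> measurable (NM (Suc k)) (count_space UNIV)"
proof -
  let ?m = "\<lambda>A. ballcount A R \<in> measurable (NM (Suc k)) (count_space UNIV)"
  let ?N = "nets (Suc (Suc k))"
  let ?L = "{A. local_set (Suc (Suc k)) A}"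
  have Pow: "?L \<subseteq> Pow ?N" by (auto simp: local_set_def)
  have A: "A \<in> sigma_sets ?N ?L" using assms by (simp add: sets_NM)
  show ?thesis
    using Int_stable_local Pow A
  proof (induction rule: sigma_sets_induct_disjoint)
    case (basic A)
    then show ?case by (simp add: ballcount_local_measurable)
  next
    case empty
    have "ballcount {} R = (\<lambda>_. 0)" by (simp add: ballcount_def fun_eq_iff)
    then show ?case by simp
  next
    case (compl A)
    have top: "?m ?N" by (rule ballcount_local_measurable) (auto simp: local_set_def)
    have "ballcount (?N - A) R \<omega> = ballcount ?N R \<omega> - ballcount A R \<omega>" if "\<omega> \<in> space (NM (Suc k))" for \<omega>
    proof -
      let ?b = "graph_ball (fst \<omega>) R (hd (snd \<omega>))"
      have fin: "finite ?b" using that finite_ball_nets by (simp add: space_NM)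
      have AN: "A \<subseteq> ?N" using sigma_sets_into_sp[OF Pow compl(1)] .
      have "{w \<in> ?b. (fst \<omega>, w # snd \<omega>) \<in> ?N - A} = {w \<in> ?b. (fst \<omega>, w # snd \<omega>) \<in> ?N} - {w \<in> ?b. (fst \<omega>, w # snd \<omega>) \<in> A}"
        by auto
      then show ?thesis unfolding ballcount_def using fin AN
        by (simp only:) (rule card_Diff_subset; auto)
    qed
    moreover have "(\<lambda>\<omega>. ballcount ?N R \<omega> - ballcount A R \<omega>) \<in> measurable (NM (Suc k)) (count_space UNIV)"
      using compl(2) top by measurable
    ultimately show ?case by (subst measurable_cong)
  next
    case (union A)
    have e: "ennreal (real (ballcount (\<Union>i. A i) R \<omega>)) = (\<Sum>i. ennreal (real (ballcount (A i) R \<omega>)))"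
      if "\<omega> \<in> space (NM (Suc k))" for \<omega>
    proof -
      let ?b = "graph_ball (fst \<omega>) R (hd (snd \<omega>))"
      have fin: "finite ?b" using that finite_ball_nets by (simp add: space_NM)
      have "ennreal (real (ballcount X R \<omega>)) = emeasure (count_space ?b) {w \<in> ?b. (fst \<omega>, w # snd \<omega>) \<in> X}" for X
        unfolding ballcount_def using fin by (subst emeasure_count_space_finite) (auto simp: ennreal_of_nat_eq_real_of_nat)
      moreover have "(\<Sum>i. emeasure (count_space ?b) {w \<in> ?b. (fst \<omega>, w # snd \<omega>) \<in> A i}) =
          emeasure (count_space ?b) (\<Union>i. {w \<in> ?b. (fst \<omega>, w # snd \<omega>) \<in> A i})"
        by (rule suminf_emeasure) (use union(1) in \<open>auto simp: disjoint_family_on_def\<close>)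
      moreover have "(\<Union>i. {w \<in> ?b. (fst \<omega>, w # snd \<omega>) \<in> A i}) = {w \<in> ?b. (fst \<omega>, w # snd \<omega>) \<in> (\<Union>i. A i)}" by auto
      ultimately show ?thesis by simp
    qed
    have [measurable]: "ballcount (A i) R \<in> measurable (NM (Suc k)) (count_space UNIV)" for i by (rule union(3))
    have "(\<lambda>\<omega>. \<Sum>i. ennreal (real (ballcount (A i) R \<omega>))) \<in> borel_measurable (NM (Suc k))" by measurable
    then have m: "(\<lambda>\<omega>. ennreal (real (ballcount (\<Union>i. A i) R \<omega>))) \<in> borel_measurable (NM (Suc k))"
      by (subst measurable_cong[OF e])
    \<comment> \<open>Countable additivity was used in \<open>ennreal\<close>. The embedding of the
      naturals is injective and the image of any set of naturals is countable, hence Borel, so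
      measurability pulls back to the count itself.\<close>
    show "?m (\<Union>i. A i)"
    proof (rule measurableI)
      fix X :: "nat set"
      have "ballcount (\<Union>i. A i) R -` X \<inter> space (NM (Suc k)) =
        (\<lambda>\<omega>. ennreal (real (ballcount (\<Union>i. A i) R \<omega>))) -` ((\<lambda>n. ennreal (real n)) ` X) \<inter> space (NM (Suc k))"
        by auto
      also have "\<dots> \<in> sets (NM (Suc k))"
        by (rule measurable_sets[OF m], rule sets.countable) (auto intro: countable_image)
      finally show "ballcount (\<Union>i. A i) R -` X \<inter> space (NM (Suc k)) \<in> sets (NM (Suc k))" .
    qed simp
  qed
qed

lemma UN_graph_ball:
  assumes "\<omega> \<in> nets (Suc k)"
  shows "(\<Union>R. graph_ball (fst \<omega>) R (hd (snd \<omega>))) = verts (fst \<omega>)"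
proof -
  obtain G xs where \<omega>: "\<omega> = (G, xs)" by (cases \<omega>)
  then have n: "is_network G xs" "xs \<noteq> []" using assms by (auto simp: nets_def)
  then have h: "hd xs \<in> verts G" by (auto simp: is_network_def dest: hd_in_set)
  have "w \<in> (\<Union>R. graph_ball G R (hd xs))" if "w \<in> verts G" for w
  proof -
    have "(adjacent G)\<^sup>*\<^sup>* (hd xs) w" using n h that by (auto simp: is_network_def graph_connected_def)
    then show ?thesis by (auto dest!: rtranclp_imp_relpowp simp: graph_ball_def)
  qed
  moreover have "graph_ball G R (hd xs) \<subseteq> verts G" for R
    using graph_ball_subset[of G "hd xs" R] n h by (simp add: is_network_def)
  ultimately show ?thesis by (auto simp: \<omega>)
qed

text \<open>The closure property on which all later measurability rests: a root can be integrated
  out. The new root is put at the head of the list, so old indices shift by one; this explains the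
  \<open>Suc\<close> in later index positions.\<close>

lemma nn_integral_root_measurable:
  assumes "F \<in> borel_measurable (NM (Suc (Suc k)))"
  shows "(\<lambda>\<omega>. \<integral>\<^sup>+w. F (fst \<omega>, w # snd \<omega>) \<partial>count_space (verts (fst \<omega>))) \<in> borel_measurable (NM (Suc k))"
  using assms
proof (induction rule: borel_measurable_induct)
  case (cong f g)
  have "(\<integral>\<^sup>+w. f (fst \<omega>, w # snd \<omega>) \<partial>count_space (verts (fst \<omega>))) = (\<integral>\<^sup>+w. g (fst \<omega>, w # snd \<omega>) \<partial>count_space (verts (fst \<omega>)))"
    if "\<omega> \<in> space (NM (Suc k))" for \<omega>
  proof (rule nn_integral_cong)
    fix w assume "w \<in> space (count_space (verts (fst \<omega>)))"
    then have "(fst \<omega>, w # snd \<omega>) \<in> nets (Suc (Suc k))" using that by (intro nets_Cons) (auto simp: space_NM)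
    then show "f (fst \<omega>, w # snd \<omega>) = g (fst \<omega>, w # snd \<omega>)" using cong(3) by (simp add: space_NM)
  qed
  then show ?case using cong(4) by (subst (asm) measurable_cong) auto
next
  case (set A)
  have "(\<integral>\<^sup>+w. indicator A (fst \<omega>, w # snd \<omega>) \<partial>count_space (verts (fst \<omega>))) = (SUP R. ennreal (real (ballcount A R \<omega>)))"
    if "\<omega> \<in> space (NM (Suc k))" for \<omega>
  proof -
    let ?b = "\<lambda>R. graph_ball (fst \<omega>) R (hd (snd \<omega>))"
    let ?X = "\<lambda>R. {w \<in> ?b R. (fst \<omega>, w # snd \<omega>) \<in> A}"
    have \<omega>: "\<omega> \<in> nets (Suc k)" using that by (simp add: space_NM)
    have bc: "emeasure (count_space (verts (fst \<omega>))) (?X R) = ennreal (real (ballcount A R \<omega>))" for R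
      using finite_ball_nets[OF \<omega>, of R]
      by (subst emeasure_count_space_finite) (auto simp: ballcount_def ennreal_of_nat_eq_real_of_nat)
    have "(\<integral>\<^sup>+w. indicator A (fst \<omega>, w # snd \<omega>) \<partial>count_space (verts (fst \<omega>))) =
      (\<integral>\<^sup>+w. indicator {w \<in> verts (fst \<omega>). (fst \<omega>, w # snd \<omega>) \<in> A} w \<partial>count_space (verts (fst \<omega>)))"
      by (intro nn_integral_cong) (auto simp: indicator_def)
    also have "\<dots> = emeasure (count_space (verts (fst \<omega>))) {w \<in> verts (fst \<omega>). (fst \<omega>, w # snd \<omega>) \<in> A}"
      by (rule nn_integral_indicator) auto
    also have "{w \<in> verts (fst \<omega>). (fst \<omega>, w # snd \<omega>) \<in> A} = (\<Union>R. ?X R)"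
      using UN_graph_ball[OF \<omega>] by auto
    also have "emeasure (count_space (verts (fst \<omega>))) (\<Union>R. ?X R) = (SUP R. emeasure (count_space (verts (fst \<omega>))) (?X R))"
      using finite_ball_nets(2)[OF \<omega>] graph_ball_mono[of _ _ "fst \<omega>"]
      by (intro SUP_emeasure_incseq[symmetric]) (fastforce simp: incseq_def)+
    also have "\<dots> = (SUP R. ennreal (real (ballcount A R \<omega>)))" by (simp only: bc)
    finally show ?thesis .
  qed
  moreover have "(\<lambda>\<omega>. SUP R. ennreal (real (ballcount A R \<omega>))) \<in> borel_measurable (NM (Suc k))"
  proof -
    have [measurable]: "ballcount A R \<in> measurable (NM (Suc k)) (count_space UNIV)" for R
      using set by (rule ballcount_measurable)
    show ?thesis by measurable
  qed
  ultimately show ?case by (subst measurable_cong) auto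
next
  case (mult u c)
  then show ?case by (simp add: nn_integral_cmult)
next
  case (add u v)
  then show ?case by (simp add: nn_integral_add)
next
  case (seq U)
  have "(\<lambda>\<omega>. SUP i. \<integral>\<^sup>+w. U i (fst \<omega>, w # snd \<omega>) \<partial>count_space (verts (fst \<omega>))) \<in> borel_measurable (NM (Suc k))"
    using seq by measurable
  moreover have "(\<integral>\<^sup>+w. (SUP i. U i) (fst \<omega>, w # snd \<omega>) \<partial>count_space (verts (fst \<omega>))) =
      (SUP i. \<integral>\<^sup>+w. U i (fst \<omega>, w # snd \<omega>) \<partial>count_space (verts (fst \<omega>)))" for \<omega>
    unfolding SUP_apply using seq by (intro nn_integral_monotone_convergence_SUP) (auto simp: incseq_def le_fun_def)
  ultimately show ?case by simp
qed

lemma infsum_eq_nn_integral: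
  fixes f :: "nat \<Rightarrow> ennreal"
  shows "(\<Sum>\<^sub>\<infinity>x\<in>A. f x) = (\<integral>\<^sup>+x. f x \<partial>count_space A)"
proof -
  have *: "(\<integral>\<^sup>+x. f x \<partial>count_space A) = (\<Sum>n. f n * indicator A n)"
    by (simp add: nn_integral_count_space_indicator nn_integral_count_space_nat)
  have "(\<Sum>\<^sub>\<infinity>x\<in>A. f x) = (SUP F\<in>{F. finite F \<and> F \<subseteq> A}. sum f F)"
    by (rule nonneg_infsum_complete) simp
  also have "\<dots> = (\<Sum>n. f n * indicator A n)"
  proof (rule antisym)
    show "(SUP F\<in>{F. finite F \<and> F \<subseteq> A}. sum f F) \<le> (\<Sum>n. f n * indicator A n)"
    proof (rule SUP_least)
      fix F assume "F \<in> {F. finite F \<and> F \<subseteq> A}"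
      then have F: "finite F" "F \<subseteq> A" by auto
      have "sum f F = (\<Sum>n\<in>F. f n * indicator A n)" using F by (intro sum.cong) auto
      also have "\<dots> \<le> (\<Sum>n. f n * indicator A n)" by (rule sum_le_suminf) (use F in auto)
      finally show "sum f F \<le> (\<Sum>n. f n * indicator A n)" .
    qed
    show "(\<Sum>n. f n * indicator A n) \<le> (SUP F\<in>{F. finite F \<and> F \<subseteq> A}. sum f F)"
      unfolding suminf_eq_SUP
    proof (rule SUP_least)
      fix n
      have "(\<Sum>i<n. f i * indicator A i) = sum f ({..<n} \<inter> A)"
        by (simp add: sum.inter_restrict indicator_def if_distrib cong: if_cong)
      also have "\<dots> \<le> (SUP F\<in>{F. finite F \<and> F \<subseteq> A}. sum f F)" by (rule SUP_upper) auto
      finally show "(\<Sum>i<n. f i * indicator A i) \<le> (SUP F\<in>{F. finite F \<and> F \<subseteq> A}. sum f F)" .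
    qed
  qed
  finally show ?thesis by (simp add: *)
qed

section \<open>Measurability of basic predicates and of sums over neighbours\<close>

abbreviation "bmeas k \<equiv> borel_measurable (NM (Suc k))"
abbreviation "bpred k \<equiv> Measurable.pred (NM (Suc k))"

lemma adjacent_meas [measurable]:
  assumes "i < Suc k" "j < Suc k"
  shows "bpred k (\<lambda>\<omega>. adjacent (fst \<omega>) (snd \<omega> ! i) (snd \<omega> ! j))"
proof -
  have "local_set (Suc k) {\<omega> \<in> nets (Suc k). adjacent (fst \<omega>) (snd \<omega> ! i) (snd \<omega> ! j)}"
    unfolding local_set_def
  proof (intro conjI exI[of _ 0] allI impI)
    fix G xs H ys
    assume G: "(G, xs) \<in> {\<omega> \<in> nets (Suc k). adjacent (fst \<omega>) (snd \<omega> ! i) (snd \<omega> ! j)}"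
      and H: "(H, ys) \<in> nets (Suc k)" and "agree_upto 0 G xs H ys"
    then obtain f where f: "graph_iso f (rooted_ball G xs 0) (rooted_ball H ys 0)" "map f xs = ys"
      by (auto simp: agree_upto_def rooted_iso_def)
    have l: "length xs = Suc k" "is_network G xs" "is_network H ys" "length ys = Suc k" using G H by (auto simp: nets_def)
    have xs: "xs ! i \<in> verts (rooted_ball G xs 0)" "xs ! j \<in> verts (rooted_ball G xs 0)"
      using l assms roots_in_ball[of xs G 0] by (auto simp: is_network_def)
    have ys: "ys ! i \<in> verts (rooted_ball H ys 0)" "ys ! j \<in> verts (rooted_ball H ys 0)"
      using l assms roots_in_ball[of ys H 0] by (auto simp: is_network_def)
    have "f (xs ! i) = ys ! i" "f (xs ! j) = ys ! j" using f(2) l assms by auto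
    then have "adjacent H (ys ! i) (ys ! j)"
      using f(1) xs ys G unfolding graph_iso_def by (metis (no_types, lifting) adjacent_rooted_ball fst_conv mem_Collect_eq snd_conv)
    then show "(H, ys) \<in> {\<omega> \<in> nets (Suc k). adjacent (fst \<omega>) (snd \<omega> ! i) (snd \<omega> ! j)}" using H by simp
  qed auto
  then show ?thesis by (simp add: pred_def space_NM local_set_in_NM)
qed

lemma eq_meas [measurable]:
  assumes "i < Suc k" "j < Suc k"
  shows "bpred k (\<lambda>\<omega>. snd \<omega> ! i = snd \<omega> ! j)"
proof -
  have "local_set (Suc k) {\<omega> \<in> nets (Suc k). snd \<omega> ! i = snd \<omega> ! j}"
    unfolding local_set_def
  proof (intro conjI exI[of _ 0] allI impI)
    fix G xs H ys
    assume G: "(G, xs) \<in> {\<omega> \<in> nets (Suc k). snd \<omega> ! i = snd \<omega> ! j}"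
      and H: "(H, ys) \<in> nets (Suc k)" and "agree_upto 0 G xs H ys"
    then obtain f where "map f xs = ys" by (auto simp: agree_upto_def rooted_iso_def)
    moreover have "length xs = Suc k" "xs ! i = xs ! j" using G by (auto simp: nets_def)
    ultimately have "ys ! i = ys ! j" using assms by (metis nth_map)
    then show "(H, ys) \<in> {\<omega> \<in> nets (Suc k). snd \<omega> ! i = snd \<omega> ! j}" using H by simp
  qed auto
  then show ?thesis by (simp add: pred_def space_NM local_set_in_NM)
qed

lemma root_integral_meas:
  assumes "(\<lambda>\<omega>. F (fst \<omega>) (snd \<omega>)) \<in> bmeas (Suc k)"
  shows "(\<lambda>\<omega>. \<integral>\<^sup>+w. F (fst \<omega>) (w # snd \<omega>) \<partial>count_space (verts (fst \<omega>))) \<in> bmeas k"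
  using nn_integral_root_measurable[OF assms] by simp

text \<open>A vertex with the property exists iff the integral of its indicator over the vertices is
  nonzero.\<close>

lemma root_ex_meas:
  assumes [measurable]: "bpred (Suc k) (\<lambda>\<omega>. Q (fst \<omega>) (snd \<omega>))"
  shows "bpred k (\<lambda>\<omega>. \<exists>w\<in>verts (fst \<omega>). Q (fst \<omega>) (w # snd \<omega>))"
proof -
  have "(\<lambda>\<omega>. if Q (fst \<omega>) (snd \<omega>) then 1 else 0 :: ennreal) \<in> bmeas (Suc k)"
    by measurable
  note I = root_integral_meas[where F="\<lambda>G ys. if Q G ys then 1 else 0", OF this]
  have p: "Measurable.pred borel (\<lambda>x::ennreal. x \<noteq> 0)" by measurable
  have "(\<integral>\<^sup>+w. (if Q (fst \<omega>) (w # snd \<omega>) then 1 else 0) \<partial>count_space (verts (fst \<omega>)) :: ennreal) \<noteq> 0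
    \<longleftrightarrow> (\<exists>w\<in>verts (fst \<omega>). Q (fst \<omega>) (w # snd \<omega>))" for \<omega>
    by (subst nn_integral_0_iff_AE) (auto simp: AE_count_space)
  then show ?thesis using measurable_compose[OF I p] by (simp only:)
qed

lemma neighbours_finite:
  assumes "\<omega> \<in> space (NM (Suc k))" "j < Suc k"
  shows "finite (neighbours (fst \<omega>) (snd \<omega> ! j))" "neighbours (fst \<omega>) (snd \<omega> ! j) \<subseteq> verts (fst \<omega>)"
proof -
  obtain G xs where \<omega>: "\<omega> = (G, xs)" by (cases \<omega>)
  then have n: "is_network G xs" "length xs = Suc k" using assms by (auto simp: space_NM nets_def)
  then have "xs ! j \<in> verts G" using assms nth_mem[of j xs] by (auto simp: is_network_def)
  then show "finite (neighbours (fst \<omega>) (snd \<omega> ! j))" using n by (simp add: \<omega> is_network_def locally_finite_def)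
  show "neighbours (fst \<omega>) (snd \<omega> ! j) \<subseteq> verts (fst \<omega>)"
    using n adjacent_verts(2)[of G "xs ! j"] by (auto simp: \<omega> is_network_def neighbours_def)
qed

lemma nn_integral_neighbours:
  fixes f :: "nat \<Rightarrow> ennreal"
  assumes "finite (neighbours G x)" "neighbours G x \<subseteq> verts G"
  shows "(\<integral>\<^sup>+w. f w * (if adjacent G x w then 1 else 0) \<partial>count_space (verts G)) = (\<Sum>w\<in>neighbours G x. f w)"
proof -
  have "(\<integral>\<^sup>+w. f w * (if adjacent G x w then 1 else 0) \<partial>count_space (verts G)) =
    (\<integral>\<^sup>+w. f w * indicator (neighbours G x) w \<partial>count_space (verts G))"
    by (intro nn_integral_cong) (auto simp: neighbours_def)
  also have "\<dots> = (\<integral>\<^sup>+w. f w \<partial>count_space (neighbours G x))"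
    using assms(2) by (auto simp: nn_integral_count_space_indicator intro!: nn_integral_cong split: split_indicator)
  also have "\<dots> = (\<Sum>w\<in>neighbours G x. f w)" by (rule nn_integral_count_space_finite[OF assms(1)])
  finally show ?thesis .
qed

lemma neighbour_sum_meas_ennreal:
  fixes F :: "nat graph \<Rightarrow> nat list \<Rightarrow> ennreal"
  assumes [measurable]: "(\<lambda>\<omega>. F (fst \<omega>) (snd \<omega>)) \<in> bmeas (Suc k)" and j: "j < Suc k"
  shows "(\<lambda>\<omega>. \<Sum>w\<in>neighbours (fst \<omega>) (snd \<omega> ! j). F (fst \<omega>) (w # snd \<omega>)) \<in> bmeas k"
proof -
  have [measurable]: "bpred (Suc k) (\<lambda>\<omega>. adjacent (fst \<omega>) (snd \<omega> ! Suc j) (snd \<omega> ! 0))"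
    using j by (intro adjacent_meas) auto
  have "(\<lambda>\<omega>. F (fst \<omega>) (snd \<omega>) * (if adjacent (fst \<omega>) (snd \<omega> ! Suc j) (snd \<omega> ! 0) then 1 else 0)) \<in> bmeas (Suc k)"
    by measurable
  from root_integral_meas[where F="\<lambda>G ys. F G ys * (if adjacent G (ys ! Suc j) (ys ! 0) then 1 else 0)", OF this]
  have "(\<lambda>\<omega>. \<integral>\<^sup>+w. F (fst \<omega>) (w # snd \<omega>) * (if adjacent (fst \<omega>) (snd \<omega> ! j) w then 1 else 0) \<partial>count_space (verts (fst \<omega>))) \<in> bmeas k"
    by simp
  moreover have "(\<integral>\<^sup>+w. F (fst \<omega>) (w # snd \<omega>) * (if adjacent (fst \<omega>) (snd \<omega> ! j) w then 1 else 0) \<partial>count_space (verts (fst \<omega>))) =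
      (\<Sum>w\<in>neighbours (fst \<omega>) (snd \<omega> ! j). F (fst \<omega>) (w # snd \<omega>))" if "\<omega> \<in> space (NM (Suc k))" for \<omega>
    using nn_integral_neighbours[OF neighbours_finite[OF that j], of "\<lambda>w. F (fst \<omega>) (w # snd \<omega>)"] .
  ultimately show ?thesis by (subst measurable_cong[symmetric]) auto
qed

text \<open>As \<open>ennreal\<close> sends negative numbers to 0, the two sums in
  \<open>ennreal\<close> are the sums of the positive and of the negative parts.\<close>

lemma neighbour_sum_meas:
  fixes F :: "nat graph \<Rightarrow> nat list \<Rightarrow> real"
  assumes [measurable]: "(\<lambda>\<omega>. F (fst \<omega>) (snd \<omega>)) \<in> bmeas (Suc k)" and j: "j < Suc k"
  shows "(\<lambda>\<omega>. \<Sum>w\<in>neighbours (fst \<omega>) (snd \<omega> ! j). F (fst \<omega>) (w # snd \<omega>)) \<in> bmeas k"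
proof -
  have p: "(\<lambda>\<omega>. \<Sum>w\<in>neighbours (fst \<omega>) (snd \<omega> ! j). ennreal (F (fst \<omega>) (w # snd \<omega>))) \<in> bmeas k"
    by (rule neighbour_sum_meas_ennreal[where F="\<lambda>G ys. ennreal (F G ys)", OF _ j]) measurable
  have n: "(\<lambda>\<omega>. \<Sum>w\<in>neighbours (fst \<omega>) (snd \<omega> ! j). ennreal (- F (fst \<omega>) (w # snd \<omega>))) \<in> bmeas k"
    by (rule neighbour_sum_meas_ennreal[where F="\<lambda>G ys. ennreal (- F G ys)", OF _ j]) measurable
  have "(\<Sum>w\<in>N. f w) = enn2real (\<Sum>w\<in>N. ennreal (f w)) - enn2real (\<Sum>w\<in>N. ennreal (- f w))"
    if "finite N" for N and f :: "nat \<Rightarrow> real"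
  proof -
    have "(\<Sum>w\<in>N. ennreal (f w)) = ennreal (\<Sum>w\<in>N. max 0 (f w))" for f :: "nat \<Rightarrow> real"
    proof -
      have "(\<Sum>w\<in>N. ennreal (f w)) = (\<Sum>w\<in>N. ennreal (max 0 (f w)))"
        by (intro sum.cong) (auto simp: max_def ennreal_neg)
      also have "\<dots> = ennreal (\<Sum>w\<in>N. max 0 (f w))" by (rule sum_ennreal) simp
      finally show ?thesis .
    qed
    then have "enn2real (\<Sum>w\<in>N. ennreal (f w)) = (\<Sum>w\<in>N. max 0 (f w))" for f :: "nat \<Rightarrow> real"
      by (simp add: sum_nonneg)
    then show ?thesis by (simp add: sum_subtractf[symmetric] max_def if_distrib cong: if_cong)
  qed
  note sum_eq = this
  have "(\<lambda>\<omega>. enn2real (\<Sum>w\<in>neighbours (fst \<omega>) (snd \<omega> ! j). ennreal (F (fst \<omega>) (w # snd \<omega>))) -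
      enn2real (\<Sum>w\<in>neighbours (fst \<omega>) (snd \<omega> ! j). ennreal (- F (fst \<omega>) (w # snd \<omega>)))) \<in> bmeas k"
    by (intro borel_measurable_diff borel_measurable_enn2real p n)
  moreover have "(\<Sum>w\<in>neighbours (fst \<omega>) (snd \<omega> ! j). F (fst \<omega>) (w # snd \<omega>)) =
    enn2real (\<Sum>w\<in>neighbours (fst \<omega>) (snd \<omega> ! j). ennreal (F (fst \<omega>) (w # snd \<omega>))) -
      enn2real (\<Sum>w\<in>neighbours (fst \<omega>) (snd \<omega> ! j). ennreal (- F (fst \<omega>) (w # snd \<omega>)))"
    if "\<omega> \<in> space (NM (Suc k))" for \<omega>
    by (rule sum_eq) (rule neighbours_finite[OF that j])
  ultimately show ?thesis by (subst measurable_cong) auto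
qed

subsection \<open>The mass transport principle\<close>

text \<open>Unimodularity speaks of Borel functions of isomorphism classes. Such a function arises
  from \<open>h\<close> by evaluation at the representative \<open>rep2\<close>; its value at
  \<open>abs_gstar2 (G, v, w)\<close> is \<open>h G v w\<close> because measurable functionals are
  invariant.\<close>

lemma mass_transport:
  fixes h :: "nat graph \<Rightarrow> nat \<Rightarrow> nat \<Rightarrow> ennreal"
  assumes L: "unimodular L"
    and h: "\<And>k i j. i < Suc k \<Longrightarrow> j < Suc k \<Longrightarrow> (\<lambda>\<omega>. h (fst \<omega>) (snd \<omega> ! i) (snd \<omega> ! j)) \<in> bmeas k"
  shows "(\<integral>\<^sup>+g. (\<integral>\<^sup>+w. h (fst (rep1 g)) (snd (rep1 g) ! 0) w \<partial>count_space (verts (fst (rep1 g)))) \<partial>L) =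
    (\<integral>\<^sup>+g. (\<integral>\<^sup>+w. h (fst (rep1 g)) w (snd (rep1 g) ! 0) \<partial>count_space (verts (fst (rep1 g)))) \<partial>L)"
proof -
  define F where "F = (\<lambda>\<omega>. h (fst \<omega>) (snd \<omega> ! 0) (snd \<omega> ! 1))"
  have FM: "F \<in> borel_measurable (NM 2)" using h[of 0 1 1] by (simp add: F_def numeral_2_eq_2)
  define f where "f = (\<lambda>g2. F (rep2 g2))"
  have f: "f \<in> borel_measurable borel" unfolding f_def by (rule measurable_compose[OF rep2_measurable FM])
  have fabs: "f (abs_gstar2 (G, v, w)) = h G v w" if "is_network G [v, w]" for G v w
  proof -
    obtain H v' w' where H: "rep_gstar2 (abs_gstar2 (G, v, w)) = (H, v', w')" by (metis surj_pair)
    have "network_iso G [v, w] G [v, w]" using network_iso_refl that by blast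
    then have "network_iso H [v', w'] G [v, w]"
      using Quotient3_rep_abs[OF Quotient3_gstar2, of "(G, v, w)"] H by simp
    then have "rooted_iso H [v', w'] G [v, w]" "(H, [v', w']) \<in> nets 2" "(G, [v, w]) \<in> nets 2"
      by (auto simp: network_iso_def nets_def)
    then have "F (H, [v', w']) = F (G, [v, w])" using NM_fun_invariant[OF FM] by blast
    then show ?thesis by (simp add: f_def rep2_def H F_def)
  qed
  have E1: "(\<integral>\<^sup>+w. h (fst (rep1 g)) (snd (rep1 g) ! 0) w \<partial>count_space (verts (fst (rep1 g)))) =
      (case rep_gstar g of (G, v) \<Rightarrow> \<Sum>\<^sub>\<infinity>x\<in>verts G. f (abs_gstar2 (G, v, x)))"
    and E2: "(\<integral>\<^sup>+w. h (fst (rep1 g)) w (snd (rep1 g) ! 0) \<partial>count_space (verts (fst (rep1 g)))) =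
      (case rep_gstar g of (G, v) \<Rightarrow> \<Sum>\<^sub>\<infinity>x\<in>verts G. f (abs_gstar2 (G, x, v)))" for g
  proof -
    obtain G v where g: "rep_gstar g = (G, v)" by (metis surj_pair)
    have "is_network G [v]" by (rule is_network_rep_gstar[OF g])
    then have "is_network G [v, x]" "is_network G [x, v]" if "x \<in> verts G" for x
      using that by (auto simp: is_network_def)
    then show "(\<integral>\<^sup>+w. h (fst (rep1 g)) (snd (rep1 g) ! 0) w \<partial>count_space (verts (fst (rep1 g)))) =
      (case rep_gstar g of (G, v) \<Rightarrow> \<Sum>\<^sub>\<infinity>x\<in>verts G. f (abs_gstar2 (G, v, x)))"
      "(\<integral>\<^sup>+w. h (fst (rep1 g)) w (snd (rep1 g) ! 0) \<partial>count_space (verts (fst (rep1 g)))) =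
      (case rep_gstar g of (G, v) \<Rightarrow> \<Sum>\<^sub>\<infinity>x\<in>verts G. f (abs_gstar2 (G, x, v)))"
      by (auto simp: rep1_def g infsum_eq_nn_integral fabs intro!: nn_integral_cong)
  qed
  show ?thesis unfolding E1 E2 using L f by (simp add: unimodular_def)
qed

subsection \<open>Measurability of the spectral functionals\<close>

text \<open>Intermediate vertices of a walk are added as roots and then quantified away, so each
  walk length is settled by induction; reachability is the union over all lengths. The parameter
  vertex of \<open>T\<close> is the deleted vertex of a branch.\<close>

lemma root_reach_meas:
  assumes T: "\<And>k i j l. i < Suc k \<Longrightarrow> j < Suc k \<Longrightarrow> l < Suc k \<Longrightarrow>
      bpred k (\<lambda>\<omega>. T (fst \<omega>) (snd \<omega> ! i) (snd \<omega> ! j) (snd \<omega> ! l))"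
    and adj: "\<And>G a u w. T G a u w \<Longrightarrow> adjacent G u w"
    and ijl: "i < Suc k" "j < Suc k" "l < Suc k"
  shows "bpred k (\<lambda>\<omega>. (T (fst \<omega>) (snd \<omega> ! i))\<^sup>*\<^sup>* (snd \<omega> ! j) (snd \<omega> ! l))"
proof -
  have "bpred k (\<lambda>\<omega>. ((T (fst \<omega>) (snd \<omega> ! i)) ^^ n) (snd \<omega> ! j) (snd \<omega> ! l))"
    if "i < Suc k" "j < Suc k" "l < Suc k" for n k i j l
    using that
  proof (induction n arbitrary: k i j l)
    case 0
    then show ?case by (simp add: eq_meas)
  next
    case (Suc n)
    define Q where "Q G ys = (((T G (ys ! Suc i)) ^^ n) (ys ! Suc j) (ys ! 0) \<and> T G (ys ! Suc i) (ys ! 0) (ys ! Suc l))" for G ys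
    have "bpred (Suc k) (\<lambda>\<omega>. Q (fst \<omega>) (snd \<omega>))"
      unfolding Q_def using Suc by (intro pred_intros_logic Suc.IH T) auto
    from root_ex_meas[OF this]
    have "bpred k (\<lambda>\<omega>. \<exists>u\<in>verts (fst \<omega>). Q (fst \<omega>) (u # snd \<omega>))" .
    moreover have "(\<exists>u\<in>verts (fst \<omega>). Q (fst \<omega>) (u # snd \<omega>)) \<longleftrightarrow>
        ((T (fst \<omega>) (snd \<omega> ! i)) ^^ Suc n) (snd \<omega> ! j) (snd \<omega> ! l)" if "\<omega> \<in> space (NM (Suc k))" for \<omega>
    proof -
      have "is_graph (fst \<omega>)" using that by (auto simp: space_NM nets_def is_network_def)
      then have "u \<in> verts (fst \<omega>)" if "T (fst \<omega>) a u w" for a u w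
        using adjacent_verts(1)[OF _ adj[OF that]] by simp
      then show ?thesis by (auto simp: Q_def)
    qed
    ultimately show ?case by (subst measurable_cong[symmetric]) auto
  qed
  then have "bpred k (\<lambda>\<omega>. \<exists>n. ((T (fst \<omega>) (snd \<omega> ! i)) ^^ n) (snd \<omega> ! j) (snd \<omega> ! l))"
    using ijl by (intro pred_intros_countable) auto
  then show ?thesis by (simp add: rtranclp_power)
qed

lemma branch_meas:
  assumes "i < Suc k" "j < Suc k" "l < Suc k"
  shows "bpred k (\<lambda>\<omega>. snd \<omega> ! l \<in> branch (fst \<omega>) (snd \<omega> ! i) (snd \<omega> ! j))"
proof -
  have "bpred k (\<lambda>\<omega>. (\<lambda>u w. adjacent (fst \<omega>) u w \<and> w \<noteq> snd \<omega> ! i)\<^sup>*\<^sup>* (snd \<omega> ! j) (snd \<omega> ! l))"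
    by (rule root_reach_meas[where T="\<lambda>G a u w. adjacent G u w \<and> w \<noteq> a"])
      (use assms in \<open>auto intro!: pred_intros_logic adjacent_meas eq_meas\<close>)
  then show ?thesis unfolding branch_def mem_Collect_eq
    using assms by (intro pred_intros_logic eq_meas) auto
qed

text \<open>The operator \<open>dpoly \<theta>\<close> of the adjacency operator, written out so that it makes sense on every graph.\<close>

definition dop :: "nat \<Rightarrow> real \<Rightarrow> nat graph \<Rightarrow> (nat \<Rightarrow> real) \<Rightarrow> nat \<Rightarrow> real" where
  "dop \<Delta> \<theta> G f y = f y - ((\<Sum>z\<in>neighbours G y. \<Sum>w\<in>neighbours G z. f w)
     - 2 * \<theta> * (\<Sum>z\<in>neighbours G y. f z) + \<theta>\<^sup>2 * f y) / (real \<Delta> + \<bar>\<theta>\<bar>)\<^sup>2"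

definition ent :: "nat \<Rightarrow> real \<Rightarrow> nat graph \<Rightarrow> nat \<Rightarrow> nat \<Rightarrow> nat \<Rightarrow> real" where
  "ent \<Delta> \<theta> G n x = (dop \<Delta> \<theta> G ^^ n) (\<lambda>w. if w = x then 1 else 0)"

text \<open>The matrix of the orthogonal projection onto the \<open>\<theta>\<close>-eigenspace, as a limit of local functionals.\<close>

definition pk :: "nat \<Rightarrow> real \<Rightarrow> nat graph \<Rightarrow> nat \<Rightarrow> nat \<Rightarrow> real" where
  "pk \<Delta> \<theta> G x y = lim (\<lambda>n. ent \<Delta> \<theta> G n x y)"

text \<open>The functionals \<open>Sg\<close>, \<open>dSg\<close>, \<open>Cg\<close> and \<open>eg\<close> make \<open>S\<close>, \<open>dS\<close>, \<open>Cc\<close> and \<open>ee\<close> total functions of the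
  graph, as required for measurability.\<close>

definition Sg :: "nat \<Rightarrow> real \<Rightarrow> nat graph \<Rightarrow> nat \<Rightarrow> bool" where
  "Sg \<Delta> \<theta> G x \<longleftrightarrow> 0 < pk \<Delta> \<theta> G x x"

definition dSg :: "nat \<Rightarrow> real \<Rightarrow> nat graph \<Rightarrow> nat \<Rightarrow> bool" where
  "dSg \<Delta> \<theta> G y \<longleftrightarrow> \<not> Sg \<Delta> \<theta> G y \<and> (\<exists>x\<in>verts G. adjacent G y x \<and> Sg \<Delta> \<theta> G x)"

definition Cg :: "nat \<Rightarrow> real \<Rightarrow> nat graph \<Rightarrow> nat \<Rightarrow> nat set" where
  "Cg \<Delta> \<theta> G x = {w. (\<lambda>u w. adjacent G u w \<and> Sg \<Delta> \<theta> G w)\<^sup>*\<^sup>* x w}"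

definition eg :: "nat \<Rightarrow> real \<Rightarrow> nat graph \<Rightarrow> nat \<Rightarrow> nat \<Rightarrow> ennreal" where
  "eg \<Delta> \<theta> G x y = (\<integral>\<^sup>+w. (if w \<in> branch G x y then ennreal ((pk \<Delta> \<theta> G x w)\<^sup>2) else 0) \<partial>count_space (verts G))
     / ennreal (pk \<Delta> \<theta> G x x)"

lemma ent_meas:
  assumes "i < Suc k" "j < Suc k"
  shows "(\<lambda>\<omega>. ent \<Delta> \<theta> (fst \<omega>) n (snd \<omega> ! i) (snd \<omega> ! j)) \<in> bmeas k"
  using assms
proof (induction n arbitrary: k i j)
  case 0
  then have "bpred k (\<lambda>\<omega>. snd \<omega> ! j = snd \<omega> ! i)" by (intro eq_meas)
  then show ?case by (simp add: ent_def)
next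
  case (Suc n)
  let ?e = "\<lambda>G. ent \<Delta> \<theta> G n"
  have 1: "(\<lambda>\<omega>. \<Sum>z\<in>neighbours (fst \<omega>) (snd \<omega> ! j). ?e (fst \<omega>) (snd \<omega> ! i) z) \<in> bmeas k"
    if "i < Suc k" "j < Suc k" for k i j
    using neighbour_sum_meas[where F="\<lambda>G ys. ?e G (ys ! Suc i) (ys ! 0)", OF Suc.IH that(2)] that by simp
  have 2: "(\<lambda>\<omega>. \<Sum>z\<in>neighbours (fst \<omega>) (snd \<omega> ! j). \<Sum>w\<in>neighbours (fst \<omega>) z. ?e (fst \<omega>) (snd \<omega> ! i) w) \<in> bmeas k"
    using neighbour_sum_meas[where F="\<lambda>G ys. \<Sum>w\<in>neighbours G (ys ! 0). ?e G (ys ! Suc i) w", OF 1 Suc.prems(2)] Suc.prems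
    by simp
  have "(\<lambda>\<omega>. dop \<Delta> \<theta> (fst \<omega>) (?e (fst \<omega>) (snd \<omega> ! i)) (snd \<omega> ! j)) \<in> bmeas k"
    unfolding dop_def
    by (intro borel_measurable_diff borel_measurable_add borel_measurable_times borel_measurable_divide
        borel_measurable_const 1 2 Suc.IH Suc.prems)
  then show ?case by (simp add: ent_def)
qed

lemma pk_meas:
  assumes "i < Suc k" "j < Suc k"
  shows "(\<lambda>\<omega>. pk \<Delta> \<theta> (fst \<omega>) (snd \<omega> ! i) (snd \<omega> ! j)) \<in> bmeas k"
  unfolding pk_def by (intro borel_measurable_lim_metric ent_meas assms)

lemma Sg_meas:
  assumes "i < Suc k"
  shows "bpred k (\<lambda>\<omega>. Sg \<Delta> \<theta> (fst \<omega>) (snd \<omega> ! i))"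
proof -
  note [measurable] = pk_meas[OF assms assms, of \<Delta> \<theta>]
  show ?thesis unfolding Sg_def by measurable
qed

lemma dSg_meas:
  assumes "i < Suc k"
  shows "bpred k (\<lambda>\<omega>. dSg \<Delta> \<theta> (fst \<omega>) (snd \<omega> ! i))"
proof -
  have "bpred (Suc k) (\<lambda>\<omega>. adjacent (fst \<omega>) (snd \<omega> ! Suc i) (snd \<omega> ! 0) \<and> Sg \<Delta> \<theta> (fst \<omega>) (snd \<omega> ! 0))"
    using assms by (intro pred_intros_logic adjacent_meas Sg_meas) auto
  from root_ex_meas[where Q="\<lambda>G ys. adjacent G (ys ! Suc i) (ys ! 0) \<and> Sg \<Delta> \<theta> G (ys ! 0)", OF this]
  show ?thesis unfolding dSg_def using assms by (intro pred_intros_logic Sg_meas) auto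
qed

lemma Cg_meas:
  assumes "i < Suc k" "j < Suc k"
  shows "bpred k (\<lambda>\<omega>. snd \<omega> ! j \<in> Cg \<Delta> \<theta> (fst \<omega>) (snd \<omega> ! i))"
  unfolding Cg_def mem_Collect_eq
  by (rule root_reach_meas[where T="\<lambda>G a u w. adjacent G u w \<and> Sg \<Delta> \<theta> G w"])
    (use assms in \<open>auto intro!: pred_intros_logic adjacent_meas Sg_meas\<close>)

lemma eg_meas:
  assumes "i < Suc k" "j < Suc k"
  shows "(\<lambda>\<omega>. eg \<Delta> \<theta> (fst \<omega>) (snd \<omega> ! i) (snd \<omega> ! j)) \<in> bmeas k"
proof -
  note [measurable] = pk_meas[OF assms(1) assms(1), of \<Delta> \<theta>]
  have "(\<lambda>\<omega>. if snd \<omega> ! 0 \<in> branch (fst \<omega>) (snd \<omega> ! Suc i) (snd \<omega> ! Suc j)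
      then ennreal ((pk \<Delta> \<theta> (fst \<omega>) (snd \<omega> ! Suc i) (snd \<omega> ! 0))\<^sup>2) else 0) \<in> bmeas (Suc k)"
  proof -
    have [measurable]: "(\<lambda>\<omega>. pk \<Delta> \<theta> (fst \<omega>) (snd \<omega> ! Suc i) (snd \<omega> ! 0)) \<in> bmeas (Suc k)"
      "bpred (Suc k) (\<lambda>\<omega>. snd \<omega> ! 0 \<in> branch (fst \<omega>) (snd \<omega> ! Suc i) (snd \<omega> ! Suc j))"
      using assms by (auto intro: pk_meas branch_meas)
    show ?thesis by measurable
  qed
  from root_integral_meas[where F="\<lambda>G ys. if ys ! 0 \<in> branch G (ys ! Suc i) (ys ! Suc j)
      then ennreal ((pk \<Delta> \<theta> G (ys ! Suc i) (ys ! 0))\<^sup>2) else 0", OF this]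
  have I: "(\<lambda>\<omega>. \<integral>\<^sup>+w. (if w \<in> branch (fst \<omega>) (snd \<omega> ! i) (snd \<omega> ! j)
      then ennreal ((pk \<Delta> \<theta> (fst \<omega>) (snd \<omega> ! i) w)\<^sup>2) else 0) \<partial>count_space (verts (fst \<omega>))) \<in> bmeas k"
    by (simp cong: if_cong)
  show ?thesis unfolding eg_def by (rule borel_measurable_divide_ennreal[OF I]) measurable
qed

subsection \<open>Agreement with the operator-theoretic definitions\<close>

context bdd_graph
begin

lemma crd_polyop_ent: "crd (polyop Aop (A.dpoly \<theta> ^ n) (bas x)) y = ent \<Delta> \<theta> G n x y"
proof (induction n arbitrary: y)
  case 0
  then show ?case by (simp add: ent_def)
next
  case (Suc n)
  let ?u = "polyop Aop (A.dpoly \<theta> ^ n) (bas x)"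
  have u: "crd ?u = ent \<Delta> \<theta> G n x" using Suc.IH by (rule ext)
  have lin: "Aop 0 = 0" "Aop (a - b) = Aop a - Aop b" "Aop (a + b) = Aop a + Aop b" "Aop (c *\<^sub>R a) = c *\<^sub>R Aop a" for a b c
    using linear_Aop by (auto simp: linear_0 linear_diff linear_scale linear_add)
  have "[:-\<theta>, 1:] * [:-\<theta>, 1:] = [:\<theta>\<^sup>2, -2*\<theta>, 1:]" by (simp add: power2_eq_square)
  then have pp: "polyop Aop ([:-\<theta>, 1:] * [:-\<theta>, 1:]) w = \<theta>\<^sup>2 *\<^sub>R w - (2*\<theta>) *\<^sub>R Aop w + Aop (Aop w)" for w
    by (simp add: lin del: mult_pCons_left mult_pCons_right)
  have "crd (polyop Aop (A.dpoly \<theta>) w) y = dop \<Delta> \<theta> G (crd w) y" for w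
    unfolding A.dpoly_def A.polyop_diff A.polyop_smult A.polyop_1 pp
    by (simp add: dop_def crd_Aop add.commute)
  then have "crd (polyop Aop (A.dpoly \<theta>) ?u) y = dop \<Delta> \<theta> G (ent \<Delta> \<theta> G n x) y" by (simp add: u)
  then show ?case by (simp add: A.polyop_mult ent_def)
qed

lemma pk_proj: "pk \<Delta> \<theta> G x y = crd (proj \<theta> x) y"
  unfolding pk_def crd_polyop_ent[symmetric]
  by (rule limI) (rule bounded_linear.tendsto[OF bounded_linear_crd proj_lim])

end

context tree_eig
begin

lemma Sg_iff: "x \<in> V \<Longrightarrow> Sg \<Delta> \<theta> G x \<longleftrightarrow> x \<in> S"
  by (simp add: Sg_def S_def pk_proj)

lemma dSg_iff: "y \<in> V \<Longrightarrow> dSg \<Delta> \<theta> G y \<longleftrightarrow> y \<in> dS"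
  using nb_verts by (auto simp: dSg_def dS_def Sg_iff nb_adjacent)

lemma Cg_eq: "x \<in> V \<Longrightarrow> Cg \<Delta> \<theta> G x = Cc x"
proof -
  have "(\<lambda>u w. adjacent G u w \<and> Sg \<Delta> \<theta> G w) = (\<lambda>u w. w \<in> nb u \<and> w \<in> S)"
    using adjacent_verts(2)[OF graph] by (auto simp: fun_eq_iff Sg_iff nb_adjacent)
  then show ?thesis by (simp add: Cg_def Cc_def)
qed

lemma eg_eq:
  assumes "x \<in> S" "y \<in> nb x"
  shows "eg \<Delta> \<theta> G x y = ennreal (ee x y)"
proof -
  have "(\<integral>\<^sup>+w. (if w \<in> B x y then ennreal ((pk \<Delta> \<theta> G x w)\<^sup>2) else 0) \<partial>count_space V) =
    (\<Sum>w. ennreal (if w \<in> B x y then (p x w)\<^sup>2 else 0))"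
    using B_verts[OF assms(2)] unfolding pk_proj
    by (auto simp: nn_integral_count_space_indicator nn_integral_count_space_nat indicator_def
        intro!: suminf_cong)
  also have "\<dots> = ennreal (en (B x y) (P x))"
    unfolding en_suminf by (rule suminf_ennreal_eq[OF _ summable_sums[OF summable_en]]) simp
  finally show ?thesis using S_pos[OF assms(1)]
    by (simp add: eg_def pk_proj ee_def divide_ennreal)
qed

end

subsection \<open>Supremal weights of finite connected sets\<close>

text \<open>\<open>gain n x y\<close> is the largest weight of a connected set containing \<open>x\<close>, avoiding the neighbour
  \<open>y\<close>, inside \<open>H\<close> and of depth at most \<open>n\<close>; the empty set is allowed.\<close>

primrec gain :: "nat graph \<Rightarrow> nat set \<Rightarrow> (nat \<Rightarrow> real) \<Rightarrow> nat \<Rightarrow> nat \<Rightarrow> nat \<Rightarrow> real" where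
  "gain G H f 0 x y = 0"
| "gain G H f (Suc n) x y = max 0 (f x + (\<Sum>z\<in>neighbours G x. if z \<in> H \<and> z \<noteq> y then gain G H f n z x else 0))"

definition gainl :: "nat graph \<Rightarrow> nat set \<Rightarrow> (nat \<Rightarrow> real) \<Rightarrow> nat \<Rightarrow> nat \<Rightarrow> real" where
  "gainl G H f x y = lim (\<lambda>n. gain G H f n x y)"

text \<open>On a tree, the supremal weight of the finite connected sets through \<open>x\<close>
  whose other vertices lie in \<open>H\<close>. As \<open>x\<close> is compulsory, the value can be
  negative.\<close>

definition total_gain :: "nat graph \<Rightarrow> nat set \<Rightarrow> (nat \<Rightarrow> real) \<Rightarrow> nat \<Rightarrow> real" where
  "total_gain G H f x = f x + (\<Sum>z\<in>neighbours G x. if z \<in> H then gainl G H f z x else 0)"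

lemma gain_nonneg: "0 \<le> gain G H f n x y"
  by (cases n) auto

lemma gain_mono: "gain G H f n x y \<le> gain G H f (Suc n) x y"
proof (induction n arbitrary: x y)
  case 0
  then show ?case by simp
next
  case (Suc n)
  have "(\<Sum>z\<in>neighbours G x. if z \<in> H \<and> z \<noteq> y then gain G H f n z x else 0) \<le>
      (\<Sum>z\<in>neighbours G x. if z \<in> H \<and> z \<noteq> y then gain G H f (Suc n) z x else 0)"
    by (rule sum_mono) (use Suc.IH in \<open>auto simp del: gain.simps\<close>)
  then show ?case unfolding gain.simps(2)[of G H f "Suc n"] gain.simps(2)[of G H f n x y] by linarith
qed

section \<open>Rooted connected sets and the weights allowed by anchored expansion\<close>

definition rconn :: "nat graph \<Rightarrow> nat \<Rightarrow> nat set \<Rightarrow> bool" where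
  "rconn G x W \<longleftrightarrow> x \<in> W \<and> (\<forall>w\<in>W. (\<lambda>u v. adjacent G u v \<and> v \<in> W)\<^sup>*\<^sup>* x w)"

lemma reach_mono: "W \<subseteq> W' \<Longrightarrow> (\<lambda>u v. adjacent G u v \<and> v \<in> W)\<^sup>*\<^sup>* x w \<Longrightarrow> (\<lambda>u v. adjacent G u v \<and> v \<in> W')\<^sup>*\<^sup>* x w"
  by (erule rtranclp_mono[THEN predicate2D, rotated]) auto

lemma rconn_union:
  assumes "rconn G o' Q" "x \<in> Q" "rconn G x W"
  shows "rconn G o' (W \<union> Q)"
  unfolding rconn_def
proof (intro conjI ballI)
  show "o' \<in> W \<union> Q" using assms by (simp add: rconn_def)
  fix w assume "w \<in> W \<union> Q"
  then show "(\<lambda>u v. adjacent G u v \<and> v \<in> W \<union> Q)\<^sup>*\<^sup>* o' w"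
  proof
    assume "w \<in> Q"
    then show ?thesis using assms(1) reach_mono[of Q "W \<union> Q"] by (auto simp: rconn_def)
  next
    assume "w \<in> W"
    then have "(\<lambda>u v. adjacent G u v \<and> v \<in> W \<union> Q)\<^sup>*\<^sup>* x w"
      using assms(3) reach_mono[of W "W \<union> Q"] by (auto simp: rconn_def)
    moreover have "(\<lambda>u v. adjacent G u v \<and> v \<in> W \<union> Q)\<^sup>*\<^sup>* o' x"
      using assms(1,2) reach_mono[of Q "W \<union> Q"] by (auto simp: rconn_def)
    ultimately show ?thesis by (rule rtranclp_trans[rotated])
  qed
qed

lemma rconn_connected:
  assumes "rconn G x W" "W \<subseteq> verts G"
  shows "graph_connected (induced G W)"
proof -
  have adj: "adjacent (induced G W) u v \<longleftrightarrow> adjacent G u v \<and> u \<in> W \<and> v \<in> W" for u v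
    by (auto simp: adjacent_def induced_def)
  have reach: "(adjacent (induced G W))\<^sup>*\<^sup>* x w" if "w \<in> W" for w
  proof -
    have "(\<lambda>u v. adjacent G u v \<and> v \<in> W)\<^sup>*\<^sup>* x w" using assms that by (simp add: rconn_def)
    then have "w \<in> W \<and> (adjacent (induced G W))\<^sup>*\<^sup>* x w"
    proof (induction rule: rtranclp_induct)
      case base
      then show ?case using assms by (simp add: rconn_def)
    next
      case (step u v)
      then show ?case using adj by (auto intro: rtranclp.rtrancl_into_rtrancl)
    qed
    then show ?thesis ..
  qed
  have "symp (adjacent (induced G W))" by (auto simp: symp_def adjacent_commute)
  then have "(adjacent (induced G W))\<^sup>*\<^sup>* u v" if "u \<in> W" "v \<in> W" for u v
    using reach[OF that(1)] reach[OF that(2)] by (meson rtranclp_trans symp_rtranclp sympD)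
  moreover have "verts (induced G W) = W" using assms(2) by (auto simp: induced_def)
  moreover have "W \<noteq> {}" using assms(1) by (auto simp: rconn_def)
  ultimately show ?thesis by (simp add: graph_connected_def)
qed

context bdd_graph
begin

text \<open>A connected set spans at least |W| - 1 edges, each counted from both ends. The set is
  built up from \<open>x\<close>: a new vertex \<open>v\<close> raises the internal degree of some
  earlier \<open>u\<close> by 1 and has internal degree at least 1 itself.\<close>

lemma internal_degrees:
  assumes W: "finite W" "rconn G x W"
  shows "2 * (real (card W) - 1) \<le> (\<Sum>w\<in>W. real (card (nb w \<inter> W)))"
proof -
  define Q where "Q U \<longleftrightarrow> 2 * (real (card U) - 1) \<le> (\<Sum>w\<in>U. real (card (nb w \<inter> U)))" for U
  have "Q W" if "x \<in> U" "U \<subseteq> W" "Q U" for U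
    using that
  proof (induction "card (W - U)" arbitrary: U)
    case 0
    then have "U = W" using W(1) by auto
    then show ?case using 0 by simp
  next
    case (Suc m)
    have fU: "finite U" using Suc.prems W finite_subset by blast
    obtain w where w: "w \<in> W" "w \<notin> U" using Suc.hyps(2) by (metis Diff_iff card.empty equals0I nat.distinct(1))
    have "(\<lambda>u v. adjacent G u v \<and> v \<in> W)\<^sup>*\<^sup>* x w" using W(2) w by (simp add: rconn_def)
    then have "w \<in> U \<or> (\<exists>u\<in>U. \<exists>v\<in>W - U. adjacent G u v)"
      by (induction rule: rtranclp_induct) (use Suc.prems in auto)
    then obtain u v where uv: "u \<in> U" "v \<in> W" "v \<notin> U" "adjacent G u v" using w by blast
    have sub: "nb w \<inter> U \<subseteq> nb w \<inter> insert v U" for w by auto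
    have "(\<Sum>w\<in>U. real (card (nb w \<inter> U))) + 1 \<le> (\<Sum>w\<in>U. real (card (nb w \<inter> insert v U)))"
    proof -
      have "(\<Sum>w\<in>U. real (card (nb w \<inter> U)) + (if w = u then 1 else 0)) \<le> (\<Sum>w\<in>U. real (card (nb w \<inter> insert v U)))"
      proof (rule sum_mono)
        fix w
        show "real (card (nb w \<inter> U)) + (if w = u then 1 else 0) \<le> real (card (nb w \<inter> insert v U))"
        proof (cases "w = u")
          case True
          have "v \<in> nb u" using uv by (simp add: neighbours_def)
          then have "nb u \<inter> insert v U = insert v (nb u \<inter> U)" by auto
          then show ?thesis using True uv by simp
        next
          case False
          then show ?thesis using card_mono[OF _ sub[of w]] by simp
        qed
      qed
      then show ?thesis using fU uv by (simp add: sum.distrib)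
    qed
    moreover have "1 \<le> real (card (nb v \<inter> insert v U))"
    proof -
      have "u \<in> nb v \<inter> insert v U" using uv by (simp add: neighbours_def adjacent_commute)
      then have "card (nb v \<inter> insert v U) \<noteq> 0" by auto
      then show ?thesis by linarith
    qed
    ultimately have "Q (insert v U)" using Suc.prems(3) fU uv by (simp add: Q_def)
    moreover have "m = card (W - insert v U)"
    proof -
      have "W - insert v U = (W - U) - {v}" by auto
      then show ?thesis using Suc.hyps(2) uv W(1) by simp
    qed
    ultimately show ?case using Suc.hyps(1)[of "insert v U"] Suc.prems uv by auto
  qed
  from this[of "{x}"] show ?thesis using W(2) by (simp add: Q_def rconn_def)
qed

text \<open>Every boundary vertex ends an edge that leaves \<open>W\<close>, and the number of such
  edges is the sum of the degrees minus that of the internal degrees.\<close>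

lemma boundary_bound:
  assumes W: "finite W" "rconn G x W"
  shows "real (card (vertex_boundary G W)) \<le> (\<Sum>w\<in>W. real (card (nb w)) - 2) + 2"
proof -
  have "vertex_boundary G W \<subseteq> (\<Union>w\<in>W. nb w - W)"
    by (auto simp: vertex_boundary_def neighbours_def)
  then have "card (vertex_boundary G W) \<le> card (\<Union>w\<in>W. nb w - W)"
    using W(1) by (intro card_mono) auto
  also have "\<dots> \<le> (\<Sum>w\<in>W. card (nb w - W))" by (rule card_UN_le[OF W(1)])
  finally have "real (card (vertex_boundary G W)) \<le> (\<Sum>w\<in>W. real (card (nb w - W)))"
    by (metis of_nat_mono of_nat_sum)
  also have "\<dots> = (\<Sum>w\<in>W. real (card (nb w)) - real (card (nb w \<inter> W)))"
  proof (rule sum.cong)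
    fix w
    have "card (nb w \<inter> W) + card (nb w - W) = card (nb w)"
      by (subst card_Un_disjoint[symmetric]) (auto simp: Int_Diff_Un)
    then show "real (card (nb w - W)) = real (card (nb w)) - real (card (nb w \<inter> W))" by linarith
  qed simp
  finally show ?thesis using internal_degrees[OF W] by (simp add: sum_subtractf)
qed

text \<open>Expansion is known only for large sets through \<open>o'\<close>. A set through
  \<open>x\<close> is joined to \<open>o'\<close> by a fixed path \<open>Q\<close>, at a cost that
  depends on \<open>x\<close>; for a large joined set, expansion and \<open>boundary_bound\<close>
  then limit the weight to 2.\<close>

lemma anchored_bound:
  assumes oV: "o' \<in> V" and conn: "graph_connected G" and iso: "ereal i \<le> anchored_isoperimetric G o'"
    and c: "0 < c" "c < i" and x: "x \<in> V"
  shows "\<exists>K\<ge>0. \<forall>W. finite W \<longrightarrow> W \<subseteq> V \<longrightarrow> rconn G x W \<longrightarrow> (\<Sum>w\<in>W. c + 2 - real (card (nb w))) \<le> K"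
proof -
  let ?A = "\<lambda>n. {S. o' \<in> S \<and> S \<subseteq> V \<and> graph_connected (induced G S) \<and> finite S \<and> n \<le> card S}"
  let ?q = "\<lambda>S. ereal (real (card (vertex_boundary G S)) / real (card S))"
  have inc: "incseq (\<lambda>n. INF S\<in>?A n. ?q S)"
    unfolding incseq_def by (intro allI impI INF_superset_mono) auto
  \<comment> \<open>The infima increase with \<open>n\<close>, so the limit in the definition is
    their supremum, and one of them already exceeds \<open>c\<close>.\<close>
  have "anchored_isoperimetric G o' = (SUP n. INF S\<in>?A n. ?q S)"
    unfolding anchored_isoperimetric_def by (rule limI[OF LIMSEQ_SUP[OF inc]])
  then have "ereal i \<le> (SUP n. INF S\<in>?A n. ?q S)" using iso by simp
  moreover have "ereal c < ereal i" using c by simp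
  ultimately have "ereal c < (SUP n. INF S\<in>?A n. ?q S)" by (rule order_less_le_trans[rotated])
  then obtain n where n: "ereal c < (INF S\<in>?A n. ?q S)" by (auto simp: less_SUP_iff)
  have big: "c * real (card S) \<le> real (card (vertex_boundary G S))" if "S \<in> ?A n" for S
  proof -
    have "ereal c < ?q S" using n INF_lower[OF that, of ?q] by (rule order_less_le_trans)
    moreover have "real (card S) > 0" using that by (auto simp: card_gt_0_iff)
    ultimately show ?thesis by (simp add: field_simps)
  qed
  have "(adjacent G)\<^sup>*\<^sup>* o' x" using conn oV x by (simp add: graph_connected_def)
  from rtranclp_distinct_path[OF this] obtain xs where
    xs: "xs \<noteq> []" "hd xs = o'" "last xs = x" "successively (adjacent G) xs" by blast
  define Q where "Q = set xs"
  have reach: "(\<lambda>u v. adjacent G u v \<and> v \<in> set xs)\<^sup>*\<^sup>* (hd xs) w"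
    if "successively (adjacent G) xs" "w \<in> set xs" for xs :: "nat list" and w
    using that
  proof (induction xs)
    case (Cons a xs)
    show ?case
    proof (cases "w = a")
      case False
      then have w: "w \<in> set xs" using Cons.prems by simp
      then have ne: "xs \<noteq> []" by auto
      have "(\<lambda>u v. adjacent G u v \<and> v \<in> set xs)\<^sup>*\<^sup>* (hd xs) w"
        using Cons w ne by (auto simp: successively_Cons)
      then have "(\<lambda>u v. adjacent G u v \<and> v \<in> set (a # xs))\<^sup>*\<^sup>* (hd xs) w"
        by (rule reach_mono[rotated]) auto
      moreover have "adjacent G a (hd xs) \<and> hd xs \<in> set (a # xs)"
        using Cons.prems ne by (auto simp: successively_Cons)
      ultimately show ?thesis by (auto intro: converse_rtranclp_into_rtranclp)
    qed simp
  qed simp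
  have Q: "rconn G o' Q" using reach[OF xs(4)] xs by (auto simp: rconn_def Q_def intro: hd_in_set)
  have xQ: "x \<in> Q" using xs by (auto simp: Q_def intro: last_in_set)
  have QV: "Q \<subseteq> V"
  proof
    fix w assume "w \<in> Q"
    then have "(\<lambda>u v. adjacent G u v \<and> v \<in> Q)\<^sup>*\<^sup>* o' w" using Q by (simp add: rconn_def)
    then show "w \<in> V" by (induction rule: rtranclp_induct) (use oV adjacent_verts(2)[OF graph] in auto)
  qed
  \<comment> \<open>The terms bound the weight of a joined set with at least \<open>n\<close>
    vertices, the weight of one with fewer, and the weight that the path can take away.\<close>
  define K where "K = 2 + (c + 2) * real n + real \<Delta> * real (card Q)"
  have "(\<Sum>w\<in>W. c + 2 - real (card (nb w))) \<le> K" if W: "finite W" "W \<subseteq> V" "rconn G x W" for W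
  proof -
    define W' where "W' = W \<union> Q"
    have rc: "rconn G o' W'" unfolding W'_def by (rule rconn_union[OF Q xQ W(3)])
    have fW': "finite W'" "W' \<subseteq> V" using W QV by (auto simp: W'_def Q_def)
    have "(\<Sum>w\<in>W'. c + 2 - real (card (nb w))) \<le> 2 + (c + 2) * real n"
    proof (cases "n \<le> card W'")
      case True
      then have "W' \<in> ?A n" using rc fW' rconn_connected[OF rc fW'(2)] by (auto simp: rconn_def)
      then have "c * real (card W') \<le> (\<Sum>w\<in>W'. real (card (nb w)) - 2) + 2"
        using big boundary_bound[OF fW'(1) rc] by fastforce
      moreover have "(\<Sum>w\<in>W'. c + 2 - real (card (nb w))) = c * real (card W') - (\<Sum>w\<in>W'. real (card (nb w)) - 2)"
        by (simp add: sum_subtractf sum.distrib algebra_simps)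
      moreover have "0 \<le> (c + 2) * real n" using c by simp
      ultimately show ?thesis by linarith
    next
      case False
      have "(\<Sum>w\<in>W'. c + 2 - real (card (nb w))) \<le> (\<Sum>w\<in>W'. c + 2)" by (rule sum_mono) simp
      also have "\<dots> = (c + 2) * real (card W')" by simp
      also have "\<dots> \<le> (c + 2) * real n" using False c by (intro mult_left_mono) auto
      finally show ?thesis by simp
    qed
    moreover have "(\<Sum>w\<in>W'. c + 2 - real (card (nb w))) =
        (\<Sum>w\<in>W. c + 2 - real (card (nb w))) + (\<Sum>w\<in>Q - W. c + 2 - real (card (nb w)))"
      using W(1) by (subst sum.union_disjoint[symmetric]) (auto simp: W'_def Q_def intro: sum.cong)
    moreover have "- real \<Delta> * real (card Q) \<le> (\<Sum>w\<in>Q - W. c + 2 - real (card (nb w)))"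
    proof -
      have "- real \<Delta> * real (card Q) \<le> - real \<Delta> * real (card (Q - W))"
        using card_mono[of Q "Q - W"] by (auto simp: Q_def intro!: mult_left_mono)
      also have "\<dots> = (\<Sum>w\<in>Q - W. - real \<Delta>)" by simp
      also have "\<dots> \<le> (\<Sum>w\<in>Q - W. c + 2 - real (card (nb w)))"
      proof (rule sum_mono)
        fix w show "- real \<Delta> \<le> c + 2 - real (card (nb w))" using card_nb_le[of w] c by linarith
      qed
      finally show ?thesis .
    qed
    ultimately show ?thesis by (simp add: K_def)
  qed
  moreover have "K \<ge> 0" using c by (simp add: K_def)
  ultimately show ?thesis by blast
qed

end

context tree_graph
begin

text \<open>The branches at distinct neighbours are disjoint, so the recursive sum in
  \<open>gain\<close> is the weight of an actual connected set. Bounds on weights thereby become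
  bounds on gains.\<close>

lemma gain_attained:
  assumes "y \<in> nb x"
  shows "gain G H f n x y = 0 \<or>
    (\<exists>W. finite W \<and> W \<subseteq> B y x \<and> rconn G x W \<and> gain G H f n x y = (\<Sum>w\<in>W. f w))"
  using assms
proof (induction n arbitrary: x y)
  case 0
  then show ?case by simp
next
  case (Suc n)
  define Z where "Z = {z \<in> nb x. z \<in> H \<and> z \<noteq> y \<and> gain G H f n z x \<noteq> 0}"
  have fZ: "finite Z" by (simp add: Z_def)
  have "\<exists>W. finite W \<and> W \<subseteq> B x z \<and> rconn G z W \<and> gain G H f n z x = (\<Sum>w\<in>W. f w)" if "z \<in> Z" for z
    using Suc.IH[of x z] that nb_sym by (auto simp: Z_def)
  then obtain W where W: "\<And>z. z \<in> Z \<Longrightarrow> finite (W z) \<and> W z \<subseteq> B x z \<and> rconn G z (W z) \<and> gain G H f n z x = (\<Sum>w\<in>W z. f w)"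
    by metis
  define U where "U = insert x (\<Union>z\<in>Z. W z)"
  have xU: "x \<notin> (\<Union>z\<in>Z. W z)" using W B_not_root by blast
  have fU: "finite (\<Union>z\<in>Z. W z)" using fZ W by auto
  have "(\<Sum>w\<in>(\<Union>z\<in>Z. W z). f w) = (\<Sum>z\<in>Z. \<Sum>w\<in>W z. f w)"
  proof (rule sum.UNION_disjoint[OF fZ])
    show "\<forall>i\<in>Z. \<forall>j\<in>Z. i \<noteq> j \<longrightarrow> W i \<inter> W j = {}"
    proof (intro ballI impI)
      fix i j assume ij: "i \<in> Z" "j \<in> Z" "i \<noteq> j"
      then have "i \<in> nb x" "j \<in> nb x" by (auto simp: Z_def)
      then show "W i \<inter> W j = {}" using B_unique W[OF ij(1)] W[OF ij(2)] ij(3) by blast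
    qed
  qed (use W in blast)
  also have "\<dots> = (\<Sum>z\<in>Z. gain G H f n z x)" using W by (intro sum.cong) auto
  also have "\<dots> = (\<Sum>z\<in>nb x. if z \<in> H \<and> z \<noteq> y then gain G H f n z x else 0)"
    unfolding Z_def by (intro sum.mono_neutral_cong_left) auto
  finally have sumU: "(\<Sum>w\<in>U. f w) = f x + (\<Sum>z\<in>nb x. if z \<in> H \<and> z \<noteq> y then gain G H f n z x else 0)"
    using xU fU by (simp add: U_def)
  have "U \<subseteq> B y x"
  proof -
    have "x \<in> B y x" using B_self Suc.prems nb_irrefl by metis
    moreover have "B x z \<subseteq> B y x" if "z \<in> Z" for z
      using that Suc.prems by (intro B_child) (auto simp: Z_def nb_sym)
    ultimately show ?thesis using W unfolding U_def by blast
  qed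
  moreover have "rconn G x U"
    unfolding rconn_def
  proof (intro conjI ballI)
    show "x \<in> U" by (simp add: U_def)
    fix w assume "w \<in> U"
    then consider "w = x" | z where "z \<in> Z" "w \<in> W z" by (auto simp: U_def)
    then show "(\<lambda>u v. adjacent G u v \<and> v \<in> U)\<^sup>*\<^sup>* x w"
    proof cases
      case 2
      have "(\<lambda>u v. adjacent G u v \<and> v \<in> W z)\<^sup>*\<^sup>* z w" using W[OF 2(1)] 2(2) by (simp add: rconn_def)
      then have "(\<lambda>u v. adjacent G u v \<and> v \<in> U)\<^sup>*\<^sup>* z w"
        by (rule reach_mono[rotated]) (use 2 in \<open>auto simp: U_def\<close>)
      moreover have "adjacent G x z \<and> z \<in> U"
        using 2 W[OF 2(1)] by (auto simp: Z_def nb_adjacent U_def rconn_def)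
      ultimately show ?thesis by (auto intro: converse_rtranclp_into_rtranclp)
    qed simp
  qed
  moreover have "finite U" using fU by (simp add: U_def)
  moreover have "gain G H f (Suc n) x y = 0 \<or> gain G H f (Suc n) x y = (\<Sum>w\<in>U. f w)"
    unfolding gain.simps(2) sumU[symmetric] by (simp only: max_def split: if_splits) simp
  ultimately show ?case by blast
qed

text \<open>The limiting gain from \<open>x\<close> to \<open>y\<close> is read as mass sent along
  that edge, provided both ends have total gain at most \<open>T\<close>. On such an edge the two
  gains add up to at least the total gain of \<open>x\<close>; summed over two or more neighbours,
  this beats twice the equation that defines the total gain.\<close>

lemma gain_flow_bound:
  assumes bdd: "\<And>x. x \<in> V \<Longrightarrow> \<exists>K\<ge>0. \<forall>W. finite W \<longrightarrow> W \<subseteq> V \<longrightarrow> rconn G x W \<longrightarrow> (\<Sum>w\<in>W. f w) \<le> K"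
    and x: "x \<in> H" and two: "card (nb x \<inter> H) \<ge> 2" and T: "total_gain G H f x \<le> T"
  shows "f x \<le> ((\<Sum>z\<in>nb x. if z \<in> H \<and> total_gain G H f z \<le> T then gainl G H f x z else 0)
      - (\<Sum>z\<in>nb x. if z \<in> H \<and> total_gain G H f z \<le> T then gainl G H f z x else 0)) / 2" (is ?flow)
    "(\<Sum>z\<in>nb x. if z \<in> H \<and> total_gain G H f z \<le> T then gainl G H f z x else 0) \<le> T - f x" (is ?int)
    "\<And>x y. y \<in> nb x \<Longrightarrow> 0 \<le> gainl G H f x y"
proof -
  let ?g = "gain G H f" and ?l = "gainl G H f" and ?t = "total_gain G H f"
  have conv: "(\<lambda>n. ?g n x y) \<longlonglongrightarrow> ?l x y" if y: "y \<in> nb x" for x y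
  proof -
    have xV: "x \<in> V" using y nb_verts by blast
    obtain K where K: "K \<ge> 0" "\<And>W. finite W \<Longrightarrow> W \<subseteq> V \<Longrightarrow> rconn G x W \<Longrightarrow> (\<Sum>w\<in>W. f w) \<le> K"
      using bdd[OF xV] by blast
    have le: "?g n x y \<le> K" for n
      using gain_attained[OF y, of H f n]
    proof (elim disjE exE conjE)
      fix W assume W: "finite W" "W \<subseteq> B y x" "rconn G x W" "?g n x y = (\<Sum>w\<in>W. f w)"
      have "W \<subseteq> V" using W(2) B_verts[of x y] y nb_sym by blast
      then show ?thesis using K(2) W by simp
    qed (use K in simp)
    have inc: "incseq (\<lambda>n. ?g n x y)" by (rule incseq_SucI) (rule gain_mono)
    obtain L where "(\<lambda>n. ?g n x y) \<longlonglongrightarrow> L"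
      by (rule incseq_convergent[OF inc]) (use le in auto)
    then have "convergent (\<lambda>n. ?g n x y)" by (rule convergentI)
    then show ?thesis unfolding gainl_def by (simp add: convergent_LIMSEQ_iff)
  qed
  show nonneg: "0 \<le> ?l x y" if "y \<in> nb x" for x y
    by (rule LIMSEQ_le_const[OF conv[OF that]]) (simp add: gain_nonneg)
  have fix0: "?l x y = max 0 (f x + (\<Sum>z\<in>nb x. if z \<in> H \<and> z \<noteq> y then ?l z x else 0))" if y: "y \<in> nb x" for x y
  proof (rule LIMSEQ_unique)
    show "(\<lambda>n. ?g (Suc n) x y) \<longlonglongrightarrow> ?l x y" by (rule LIMSEQ_Suc[OF conv[OF y]])
    have "(\<lambda>n. if z \<in> H \<and> z \<noteq> y then ?g n z x else 0) \<longlonglongrightarrow> (if z \<in> H \<and> z \<noteq> y then ?l z x else 0)"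
      if "z \<in> nb x" for z using conv[of x z] that nb_sym by auto
    then have "(\<lambda>n. max 0 (f x + (\<Sum>z\<in>nb x. if z \<in> H \<and> z \<noteq> y then ?g n z x else 0)))
      \<longlonglongrightarrow> max 0 (f x + (\<Sum>z\<in>nb x. if z \<in> H \<and> z \<noteq> y then ?l z x else 0))"
      by (intro tendsto_intros)
    then show "(\<lambda>n. ?g (Suc n) x y) \<longlonglongrightarrow> max 0 (f x + (\<Sum>z\<in>nb x. if z \<in> H \<and> z \<noteq> y then ?l z x else 0))"
      by simp
  qed
  \<comment> \<open>Avoiding \<open>y\<close> removes exactly the contribution of \<open>y\<close>
    from the total gain of \<open>x\<close>; the empty set contributes the cut-off at 0.\<close>
  have fixp: "?l x y = max 0 (?t x - ?l y x)" if y: "y \<in> nb x" "y \<in> H" for x y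
  proof -
    have "(\<Sum>z\<in>nb x. if z \<in> H then ?l z x else 0) = ?l y x + (\<Sum>z\<in>nb x - {y}. if z \<in> H then ?l z x else 0)"
      using y by (subst sum.remove[of _ y]) auto
    also have "(\<Sum>z\<in>nb x - {y}. if z \<in> H then ?l z x else 0) = (\<Sum>z\<in>nb x. if z \<in> H \<and> z \<noteq> y then ?l z x else 0)"
      by (rule sum.mono_neutral_cong_left) auto
    finally show ?thesis unfolding fix0[OF y(1)] total_gain_def by simp
  qed
  define N1 where "N1 = {z \<in> nb x \<inter> H. ?t z \<le> T}"
  define N2 where "N2 = {z \<in> nb x \<inter> H. \<not> ?t z \<le> T}"
  define gp where "gp = max 0 (?t x)"
  have N: "nb x \<inter> H = N1 \<union> N2" "N1 \<inter> N2 = {}" "finite N1" "finite N2" by (auto simp: N1_def N2_def)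
  have "card N1 + card N2 \<ge> 2" using two unfolding N(1) using card_Un_disjoint[OF N(3,4,2)] by simp
  then have two': "2 \<le> real (card N1) + real (card N2)" by linarith
  have s1: "(\<Sum>z\<in>nb x. if z \<in> H \<and> ?t z \<le> T then h z else 0) = (\<Sum>z\<in>N1. h z)" for h :: "nat \<Rightarrow> real"
    by (rule sum.mono_neutral_cong_right) (auto simp: N1_def)
  have tot: "?t x = f x + (\<Sum>z\<in>N1. ?l z x) + (\<Sum>z\<in>N2. ?l z x)"
  proof -
    have "(\<Sum>z\<in>nb x. if z \<in> H then ?l z x else 0) = (\<Sum>z\<in>nb x \<inter> H. ?l z x)"
      by (simp add: sum.inter_restrict)
    then show ?thesis unfolding total_gain_def N(1) using sum.union_disjoint[OF N(3,4,2)] by simp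
  qed
  have l1: "gp \<le> ?l x z + ?l z x" if "z \<in> N1" for z
  proof -
    have z: "z \<in> nb x" "z \<in> H" "x \<in> nb z" using that nb_sym by (auto simp: N1_def)
    have "?t x - ?l z x \<le> ?l x z" unfolding fixp[OF z(1,2)] by (rule max.cobounded2)
    then show ?thesis using nonneg[OF z(1)] nonneg[OF z(3)] by (simp add: gp_def)
  qed
  \<comment> \<open>If mass went from \<open>x\<close> to \<open>z\<close>, the two fixed-point
    equations would give a total gain of \<open>z\<close> not above that of \<open>x\<close>.
    Nothing flows towards a larger total gain, so the truncation at \<open>T\<close> removes only
    inflow.\<close>
  have l2: "gp \<le> ?l z x" if z: "z \<in> N2" for z
  proof -
    have zx: "z \<in> nb x" "z \<in> H" "x \<in> nb z" "?t z > T" using z nb_sym by (auto simp: N2_def)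
    have 1: "?t z - ?l x z \<le> ?l z x" unfolding fixp[OF zx(3) x] by (rule max.cobounded2)
    have 2: "?l x z = 0 \<or> ?l x z = ?t x - ?l z x" unfolding fixp[OF zx(1,2)] by (simp add: max_def)
    have "?l x z = 0" using 1 2 T zx(4) by linarith
    then show ?thesis using 1 T zx(4) nonneg[OF zx(3)] by (simp add: gp_def)
  qed
  have gp: "0 \<le> gp" "?t x \<le> gp" by (auto simp: gp_def)
  have a1: "real (card N1) * gp \<le> (\<Sum>z\<in>N1. ?l x z) + (\<Sum>z\<in>N1. ?l z x)"
    using sum_mono[of N1 "\<lambda>_. gp" "\<lambda>z. ?l x z + ?l z x"] l1 by (simp add: sum.distrib)
  have a2: "real (card N2) * gp \<le> (\<Sum>z\<in>N2. ?l z x)"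
    using sum_mono[of N2 "\<lambda>_. gp" "\<lambda>z. ?l z x"] l2 by simp
  \<comment> \<open>Two neighbours in \<open>H\<close> are used here: adding \<open>gp\<close> once
    per neighbour yields at least \<open>2 * gp\<close>, which dominates twice the total gain of
    \<open>x\<close>.\<close>
  have a3: "2 * gp \<le> real (card N1) * gp + real (card N2) * gp"
    using mult_right_mono[OF two' gp(1)] by (simp add: distrib_right)
  have a4: "0 \<le> real (card N2) * gp" using gp by simp
  have "2 * f x \<le> (\<Sum>z\<in>N1. ?l x z) - (\<Sum>z\<in>N1. ?l z x)" using a1 a2 a3 a4 tot gp by linarith
  then show ?flow unfolding s1 by simp
  have "0 \<le> (\<Sum>z\<in>N2. ?l z x)" using a2 a4 by linarith
  then show ?int unfolding s1 using tot T by linarith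
qed

end

subsection \<open>Mass transport inequalities\<close>

text \<open>The total version of \<open>rho\<close>, taken in the form of \<open>rho_eq\<close>,
  where all terms are nonnegative and \<open>ennreal\<close> meets no subtraction.\<close>

definition rg :: "nat \<Rightarrow> real \<Rightarrow> nat graph \<Rightarrow> nat \<Rightarrow> ennreal" where
  "rg \<Delta> \<theta> G x = ennreal (pk \<Delta> \<theta> G x x) + (\<Sum>y\<in>neighbours G x. if Sg \<Delta> \<theta> G y then 0 else eg \<Delta> \<theta> G x y)"

definition Hg :: "nat \<Rightarrow> real \<Rightarrow> nat graph \<Rightarrow> nat set" where
  "Hg \<Delta> \<theta> G = {x. Sg \<Delta> \<theta> G x \<or> dSg \<Delta> \<theta> G x}"

text \<open>A nonpositive mean of this weight over \<open>S\<close> and its boundary is the degree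
  bound \<open>expansion_density\<close>.\<close>

definition wt :: "real \<Rightarrow> nat graph \<Rightarrow> nat \<Rightarrow> real" where
  "wt c G x = c + 2 - real (card (neighbours G x))"

lemma rg_meas:
  assumes "i < Suc k"
  shows "(\<lambda>\<omega>. rg \<Delta> \<theta> (fst \<omega>) (snd \<omega> ! i)) \<in> bmeas k"
proof -
  note [measurable] = pk_meas[OF assms assms, of \<Delta> \<theta>]
  have "(\<lambda>\<omega>. if Sg \<Delta> \<theta> (fst \<omega>) (snd \<omega> ! 0) then 0 else eg \<Delta> \<theta> (fst \<omega>) (snd \<omega> ! Suc i) (snd \<omega> ! 0)) \<in> bmeas (Suc k)"
  proof -
    have [measurable]: "bpred (Suc k) (\<lambda>\<omega>. Sg \<Delta> \<theta> (fst \<omega>) (snd \<omega> ! 0))"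
      "(\<lambda>\<omega>. eg \<Delta> \<theta> (fst \<omega>) (snd \<omega> ! Suc i) (snd \<omega> ! 0)) \<in> bmeas (Suc k)"
      using assms by (auto intro: Sg_meas eg_meas)
    show ?thesis by measurable
  qed
  note I = neighbour_sum_meas_ennreal[where F="\<lambda>G ys. if Sg \<Delta> \<theta> G (ys ! 0) then 0 else eg \<Delta> \<theta> G (ys ! Suc i) (ys ! 0)", OF this assms]
  have "(\<lambda>\<omega>. \<Sum>y\<in>neighbours (fst \<omega>) (snd \<omega> ! i). if Sg \<Delta> \<theta> (fst \<omega>) y then 0 else eg \<Delta> \<theta> (fst \<omega>) (snd \<omega> ! i) y) \<in> bmeas k"
    using I by (simp cong: if_cong)
  moreover have "(\<lambda>\<omega>. ennreal (pk \<Delta> \<theta> (fst \<omega>) (snd \<omega> ! i) (snd \<omega> ! i))) \<in> bmeas k" by measurable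
  ultimately show ?thesis unfolding rg_def by (intro borel_measurable_add)
qed

lemma Hg_meas: "i < Suc k \<Longrightarrow> bpred k (\<lambda>\<omega>. snd \<omega> ! i \<in> Hg \<Delta> \<theta> (fst \<omega>))"
  unfolding Hg_def mem_Collect_eq by (intro pred_intros_logic Sg_meas dSg_meas)

lemma card_neighbours_meas: "i < Suc k \<Longrightarrow> (\<lambda>\<omega>. real (card (neighbours (fst \<omega>) (snd \<omega> ! i)))) \<in> bmeas k"
  using neighbour_sum_meas[where F="\<lambda>G ys. 1" and k=k and j=i] by simp

lemma wt_meas: "i < Suc k \<Longrightarrow> (\<lambda>\<omega>. wt c (fst \<omega>) (snd \<omega> ! i)) \<in> bmeas k"
  unfolding wt_def by (intro borel_measurable_diff borel_measurable_const card_neighbours_meas)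

abbreviation gainH :: "nat \<Rightarrow> real \<Rightarrow> real \<Rightarrow> nat graph \<Rightarrow> nat \<Rightarrow> nat \<Rightarrow> nat \<Rightarrow> real" where
  "gainH \<Delta> \<theta> c G \<equiv> gain G (Hg \<Delta> \<theta> G) (wt c G)"

lemma gain_meas:
  assumes "i < Suc k" "j < Suc k"
  shows "(\<lambda>\<omega>. gainH \<Delta> \<theta> c (fst \<omega>) n (snd \<omega> ! i) (snd \<omega> ! j)) \<in> bmeas k"
  using assms
proof (induction n arbitrary: k i j)
  case 0
  then show ?case by simp
next
  case (Suc n)
  define F where "F G ys = (if ys ! 0 \<in> Hg \<Delta> \<theta> G \<and> ys ! 0 \<noteq> ys ! Suc j then gainH \<Delta> \<theta> c G n (ys ! 0) (ys ! Suc i) else 0)" for G ys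
  have "(\<lambda>\<omega>. F (fst \<omega>) (snd \<omega>)) \<in> bmeas (Suc k)"
  proof -
    have [measurable]: "bpred (Suc k) (\<lambda>\<omega>. snd \<omega> ! 0 \<in> Hg \<Delta> \<theta> (fst \<omega>))"
      "bpred (Suc k) (\<lambda>\<omega>. snd \<omega> ! 0 = snd \<omega> ! Suc j)"
      "(\<lambda>\<omega>. gainH \<Delta> \<theta> c (fst \<omega>) n (snd \<omega> ! 0) (snd \<omega> ! Suc i)) \<in> bmeas (Suc k)"
      using Suc by (auto intro: Hg_meas eq_meas)
    show ?thesis unfolding F_def by measurable
  qed
  from neighbour_sum_meas[OF this Suc.prems(1)]
  have "(\<lambda>\<omega>. \<Sum>z\<in>neighbours (fst \<omega>) (snd \<omega> ! i). if z \<in> Hg \<Delta> \<theta> (fst \<omega>) \<and> z \<noteq> snd \<omega> ! j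
      then gainH \<Delta> \<theta> c (fst \<omega>) n z (snd \<omega> ! i) else 0) \<in> bmeas k"
    by (simp add: F_def cong: if_cong)
  then show ?case unfolding gain.simps
    by (intro borel_measurable_max borel_measurable_add borel_measurable_const wt_meas Suc.prems)
qed

lemma gainl_meas:
  assumes "i < Suc k" "j < Suc k"
  shows "(\<lambda>\<omega>. gainl (fst \<omega>) (Hg \<Delta> \<theta> (fst \<omega>)) (wt c (fst \<omega>)) (snd \<omega> ! i) (snd \<omega> ! j)) \<in> bmeas k"
  unfolding gainl_def by (intro borel_measurable_lim_metric gain_meas assms)

lemma total_gain_meas:
  assumes "i < Suc k"
  shows "(\<lambda>\<omega>. total_gain (fst \<omega>) (Hg \<Delta> \<theta> (fst \<omega>)) (wt c (fst \<omega>)) (snd \<omega> ! i)) \<in> bmeas k"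
proof -
  define F where "F G ys = (if ys ! 0 \<in> Hg \<Delta> \<theta> G then gainl G (Hg \<Delta> \<theta> G) (wt c G) (ys ! 0) (ys ! Suc i) else 0)" for G ys
  have "(\<lambda>\<omega>. F (fst \<omega>) (snd \<omega>)) \<in> bmeas (Suc k)"
  proof -
    have [measurable]: "bpred (Suc k) (\<lambda>\<omega>. snd \<omega> ! 0 \<in> Hg \<Delta> \<theta> (fst \<omega>))"
      "(\<lambda>\<omega>. gainl (fst \<omega>) (Hg \<Delta> \<theta> (fst \<omega>)) (wt c (fst \<omega>)) (snd \<omega> ! 0) (snd \<omega> ! Suc i)) \<in> bmeas (Suc k)"
      using assms by (auto intro: Hg_meas gainl_meas)
    show ?thesis unfolding F_def by measurable
  qed
  from neighbour_sum_meas[OF this assms]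
  have "(\<lambda>\<omega>. \<Sum>z\<in>neighbours (fst \<omega>) (snd \<omega> ! i). if z \<in> Hg \<Delta> \<theta> (fst \<omega>)
      then gainl (fst \<omega>) (Hg \<Delta> \<theta> (fst \<omega>)) (wt c (fst \<omega>)) z (snd \<omega> ! i) else 0) \<in> bmeas k"
    by (simp add: F_def cong: if_cong)
  then show ?thesis unfolding total_gain_def by (intro borel_measurable_add wt_meas assms)
qed

lemma flow_meas:
  fixes h :: "nat graph \<Rightarrow> nat \<Rightarrow> nat \<Rightarrow> ennreal"
  assumes h: "\<And>k i j. i < Suc k \<Longrightarrow> j < Suc k \<Longrightarrow> (\<lambda>\<omega>. h (fst \<omega>) (snd \<omega> ! i) (snd \<omega> ! j)) \<in> bmeas k"
  shows "(\<lambda>\<omega>. \<integral>\<^sup>+w. h (fst \<omega>) (snd \<omega> ! 0) w \<partial>count_space (verts (fst \<omega>))) \<in> bmeas 0"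
    "(\<lambda>\<omega>. \<integral>\<^sup>+w. h (fst \<omega>) w (snd \<omega> ! 0) \<partial>count_space (verts (fst \<omega>))) \<in> bmeas 0"
proof -
  have "(\<lambda>\<omega>. h (fst \<omega>) (snd \<omega> ! 1) (snd \<omega> ! 0)) \<in> bmeas (Suc 0)" "(\<lambda>\<omega>. h (fst \<omega>) (snd \<omega> ! 0) (snd \<omega> ! 1)) \<in> bmeas (Suc 0)"
    using h by auto
  from root_integral_meas[where F="\<lambda>G ys. h G (ys ! 1) (ys ! 0)", OF this(1)]
    root_integral_meas[where F="\<lambda>G ys. h G (ys ! 0) (ys ! 1)", OF this(2)]
  show "(\<lambda>\<omega>. \<integral>\<^sup>+w. h (fst \<omega>) (snd \<omega> ! 0) w \<partial>count_space (verts (fst \<omega>))) \<in> bmeas 0"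
    "(\<lambda>\<omega>. \<integral>\<^sup>+w. h (fst \<omega>) w (snd \<omega> ! 0) \<partial>count_space (verts (fst \<omega>))) \<in> bmeas 0"
    by simp_all
qed

context bdd_graph
begin

lemma flow_sum:
  fixes f :: "nat \<Rightarrow> ennreal"
  assumes "\<And>w. w \<notin> nb x \<Longrightarrow> f w = 0"
  shows "(\<integral>\<^sup>+w. f w \<partial>count_space V) = (\<Sum>w\<in>nb x. f w)"
proof -
  have "(\<integral>\<^sup>+w. f w \<partial>count_space V) = (\<integral>\<^sup>+w. f w * (if adjacent G x w then 1 else 0) \<partial>count_space V)"
    using assms by (intro nn_integral_cong) (auto simp: neighbours_def)
  also have "\<dots> = (\<Sum>w\<in>nb x. f w)"
    using nb_verts by (intro nn_integral_neighbours) auto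
  finally show ?thesis .
qed

end

section \<open>Pointwise estimates of the transported masses\<close>

locale tree_eig2 = tree_eig +
  assumes deg2: "\<And>x. x \<in> V \<Longrightarrow> 2 \<le> card (nb x)"
begin

lemma Sg_nb: "y \<in> nb x \<Longrightarrow> Sg \<Delta> \<theta> G y \<longleftrightarrow> y \<in> S"
  using nb_verts Sg_iff by blast

lemma rg_eq:
  assumes "x \<in> S"
  shows "rg \<Delta> \<theta> G x = ennreal (rho x)"
proof -
  have "(\<Sum>y\<in>nb x. if Sg \<Delta> \<theta> G y then 0 else eg \<Delta> \<theta> G x y) = (\<Sum>y\<in>nb x - S. ennreal (ee x y))"
    by (rule sum.mono_neutral_cong_right) (auto simp: Sg_iff eg_eq[OF assms] dest: nb_verts)
  also have "\<dots> = ennreal (\<Sum>y\<in>nb x - S. ee x y)" by (rule sum_ennreal) (rule ee_nonneg)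
  finally show ?thesis unfolding rg_def rho_eq[OF assms] pk_proj
    by (simp add: ennreal_plus p_nonneg sum_nonneg ee_nonneg)
qed

text \<open>In this transport every vertex of a component sends \<open>rg y\<close> to each
  \<open>y\<close> in it, so the amount sent is the sum of \<open>rho\<close> over the
  component.\<close>

lemma component_flow_out:
  assumes "x \<in> S"
  shows "(\<integral>\<^sup>+y. (if Sg \<Delta> \<theta> G x \<and> y \<in> Cg \<Delta> \<theta> G x then rg \<Delta> \<theta> G y else 0) \<partial>count_space V) \<le> 1"
proof -
  have x: "x \<in> V" using assms S_verts by blast
  have CS: "Cc x \<subseteq> S" using Cc_S[OF assms] by blast
  then have CV: "Cc x \<subseteq> V" using S_verts by blast
  have "(\<integral>\<^sup>+y. (if Sg \<Delta> \<theta> G x \<and> y \<in> Cg \<Delta> \<theta> G x then rg \<Delta> \<theta> G y else 0) \<partial>count_space V) =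
    (\<integral>\<^sup>+y. ennreal (rho y) \<partial>count_space (Cc x))"
    using assms CV
    by (auto simp: nn_integral_count_space_indicator Sg_iff x Cg_eq rg_eq[OF subsetD[OF CS]] dest: subsetD
      intro!: nn_integral_cong split: split_indicator)
  also have "\<dots> = (SUP F\<in>{F. finite F \<and> F \<subseteq> Cc x}. sum (\<lambda>y. ennreal (rho y)) F)"
    unfolding infsum_eq_nn_integral[symmetric] by (rule nonneg_infsum_complete) simp
  also have "\<dots> \<le> 1"
  proof (rule SUP_least)
    fix F assume F: "F \<in> {F. finite F \<and> F \<subseteq> Cc x}"
    then have "sum (\<lambda>y. ennreal (rho y)) F = ennreal (sum rho F)"
      using CS rho_nonneg by (intro sum_ennreal) auto
    also have "\<dots> \<le> ennreal 1" using sum_rho_component[OF assms, of F] F by (intro ennreal_leI) auto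
    finally show "sum (\<lambda>y. ennreal (rho y)) F \<le> 1" by simp
  qed
  finally show ?thesis .
qed

text \<open>In the same transport \<open>x\<close> receives \<open>rg x\<close> once from each
  member of its component. An infinite component has finite subsets of every size, so any
  \<open>n\<close> is admissible there.\<close>

lemma component_flow_in:
  assumes x: "x \<in> S" and n: "finite (Cc x) \<Longrightarrow> n \<le> card (Cc x)"
  shows "of_nat n * rg \<Delta> \<theta> G x \<le>
    (\<integral>\<^sup>+y. (if Sg \<Delta> \<theta> G y \<and> x \<in> Cg \<Delta> \<theta> G y then rg \<Delta> \<theta> G x else 0) \<partial>count_space V)"
proof -
  obtain F where F: "finite F" "F \<subseteq> Cc x" "card F = n"
  proof (cases "finite (Cc x)")
    case True
    then show ?thesis using n that obtain_subset_with_card_n[of n "Cc x"] finite_subset by metis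
  next
    case False
    then show ?thesis using that infinite_arbitrarily_large by metis
  qed
  have FS: "F \<subseteq> S" using F Cc_S[OF x] by blast
  then have FV: "F \<subseteq> V" using S_verts by blast
  have in_C: "Sg \<Delta> \<theta> G y \<and> x \<in> Cg \<Delta> \<theta> G y" if "y \<in> F" for y
  proof -
    have "y \<in> S" "y \<in> V" "x \<in> Cc y" using that FS FV F Cc_sym[OF x] by blast+
    then show ?thesis by (simp add: Sg_iff Cg_eq)
  qed
  have "of_nat n * rg \<Delta> \<theta> G x = (\<Sum>y\<in>F. rg \<Delta> \<theta> G x)" using F by simp
  also have "\<dots> = (\<integral>\<^sup>+y. rg \<Delta> \<theta> G x \<partial>count_space F)" by (rule nn_integral_count_space_finite[OF F(1), symmetric])
  also have "\<dots> = (\<integral>\<^sup>+y. (if y \<in> F then rg \<Delta> \<theta> G x else 0) \<partial>count_space F)"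
    by (rule nn_integral_cong) simp
  also have "\<dots> = (\<integral>\<^sup>+y. (if y \<in> F then rg \<Delta> \<theta> G x else 0) \<partial>count_space V)"
    using FV by (intro nn_integral_count_space_eq) auto
  also have "\<dots> \<le> (\<integral>\<^sup>+y. (if Sg \<Delta> \<theta> G y \<and> x \<in> Cg \<Delta> \<theta> G y then rg \<Delta> \<theta> G x else 0) \<partial>count_space V)"
    using in_C by (intro nn_integral_mono) auto
  finally show ?thesis .
qed

lemma boundary_flow_in:
  assumes "y \<in> dS"
  shows "1 \<le> (\<integral>\<^sup>+x. (if Sg \<Delta> \<theta> G x \<and> dSg \<Delta> \<theta> G y \<and> adjacent G x y then eg \<Delta> \<theta> G x y else 0) \<partial>count_space V)"
proof -
  have y: "y \<in> V" using assms by (simp add: dS_def)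
  have "(\<integral>\<^sup>+x. (if Sg \<Delta> \<theta> G x \<and> dSg \<Delta> \<theta> G y \<and> adjacent G x y then eg \<Delta> \<theta> G x y else 0) \<partial>count_space V) =
    (\<Sum>x\<in>nb y. if Sg \<Delta> \<theta> G x \<and> dSg \<Delta> \<theta> G y \<and> adjacent G x y then eg \<Delta> \<theta> G x y else 0)"
    by (rule flow_sum) (auto simp: neighbours_def adjacent_commute)
  also have "\<dots> = (\<Sum>x\<in>nb y \<inter> S. ennreal (ee x y))"
  proof (rule sum.mono_neutral_cong_right)
    fix x assume x: "x \<in> nb y \<inter> S"
    then have "y \<in> nb x" "x \<in> V" using nb_sym nb_verts by blast+
    then show "(if Sg \<Delta> \<theta> G x \<and> dSg \<Delta> \<theta> G y \<and> adjacent G x y then eg \<Delta> \<theta> G x y else 0) = ennreal (ee x y)"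
      using x y assms by (simp add: Sg_iff dSg_iff eg_eq nb_adjacent)
  qed (auto simp: Sg_iff dest: nb_verts)
  also have "\<dots> = ennreal (\<Sum>x\<in>nb y \<inter> S. ee x y)" by (rule sum_ennreal) (rule ee_nonneg)
  also have "1 \<le> \<dots>" using sum_ee_boundary[OF assms] by simp
  finally show ?thesis .
qed

lemma boundary_flow_out:
  assumes "x \<in> S"
  shows "ennreal (p x x) + (\<integral>\<^sup>+y. (if Sg \<Delta> \<theta> G x \<and> dSg \<Delta> \<theta> G y \<and> adjacent G x y then eg \<Delta> \<theta> G x y else 0) \<partial>count_space V)
    = rg \<Delta> \<theta> G x"
proof -
  have x: "x \<in> V" using assms S_verts by blast
  have "(\<integral>\<^sup>+y. (if Sg \<Delta> \<theta> G x \<and> dSg \<Delta> \<theta> G y \<and> adjacent G x y then eg \<Delta> \<theta> G x y else 0) \<partial>count_space V) =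
    (\<Sum>y\<in>nb x. if Sg \<Delta> \<theta> G x \<and> dSg \<Delta> \<theta> G y \<and> adjacent G x y then eg \<Delta> \<theta> G x y else 0)"
    by (rule flow_sum) (auto simp: neighbours_def)
  also have "\<dots> = (\<Sum>y\<in>nb x. if Sg \<Delta> \<theta> G y then 0 else eg \<Delta> \<theta> G x y)"
  proof (rule sum.cong)
    fix y assume y: "y \<in> nb x"
    then have "y \<in> V" "x \<in> nb y" using nb_verts nb_sym by blast+
    then show "(if Sg \<Delta> \<theta> G x \<and> dSg \<Delta> \<theta> G y \<and> adjacent G x y then eg \<Delta> \<theta> G x y else 0) =
      (if Sg \<Delta> \<theta> G y then 0 else eg \<Delta> \<theta> G x y)"
      using assms x y by (auto simp: Sg_iff dSg_iff dS_def nb_adjacent)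
  qed simp
  finally show ?thesis by (simp add: rg_def pk_proj)
qed

text \<open>The first bound is \<open>rho_nonneg\<close>. By \<open>ee_opposite\<close> inflow plus
  outflow is one unit per edge inside \<open>S\<close>, so a bound on the outflow becomes a bound on
  internal degrees.\<close>

lemma internal_flow:
  assumes "x \<in> S"
  shows "(\<integral>\<^sup>+y. (if Sg \<Delta> \<theta> G x \<and> Sg \<Delta> \<theta> G y \<and> adjacent G x y then eg \<Delta> \<theta> G x y else 0) \<partial>count_space V) \<le> 1"
    "(\<integral>\<^sup>+y. (if Sg \<Delta> \<theta> G x \<and> Sg \<Delta> \<theta> G y \<and> adjacent G x y then eg \<Delta> \<theta> G x y else 0) \<partial>count_space V) +
     (\<integral>\<^sup>+y. (if Sg \<Delta> \<theta> G y \<and> Sg \<Delta> \<theta> G x \<and> adjacent G y x then eg \<Delta> \<theta> G y x else 0) \<partial>count_space V)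
     = ennreal (real (card (nb x \<inter> S)))"
proof -
  have x: "x \<in> V" using assms S_verts by blast
  have out: "(\<integral>\<^sup>+y. (if Sg \<Delta> \<theta> G x \<and> Sg \<Delta> \<theta> G y \<and> adjacent G x y then eg \<Delta> \<theta> G x y else 0) \<partial>count_space V) =
    ennreal (\<Sum>y\<in>nb x \<inter> S. ee x y)"
  proof -
    have "(\<integral>\<^sup>+y. (if Sg \<Delta> \<theta> G x \<and> Sg \<Delta> \<theta> G y \<and> adjacent G x y then eg \<Delta> \<theta> G x y else 0) \<partial>count_space V) =
      (\<Sum>y\<in>nb x. if Sg \<Delta> \<theta> G x \<and> Sg \<Delta> \<theta> G y \<and> adjacent G x y then eg \<Delta> \<theta> G x y else 0)"
      by (rule flow_sum) (auto simp: neighbours_def)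
    also have "\<dots> = (\<Sum>y\<in>nb x \<inter> S. ennreal (ee x y))"
      by (rule sum.mono_neutral_cong_right) (use assms x in \<open>auto simp: Sg_iff[OF x] Sg_nb eg_eq nb_adjacent[symmetric]\<close>)
    also have "\<dots> = ennreal (\<Sum>y\<in>nb x \<inter> S. ee x y)" by (rule sum_ennreal) (rule ee_nonneg)
    finally show ?thesis .
  qed
  have inn: "(\<integral>\<^sup>+y. (if Sg \<Delta> \<theta> G y \<and> Sg \<Delta> \<theta> G x \<and> adjacent G y x then eg \<Delta> \<theta> G y x else 0) \<partial>count_space V) =
    ennreal (\<Sum>y\<in>nb x \<inter> S. ee y x)"
  proof -
    have "(\<integral>\<^sup>+y. (if Sg \<Delta> \<theta> G y \<and> Sg \<Delta> \<theta> G x \<and> adjacent G y x then eg \<Delta> \<theta> G y x else 0) \<partial>count_space V) =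
      (\<Sum>y\<in>nb x. if Sg \<Delta> \<theta> G y \<and> Sg \<Delta> \<theta> G x \<and> adjacent G y x then eg \<Delta> \<theta> G y x else 0)"
      by (rule flow_sum) (auto simp: neighbours_def adjacent_commute)
    also have "\<dots> = (\<Sum>y\<in>nb x \<inter> S. ennreal (ee y x))"
    proof (rule sum.mono_neutral_cong_right)
      fix y assume y: "y \<in> nb x \<inter> S"
      then have "x \<in> nb y" "y \<in> V" using nb_sym nb_verts by blast+
      then show "(if Sg \<Delta> \<theta> G y \<and> Sg \<Delta> \<theta> G x \<and> adjacent G y x then eg \<Delta> \<theta> G y x else 0) = ennreal (ee y x)"
        using y x assms by (simp add: Sg_iff eg_eq nb_adjacent)
    qed (auto simp: Sg_iff dest: nb_verts)
    also have "\<dots> = ennreal (\<Sum>y\<in>nb x \<inter> S. ee y x)" by (rule sum_ennreal) (rule ee_nonneg)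
    finally show ?thesis .
  qed
  have "(\<Sum>y\<in>nb x \<inter> S. ee x y) \<le> 1" using rho_nonneg[OF assms] by (simp add: rho_def)
  then show "(\<integral>\<^sup>+y. (if Sg \<Delta> \<theta> G x \<and> Sg \<Delta> \<theta> G y \<and> adjacent G x y then eg \<Delta> \<theta> G x y else 0) \<partial>count_space V) \<le> 1"
    unfolding out by simp
  have "(\<Sum>y\<in>nb x \<inter> S. ee x y) + (\<Sum>y\<in>nb x \<inter> S. ee y x) = real (card (nb x \<inter> S))"
  proof -
    have "(\<Sum>y\<in>nb x \<inter> S. ee x y) + (\<Sum>y\<in>nb x \<inter> S. ee y x) = (\<Sum>y\<in>nb x \<inter> S. 1)"
      unfolding sum.distrib[symmetric] by (rule sum.cong) (use assms ee_opposite in auto)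
    then show ?thesis by simp
  qed
  then show "(\<integral>\<^sup>+y. (if Sg \<Delta> \<theta> G x \<and> Sg \<Delta> \<theta> G y \<and> adjacent G x y then eg \<Delta> \<theta> G x y else 0) \<partial>count_space V) +
     (\<integral>\<^sup>+y. (if Sg \<Delta> \<theta> G y \<and> Sg \<Delta> \<theta> G x \<and> adjacent G y x then eg \<Delta> \<theta> G y x else 0) \<partial>count_space V)
     = ennreal (real (card (nb x \<inter> S)))"
    unfolding out inn by (simp add: ennreal_plus[symmetric] sum_nonneg ee_nonneg del: ennreal_plus)
qed

text \<open>Unit mass over each edge from \<open>S\<close> to its boundary moves the count of these
  edges to the boundary side, where a vertex has at most \<Delta> of them.\<close>

lemma cut_flow:
  assumes x: "x \<in> V"
  shows "x \<in> S \<Longrightarrow> (\<integral>\<^sup>+y. (if Sg \<Delta> \<theta> G x \<and> dSg \<Delta> \<theta> G y \<and> adjacent G x y then 1 else 0) \<partial>count_space V)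
      = ennreal (real (card (nb x - S)))"
    "(\<integral>\<^sup>+y. (if Sg \<Delta> \<theta> G y \<and> dSg \<Delta> \<theta> G x \<and> adjacent G y x then 1 else 0) \<partial>count_space V)
      \<le> (if dSg \<Delta> \<theta> G x then ennreal (real \<Delta>) else 0)"
proof -
  assume xS: "x \<in> S"
  have "(\<integral>\<^sup>+y. (if Sg \<Delta> \<theta> G x \<and> dSg \<Delta> \<theta> G y \<and> adjacent G x y then 1 else 0) \<partial>count_space V) =
    (\<Sum>y\<in>nb x. if Sg \<Delta> \<theta> G x \<and> dSg \<Delta> \<theta> G y \<and> adjacent G x y then 1 else 0)"
    by (rule flow_sum) (auto simp: neighbours_def)
  also have "\<dots> = (\<Sum>y\<in>nb x - S. 1)"
  proof (rule sum.mono_neutral_cong_right)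
    fix y assume y: "y \<in> nb x - S"
    then have "y \<in> V" "x \<in> nb y" using nb_verts nb_sym by blast+
    then show "(if Sg \<Delta> \<theta> G x \<and> dSg \<Delta> \<theta> G y \<and> adjacent G x y then 1 else 0 :: ennreal) = 1"
      using y x xS by (auto simp: Sg_iff dSg_iff dS_def nb_adjacent)
  qed (auto simp: dSg_iff dS_def dest: nb_verts)
  finally show "(\<integral>\<^sup>+y. (if Sg \<Delta> \<theta> G x \<and> dSg \<Delta> \<theta> G y \<and> adjacent G x y then 1 else 0) \<partial>count_space V)
      = ennreal (real (card (nb x - S)))" by (simp add: ennreal_of_nat_eq_real_of_nat)
next
  have "(\<integral>\<^sup>+y. (if Sg \<Delta> \<theta> G y \<and> dSg \<Delta> \<theta> G x \<and> adjacent G y x then 1 else 0) \<partial>count_space V) =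
    (\<Sum>y\<in>nb x. if Sg \<Delta> \<theta> G y \<and> dSg \<Delta> \<theta> G x \<and> adjacent G y x then 1 else 0)"
    by (rule flow_sum) (auto simp: neighbours_def adjacent_commute)
  also have "\<dots> \<le> (\<Sum>y\<in>nb x. if dSg \<Delta> \<theta> G x then 1 else 0)" by (rule sum_mono) auto
  also have "\<dots> \<le> (if dSg \<Delta> \<theta> G x then ennreal (real \<Delta>) else 0)"
    using card_nb_le[of x] by (simp add: ennreal_of_nat_eq_real_of_nat)
  finally show "(\<integral>\<^sup>+y. (if Sg \<Delta> \<theta> G y \<and> dSg \<Delta> \<theta> G x \<and> adjacent G y x then 1 else 0) \<partial>count_space V)
      \<le> (if dSg \<Delta> \<theta> G x then ennreal (real \<Delta>) else 0)" .
qed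

text \<open>At a vertex of \<open>S\<close> all neighbours qualify, and minimum degree 2 supplies
  two of them; a boundary vertex has two in \<open>S\<close> by
  \<open>dS_two_neighbours\<close>.\<close>

lemma Hg_two_neighbours:
  assumes x: "x \<in> V" "x \<in> Hg \<Delta> \<theta> G"
  shows "2 \<le> card (nb x \<inter> Hg \<Delta> \<theta> G)"
proof (cases "x \<in> S")
  case True
  have "nb x \<subseteq> Hg \<Delta> \<theta> G"
  proof
    fix y assume "y \<in> nb x"
    then have "y \<in> V" "x \<in> nb y" using nb_verts nb_sym by blast+
    then show "y \<in> Hg \<Delta> \<theta> G" using True by (auto simp: Hg_def Sg_iff dSg_iff dS_def)
  qed
  then show ?thesis using deg2[OF x(1)] by (simp add: Int_absorb2)
next
  case False
  then have "x \<in> dS" using x by (simp add: Hg_def Sg_iff dSg_iff)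
  from dS_two_neighbours[OF this] have "2 \<le> card (nb x \<inter> S)" .
  also have "\<dots> \<le> card (nb x \<inter> Hg \<Delta> \<theta> G)"
    by (rule card_mono) (auto simp: Hg_def Sg_nb)
  finally show ?thesis .
qed

text \<open>Twice \<open>gain_flow_bound\<close>, with negative terms moved to the other side so
  that it becomes an inequality in \<open>ennreal\<close>. The second claim supplies the
  integrability needed to cancel flows.\<close>

lemma gain_flow:
  fixes c T :: real and x :: nat
  defines "t \<equiv> total_gain G (Hg \<Delta> \<theta> G) (wt c G)" and "l \<equiv> gainl G (Hg \<Delta> \<theta> G) (wt c G)"
  defines "h \<equiv> \<lambda>x y. if x \<in> Hg \<Delta> \<theta> G \<and> y \<in> Hg \<Delta> \<theta> G \<and> adjacent G x y \<and> t x \<le> T \<and> t y \<le> T then ennreal (l x y) else 0"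
  defines "D \<equiv> x \<in> Hg \<Delta> \<theta> G \<and> t x \<le> T"
  assumes iso: "ereal i \<le> anchored_isoperimetric G x" and c: "0 < c" "c < i" and x: "x \<in> V" and T: "0 \<le> T"
  shows "(if D then ennreal (2 * (c + 2)) else 0) + (\<integral>\<^sup>+y. h y x \<partial>count_space V)
      \<le> (if D then ennreal (2 * real (card (nb x))) else 0) + (\<integral>\<^sup>+y. h x y \<partial>count_space V)"
    "(\<integral>\<^sup>+y. h y x \<partial>count_space V) \<le> ennreal (T + real \<Delta>)"
proof -
  have bdd: "\<exists>K\<ge>0. \<forall>W. finite W \<longrightarrow> W \<subseteq> V \<longrightarrow> rconn G z W \<longrightarrow> (\<Sum>w\<in>W. wt c G w) \<le> K" if "z \<in> V" for z
    unfolding wt_def using anchored_bound[OF x _ iso c that] tree by (simp add: is_tree_def)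
  have out: "(\<integral>\<^sup>+y. h x y \<partial>count_space V) = (\<Sum>y\<in>nb x. h x y)"
    by (rule flow_sum) (auto simp: h_def neighbours_def)
  have inn: "(\<integral>\<^sup>+y. h y x \<partial>count_space V) = (\<Sum>y\<in>nb x. h y x)"
    by (rule flow_sum) (auto simp: h_def neighbours_def adjacent_commute)
  have wt_lower: "- real \<Delta> \<le> wt c G x" using card_nb_le[of x] c by (simp add: wt_def)
  have "(if D then ennreal (2 * (c + 2)) else 0) + (\<Sum>y\<in>nb x. h y x)
      \<le> (if D then ennreal (2 * real (card (nb x))) else 0) + (\<Sum>y\<in>nb x. h x y) \<and>
    (\<Sum>y\<in>nb x. h y x) \<le> ennreal (T + real \<Delta>)"
  proof (cases D)
    case False
    then have "h x y = 0" "h y x = 0" for y by (auto simp: h_def D_def)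
    then show ?thesis using False by simp
  next
    case True
    then have xH: "x \<in> Hg \<Delta> \<theta> G" and xT: "t x \<le> T" by (auto simp: D_def)
    note g = gain_flow_bound[OF bdd xH Hg_two_neighbours[OF x xH] xT[unfolded t_def]]
    let ?o = "\<Sum>z\<in>nb x. if z \<in> Hg \<Delta> \<theta> G \<and> t z \<le> T then l x z else 0"
    let ?i = "\<Sum>z\<in>nb x. if z \<in> Hg \<Delta> \<theta> G \<and> t z \<le> T then l z x else 0"
    have lpos: "0 \<le> l x z" "0 \<le> l z x" if "z \<in> nb x" for z
      using g(3)[of z x] g(3)[of x z] that nb_sym by (auto simp: l_def)
    have o: "(\<Sum>y\<in>nb x. h x y) = ennreal ?o"
    proof -
      have "(\<Sum>y\<in>nb x. h x y) = (\<Sum>z\<in>nb x. ennreal (if z \<in> Hg \<Delta> \<theta> G \<and> t z \<le> T then l x z else 0))"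
        using xH xT by (intro sum.cong) (auto simp: h_def nb_adjacent)
      then show ?thesis using lpos by (subst (asm) sum_ennreal) auto
    qed
    have i: "(\<Sum>y\<in>nb x. h y x) = ennreal ?i"
    proof -
      have "(\<Sum>y\<in>nb x. h y x) = (\<Sum>z\<in>nb x. ennreal (if z \<in> Hg \<Delta> \<theta> G \<and> t z \<le> T then l z x else 0))"
        using xH xT by (intro sum.cong) (auto simp: h_def nb_adjacent adjacent_commute)
      then show ?thesis using lpos by (subst (asm) sum_ennreal) auto
    qed
    have o0: "0 \<le> ?o" and i0: "0 \<le> ?i" using lpos by (auto intro!: sum_nonneg)
    have "wt c G x \<le> (?o - ?i) / 2" using g(1) by (simp only: t_def l_def)
    then have "2 * (c + 2) + ?i \<le> 2 * real (card (nb x)) + ?o" by (simp add: wt_def)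
    then have "ennreal (2 * (c + 2)) + ennreal ?i \<le> ennreal (2 * real (card (nb x))) + ennreal ?o"
      using c o0 i0 by (simp add: ennreal_plus[symmetric] ennreal_leI del: ennreal_plus)
    moreover have "?i \<le> T + real \<Delta>"
    proof -
      have "?i \<le> T - wt c G x" using g(2) by (simp only: t_def l_def)
      then show ?thesis using wt_lower by linarith
    qed
    ultimately show ?thesis using True unfolding o i by (simp add: ennreal_leI)
  qed
  then show "(if D then ennreal (2 * (c + 2)) else 0) + (\<integral>\<^sup>+y. h y x \<partial>count_space V)
      \<le> (if D then ennreal (2 * real (card (nb x))) else 0) + (\<integral>\<^sup>+y. h x y \<partial>count_space V)"
    "(\<integral>\<^sup>+y. h y x \<partial>count_space V) \<le> ennreal (T + real \<Delta>)"
    unfolding out inn by auto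
qed

end

section \<open>Densities at the root and the final estimate\<close>

locale unimodular_tree =
  fixes L :: "gstar measure" and \<Delta> :: nat and \<theta> i :: real
  assumes uni: "unimodular L" and i_pos: "0 < i"
    and good: "AE g in L. tree_eig2 (fst (rep1 g)) \<Delta> \<and> snd (rep1 g) ! 0 \<in> verts (fst (rep1 g)) \<and>
      ereal i \<le> anchored_isoperimetric (fst (rep1 g)) (snd (rep1 g) ! 0)"
begin

abbreviation "gr g \<equiv> fst (rep1 g)"
abbreviation "rt g \<equiv> snd (rep1 g) ! 0"

lemma prob_L: "prob_space L" and sets_L: "sets L = sets borel"
  using uni by (auto simp: unimodular_def)

lemma rep1_L: "rep1 \<in> measurable L (NM (Suc 0))"
  using rep1_measurable measurable_cong_sets[OF sets_L refl] by auto

lemma meas_L: "f \<in> bmeas 0 \<Longrightarrow> (\<lambda>g. f (rep1 g)) \<in> borel_measurable L"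
  by (rule measurable_compose[OF rep1_L])

lemma pred_L: "bpred 0 Q \<Longrightarrow> Measurable.pred L (\<lambda>g. Q (rep1 g))"
  by (rule measurable_compose[OF rep1_L])

lemma Sg_L [measurable]: "Measurable.pred L (\<lambda>g. Sg \<Delta> \<theta> (gr g) (rt g))"
  by (rule pred_L) (rule Sg_meas, simp)

lemma dSg_L [measurable]: "Measurable.pred L (\<lambda>g. dSg \<Delta> \<theta> (gr g) (rt g))"
  by (rule pred_L) (rule dSg_meas, simp)

lemma rg_L [measurable]: "(\<lambda>g. rg \<Delta> \<theta> (gr g) (rt g)) \<in> borel_measurable L"
  by (rule meas_L) (rule rg_meas, simp)

lemma pk_L [measurable]: "(\<lambda>g. pk \<Delta> \<theta> (gr g) (rt g) (rt g)) \<in> borel_measurable L"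
  by (rule meas_L) (rule pk_meas; simp)

definition "dens_S = (\<integral>\<^sup>+g. (if Sg \<Delta> \<theta> (gr g) (rt g) then 1 else 0) \<partial>L)"
definition "dens_dS = (\<integral>\<^sup>+g. (if dSg \<Delta> \<theta> (gr g) (rt g) then 1 else 0) \<partial>L)"
definition "dens_rg = (\<integral>\<^sup>+g. (if Sg \<Delta> \<theta> (gr g) (rt g) then rg \<Delta> \<theta> (gr g) (rt g) else 0) \<partial>L)"
definition "dens_pk = (\<integral>\<^sup>+g. ennreal (pk \<Delta> \<theta> (gr g) (rt g) (rt g)) \<partial>L)"

lemma dens_le_1: "dens_S \<le> 1" "dens_dS \<le> 1"
proof -
  interpret prob_space L by (rule prob_L)
  have "(\<integral>\<^sup>+g. (if Q g then 1 else 0) \<partial>L) \<le> (\<integral>\<^sup>+g. 1 \<partial>L)" for Q by (rule nn_integral_mono) simp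
  then show "dens_S \<le> 1" "dens_dS \<le> 1" by (simp_all add: dens_S_def dens_dS_def emeasure_space_1)
qed

text \<open>Mass transport of the component flow. If finite components almost surely do not occur,
  every \<open>n\<close> is admissible, which \<open>atom_bound\<close> exploits.\<close>

lemma component_density:
  assumes n: "AE g in L. Sg \<Delta> \<theta> (gr g) (rt g) \<longrightarrow> finite (Cg \<Delta> \<theta> (gr g) (rt g)) \<longrightarrow> n \<le> card (Cg \<Delta> \<theta> (gr g) (rt g))"
  shows "of_nat n * dens_rg \<le> dens_S"
proof -
  define h where "h G x y = (if Sg \<Delta> \<theta> G x \<and> y \<in> Cg \<Delta> \<theta> G x then rg \<Delta> \<theta> G y else 0)" for G x y
  have hm: "(\<lambda>\<omega>. h (fst \<omega>) (snd \<omega> ! i) (snd \<omega> ! j)) \<in> bmeas k" if "i < Suc k" "j < Suc k" for k i j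
  proof -
    note [measurable] = Sg_meas[OF that(1), of \<Delta> \<theta>] Cg_meas[OF that, of \<Delta> \<theta>] rg_meas[OF that(2), of \<Delta> \<theta>]
    show ?thesis unfolding h_def by measurable
  qed
  have "of_nat n * dens_rg = (\<integral>\<^sup>+g. of_nat n * (if Sg \<Delta> \<theta> (gr g) (rt g) then rg \<Delta> \<theta> (gr g) (rt g) else 0) \<partial>L)"
    unfolding dens_rg_def by (rule nn_integral_cmult[symmetric]) measurable
  also have "\<dots> \<le> (\<integral>\<^sup>+g. (\<integral>\<^sup>+w. h (gr g) w (rt g) \<partial>count_space (verts (gr g))) \<partial>L)"
  proof (rule nn_integral_mono_AE)
    show "AE g in L. of_nat n * (if Sg \<Delta> \<theta> (gr g) (rt g) then rg \<Delta> \<theta> (gr g) (rt g) else 0)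
        \<le> (\<integral>\<^sup>+w. h (gr g) w (rt g) \<partial>count_space (verts (gr g)))"
      using good n
    proof eventually_elim
      case (elim g)
      then interpret tree_eig2 "gr g" \<Delta> \<theta> by simp
      show ?case
      proof (cases "Sg \<Delta> \<theta> (gr g) (rt g)")
        case True
        have x: "rt g \<in> V" using elim by simp
        then have xS: "rt g \<in> S" using True Sg_iff by blast
        show ?thesis using component_flow_in[OF xS, of n] elim True by (simp add: h_def Cg_eq[OF x])
      qed simp
    qed
  qed
  also have "\<dots> = (\<integral>\<^sup>+g. (\<integral>\<^sup>+w. h (gr g) (rt g) w \<partial>count_space (verts (gr g))) \<partial>L)"
    by (rule mass_transport[OF uni, symmetric]) (rule hm)
  also have "\<dots> \<le> dens_S"
    unfolding dens_S_def
  proof (rule nn_integral_mono_AE)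
    show "AE g in L. (\<integral>\<^sup>+w. h (gr g) (rt g) w \<partial>count_space (verts (gr g))) \<le> (if Sg \<Delta> \<theta> (gr g) (rt g) then 1 else 0)"
      using good
    proof eventually_elim
      case (elim g)
      then interpret tree_eig2 "gr g" \<Delta> \<theta> by simp
      show ?case
      proof (cases "Sg \<Delta> \<theta> (gr g) (rt g)")
        case True
        then have "rt g \<in> S" using elim Sg_iff by blast
        from component_flow_out[OF this] show ?thesis using True by (simp add: h_def)
      next
        case False
        then show ?thesis by (simp add: h_def)
      qed
    qed
  qed
  finally show ?thesis .
qed

text \<open>Each boundary vertex receives at least 1, and at a vertex of \<open>S\<close> the mass
  sent to the boundary together with the mass kept is exactly \<open>rg\<close>.\<close>

lemma boundary_density: "dens_dS + dens_pk \<le> dens_rg"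
proof -
  define h where "h G x y = (if Sg \<Delta> \<theta> G x \<and> dSg \<Delta> \<theta> G y \<and> adjacent G x y then eg \<Delta> \<theta> G x y else 0)" for G x y
  have hm: "(\<lambda>\<omega>. h (fst \<omega>) (snd \<omega> ! i) (snd \<omega> ! j)) \<in> bmeas k" if "i < Suc k" "j < Suc k" for k i j
  proof -
    note [measurable] = Sg_meas[OF that(1), of \<Delta> \<theta>] dSg_meas[OF that(2), of \<Delta> \<theta>] adjacent_meas[OF that] eg_meas[OF that, of \<Delta> \<theta>]
    show ?thesis unfolding h_def by measurable
  qed
  let ?out = "\<lambda>g. \<integral>\<^sup>+w. h (gr g) (rt g) w \<partial>count_space (verts (gr g))"
  have [measurable]: "?out \<in> borel_measurable L" using meas_L[OF flow_meas(1)[where h=h, OF hm]] .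
  have "dens_dS \<le> (\<integral>\<^sup>+g. (\<integral>\<^sup>+w. h (gr g) w (rt g) \<partial>count_space (verts (gr g))) \<partial>L)"
    unfolding dens_dS_def
  proof (rule nn_integral_mono_AE)
    show "AE g in L. (if dSg \<Delta> \<theta> (gr g) (rt g) then 1 else 0) \<le> (\<integral>\<^sup>+w. h (gr g) w (rt g) \<partial>count_space (verts (gr g)))"
      using good
    proof eventually_elim
      case (elim g)
      then interpret tree_eig2 "gr g" \<Delta> \<theta> by simp
      show ?case
      proof (cases "dSg \<Delta> \<theta> (gr g) (rt g)")
        case True
        then have "rt g \<in> dS" using elim dSg_iff by blast
        from boundary_flow_in[OF this] show ?thesis using True by (simp add: h_def)
      qed simp
    qed
  qed
  also have "\<dots> = (\<integral>\<^sup>+g. ?out g \<partial>L)"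
    by (rule mass_transport[OF uni, symmetric]) (rule hm)
  finally have "dens_dS + dens_pk \<le> (\<integral>\<^sup>+g. ?out g \<partial>L) + dens_pk" by (rule add_right_mono)
  also have "\<dots> = (\<integral>\<^sup>+g. ?out g + ennreal (pk \<Delta> \<theta> (gr g) (rt g) (rt g)) \<partial>L)"
    unfolding dens_pk_def by (rule nn_integral_add[symmetric]) measurable
  also have "\<dots> \<le> dens_rg"
    unfolding dens_rg_def
  proof (rule nn_integral_mono_AE)
    show "AE g in L. ?out g + ennreal (pk \<Delta> \<theta> (gr g) (rt g) (rt g)) \<le> (if Sg \<Delta> \<theta> (gr g) (rt g) then rg \<Delta> \<theta> (gr g) (rt g) else 0)"
      using good
    proof eventually_elim
      case (elim g)
      then interpret tree_eig2 "gr g" \<Delta> \<theta> by simp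
      show ?case
      proof (cases "Sg \<Delta> \<theta> (gr g) (rt g)")
        case True
        then have "rt g \<in> S" using elim Sg_iff by blast
        from boundary_flow_out[OF this] show ?thesis using True by (simp add: h_def pk_proj add.commute)
      next
        case False
        then show ?thesis by (simp add: h_def Sg_def ennreal_neg)
      qed
    qed
  qed
  finally show ?thesis .
qed

text \<open>Edges inside \<open>S\<close> are counted by inflow plus outflow, both of mean at most
  \<open>dens_S\<close>. Edges from \<open>S\<close> to the boundary, recounted at their other end,
  and the degrees on the boundary itself contribute \<Delta> times \<open>dens_dS\<close>
  each.\<close>

lemma degree_density:
  "(\<integral>\<^sup>+g. (if rt g \<in> Hg \<Delta> \<theta> (gr g) then ennreal (real (card (neighbours (gr g) (rt g)))) else 0) \<partial>L)
    \<le> 2 * dens_S + 2 * ennreal (real \<Delta>) * dens_dS"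
proof -
  define h where "h G x y = (if Sg \<Delta> \<theta> G x \<and> Sg \<Delta> \<theta> G y \<and> adjacent G x y then eg \<Delta> \<theta> G x y else 0)" for G x y
  have hm: "(\<lambda>\<omega>. h (fst \<omega>) (snd \<omega> ! i) (snd \<omega> ! j)) \<in> bmeas k" if "i < Suc k" "j < Suc k" for k i j
  proof -
    note [measurable] = Sg_meas[OF that(1), of \<Delta> \<theta>] Sg_meas[OF that(2), of \<Delta> \<theta>] adjacent_meas[OF that] eg_meas[OF that, of \<Delta> \<theta>]
    show ?thesis unfolding h_def by measurable
  qed
  define k where "k G x y = (if Sg \<Delta> \<theta> G x \<and> dSg \<Delta> \<theta> G y \<and> adjacent G x y then 1 else 0 :: ennreal)" for G x y
  have km: "(\<lambda>\<omega>. k (fst \<omega>) (snd \<omega> ! i) (snd \<omega> ! j)) \<in> bmeas n" if "i < Suc n" "j < Suc n" for n i j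
  proof -
    note [measurable] = Sg_meas[OF that(1), of \<Delta> \<theta>] dSg_meas[OF that(2), of \<Delta> \<theta>] adjacent_meas[OF that]
    show ?thesis unfolding k_def by measurable
  qed
  let ?ho = "\<lambda>g. \<integral>\<^sup>+w. h (gr g) (rt g) w \<partial>count_space (verts (gr g))"
  let ?hi = "\<lambda>g. \<integral>\<^sup>+w. h (gr g) w (rt g) \<partial>count_space (verts (gr g))"
  let ?ko = "\<lambda>g. \<integral>\<^sup>+w. k (gr g) (rt g) w \<partial>count_space (verts (gr g))"
  let ?ki = "\<lambda>g. \<integral>\<^sup>+w. k (gr g) w (rt g) \<partial>count_space (verts (gr g))"
  let ?d = "\<lambda>g. if dSg \<Delta> \<theta> (gr g) (rt g) then ennreal (real \<Delta>) else 0"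
  have [measurable]: "?ho \<in> borel_measurable L" "?hi \<in> borel_measurable L" "?ko \<in> borel_measurable L"
    using meas_L[OF flow_meas(1)[where h=h, OF hm]] meas_L[OF flow_meas(2)[where h=h, OF hm]] meas_L[OF flow_meas(1)[where h=k, OF km]] by auto
  have "(\<integral>\<^sup>+g. (if rt g \<in> Hg \<Delta> \<theta> (gr g) then ennreal (real (card (neighbours (gr g) (rt g)))) else 0) \<partial>L)
    \<le> (\<integral>\<^sup>+g. (?ho g + ?hi g) + (?ko g + ?d g) \<partial>L)"
  proof (rule nn_integral_mono_AE)
    show "AE g in L. (if rt g \<in> Hg \<Delta> \<theta> (gr g) then ennreal (real (card (neighbours (gr g) (rt g)))) else 0)
      \<le> (?ho g + ?hi g) + (?ko g + ?d g)"
      using good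
    proof eventually_elim
      case (elim g)
      then interpret tree_eig2 "gr g" \<Delta> \<theta> by simp
      have x: "rt g \<in> V" using elim by simp
      consider "rt g \<in> S" | "rt g \<in> dS" | "rt g \<notin> Hg \<Delta> \<theta> (gr g)"
        using x by (auto simp: Hg_def Sg_iff dSg_iff)
      then show ?case
      proof cases
        case 1
        have "card (nb (rt g) \<inter> S) + card (nb (rt g) - S) = card (nb (rt g))"
          by (subst card_Un_disjoint[symmetric]) (auto simp: Int_Diff_Un)
        then have "ennreal (real (card (nb (rt g)))) = ennreal (real (card (nb (rt g) \<inter> S))) + ennreal (real (card (nb (rt g) - S)))"
          by (metis ennreal_plus of_nat_0_le_iff of_nat_add)
        also have "\<dots> = (?ho g + ?hi g) + ?ko g"
          unfolding h_def k_def internal_flow(2)[OF 1] cut_flow(1)[OF x 1] ..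
        also have "\<dots> \<le> (?ho g + ?hi g) + (?ko g + ?d g)" by (intro add_left_mono) simp
        finally show ?thesis by simp
      next
        case 2
        have "real (card (nb (rt g))) \<le> real \<Delta>" using card_nb_le by simp
        then have "ennreal (real (card (nb (rt g)))) \<le> ?d g" using 2 x by (simp add: dSg_iff ennreal_leI)
        also have "\<dots> \<le> (?ho g + ?hi g) + (?ko g + ?d g)" by (simp add: add_increasing)
        finally show ?thesis by simp
      qed simp
    qed
  qed
  also have "\<dots> = (\<integral>\<^sup>+g. ?ho g \<partial>L) + (\<integral>\<^sup>+g. ?hi g \<partial>L) + ((\<integral>\<^sup>+g. ?ko g \<partial>L) + (\<integral>\<^sup>+g. ?d g \<partial>L))"
    by (simp add: nn_integral_add)
  also have "(\<integral>\<^sup>+g. ?hi g \<partial>L) = (\<integral>\<^sup>+g. ?ho g \<partial>L)"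
    by (rule mass_transport[OF uni, symmetric]) (rule hm)
  also have "(\<integral>\<^sup>+g. ?ko g \<partial>L) = (\<integral>\<^sup>+g. ?ki g \<partial>L)"
    by (rule mass_transport[OF uni]) (rule km)
  also have "(\<integral>\<^sup>+g. ?d g \<partial>L) = ennreal (real \<Delta>) * dens_dS"
  proof -
    have "(\<integral>\<^sup>+g. ?d g \<partial>L) = (\<integral>\<^sup>+g. ennreal (real \<Delta>) * (if dSg \<Delta> \<theta> (gr g) (rt g) then 1 else 0) \<partial>L)"
      by (intro nn_integral_cong) simp
    then show ?thesis unfolding dens_dS_def by (simp add: nn_integral_cmult)
  qed
  also have "(\<integral>\<^sup>+g. ?ho g \<partial>L) + (\<integral>\<^sup>+g. ?ho g \<partial>L) + ((\<integral>\<^sup>+g. ?ki g \<partial>L) + ennreal (real \<Delta>) * dens_dS)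
      \<le> dens_S + dens_S + (ennreal (real \<Delta>) * dens_dS + ennreal (real \<Delta>) * dens_dS)"
  proof (intro add_mono order_refl)
    show ho: "(\<integral>\<^sup>+g. ?ho g \<partial>L) \<le> dens_S"
      unfolding dens_S_def
    proof (rule nn_integral_mono_AE)
      show "AE g in L. ?ho g \<le> (if Sg \<Delta> \<theta> (gr g) (rt g) then 1 else 0)"
        using good
      proof eventually_elim
        case (elim g)
        then interpret tree_eig2 "gr g" \<Delta> \<theta> by simp
        show ?case
        proof (cases "Sg \<Delta> \<theta> (gr g) (rt g)")
          case True
          then have "rt g \<in> S" using elim Sg_iff by blast
          from internal_flow(1)[OF this] show ?thesis using True by (simp add: h_def)
        qed (simp add: h_def)
      qed
    qed
    show "(\<integral>\<^sup>+g. ?ho g \<partial>L) \<le> dens_S" by (rule ho)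
    have "(\<integral>\<^sup>+g. ?ki g \<partial>L) \<le> (\<integral>\<^sup>+g. ennreal (real \<Delta>) * (if dSg \<Delta> \<theta> (gr g) (rt g) then 1 else 0) \<partial>L)"
    proof (rule nn_integral_mono_AE)
      show "AE g in L. ?ki g \<le> ennreal (real \<Delta>) * (if dSg \<Delta> \<theta> (gr g) (rt g) then 1 else 0)"
        using good
      proof eventually_elim
        case (elim g)
        then interpret tree_eig2 "gr g" \<Delta> \<theta> by simp
        show ?case using cut_flow(2)[of "rt g"] elim by (simp add: k_def split: if_splits)
      qed
    qed
    then show "(\<integral>\<^sup>+g. ?ki g \<partial>L) \<le> ennreal (real \<Delta>) * dens_dS"
      unfolding dens_dS_def by (simp add: nn_integral_cmult)
  qed
  finally show ?thesis by (simp add: mult_2 distrib_right)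
qed

text \<open>Mass transport cancels the flows in \<open>gain_flow\<close>, which leaves a nonpositive
  mean weight on the event \<open>D n\<close>. Cancelling requires finite mean inflow, which the
  truncation at \<open>n\<close> guarantees; monotone convergence then removes the
  truncation.\<close>

lemma expansion_density:
  assumes c: "0 < c" "c < i"
  shows "ennreal (c + 2) * (dens_S + dens_dS)
    \<le> (\<integral>\<^sup>+g. (if rt g \<in> Hg \<Delta> \<theta> (gr g) then ennreal (real (card (neighbours (gr g) (rt g)))) else 0) \<partial>L)"
proof -
  define t where "t G = total_gain G (Hg \<Delta> \<theta> G) (wt c G)" for G
  define D where "D n g \<longleftrightarrow> rt g \<in> Hg \<Delta> \<theta> (gr g) \<and> t (gr g) (rt g) \<le> real n" for n g
  have tm [measurable]: "(\<lambda>g. t (gr g) (rt g)) \<in> borel_measurable L"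
    unfolding t_def by (rule meas_L) (rule total_gain_meas, simp)
  have Hm [measurable]: "Measurable.pred L (\<lambda>g. rt g \<in> Hg \<Delta> \<theta> (gr g))"
    by (rule pred_L) (rule Hg_meas, simp)
  have cm [measurable]: "(\<lambda>g. real (card (neighbours (gr g) (rt g)))) \<in> borel_measurable L"
    by (rule meas_L) (rule card_neighbours_meas, simp)
  have Dm [measurable]: "Measurable.pred L (D n)" for n unfolding D_def[abs_def] by measurable
  have step: "(\<integral>\<^sup>+g. (if D n g then ennreal (2 * (c + 2)) else 0) \<partial>L)
      \<le> (\<integral>\<^sup>+g. (if D n g then ennreal (2 * real (card (neighbours (gr g) (rt g)))) else 0) \<partial>L)" for n
  proof -
    define h where "h G x y = (if x \<in> Hg \<Delta> \<theta> G \<and> y \<in> Hg \<Delta> \<theta> G \<and> adjacent G x y \<and> t G x \<le> real n \<and> t G y \<le> real n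
      then ennreal (gainl G (Hg \<Delta> \<theta> G) (wt c G) x y) else 0)" for G x y
    have hm: "(\<lambda>\<omega>. h (fst \<omega>) (snd \<omega> ! i) (snd \<omega> ! j)) \<in> bmeas k" if "i < Suc k" "j < Suc k" for k i j
    proof -
      note [measurable] = Hg_meas[OF that(1), of \<Delta> \<theta>] Hg_meas[OF that(2), of \<Delta> \<theta>] adjacent_meas[OF that]
        total_gain_meas[OF that(1), of \<Delta> \<theta> c, folded t_def] total_gain_meas[OF that(2), of \<Delta> \<theta> c, folded t_def]
        gainl_meas[OF that, of \<Delta> \<theta> c]
      show ?thesis unfolding h_def by measurable
    qed
    let ?ho = "\<lambda>g. \<integral>\<^sup>+w. h (gr g) (rt g) w \<partial>count_space (verts (gr g))"
    let ?hi = "\<lambda>g. \<integral>\<^sup>+w. h (gr g) w (rt g) \<partial>count_space (verts (gr g))"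
    have [measurable]: "?ho \<in> borel_measurable L" "?hi \<in> borel_measurable L"
      using meas_L[OF flow_meas(1)[where h=h, OF hm]] meas_L[OF flow_meas(2)[where h=h, OF hm]] by auto
    have eq: "(\<integral>\<^sup>+g. ?hi g \<partial>L) = (\<integral>\<^sup>+g. ?ho g \<partial>L)"
      by (rule mass_transport[OF uni, symmetric]) (rule hm)
    have pw: "AE g in L. (if D n g then ennreal (2 * (c + 2)) else 0) + ?hi g
        \<le> (if D n g then ennreal (2 * real (card (neighbours (gr g) (rt g)))) else 0) + ?ho g \<and>
        ?hi g \<le> ennreal (real n + real \<Delta>)"
      using good
    proof eventually_elim
      case (elim g)
      then interpret tree_eig2 "gr g" \<Delta> \<theta> by simp
      have "ereal i \<le> anchored_isoperimetric (gr g) (rt g)" "rt g \<in> V" using elim by auto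
      from gain_flow[OF this(1) c this(2), of "real n"] show ?case
        unfolding h_def t_def D_def by simp
    qed
    have "(\<integral>\<^sup>+g. ?hi g \<partial>L) \<le> (\<integral>\<^sup>+g. ennreal (real n + real \<Delta>) \<partial>L)"
      by (rule nn_integral_mono_AE) (use pw in eventually_elim, simp)
    also have "\<dots> = ennreal (real n + real \<Delta>)"
      using prob_space.emeasure_space_1[OF prob_L] by simp
    finally have fin: "(\<integral>\<^sup>+g. ?hi g \<partial>L) \<noteq> \<infinity>" by (auto simp: top_unique)
    have "(\<integral>\<^sup>+g. (if D n g then ennreal (2 * (c + 2)) else 0) + ?hi g \<partial>L) \<le>
        (\<integral>\<^sup>+g. (if D n g then ennreal (2 * real (card (neighbours (gr g) (rt g)))) else 0) + ?ho g \<partial>L)"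
      by (rule nn_integral_mono_AE) (use pw in eventually_elim, simp)
    then have "(\<integral>\<^sup>+g. (if D n g then ennreal (2 * (c + 2)) else 0) \<partial>L) + (\<integral>\<^sup>+g. ?hi g \<partial>L) \<le>
        (\<integral>\<^sup>+g. (if D n g then ennreal (2 * real (card (neighbours (gr g) (rt g)))) else 0) \<partial>L) + (\<integral>\<^sup>+g. ?ho g \<partial>L)"
      by (subst (asm) (1 2) nn_integral_add) measurable
    then show ?thesis using fin by (simp add: eq add.commute[of _ "integral\<^sup>N L ?ho"] ennreal_add_left_cancel_le)
  qed
  let ?d = "\<lambda>g. if rt g \<in> Hg \<Delta> \<theta> (gr g) then ennreal (real (card (neighbours (gr g) (rt g)))) else 0"
  have lim: "(\<integral>\<^sup>+g. (if rt g \<in> Hg \<Delta> \<theta> (gr g) then ennreal (2 * (c + 2)) else 0) \<partial>L) \<le> 2 * (\<integral>\<^sup>+g. ?d g \<partial>L)"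
  proof -
    have "(if rt g \<in> Hg \<Delta> \<theta> (gr g) then ennreal (2 * (c + 2)) else 0) = (SUP n. if D n g then ennreal (2 * (c + 2)) else 0)" for g
    proof (cases "rt g \<in> Hg \<Delta> \<theta> (gr g)")
      case True
      obtain m :: nat where "t (gr g) (rt g) \<le> real m" using real_arch_simple by blast
      then have "D m g" using True by (simp add: D_def)
      then show ?thesis using True by (intro antisym SUP_upper2[of m] SUP_least) auto
    qed (simp add: D_def)
    then have "(\<integral>\<^sup>+g. (if rt g \<in> Hg \<Delta> \<theta> (gr g) then ennreal (2 * (c + 2)) else 0) \<partial>L) =
        (\<integral>\<^sup>+g. (SUP n. if D n g then ennreal (2 * (c + 2)) else 0) \<partial>L)" by simp
    also have "\<dots> = (SUP n. \<integral>\<^sup>+g. (if D n g then ennreal (2 * (c + 2)) else 0) \<partial>L)"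
    proof (rule nn_integral_monotone_convergence_SUP)
      show "incseq (\<lambda>n g. if D n g then ennreal (2 * (c + 2)) else 0)"
        by (auto simp: incseq_def le_fun_def D_def)
    qed measurable
    also have "\<dots> \<le> 2 * (\<integral>\<^sup>+g. ?d g \<partial>L)"
    proof (rule SUP_least)
      fix n
      have "(\<integral>\<^sup>+g. (if D n g then ennreal (2 * (c + 2)) else 0) \<partial>L) \<le> (\<integral>\<^sup>+g. 2 * ?d g \<partial>L)"
        using step[of n] by (rule order_trans) (auto intro!: nn_integral_mono simp: D_def ennreal_mult)
      then show "(\<integral>\<^sup>+g. (if D n g then ennreal (2 * (c + 2)) else 0) \<partial>L) \<le> 2 * (\<integral>\<^sup>+g. ?d g \<partial>L)"
        by (subst (asm) nn_integral_cmult) measurable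
    qed
    finally show ?thesis .
  qed
  have "2 * (ennreal (c + 2) * (dens_S + dens_dS)) = (\<integral>\<^sup>+g. (if rt g \<in> Hg \<Delta> \<theta> (gr g) then ennreal (2 * (c + 2)) else 0) \<partial>L)"
  proof -
    have "dens_S + dens_dS = (\<integral>\<^sup>+g. (if rt g \<in> Hg \<Delta> \<theta> (gr g) then 1 else 0) \<partial>L)"
      unfolding dens_S_def dens_dS_def
      by (subst nn_integral_add[symmetric], measurable) (auto simp: Hg_def dSg_def intro!: nn_integral_cong)
    moreover have "ennreal (2 * (c + 2)) * (\<integral>\<^sup>+g. (if rt g \<in> Hg \<Delta> \<theta> (gr g) then 1 else 0) \<partial>L) =
      (\<integral>\<^sup>+g. ennreal (2 * (c + 2)) * (if rt g \<in> Hg \<Delta> \<theta> (gr g) then 1 else 0) \<partial>L)"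
      by (rule nn_integral_cmult[symmetric]) measurable
    moreover have "(\<integral>\<^sup>+g. ennreal (2 * (c + 2)) * (if rt g \<in> Hg \<Delta> \<theta> (gr g) then 1 else 0) \<partial>L) =
      (\<integral>\<^sup>+g. (if rt g \<in> Hg \<Delta> \<theta> (gr g) then ennreal (2 * (c + 2)) else 0) \<partial>L)"
      by (intro nn_integral_cong) simp
    moreover have "ennreal (2 * (c + 2)) = 2 * ennreal (c + 2)" using c by (simp add: ennreal_mult)
    ultimately show ?thesis by (simp add: mult.assoc)
  qed
  then have "2 * (ennreal (c + 2) * (dens_S + dens_dS)) \<le> 2 * (\<integral>\<^sup>+g. ?d g \<partial>L)" using lim by simp
  then show ?thesis by (simp add: ennreal_mult_le_mult_iff)
qed

lemma mean_spectral_le: "mean_spectral L {\<theta>} \<le> dens_pk"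
  unfolding mean_spectral_def dens_pk_def
proof (rule nn_integral_mono_AE)
  show "AE g in L. (case rep_gstar g of (G, v) \<Rightarrow> emeasure (spectral_measure G v) {\<theta>})
      \<le> ennreal (pk \<Delta> \<theta> (gr g) (rt g) (rt g))"
    using good
  proof eventually_elim
    case (elim g)
    then interpret tree_eig2 "gr g" \<Delta> \<theta> by simp
    obtain G v where g: "rep_gstar g = (G, v)" by (metis surj_pair)
    then show ?case
      using emeasure_spectral_measure_le[of "rt g" \<theta>] elim by (simp add: pk_proj) (simp add: rep1_def)
  qed
qed

lemma atom_bound:
  assumes pos: "0 < mean_spectral L {\<theta>}"
  shows "\<theta> \<in> totally_real_algebraic_ints" "real (tree_complexity \<theta>) < 3 * (real \<Delta>)\<^sup>2 / i"
proof -
  have \<mu>: "0 < dens_pk" using pos mean_spectral_le by (rule order_less_le_trans)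
  have "dens_pk \<le> dens_dS + dens_pk" by (rule add_increasing) simp_all
  then have pk_le: "dens_pk \<le> dens_rg" using boundary_density by (rule order_trans)
  have rg_pos: "0 < dens_rg"
    using \<mu> pk_le by (rule order_less_le_trans)
  have complexity: "AE g in L. \<theta> \<in> totally_real_algebraic_ints \<or> \<not> (Sg \<Delta> \<theta> (gr g) (rt g) \<and> finite (Cg \<Delta> \<theta> (gr g) (rt g)))"
    and K: "AE g in L. Sg \<Delta> \<theta> (gr g) (rt g) \<longrightarrow> finite (Cg \<Delta> \<theta> (gr g) (rt g)) \<longrightarrow>
      tree_complexity \<theta> \<le> card (Cg \<Delta> \<theta> (gr g) (rt g))"
  proof -
    have "AE g in L. Sg \<Delta> \<theta> (gr g) (rt g) \<longrightarrow> finite (Cg \<Delta> \<theta> (gr g) (rt g)) \<longrightarrow>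
      \<theta> \<in> totally_real_algebraic_ints \<and> tree_complexity \<theta> \<le> card (Cg \<Delta> \<theta> (gr g) (rt g))"
      using good
    proof eventually_elim
      case (elim g)
      then interpret tree_eig2 "gr g" \<Delta> \<theta> by simp
      show ?case using component_tree_complexity[of "rt g"] elim by (auto simp: Sg_iff Cg_eq)
    qed
    then show "AE g in L. \<theta> \<in> totally_real_algebraic_ints \<or> \<not> (Sg \<Delta> \<theta> (gr g) (rt g) \<and> finite (Cg \<Delta> \<theta> (gr g) (rt g)))"
      "AE g in L. Sg \<Delta> \<theta> (gr g) (rt g) \<longrightarrow> finite (Cg \<Delta> \<theta> (gr g) (rt g)) \<longrightarrow>
      tree_complexity \<theta> \<le> card (Cg \<Delta> \<theta> (gr g) (rt g))" by auto
  qed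
  \<comment> \<open>The case \<open>n = 1\<close> of \<open>component_density\<close>, valid since a
    component contains its own starting vertex.\<close>
  have rg_le: "dens_rg \<le> 1"
  proof -
    have "AE g in L. Sg \<Delta> \<theta> (gr g) (rt g) \<longrightarrow> finite (Cg \<Delta> \<theta> (gr g) (rt g)) \<longrightarrow> 1 \<le> card (Cg \<Delta> \<theta> (gr g) (rt g))"
    proof (rule AE_I2, intro impI)
      fix g assume "finite (Cg \<Delta> \<theta> (gr g) (rt g))"
      moreover have "rt g \<in> Cg \<Delta> \<theta> (gr g) (rt g)" by (simp add: Cg_def)
      ultimately show "1 \<le> card (Cg \<Delta> \<theta> (gr g) (rt g))" by (auto simp: Suc_le_eq card_gt_0_iff)
    qed
    from component_density[OF this] show ?thesis using dens_le_1(1) by (simp add: order_trans)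
  qed
  show "\<theta> \<in> totally_real_algebraic_ints"
  proof (rule ccontr)
    \<comment> \<open>A finite component would exhibit \<theta> as an eigenvalue of a finite tree.
      So otherwise almost surely all components are infinite, and \<open>component_density\<close>
      holds for every \<open>n\<close>, against \<open>dens_rg > 0\<close>.\<close>
    assume "\<theta> \<notin> totally_real_algebraic_ints"
    then have "AE g in L. Sg \<Delta> \<theta> (gr g) (rt g) \<longrightarrow> finite (Cg \<Delta> \<theta> (gr g) (rt g)) \<longrightarrow> n \<le> card (Cg \<Delta> \<theta> (gr g) (rt g))" for n
      using complexity by auto
    from component_density[OF this] have b: "of_nat n * dens_rg \<le> 1" for n
      using dens_le_1(1) order_trans by blast
    obtain r where r: "dens_rg = ennreal r" "0 \<le> r"
      using rg_le by (cases dens_rg) (auto simp: top_unique)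
    then have "0 < r" using rg_pos by simp
    then obtain n :: nat where "1 < real n * r" using reals_Archimedean3 by blast
    moreover have "ennreal (real n * r) \<le> ennreal 1"
      using b[of n] r by (simp add: ennreal_mult ennreal_of_nat_eq_real_of_nat)
    ultimately show False by (simp add: ennreal_le_iff)
  qed
  define K where "K = real (tree_complexity \<theta>)"
  \<comment> \<open>Any \<open>c\<close> between 0 and \<open>i\<close> gives the bound 2 \<Delta> /
    c for the complexity; two thirds of \<open>i\<close> turn it into 3 \<Delta> / i.\<close>
  define c where "c = 2 * i / 3"
  have c: "0 < c" "c < i" using i_pos by (auto simp: c_def)
  obtain s where s: "dens_S = ennreal s" "0 \<le> s" using dens_le_1(1) by (cases dens_S) (auto simp: top_unique)
  obtain b where b: "dens_dS = ennreal b" "0 \<le> b" using dens_le_1(2) by (cases dens_dS) (auto simp: top_unique)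
  obtain r where r: "dens_rg = ennreal r" "0 \<le> r" using rg_le by (cases dens_rg) (auto simp: top_unique)
  obtain m where m: "dens_pk = ennreal m" "0 \<le> m" using pk_le r by (cases dens_pk) (auto simp: top_unique)
  have m0: "0 < m" using \<mu> m by simp
  have 1: "b + m \<le> r"
    using boundary_density unfolding b(1) m(1) r(1)
    by (simp add: ennreal_plus[symmetric] b m r del: ennreal_plus)
  have 2: "K * r \<le> s"
    using component_density[OF K] unfolding r(1) s(1) K_def
    by (simp add: ennreal_of_nat_eq_real_of_nat ennreal_mult[symmetric] s r)
  have 3: "(c + 2) * (s + b) \<le> 2 * s + 2 * real \<Delta> * b"
  proof -
    have "ennreal (c + 2) * (ennreal s + ennreal b) \<le> 2 * ennreal s + 2 * ennreal (real \<Delta>) * ennreal b"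
      using order_trans[OF expansion_density[OF c] degree_density] unfolding s(1) b(1) .
    moreover have "ennreal (c + 2) * (ennreal s + ennreal b) = ennreal ((c + 2) * (s + b))"
      using s b c by (simp add: ennreal_mult ennreal_plus[symmetric] del: ennreal_plus)
    moreover have "2 * ennreal s + 2 * ennreal (real \<Delta>) * ennreal b = ennreal (2 * s + 2 * real \<Delta> * b)"
      using s b by (simp add: ennreal_mult ennreal_plus)
    ultimately have "ennreal ((c + 2) * (s + b)) \<le> ennreal (2 * s + 2 * real \<Delta> * b)" by simp
    then show ?thesis using s b by (simp add: ennreal_le_iff del: ennreal_plus)
  qed
  have "c * (K * (b + m)) \<le> c * (K * r)" using 1 c by (intro mult_left_mono) (auto simp: K_def)
  also have "\<dots> \<le> c * s" using 2 c by (intro mult_left_mono) auto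
  also have "\<dots> \<le> 2 * real \<Delta> * b - (c + 2) * b" using 3 by (simp add: algebra_simps)
  also have "\<dots> \<le> 2 * real \<Delta> * b" using c b by simp
  also have "\<dots> \<le> 2 * real \<Delta> * (b + m)" using m by (intro mult_left_mono) auto
  finally have "c * K * (b + m) \<le> 2 * real \<Delta> * (b + m)" by simp
  \<comment> \<open>The positive \<open>m\<close> makes \<open>b + m\<close> cancellable even if the
    boundary has density 0.\<close>
  then have cK: "c * K \<le> 2 * real \<Delta>" using m0 b by simp
  have \<Delta>: "2 \<le> real \<Delta>"
  proof -
    interpret prob_space L by (rule prob_L)
    have "\<exists>g. tree_eig2 (gr g) \<Delta> \<and> rt g \<in> verts (gr g)"
    proof (rule ccontr)
      assume "\<not> ?thesis"
      then have "AE g in L. False" by (intro eventually_mono[OF good]) blast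
      then show False by simp
    qed
    then obtain g where g: "tree_eig2 (gr g) \<Delta>" "rt g \<in> verts (gr g)" by blast
    interpret tree_eig2 "gr g" \<Delta> \<theta> by (rule g)
    have "2 \<le> \<Delta>" using deg2[OF g(2)] card_nb_le[of "rt g"] by linarith
    then show ?thesis by simp
  qed
  have "K \<le> 3 * real \<Delta> / i" using cK i_pos by (simp add: c_def field_simps)
  also have "\<dots> < 3 * (real \<Delta>)\<^sup>2 / i"
  proof (rule divide_strict_right_mono)
    have "1 * real \<Delta> < real \<Delta> * real \<Delta>" using \<Delta> by (intro mult_strict_right_mono) auto
    then show "3 * real \<Delta> < 3 * (real \<Delta>)\<^sup>2" by (simp add: power2_eq_square)
  qed (rule i_pos)
  finally show "real (tree_complexity \<theta>) < 3 * (real \<Delta>)\<^sup>2 / i" by (simp add: K_def)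
qed

end

theorem theorem6:
  fixes \<Delta> :: nat and i\<^sub>s :: real and L :: "gstar measure"
  assumes "i\<^sub>s > 0"
    and "unimodular L"
    and "concentrated_on L (\<lambda>G v. is_tree G \<and>
           (\<forall>x\<in>verts G. degree_in G x \<in> {2..\<Delta>}) \<and>
           anchored_isoperimetric G v \<ge> ereal i\<^sub>s)"
  shows "pure_point_support L \<subseteq>
           {\<theta> \<in> totally_real_algebraic_ints.
              real (tree_complexity \<theta>) < 3 * (real \<Delta>)\<^sup>2 / i\<^sub>s}"
proof
  fix \<theta> assume "\<theta> \<in> pure_point_support L"
  then have \<theta>: "0 < mean_spectral L {\<theta>}" by (simp add: pure_point_support_def)
  have "unimodular_tree L \<Delta> i\<^sub>s"
  proof
    show "AE g in L. tree_eig2 (fst (rep1 g)) \<Delta> \<and> snd (rep1 g) ! 0 \<in> verts (fst (rep1 g)) \<and>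
      ereal i\<^sub>s \<le> anchored_isoperimetric (fst (rep1 g)) (snd (rep1 g) ! 0)"
      using assms(3) unfolding concentrated_on_def
    proof eventually_elim
      case (elim g)
      obtain G v where g: "rep_gstar g = (G, v)" by (metis surj_pair)
      then have t: "is_tree G" "\<And>x. x \<in> verts G \<Longrightarrow> degree_in G x \<in> {2..\<Delta>}" "ereal i\<^sub>s \<le> anchored_isoperimetric G v"
        using elim by auto
      have v: "v \<in> verts G" using is_network_rep_gstar[OF g] by (simp add: is_network_def)
      have "tree_eig2 G \<Delta>"
      proof
        show "is_graph G" using t(1) by (simp add: is_tree_def)
        show "finite (neighbours G x)" if "x \<in> verts G" for x
          using t(2)[OF that] by (intro card_ge_0_finite) (simp add: degree_in_def)
        show "card (neighbours G x) \<le> \<Delta>" "2 \<le> card (neighbours G x)" if "x \<in> verts G" for x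
          using t(2)[OF that] by (auto simp: degree_in_def)
        show "0 < \<Delta>" using t(2)[OF v] by auto
      qed (rule t(1))
      then show ?case using g t v by (simp add: rep1_def)
    qed
  qed (use assms in auto)
  then interpret unimodular_tree L \<Delta> \<theta> i\<^sub>s .
  show "\<theta> \<in> {\<theta> \<in> totally_real_algebraic_ints. real (tree_complexity \<theta>) < 3 * (real \<Delta>)\<^sup>2 / i\<^sub>s}"
    using atom_bound[OF \<theta>] by simp
qed

end
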